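(* Let $A$ be an $H^*$-Galois left $H$-module algebra over a finite dimensional Hopf algebra $H$ and let $E=\operatorname{End}_HA$ with its Hopf algebra structure. There is a bijective correspondence between the quasitriangular structures on $H$ and those on $E$ under which $R=\sum_i r'_i\otimes r''_i\in H\otimes H$ and $\widetilde R=\sum_m\rho'_m\otimes\rho''_m\in E\otimes E$ correspond to one another if and only if $$\sum_i(r''_ib)(r'_ia)=\sum_m(\rho''_ma)(\rho'_mb)\qquad\text{for all }a,b\in A.$$ Furthermore, $\widetilde R$ is triangular if and only if $R$ is triangular. If $c$ and $\tilde c$ denote the braidings of the categories $H\text{-mod}$ and $E\text{-mod}$ determined by $R$ and $\widetilde R$, respectively, then for each pair $U,V\in H\text{-mod}$ the square formed by $$D(c_{UV}):D(V\otimes U)\to D(U\otimes V),\qquad \tilde c_{D(V),D(U)}:D(V)\otimes D(U)\to D(U)\otimes D(V)$$ and the bijections $D(V)\otimes D(U)\to D(V\otimes U)$, $D(U)\otimes D(V)\to D(U\otimes V)$, $\tau\otimes\sigma\mapsto\tau\smile\sigma$, is commutative.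
   Context: $k$ is a field; unadorned $\otimes$, $\operatorname{Hom}$, $\operatorname{End}$ are over $k$. $H$ is a finite dimensional Hopf algebra over $k$ with comultiplication $\Delta h=\sum_{(h)}h'\otimes h''$, counit $\varepsilon$, antipode $S$. $H\text{-mod}$ is the category of finite dimensional left $H$-modules. Algebras are extensions of $k$ (so $A\neq0$, $k=k1_A\subset A$). A left $H$-module algebra $A$ is $H^*$-Galois if the map $\pi:A\otimes H\to\operatorname{End}A$, $\pi(a\otimes h)(b)=a(hb)$, is bijective; equivalently (known fact) if any one of the maps $\pi'(a\otimes h)(b)=(hb)a$ from $A\otimes H$ to $\operatorname{End}A$, $\gamma(a\otimes b)(h)=a(hb)$, $\gamma'(a\otimes b)(h)=(ha)b$ from $A\otimes A$ to $\operatorname{Hom}(H,A)\cong A\otimes H^*$ is bijective. Then $\dim A<\infty$ and $A^H=\{a: ha=\varepsilon(h)a\ \forall h\}=k$. $E=\operatorname{End}_HA$ acts on $A$ from the left and carries the unique Hopf algebra structure making $A$ a left $E$-module algebra: $\varphi(ab)=\sum_{(\varphi)}\varphi'(a)\varphi''(b)$, $\varepsilon(\varphi)=\varphi(1)$. A quasitriangular structure on a Hopf algebra $H$ is an element $R=\sum_ir'_i\otimes r''_i\in H\otimes H$ with $\Delta^{\mathrm{op}}(h)R=R\Delta(h)$ for all $h\in H$ (where $\Delta^{\mathrm{op}}h=\sum_{(h)}h''\otimes h'$), $(\varepsilon\otimes\operatorname{id})(R)=1=(\operatorname{id}\otimes\varepsilon)(R)$, $(\Delta\otimes\operatorname{id})(R)=R_{13}R_{23}$,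 $(\operatorname{id}\otimes\Delta)(R)=R_{13}R_{12}$. It is then invertible, and it is triangular if $R^{-1}=R_{21}=\sum_ir''_i\otimes r'_i$. The braiding determined by $R$ is $c_{UV}:U\otimes V\to V\otimes U$, $u\otimes v\mapsto\sum_ir''_iv\otimes r'_iu$ (and likewise $\tilde c$ for $\widetilde R$). $D=\operatorname{Hom}_H(?,A)$ is the contravariant functor $H\text{-mod}\to E\text{-mod}$, with $E$ acting on $D(V)$ by composition, $(\varphi\sigma)(v)=\varphi(\sigma(v))$. For $\tau\in D(U)$, $\sigma\in D(V)$ the element $\tau\smile\sigma\in D(U\otimes V)$ is $(\tau\smile\sigma)(u\otimes v)=\tau(u)\sigma(v)$; this gives bijections $D(U)\otimes D(V)\to D(U\otimes V)$. *)

theory Defs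
  imports "Jordan_Normal_Form.Missing_VectorSpace"
begin

section \<open>Algebras and spaces of linear maps\<close>

text \<open>
  The locale \<^locale>\<open>algebra\<close> of the library is restricted to commutative algebras.  The last
  assumption says that an algebra is an extension of the base field.
\<close>

locale unital_algebra = vectorspace K A + ring A
  for K :: "'k ring" and A :: "('k, 'a) module" +
  assumes smult_mult_left:
    "\<lbrakk>c \<in> carrier K; x \<in> carrier A; y \<in> carrier A\<rbrakk>
      \<Longrightarrow> (c \<odot>\<^bsub>A\<^esub> x) \<otimes>\<^bsub>A\<^esub> y = c \<odot>\<^bsub>A\<^esub> (x \<otimes>\<^bsub>A\<^esub> y)"
    and smult_mult_right:
    "\<lbrakk>c \<in> carrier K; x \<in> carrier A; y \<in> carrier A\<rbrakk>
      \<Longrightarrow> x \<otimes>\<^bsub>A\<^esub> (c \<odot>\<^bsub>A\<^esub> y) = c \<odot>\<^bsub>A\<^esub> (x \<otimes>\<^bsub>A\<^esub> y)"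
    and algebra_one_not_zero: "\<one>\<^bsub>A\<^esub> \<noteq> \<zero>\<^bsub>A\<^esub>"

definition base_algebra :: "'k ring \<Rightarrow> ('k, 'k) module" where
  "base_algebra K =
    \<lparr>carrier = carrier K, mult = mult K, one = one K, zero = zero K, add = add K,
     smult = mult K\<rparr>"

definition algebra_hom :: "'k ring \<Rightarrow> ('k, 'a) module \<Rightarrow> ('k, 'b) module \<Rightarrow> ('a \<Rightarrow> 'b) set" where
  "algebra_hom K A B = module_hom K A B \<inter> ring_hom A B"

text \<open>
  Linear maps are made extensional, so that equality in the carrier is equality of maps on
  the domain.  The fields \<open>mult\<close> and \<open>one\<close> carry no information here.
\<close>

definition hom_space :: "'k ring \<Rightarrow> ('k, 'v) module \<Rightarrow> ('k, 'w) module \<Rightarrow> ('k, 'v \<Rightarrow> 'w) module" where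
  "hom_space K V W =
    \<lparr>carrier = module_hom K V W \<inter> extensional (carrier V),
     mult = undefined,
     one = undefined,
     zero = (\<lambda>v\<in>carrier V. \<zero>\<^bsub>W\<^esub>),
     add = (\<lambda>f g. \<lambda>v\<in>carrier V. f v \<oplus>\<^bsub>W\<^esub> g v),
     smult = (\<lambda>c f. \<lambda>v\<in>carrier V. c \<odot>\<^bsub>W\<^esub> f v)\<rparr>"

section \<open>Tensor products over a field\<close>

text \<open>
  A list \<open>[(v\<^sub>1, w\<^sub>1), \<dots>, (v\<^sub>n, w\<^sub>n)]\<close> stands for the formal sum of the \<open>v\<^sub>i \<otimes> w\<^sub>i\<close>.  The tensor
  product is the set of such formal sums modulo the congruence generated by bilinearity
  (the relations \<open>0 \<otimes> w = 0\<close> make additive inverses available).  The resulting record also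
  carries the componentwise product, which is meaningful when both factors are algebras.
\<close>

type_synonym ('v, 'w) tensor = "('v \<times> 'w) list set"

inductive tensor_equiv ::
  "'k ring \<Rightarrow> ('k, 'v) module \<Rightarrow> ('k, 'w) module \<Rightarrow> ('v \<times> 'w) list \<Rightarrow> ('v \<times> 'w) list \<Rightarrow> bool"
  for K V W where
    refl: "l \<in> lists (carrier V \<times> carrier W) \<Longrightarrow> tensor_equiv K V W l l"
  | sym: "tensor_equiv K V W l m \<Longrightarrow> tensor_equiv K V W m l"
  | trans: "\<lbrakk>tensor_equiv K V W l m; tensor_equiv K V W m n\<rbrakk> \<Longrightarrow> tensor_equiv K V W l n"
  | append: "\<lbrakk>tensor_equiv K V W l l'; tensor_equiv K V W m m'\<rbrakk>
      \<Longrightarrow> tensor_equiv K V W (l @ m) (l' @ m')"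
  | commute: "\<lbrakk>l \<in> lists (carrier V \<times> carrier W); m \<in> lists (carrier V \<times> carrier W)\<rbrakk>
      \<Longrightarrow> tensor_equiv K V W (l @ m) (m @ l)"
  | add_left: "\<lbrakk>v \<in> carrier V; v' \<in> carrier V; w \<in> carrier W\<rbrakk>
      \<Longrightarrow> tensor_equiv K V W [(v \<oplus>\<^bsub>V\<^esub> v', w)] [(v, w), (v', w)]"
  | add_right: "\<lbrakk>v \<in> carrier V; w \<in> carrier W; w' \<in> carrier W\<rbrakk>
      \<Longrightarrow> tensor_equiv K V W [(v, w \<oplus>\<^bsub>W\<^esub> w')] [(v, w), (v, w')]"
  | smult: "\<lbrakk>c \<in> carrier K; v \<in> carrier V; w \<in> carrier W\<rbrakk>
      \<Longrightarrow> tensor_equiv K V W [(c \<odot>\<^bsub>V\<^esub> v, w)] [(v, c \<odot>\<^bsub>W\<^esub> w)]"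
  | zero: "w \<in> carrier W \<Longrightarrow> tensor_equiv K V W [(\<zero>\<^bsub>V\<^esub>, w)] []"

definition tensor_class ::
  "'k ring \<Rightarrow> ('k, 'v) module \<Rightarrow> ('k, 'w) module \<Rightarrow> ('v \<times> 'w) list \<Rightarrow> ('v, 'w) tensor" where
  "tensor_class K V W l = {m. tensor_equiv K V W l m}"

definition pure_tensor ::
  "'k ring \<Rightarrow> ('k, 'v) module \<Rightarrow> ('k, 'w) module \<Rightarrow> 'v \<Rightarrow> 'w \<Rightarrow> ('v, 'w) tensor" where
  "pure_tensor K V W v w = tensor_class K V W [(v, w)]"

definition tensor ::
  "'k ring \<Rightarrow> ('k, 'v) module \<Rightarrow> ('k, 'w) module \<Rightarrow> ('k, ('v, 'w) tensor) module" where
  "tensor K V W =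
    \<lparr>carrier = tensor_class K V W ` lists (carrier V \<times> carrier W),
     mult = (\<lambda>s t. \<Union>l\<in>s. \<Union>m\<in>t.
       tensor_class K V W [(a \<otimes>\<^bsub>V\<^esub> c, b \<otimes>\<^bsub>W\<^esub> d). (a, b) \<leftarrow> l, (c, d) \<leftarrow> m]),
     one = pure_tensor K V W \<one>\<^bsub>V\<^esub> \<one>\<^bsub>W\<^esub>,
     zero = tensor_class K V W [],
     add = (\<lambda>s t. \<Union>l\<in>s. \<Union>m\<in>t. tensor_class K V W (l @ m)),
     smult = (\<lambda>c t. \<Union>l\<in>t. tensor_class K V W [(c \<odot>\<^bsub>V\<^esub> v, w). (v, w) \<leftarrow> l])\<rparr>"

text \<open>
  \<open>tensor_lift X \<beta>\<close> is the linear map into \<open>X\<close> induced by the bilinear map \<open>\<beta>\<close>: it sends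
  the sum of the \<open>v\<^sub>i \<otimes> w\<^sub>i\<close> to the sum of the \<open>\<beta> v\<^sub>i w\<^sub>i\<close>, which does not depend on the
  representing list.
\<close>

definition tensor_lift ::
  "('k, 'x) module \<Rightarrow> ('v \<Rightarrow> 'w \<Rightarrow> 'x) \<Rightarrow> ('v, 'w) tensor \<Rightarrow> 'x" where
  "tensor_lift X \<beta> t = the_elem ((\<lambda>l. foldr (\<lambda>(v, w) s. \<beta> v w \<oplus>\<^bsub>X\<^esub> s) l \<zero>\<^bsub>X\<^esub>) ` t)"

text \<open>In \<open>tensor_map K V W f g\<close> the spaces \<open>V\<close> and \<open>W\<close> are the codomains of \<open>f\<close> and \<open>g\<close>.\<close>

definition tensor_map ::
  "'k ring \<Rightarrow> ('k, 'v) module \<Rightarrow> ('k, 'w) module \<Rightarrow> ('s \<Rightarrow> 'v) \<Rightarrow> ('t \<Rightarrow> 'w) \<Rightarrow>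
    ('s, 't) tensor \<Rightarrow> ('v, 'w) tensor" where
  "tensor_map K V W f g = tensor_lift (tensor K V W) (\<lambda>x y. pure_tensor K V W (f x) (g y))"

definition tensor_swap ::
  "'k ring \<Rightarrow> ('k, 'v) module \<Rightarrow> ('k, 'w) module \<Rightarrow> ('v, 'w) tensor \<Rightarrow> ('w, 'v) tensor" where
  "tensor_swap K V W = tensor_lift (tensor K W V) (\<lambda>v w. pure_tensor K W V w v)"

text \<open>The isomorphism \<open>U \<otimes> (V \<otimes> W) \<rightarrow> (U \<otimes> V) \<otimes> W\<close>.\<close>

definition tensor_unassoc ::
  "'k ring \<Rightarrow> ('k, 'u) module \<Rightarrow> ('k, 'v) module \<Rightarrow> ('k, 'w) module \<Rightarrow>
    ('u, ('v, 'w) tensor) tensor \<Rightarrow> (('u, 'v) tensor, 'w) tensor" where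
  "tensor_unassoc K U V W =
    (let X = tensor K (tensor K U V) W in
     tensor_lift X (\<lambda>u. tensor_lift X (\<lambda>v w.
       pure_tensor K (tensor K U V) W (pure_tensor K U V u v) w)))"

section \<open>Hopf algebras and their modules\<close>

locale bialgebra = unital_algebra K H
  for K :: "'k ring" and H :: "('k, 'h) module" +
  fixes \<Delta> :: "'h \<Rightarrow> ('h, 'h) tensor"
    and \<epsilon> :: "'h \<Rightarrow> 'k"
  assumes comult_hom: "\<Delta> \<in> algebra_hom K H (tensor K H H)"
    and counit_hom: "\<epsilon> \<in> algebra_hom K H (base_algebra K)"
    and coassoc: "h \<in> carrier H \<Longrightarrow>
      tensor_map K (tensor K H H) H \<Delta> id (\<Delta> h) =
      tensor_unassoc K H H H (tensor_map K H (tensor K H H) id \<Delta> (\<Delta> h))"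
    and counit_left: "h \<in> carrier H \<Longrightarrow> tensor_lift H (\<lambda>x y. \<epsilon> x \<odot>\<^bsub>H\<^esub> y) (\<Delta> h) = h"
    and counit_right: "h \<in> carrier H \<Longrightarrow> tensor_lift H (\<lambda>x y. \<epsilon> y \<odot>\<^bsub>H\<^esub> x) (\<Delta> h) = h"

locale hopf_algebra = bialgebra K H \<Delta> \<epsilon>
  for K :: "'k ring" and H :: "('k, 'h) module" and \<Delta> \<epsilon> +
  fixes S :: "'h \<Rightarrow> 'h"
  assumes antipode_linear: "S \<in> module_hom K H H"
    and antipode_left: "h \<in> carrier H \<Longrightarrow>
      tensor_lift H (\<lambda>x y. S x \<otimes>\<^bsub>H\<^esub> y) (\<Delta> h) = \<epsilon> h \<odot>\<^bsub>H\<^esub> \<one>\<^bsub>H\<^esub>"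
    and antipode_right: "h \<in> carrier H \<Longrightarrow>
      tensor_lift H (\<lambda>x y. x \<otimes>\<^bsub>H\<^esub> S y) (\<Delta> h) = \<epsilon> h \<odot>\<^bsub>H\<^esub> \<one>\<^bsub>H\<^esub>"

locale left_module = H: unital_algebra K H + V: vectorspace K V
  for K :: "'k ring" and H :: "('k, 'h) module" and V :: "('k, 'v) module" +
  fixes act :: "'h \<Rightarrow> 'v \<Rightarrow> 'v"
  assumes act_linear: "h \<in> carrier H \<Longrightarrow> act h \<in> module_hom K V V"
    and act_add: "\<lbrakk>g \<in> carrier H; h \<in> carrier H; v \<in> carrier V\<rbrakk>
      \<Longrightarrow> act (g \<oplus>\<^bsub>H\<^esub> h) v = act g v \<oplus>\<^bsub>V\<^esub> act h v"
    and act_smult: "\<lbrakk>c \<in> carrier K; h \<in> carrier H; v \<in> carrier V\<rbrakk>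
      \<Longrightarrow> act (c \<odot>\<^bsub>H\<^esub> h) v = c \<odot>\<^bsub>V\<^esub> act h v"
    and act_mult: "\<lbrakk>g \<in> carrier H; h \<in> carrier H; v \<in> carrier V\<rbrakk>
      \<Longrightarrow> act (g \<otimes>\<^bsub>H\<^esub> h) v = act g (act h v)"
    and act_one: "v \<in> carrier V \<Longrightarrow> act \<one>\<^bsub>H\<^esub> v = v"

locale module_algebra = left_module K H A act + A: unital_algebra K A
  for K :: "'k ring" and H :: "('k, 'h) module"
    and \<Delta> :: "'h \<Rightarrow> ('h, 'h) tensor" and \<epsilon> :: "'h \<Rightarrow> 'k"
    and A :: "('k, 'a) module" and act :: "'h \<Rightarrow> 'a \<Rightarrow> 'a" +
  assumes act_product: "\<lbrakk>h \<in> carrier H; a \<in> carrier A; b \<in> carrier A\<rbrakk>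
      \<Longrightarrow> act h (a \<otimes>\<^bsub>A\<^esub> b) = tensor_lift A (\<lambda>x y. act x a \<otimes>\<^bsub>A\<^esub> act y b) (\<Delta> h)"
    and act_unit: "h \<in> carrier H \<Longrightarrow> act h \<one>\<^bsub>A\<^esub> = \<epsilon> h \<odot>\<^bsub>A\<^esub> \<one>\<^bsub>A\<^esub>"

text \<open>The Galois condition over the dual of \<open>H\<close>: the map \<open>a \<otimes> h \<mapsto> (b \<mapsto> a (h b))\<close> is bijective.\<close>

definition dual_galois ::
  "'k ring \<Rightarrow> ('k, 'h) module \<Rightarrow> ('k, 'a) module \<Rightarrow> ('h \<Rightarrow> 'a \<Rightarrow> 'a) \<Rightarrow> bool" where
  "dual_galois K H A act \<longleftrightarrow>
    bij_betw (tensor_lift (hom_space K A A) (\<lambda>a h. \<lambda>b\<in>carrier A. a \<otimes>\<^bsub>A\<^esub> act h b))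
      (carrier (tensor K A H)) (carrier (hom_space K A A))"

definition equivariant_hom ::
  "'k ring \<Rightarrow> ('k, 'h) module \<Rightarrow> ('k, 'v) module \<Rightarrow> ('h \<Rightarrow> 'v \<Rightarrow> 'v) \<Rightarrow>
    ('k, 'w) module \<Rightarrow> ('h \<Rightarrow> 'w \<Rightarrow> 'w) \<Rightarrow> ('k, 'v \<Rightarrow> 'w) module" where
  "equivariant_hom K H V actV W actW =
    (hom_space K V W)\<lparr>carrier :=
      {f \<in> carrier (hom_space K V W).
        \<forall>h\<in>carrier H. \<forall>v\<in>carrier V. f (actV h v) = actW h (f v)}\<rparr>"

definition equivariant_End ::
  "'k ring \<Rightarrow> ('k, 'h) module \<Rightarrow> ('k, 'a) module \<Rightarrow> ('h \<Rightarrow> 'a \<Rightarrow> 'a) \<Rightarrow> ('k, 'a \<Rightarrow> 'a) module" where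
  "equivariant_End K H A act =
    (equivariant_hom K H A act A act)
      \<lparr>mult := compose (carrier A), one := (\<lambda>a\<in>carrier A. a)\<rparr>"

definition tensor_act ::
  "'k ring \<Rightarrow> ('h \<Rightarrow> ('h, 'h) tensor) \<Rightarrow> ('k, 'v) module \<Rightarrow> ('h \<Rightarrow> 'v \<Rightarrow> 'v) \<Rightarrow>
    ('k, 'w) module \<Rightarrow> ('h \<Rightarrow> 'w \<Rightarrow> 'w) \<Rightarrow> 'h \<Rightarrow> ('v, 'w) tensor \<Rightarrow> ('v, 'w) tensor" where
  "tensor_act K \<Delta> V actV W actW h t =
    tensor_lift (tensor K V W) (\<lambda>x y. tensor_map K V W (actV x) (actW y) t) (\<Delta> h)"

section \<open>Quasitriangular structures and braidings\<close>

text \<open>The elements \<open>R\<^sub>1\<^sub>2\<close>, \<open>R\<^sub>1\<^sub>3\<close>, \<open>R\<^sub>2\<^sub>3\<close> of \<open>(H \<otimes> H) \<otimes> H\<close>.\<close>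

definition embed12 ::
  "'k ring \<Rightarrow> ('k, 'h) module \<Rightarrow> ('h, 'h) tensor \<Rightarrow> (('h, 'h) tensor, 'h) tensor" where
  "embed12 K H = tensor_lift (tensor K (tensor K H H) H)
    (\<lambda>x y. pure_tensor K (tensor K H H) H (pure_tensor K H H x y) \<one>\<^bsub>H\<^esub>)"

definition embed13 ::
  "'k ring \<Rightarrow> ('k, 'h) module \<Rightarrow> ('h, 'h) tensor \<Rightarrow> (('h, 'h) tensor, 'h) tensor" where
  "embed13 K H = tensor_lift (tensor K (tensor K H H) H)
    (\<lambda>x y. pure_tensor K (tensor K H H) H (pure_tensor K H H x \<one>\<^bsub>H\<^esub>) y)"

definition embed23 ::
  "'k ring \<Rightarrow> ('k, 'h) module \<Rightarrow> ('h, 'h) tensor \<Rightarrow> (('h, 'h) tensor, 'h) tensor" where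
  "embed23 K H = tensor_lift (tensor K (tensor K H H) H)
    (\<lambda>x y. pure_tensor K (tensor K H H) H (pure_tensor K H H \<one>\<^bsub>H\<^esub> x) y)"

definition quasitriangular ::
  "'k ring \<Rightarrow> ('k, 'h) module \<Rightarrow> ('h \<Rightarrow> ('h, 'h) tensor) \<Rightarrow> ('h \<Rightarrow> 'k) \<Rightarrow>
    ('h, 'h) tensor \<Rightarrow> bool" where
  "quasitriangular K H \<Delta> \<epsilon> R \<longleftrightarrow>
    (let H2 = tensor K H H; H3 = tensor K H2 H in
     R \<in> carrier H2 \<and>
     (\<forall>h\<in>carrier H. tensor_swap K H H (\<Delta> h) \<otimes>\<^bsub>H2\<^esub> R = R \<otimes>\<^bsub>H2\<^esub> \<Delta> h) \<and>
     tensor_lift H (\<lambda>x y. \<epsilon> x \<odot>\<^bsub>H\<^esub> y) R = \<one>\<^bsub>H\<^esub> \<and>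
     tensor_lift H (\<lambda>x y. \<epsilon> y \<odot>\<^bsub>H\<^esub> x) R = \<one>\<^bsub>H\<^esub> \<and>
     tensor_map K H2 H \<Delta> id R = embed13 K H R \<otimes>\<^bsub>H3\<^esub> embed23 K H R \<and>
     tensor_unassoc K H H H (tensor_map K H H2 id \<Delta> R) = embed13 K H R \<otimes>\<^bsub>H3\<^esub> embed12 K H R)"

definition triangular ::
  "'k ring \<Rightarrow> ('k, 'h) module \<Rightarrow> ('h \<Rightarrow> ('h, 'h) tensor) \<Rightarrow> ('h \<Rightarrow> 'k) \<Rightarrow>
    ('h, 'h) tensor \<Rightarrow> bool" where
  "triangular K H \<Delta> \<epsilon> R \<longleftrightarrow>
    quasitriangular K H \<Delta> \<epsilon> R \<and>
    R \<in> Units (tensor K H H) \<and> inv\<^bsub>tensor K H H\<^esub> R = tensor_swap K H H R"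

text \<open>The map \<open>u \<otimes> v \<mapsto> \<Sum>\<^sub>i r''\<^sub>i v \<otimes> r'\<^sub>i u\<close> from \<open>U \<otimes> V\<close> to \<open>V \<otimes> U\<close>.\<close>

definition braiding ::
  "'k ring \<Rightarrow> ('h, 'h) tensor \<Rightarrow> ('k, 'u) module \<Rightarrow> ('h \<Rightarrow> 'u \<Rightarrow> 'u) \<Rightarrow>
    ('k, 'v) module \<Rightarrow> ('h \<Rightarrow> 'v \<Rightarrow> 'v) \<Rightarrow> ('u, 'v) tensor \<Rightarrow> ('v, 'u) tensor" where
  "braiding K R U actU V actV =
    tensor_lift (tensor K V U) (\<lambda>u v.
      tensor_lift (tensor K V U) (\<lambda>x y. pure_tensor K V U (actV y v) (actU x u)) R)"

section \<open>The contravariant functor into modules over the endomorphism algebra\<close>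

text \<open>
  For \<open>D = Hom\<^sub>H(?, A)\<close>, the space \<open>D(V)\<close> is \<^const>\<open>equivariant_hom\<close> with target \<open>A\<close>;
  \<open>D\<close> sends a morphism \<open>f\<close> with domain \<open>V\<close> to precomposition with \<open>f\<close>, and an endomorphism of
  \<open>A\<close> acts on \<open>D(V)\<close> by postcomposition.
\<close>

definition D_map :: "('k, 'v) module \<Rightarrow> ('v \<Rightarrow> 'w) \<Rightarrow> ('w \<Rightarrow> 'a) \<Rightarrow> 'v \<Rightarrow> 'a" where
  "D_map V f \<sigma> = compose (carrier V) \<sigma> f"

definition D_act :: "('k, 'v) module \<Rightarrow> ('a \<Rightarrow> 'a) \<Rightarrow> ('v \<Rightarrow> 'a) \<Rightarrow> 'v \<Rightarrow> 'a" where
  "D_act V \<phi> \<sigma> = compose (carrier V) \<phi> \<sigma>"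

definition cup ::
  "'k ring \<Rightarrow> ('k, 'u) module \<Rightarrow> ('k, 'v) module \<Rightarrow> ('k, 'a) module \<Rightarrow>
    ('u \<Rightarrow> 'a) \<Rightarrow> ('v \<Rightarrow> 'a) \<Rightarrow> ('u, 'v) tensor \<Rightarrow> 'a" where
  "cup K U V A \<tau> \<sigma> =
    (\<lambda>t\<in>carrier (tensor K U V). tensor_lift A (\<lambda>u v. \<tau> u \<otimes>\<^bsub>A\<^esub> \<sigma> v) t)"

definition cup_map ::
  "'k ring \<Rightarrow> ('k, 'h) module \<Rightarrow> ('h \<Rightarrow> ('h, 'h) tensor) \<Rightarrow> ('k, 'a) module \<Rightarrow> ('h \<Rightarrow> 'a \<Rightarrow> 'a) \<Rightarrow>
    ('k, 'u) module \<Rightarrow> ('h \<Rightarrow> 'u \<Rightarrow> 'u) \<Rightarrow> ('k, 'v) module \<Rightarrow> ('h \<Rightarrow> 'v \<Rightarrow> 'v) \<Rightarrow>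
    ('u \<Rightarrow> 'a, 'v \<Rightarrow> 'a) tensor \<Rightarrow> ('u, 'v) tensor \<Rightarrow> 'a" where
  "cup_map K H \<Delta> A act U actU V actV =
    tensor_lift
      (equivariant_hom K H (tensor K U V) (tensor_act K \<Delta> U actU V actV) A act)
      (cup K U V A)"

end

theory Submission
  imports Defs
begin

text \<open>
  The relation in the theorem says that the bilinear map \<open>\<theta>(a, b) = \<Sum> (r''\<^sub>i b) (r'\<^sub>i a)\<close> on \<open>A\<close>, which is
  given by an element of \<open>H \<otimes> H\<close>, is also given by an element of \<open>E \<otimes> E\<close>.  The theorem holds because
  \<open>H\<close> and \<open>E\<close> play symmetric roles: each of the two Galois actions on \<open>A\<close> is the full commutant of the
  other, and the bilinear maps that are equivariant for one of them are given by the tensor square of the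
  other.

  First, \<open>A\<close> is finite dimensional (\<open>galois_finite_dimensional\<close>).  Let \<open>c\<close> be a functional on \<open>A\<close>.  The
  operator \<open>b \<mapsto> c(b) 1\<close> comes from an element \<open>\<Sum> x \<otimes> g\<close> of \<open>A \<otimes> H\<close>, and for every operator \<open>f\<close> the
  conjugate \<open>\<Sum> x g' f S(g'')\<close> commutes with \<open>H\<close> (\<open>conj_map_rank_one_equivariant\<close>).  Letting \<open>c\<close> vary, one
  recovers \<open>f\<close> from its conjugates and coefficients in \<open>A\<close> (\<open>conj_map_decomposition\<close>), and a conjugate of
  \<open>\<Sum> x \<phi>\<close> with \<open>\<phi>\<close> in \<open>E\<close> is \<open>\<Sum> c(x) \<phi>\<close> (\<open>conj_map_galois_map\<close>).  So \<open>E\<close> is finite dimensional and its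
  action on \<open>A\<close> is Galois as well (\<open>E_coevaluation\<close>, \<open>E_galois\<close>), and \<open>H\<close> is the full commutant of \<open>E\<close>
  (\<open>H_full\<close>).

  A bilinear map that is equivariant for \<open>H\<close> is given by an element of \<open>E \<otimes> E\<close>
  (\<open>equivariant_bilinear\<close>).  If \<open>R\<close> is quasitriangular, then \<open>\<Delta>\<^sup>o\<^sup>p(h) R = R \<Delta>(h)\<close> makes \<open>\<theta>\<close>
  equivariant, and this gives \<open>R'\<close>.  Elements of twofold and threefold tensor powers of a Galois
  algebra are determined by their values at elements of \<open>A\<close> (\<open>separation\<close>).  This gives uniqueness, and
  it allows the axioms of \<open>R'\<close> to be checked on elements of \<open>A\<close>, where the relation and the rule for the
  action on a product reduce them to the axioms of \<open>R\<close> (\<open>related_quasitriangular\<close>,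
  \<open>related_triangular\<close>).  Exchanging \<open>H\<close> and \<open>E\<close> gives the inverse correspondence.

  Commutativity of the square, finally, is the relation at \<open>a = \<sigma>(u)\<close> and \<open>b = \<tau>(v)\<close>
  (\<open>braiding_square\<close>).

  Finite dimensionality is used in the form of a coevaluation: an element \<open>\<Sum> e\<^sub>i \<otimes> c\<^sub>i\<close> of \<open>V \<otimes> V\<^sup>*\<close>
  with \<open>v = \<Sum> c\<^sub>i(v) e\<^sub>i\<close> for all \<open>v\<close>.  It replaces sums over a basis by the lift of a bilinear map.
\<close>


section \<open>Linear and bilinear maps\<close>

abbreviation lin_map ::
  "'k ring \<Rightarrow> ('k, 'v) module \<Rightarrow> ('k, 'w) module \<Rightarrow> ('v \<Rightarrow> 'w) \<Rightarrow> bool" where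
  "lin_map K V W f \<equiv> f \<in> module_hom K V W"

definition bilin_map ::
  "'k ring \<Rightarrow> ('k, 'v) module \<Rightarrow> ('k, 'w) module \<Rightarrow> ('k, 'x) module \<Rightarrow> ('v \<Rightarrow> 'w \<Rightarrow> 'x) \<Rightarrow> bool" where
  "bilin_map K V W X \<beta> \<longleftrightarrow>
    (\<forall>v\<in>carrier V. lin_map K W X (\<beta> v)) \<and> (\<forall>w\<in>carrier W. lin_map K V X (\<lambda>v. \<beta> v w))"

lemma lin_mapI:
  assumes "\<And>v. v \<in> carrier V \<Longrightarrow> f v \<in> carrier W"
    and "\<And>v v'. v \<in> carrier V \<Longrightarrow> v' \<in> carrier V \<Longrightarrow> f (v \<oplus>\<^bsub>V\<^esub> v') = f v \<oplus>\<^bsub>W\<^esub> f v'"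
    and "\<And>c v. c \<in> carrier K \<Longrightarrow> v \<in> carrier V \<Longrightarrow> f (c \<odot>\<^bsub>V\<^esub> v) = c \<odot>\<^bsub>W\<^esub> f v"
  shows "lin_map K V W f"
  using assms by (auto simp: module_hom_def)

lemma lin_map_closed: "lin_map K V W f \<Longrightarrow> v \<in> carrier V \<Longrightarrow> f v \<in> carrier W"
  by (auto simp: module_hom_def)

lemma lin_map_zero:
  assumes "vectorspace K V" "vectorspace K W" "lin_map K V W f"
  shows "f \<zero>\<^bsub>V\<^esub> = \<zero>\<^bsub>W\<^esub>"
proof -
  interpret V: vectorspace K V by fact
  interpret W: vectorspace K W by fact
  have "f (\<zero>\<^bsub>K\<^esub> \<odot>\<^bsub>V\<^esub> \<zero>\<^bsub>V\<^esub>) = \<zero>\<^bsub>K\<^esub> \<odot>\<^bsub>W\<^esub> f \<zero>\<^bsub>V\<^esub>"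
    using assms(3) by (intro module_hom_smult) auto
  then show ?thesis using lin_map_closed[OF assms(3)] by simp
qed

lemma lin_map_cong:
  assumes "lin_map K V W f" "vectorspace K V" "\<And>v. v \<in> carrier V \<Longrightarrow> g v = f v"
  shows "lin_map K V W g"
proof -
  interpret V: vectorspace K V by fact
  show ?thesis using assms(1,3) by (auto simp: module_hom_def)
qed

lemma lin_map_id: "lin_map K V V (\<lambda>v. v)"
  by (auto simp: module_hom_def)

lemma lin_map_comp:
  assumes "lin_map K V W f" "lin_map K W X g"
  shows "lin_map K V X (\<lambda>v. g (f v))"
  using lin_map_closed[OF assms(1)] lin_map_closed[OF assms(2)]
  by (intro lin_mapI)
    (simp_all add: module_hom_add[OF assms(1)] module_hom_add[OF assms(2)]
      module_hom_smult[OF assms(1)] module_hom_smult[OF assms(2)])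

lemma lin_map_add:
  assumes "vectorspace K W" "lin_map K V W f" "lin_map K V W g"
  shows "lin_map K V W (\<lambda>v. f v \<oplus>\<^bsub>W\<^esub> g v)"
proof -
  interpret W: vectorspace K W by fact
  show ?thesis
    using lin_map_closed[OF assms(2)] lin_map_closed[OF assms(3)]
    by (intro lin_mapI)
      (simp_all add: module_hom_add[OF assms(2)] module_hom_add[OF assms(3)] W.M.a_ac
        module_hom_smult[OF assms(2)] module_hom_smult[OF assms(3)] W.smult_r_distr)
qed

lemma lin_map_zero_map:
  assumes "vectorspace K W"
  shows "lin_map K V W (\<lambda>v. \<zero>\<^bsub>W\<^esub>)"
proof -
  interpret W: vectorspace K W by fact
  show ?thesis by (auto simp: module_hom_def)
qed

lemma lin_map_smult_const:
  assumes "vectorspace K W" "lin_map K V W f" "c \<in> carrier K"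
  shows "lin_map K V W (\<lambda>v. c \<odot>\<^bsub>W\<^esub> f v)"
proof -
  interpret W: vectorspace K W by fact
  show ?thesis
    using lin_map_closed[OF assms(2)] assms(3)
    by (intro lin_mapI)
      (simp_all add: module_hom_add[OF assms(2)] module_hom_smult[OF assms(2)] W.smult_r_distr
        W.smult_assoc1[symmetric] W.R.m_comm)
qed

lemma bilin_mapI:
  assumes "\<And>v. v \<in> carrier V \<Longrightarrow> lin_map K W X (\<beta> v)"
    and "\<And>w. w \<in> carrier W \<Longrightarrow> lin_map K V X (\<lambda>v. \<beta> v w)"
  shows "bilin_map K V W X \<beta>"
  using assms by (auto simp: bilin_map_def)

lemma bilin_map_left: "bilin_map K V W X \<beta> \<Longrightarrow> w \<in> carrier W \<Longrightarrow> lin_map K V X (\<lambda>v. \<beta> v w)"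
  and bilin_map_right: "bilin_map K V W X \<beta> \<Longrightarrow> v \<in> carrier V \<Longrightarrow> lin_map K W X (\<beta> v)"
  by (auto simp: bilin_map_def)

lemma bilin_map_closed:
  "bilin_map K V W X \<beta> \<Longrightarrow> v \<in> carrier V \<Longrightarrow> w \<in> carrier W \<Longrightarrow> \<beta> v w \<in> carrier X"
  by (auto simp: bilin_map_def module_hom_def)

lemma bilin_map_comp:
  assumes "bilin_map K V W X \<beta>" "lin_map K X Y f"
  shows "bilin_map K V W Y (\<lambda>v w. f (\<beta> v w))"
  using assms by (auto simp: bilin_map_def intro: lin_map_comp)

section \<open>Tensor products\<close>

definition pair_lists :: "('k, 'v) module \<Rightarrow> ('k, 'w) module \<Rightarrow> ('v \<times> 'w) list set" where
  "pair_lists V W = lists (carrier V \<times> carrier W)"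

lemma pair_lists_simps [simp]:
  "[] \<in> pair_lists V W"
  "(v, w) # l \<in> pair_lists V W \<longleftrightarrow> v \<in> carrier V \<and> w \<in> carrier W \<and> l \<in> pair_lists V W"
  "l @ m \<in> pair_lists V W \<longleftrightarrow> l \<in> pair_lists V W \<and> m \<in> pair_lists V W"
  by (auto simp: pair_lists_def)

definition tensor_sum :: "('k, 'x) module \<Rightarrow> ('v \<Rightarrow> 'w \<Rightarrow> 'x) \<Rightarrow> ('v \<times> 'w) list \<Rightarrow> 'x" where
  "tensor_sum X \<beta> l = foldr (\<lambda>(v, w) s. \<beta> v w \<oplus>\<^bsub>X\<^esub> s) l \<zero>\<^bsub>X\<^esub>"

lemma tensor_lift_tensor_sum: "tensor_lift X \<beta> t = the_elem (tensor_sum X \<beta> ` t)"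
proof -
  have "(\<lambda>l. foldr (\<lambda>(v, w) s. \<beta> v w \<oplus>\<^bsub>X\<^esub> s) l \<zero>\<^bsub>X\<^esub>) = tensor_sum X \<beta>"
    by (simp add: tensor_sum_def fun_eq_iff)
  then show ?thesis unfolding tensor_lift_def by (rule arg_cong)
qed

lemma tensor_sum_Nil [simp]: "tensor_sum X \<beta> [] = \<zero>\<^bsub>X\<^esub>"
  and tensor_sum_Cons [simp]: "tensor_sum X \<beta> ((v, w) # l) = \<beta> v w \<oplus>\<^bsub>X\<^esub> tensor_sum X \<beta> l"
  by (auto simp: tensor_sum_def case_prod_beta)

lemma tensor_sum_closed:
  assumes "vectorspace K X" "\<And>v w. v \<in> carrier V \<Longrightarrow> w \<in> carrier W \<Longrightarrow> \<beta> v w \<in> carrier X"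
    "l \<in> pair_lists V W"
  shows "tensor_sum X \<beta> l \<in> carrier X"
proof -
  interpret X: vectorspace K X by fact
  show ?thesis using assms(3) by (induction l) (auto intro!: X.M.a_closed assms(2))
qed

lemma tensor_sum_append:
  assumes "vectorspace K X" "\<And>v w. v \<in> carrier V \<Longrightarrow> w \<in> carrier W \<Longrightarrow> \<beta> v w \<in> carrier X"
    "l \<in> pair_lists V W" "m \<in> pair_lists V W"
  shows "tensor_sum X \<beta> (l @ m) = tensor_sum X \<beta> l \<oplus>\<^bsub>X\<^esub> tensor_sum X \<beta> m"
proof -
  interpret X: vectorspace K X by fact
  note closed = tensor_sum_closed[OF assms(1,2)]
  show ?thesis using assms(3)
    by (induction l) (auto simp: closed assms(2,4) X.M.a_assoc)
qed

lemma tensor_sum_cong: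
  assumes "\<And>v w. v \<in> carrier V \<Longrightarrow> w \<in> carrier W \<Longrightarrow> \<beta> v w = \<gamma> v w"
    and "l \<in> pair_lists V W"
  shows "tensor_sum X \<beta> l = tensor_sum X \<gamma> l"
  using assms(2) by (induction l) (auto simp: assms(1))

lemma lin_map_tensor_sum:
  assumes "vectorspace K X" "vectorspace K Y" "lin_map K X Y f"
    "\<And>v w. v \<in> carrier V \<Longrightarrow> w \<in> carrier W \<Longrightarrow> \<beta> v w \<in> carrier X"
    "l \<in> pair_lists V W"
  shows "f (tensor_sum X \<beta> l) = tensor_sum Y (\<lambda>v w. f (\<beta> v w)) l"
proof -
  interpret X: vectorspace K X by fact
  note closed = tensor_sum_closed[OF assms(1,4)]
  show ?thesis using assms(5)
    by (induction l)
      (auto simp: closed assms(4) lin_map_zero[OF assms(1-3)] module_hom_add[OF assms(3)])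
qed

text \<open>
  Facts about duals and bases are attached to this copy of \<^locale>\<open>vectorspace\<close>, so that a locale
  with several spaces inherits them for each of its spaces under a separate prefix.
\<close>
locale one_space = vectorspace K V for K :: "'k ring" and V :: "('k, 'v) module"

locale two_spaces = V: vectorspace K V + W: vectorspace K W
  for K :: "'k ring" and V :: "('k, 'v) module" and W :: "('k, 'w) module"
begin

sublocale V: one_space K V by unfold_locales

sublocale W: one_space K W by unfold_locales

abbreviation "pairs \<equiv> pair_lists V W"
abbreviation "eqv \<equiv> tensor_equiv K V W"
abbreviation "cls \<equiv> tensor_class K V W"
abbreviation "pure \<equiv> pure_tensor K V W"
abbreviation "T \<equiv> tensor K V W"

lemma equiv_pairs: "eqv l m \<Longrightarrow> l \<in> pairs \<and> m \<in> pairs"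
  by (induction rule: tensor_equiv.induct) (auto simp: pair_lists_def[symmetric])

text \<open>
  Each generator of the congruence states one of the rules that a bilinear map obeys.  Hence the
  sum does not depend on the representing list.
\<close>
lemma tensor_sum_equiv:
  assumes "vectorspace K X" "bilin_map K V W X \<beta>" "eqv l m"
  shows "tensor_sum X \<beta> l = tensor_sum X \<beta> m"
proof -
  interpret X: vectorspace K X by fact
  note c = bilin_map_closed[OF assms(2)]
  note sc = tensor_sum_closed[OF assms(1) c]
  note sa = tensor_sum_append[OF assms(1) c]
  note L = bilin_map_left[OF assms(2)] and R = bilin_map_right[OF assms(2)]
  show ?thesis using assms(3)
  proof (induction rule: tensor_equiv.induct)
    case (append l l' m m')
    then show ?case using equiv_pairs by (simp add: sa)
  next
    case (commute l m)
    then show ?case by (simp add: pair_lists_def[symmetric] sa sc X.M.a_comm)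
  next
    case (add_left v v' w)
    then show ?case by (simp add: c module_hom_add[OF L[of w]] X.M.a_assoc)
  next
    case (add_right v w w')
    then show ?case by (simp add: c module_hom_add[OF R[of v]] X.M.a_assoc)
  next
    case (smult k v w)
    then show ?case by (simp add: c module_hom_smult[OF R[of v]] module_hom_smult[OF L[of w]])
  next
    case (zero w)
    then show ?case by (simp add: lin_map_zero[OF V.vectorspace_axioms assms(1) L[of w]])
  qed auto
qed

lemma equiv_refl: "l \<in> pairs \<Longrightarrow> eqv l l"
  by (auto simp: pair_lists_def intro: tensor_equiv.refl)

lemma equiv_commute: "l \<in> pairs \<Longrightarrow> m \<in> pairs \<Longrightarrow> eqv (l @ m) (m @ l)"
  by (auto simp: pair_lists_def intro: tensor_equiv.commute)

lemma class_eq_iff: "l \<in> pairs \<Longrightarrow> cls l = cls m \<longleftrightarrow> eqv l m"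
  unfolding tensor_class_def
  by (auto intro: equiv_refl tensor_equiv.sym tensor_equiv.trans)

lemma in_class: "l \<in> pairs \<Longrightarrow> l \<in> cls l"
  by (auto simp: tensor_class_def intro: equiv_refl)

lemma in_class_iff: "m \<in> cls l \<longleftrightarrow> eqv l m"
  by (simp add: tensor_class_def)

lemma carrier_tensor: "carrier T = cls ` pairs"
  by (simp add: tensor_def pair_lists_def)

lemma class_closed: "l \<in> pairs \<Longrightarrow> cls l \<in> carrier T"
  by (simp add: carrier_tensor)

lemma tensorE:
  assumes "t \<in> carrier T" obtains l where "l \<in> pairs" "t = cls l"
  using assms by (auto simp: carrier_tensor)

lemma zero_tensor: "\<zero>\<^bsub>T\<^esub> = cls []"
  by (simp add: tensor_def)

lemma add_class:
  assumes "l \<in> pairs" "m \<in> pairs"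
  shows "cls l \<oplus>\<^bsub>T\<^esub> cls m = cls (l @ m)"
proof -
  have "cls (l' @ m') = cls (l @ m)" if "l' \<in> cls l" "m' \<in> cls m" for l' m'
  proof -
    have "eqv l l'" "eqv m m'" using that by (simp_all add: in_class_iff)
    then show ?thesis using equiv_pairs assms
      by (intro HOL.sym[OF class_eq_iff[THEN iffD2]] tensor_equiv.append) simp_all
  qed
  then have "(\<Union>l'\<in>cls l. \<Union>m'\<in>cls m. cls (l' @ m')) = cls (l @ m)"
    using in_class[OF assms(1)] in_class[OF assms(2)] by blast
  then show ?thesis by (simp add: tensor_def)
qed

lemma smult_pairs: "c \<in> carrier K \<Longrightarrow> l \<in> pairs \<Longrightarrow> map (\<lambda>(v, w). (c \<odot>\<^bsub>V\<^esub> v, w)) l \<in> pairs"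
  by (induction l) auto

lemma smult_equiv:
  assumes "c \<in> carrier K" "eqv l m"
  shows "eqv (map (\<lambda>(v, w). (c \<odot>\<^bsub>V\<^esub> v, w)) l) (map (\<lambda>(v, w). (c \<odot>\<^bsub>V\<^esub> v, w)) m)"
  using assms(2)
proof (induction rule: tensor_equiv.induct)
  case (refl l)
  then show ?case using assms(1) by (intro equiv_refl smult_pairs) (simp_all add: pair_lists_def)
next
  case (commute l m)
  then show ?case using assms(1)
    by (simp only: map_append, intro equiv_commute smult_pairs) (simp_all add: pair_lists_def)
next
  case (smult d v w)
  then have "eqv [(d \<odot>\<^bsub>V\<^esub> (c \<odot>\<^bsub>V\<^esub> v), w)] [(c \<odot>\<^bsub>V\<^esub> v, d \<odot>\<^bsub>W\<^esub> w)]"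
    using assms(1) by (intro tensor_equiv.smult) auto
  moreover have "d \<odot>\<^bsub>V\<^esub> (c \<odot>\<^bsub>V\<^esub> v) = c \<odot>\<^bsub>V\<^esub> (d \<odot>\<^bsub>V\<^esub> v)"
    using smult assms(1) by (metis V.R.m_comm V.smult_assoc1)
  ultimately show ?case by simp
next
  case (sym l m)
  then show ?case by (auto intro: tensor_equiv.sym)
next
  case (trans l m n)
  then show ?case by (auto intro: tensor_equiv.trans)
next
  case (append l l' m m')
  then show ?case by (simp only: map_append) (rule tensor_equiv.append)
next
  case (add_left v v' w)
  then show ?case using assms(1) by (auto simp: V.smult_r_distr intro!: tensor_equiv.add_left)
next
  case (add_right v w w')
  then show ?case using assms(1) by (auto intro!: tensor_equiv.add_right)
next
  case (zero w)
  then show ?case using assms(1) by (auto intro!: tensor_equiv.zero)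
qed

lemma smult_class:
  assumes "c \<in> carrier K" "l \<in> pairs"
  shows "c \<odot>\<^bsub>T\<^esub> cls l = cls (map (\<lambda>(v, w). (c \<odot>\<^bsub>V\<^esub> v, w)) l)"
proof -
  let ?s = "map (\<lambda>(v, w). (c \<odot>\<^bsub>V\<^esub> v, w))"
  have "cls (?s l') = cls (?s l)" if "l' \<in> cls l" for l'
    using that assms
    by (intro HOL.sym[OF class_eq_iff[THEN iffD2]] smult_equiv smult_pairs) (simp_all add: in_class_iff)
  then have "(\<Union>l'\<in>cls l. cls (?s l')) = cls (?s l)"
    using in_class[OF assms(2)] by blast
  then show ?thesis by (simp add: tensor_def)
qed

lemma pure_closed [simp]: "v \<in> carrier V \<Longrightarrow> w \<in> carrier W \<Longrightarrow> pure v w \<in> carrier T"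
  by (simp add: pure_tensor_def class_closed)

lemma class_Cons:
  "v \<in> carrier V \<Longrightarrow> w \<in> carrier W \<Longrightarrow> l \<in> pairs \<Longrightarrow> cls ((v, w) # l) = pure v w \<oplus>\<^bsub>T\<^esub> cls l"
  by (simp add: pure_tensor_def add_class)

lemma zero_closed: "\<zero>\<^bsub>T\<^esub> \<in> carrier T"
  by (simp add: zero_tensor class_closed)

lemma add_closed: "s \<in> carrier T \<Longrightarrow> t \<in> carrier T \<Longrightarrow> s \<oplus>\<^bsub>T\<^esub> t \<in> carrier T"
  by (elim tensorE) (simp add: add_class class_closed)

lemma smult_closed: "c \<in> carrier K \<Longrightarrow> t \<in> carrier T \<Longrightarrow> c \<odot>\<^bsub>T\<^esub> t \<in> carrier T"
  by (elim tensorE) (simp add: smult_class class_closed smult_pairs)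

lemma add_assoc:
  "\<lbrakk>r \<in> carrier T; s \<in> carrier T; t \<in> carrier T\<rbrakk> \<Longrightarrow> (r \<oplus>\<^bsub>T\<^esub> s) \<oplus>\<^bsub>T\<^esub> t = r \<oplus>\<^bsub>T\<^esub> (s \<oplus>\<^bsub>T\<^esub> t)"
  by (elim tensorE) (simp add: add_class)

lemma add_comm: "\<lbrakk>s \<in> carrier T; t \<in> carrier T\<rbrakk> \<Longrightarrow> s \<oplus>\<^bsub>T\<^esub> t = t \<oplus>\<^bsub>T\<^esub> s"
  by (elim tensorE) (simp add: add_class class_eq_iff equiv_commute)

lemma add_zero: "s \<in> carrier T \<Longrightarrow> s \<oplus>\<^bsub>T\<^esub> \<zero>\<^bsub>T\<^esub> = s"
  by (elim tensorE) (simp add: add_class zero_tensor)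

lemma tensor_abelian_monoid: "abelian_monoid T"
  by (intro abelian_monoidI)
    (simp_all add: zero_closed add_closed add_assoc add_zero add_comm[OF zero_closed], rule add_comm)

lemma pure_add_left:
  "\<lbrakk>v \<in> carrier V; v' \<in> carrier V; w \<in> carrier W\<rbrakk> \<Longrightarrow> pure (v \<oplus>\<^bsub>V\<^esub> v') w = pure v w \<oplus>\<^bsub>T\<^esub> pure v' w"
  by (simp add: pure_tensor_def add_class class_eq_iff tensor_equiv.add_left)

lemma pure_add_right:
  "\<lbrakk>v \<in> carrier V; w \<in> carrier W; w' \<in> carrier W\<rbrakk> \<Longrightarrow> pure v (w \<oplus>\<^bsub>W\<^esub> w') = pure v w \<oplus>\<^bsub>T\<^esub> pure v w'"
  by (simp add: pure_tensor_def add_class class_eq_iff tensor_equiv.add_right)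

lemma pure_smult_left:
  "\<lbrakk>c \<in> carrier K; v \<in> carrier V; w \<in> carrier W\<rbrakk> \<Longrightarrow> pure (c \<odot>\<^bsub>V\<^esub> v) w = c \<odot>\<^bsub>T\<^esub> pure v w"
  by (simp add: pure_tensor_def smult_class)

lemma pure_smult_right:
  "\<lbrakk>c \<in> carrier K; v \<in> carrier V; w \<in> carrier W\<rbrakk> \<Longrightarrow> pure v (c \<odot>\<^bsub>W\<^esub> w) = c \<odot>\<^bsub>T\<^esub> pure v w"
  by (simp add: pure_smult_left[symmetric])
    (simp add: pure_tensor_def class_eq_iff tensor_equiv.smult[THEN tensor_equiv.sym])

lemma pure_zero_left: "w \<in> carrier W \<Longrightarrow> pure \<zero>\<^bsub>V\<^esub> w = \<zero>\<^bsub>T\<^esub>"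
  by (simp add: pure_tensor_def zero_tensor class_eq_iff tensor_equiv.zero)

lemma smult_add_tensor:
  assumes "c \<in> carrier K" "s \<in> carrier T" "t \<in> carrier T"
  shows "c \<odot>\<^bsub>T\<^esub> (s \<oplus>\<^bsub>T\<^esub> t) = c \<odot>\<^bsub>T\<^esub> s \<oplus>\<^bsub>T\<^esub> c \<odot>\<^bsub>T\<^esub> t"
proof -
  from assms(2,3) obtain l m where *: "s = cls l" "t = cls m" "l \<in> pairs" "m \<in> pairs"
    by (auto elim!: tensorE)
  with assms(1) smult_pairs[of c] show ?thesis
    by (simp add: add_class smult_class del: map_eq_conv)
qed

lemma tensor_induct [consumes 1, case_names zero add]:
  assumes "t \<in> carrier T" "P \<zero>\<^bsub>T\<^esub>"
    and step: "\<And>v w t. \<lbrakk>v \<in> carrier V; w \<in> carrier W; t \<in> carrier T; P t\<rbrakk> \<Longrightarrow> P (pure v w \<oplus>\<^bsub>T\<^esub> t)"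
  shows "P t"
proof -
  have "P (cls l)" if "l \<in> pairs" for l
    using that
  proof (induction l)
    case Nil
    then show ?case using assms(2) by (simp add: zero_tensor)
  next
    case (Cons p l)
    obtain v w where "p = (v, w)" by (cases p)
    with Cons show ?case by (simp add: class_Cons step class_closed)
  qed
  with assms(1) show ?thesis by (auto elim: tensorE)
qed

lemma smult_zero_tensor: "c \<in> carrier K \<Longrightarrow> c \<odot>\<^bsub>T\<^esub> \<zero>\<^bsub>T\<^esub> = \<zero>\<^bsub>T\<^esub>"
  by (simp add: zero_tensor smult_class)

text \<open>
  The additive inverse of \<open>t\<close> is \<open>(-1) t\<close>.  By distributivity this comes down to \<open>0 t = 0\<close>, which is
  where the relation \<open>0 \<otimes> w = 0\<close> of the congruence enters.
\<close>
lemma tensor_vectorspace: "vectorspace K T"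
proof -
  interpret T: abelian_monoid T by (rule tensor_abelian_monoid)
  have one: "\<one>\<^bsub>K\<^esub> \<odot>\<^bsub>T\<^esub> t = t" if "t \<in> carrier T" for t
    using that
    by (induction rule: tensor_induct)
      (simp_all add: smult_zero_tensor smult_add_tensor pure_smult_left[symmetric])
  have assoc: "(a \<otimes>\<^bsub>K\<^esub> b) \<odot>\<^bsub>T\<^esub> t = a \<odot>\<^bsub>T\<^esub> (b \<odot>\<^bsub>T\<^esub> t)"
    if "t \<in> carrier T" "a \<in> carrier K" "b \<in> carrier K" for a b t
    using that
    by (induction rule: tensor_induct)
      (simp_all add: smult_zero_tensor smult_add_tensor smult_closed pure_smult_left[symmetric]
        V.smult_assoc1)
  have dist: "(a \<oplus>\<^bsub>K\<^esub> b) \<odot>\<^bsub>T\<^esub> t = a \<odot>\<^bsub>T\<^esub> t \<oplus>\<^bsub>T\<^esub> b \<odot>\<^bsub>T\<^esub> t"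
    if "t \<in> carrier T" "a \<in> carrier K" "b \<in> carrier K" for a b t
    using that
    by (induction rule: tensor_induct)
      (simp_all add: smult_zero_tensor smult_add_tensor smult_closed pure_smult_left[symmetric]
        V.smult_l_distr pure_add_left T.a_ac)
  have zero: "\<zero>\<^bsub>K\<^esub> \<odot>\<^bsub>T\<^esub> t = \<zero>\<^bsub>T\<^esub>" if "t \<in> carrier T" for t
    using that
    by (induction rule: tensor_induct)
      (simp_all add: smult_zero_tensor smult_add_tensor pure_smult_left[symmetric] pure_zero_left)
  have neg: "t \<oplus>\<^bsub>T\<^esub> (\<ominus>\<^bsub>K\<^esub> \<one>\<^bsub>K\<^esub>) \<odot>\<^bsub>T\<^esub> t = \<zero>\<^bsub>T\<^esub>" if "t \<in> carrier T" for t
  proof -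
    have "(\<one>\<^bsub>K\<^esub> \<oplus>\<^bsub>K\<^esub> \<ominus>\<^bsub>K\<^esub> \<one>\<^bsub>K\<^esub>) \<odot>\<^bsub>T\<^esub> t = t \<oplus>\<^bsub>T\<^esub> (\<ominus>\<^bsub>K\<^esub> \<one>\<^bsub>K\<^esub>) \<odot>\<^bsub>T\<^esub> t"
      using that by (simp add: dist one del: V.R.r_neg)
    then show ?thesis using that by (simp add: zero V.R.r_neg)
  qed
  have inverse: "\<forall>t\<in>carrier T. \<exists>u\<in>carrier T. t \<oplus>\<^bsub>T\<^esub> u = \<zero>\<^bsub>T\<^esub>"
  proof
    fix t assume t: "t \<in> carrier T"
    show "\<exists>u\<in>carrier T. t \<oplus>\<^bsub>T\<^esub> u = \<zero>\<^bsub>T\<^esub>"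
      by (rule bexI[where x = "(\<ominus>\<^bsub>K\<^esub> \<one>\<^bsub>K\<^esub>) \<odot>\<^bsub>T\<^esub> t"]) (simp_all add: t neg smult_closed)
  qed
  show ?thesis
    by (rule vs_criteria[OF V.field_axioms zero_closed _ inverse])
      (simp_all add: one assoc dist smult_closed smult_add_tensor T.a_ac add_zero)
qed

lemma pure_bilin: "bilin_map K V W T pure"
  by (intro bilin_mapI lin_mapI)
    (auto simp: pure_add_left pure_add_right pure_smult_left pure_smult_right)

lemma lift_class:
  assumes "vectorspace K X" "bilin_map K V W X \<beta>" "l \<in> pairs"
  shows "tensor_lift X \<beta> (cls l) = tensor_sum X \<beta> l"
proof -
  have "tensor_sum X \<beta> l' = tensor_sum X \<beta> l" if "l' \<in> cls l" for l'
    using tensor_sum_equiv[OF assms(1,2)] that by (simp add: in_class_iff)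
  then have "tensor_sum X \<beta> ` cls l = {tensor_sum X \<beta> l}"
    using in_class[OF assms(3)] by blast
  then show ?thesis by (simp add: tensor_lift_tensor_sum)
qed

lemma lift_pure [simp]:
  assumes "vectorspace K X" "bilin_map K V W X \<beta>" "v \<in> carrier V" "w \<in> carrier W"
  shows "tensor_lift X \<beta> (pure v w) = \<beta> v w"
proof -
  interpret X: vectorspace K X by fact
  show ?thesis unfolding pure_tensor_def
    using assms by (simp add: lift_class bilin_map_closed)
qed

lemma lift_lin:
  assumes "vectorspace K X" "bilin_map K V W X \<beta>"
  shows "lin_map K T X (tensor_lift X \<beta>)"
proof (intro lin_mapI)
  interpret X: vectorspace K X by fact
  note c = bilin_map_closed[OF assms(2)]
  note cl = lift_class[OF assms]
  fix s t assume "s \<in> carrier T" "t \<in> carrier T"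
  then obtain l m where *: "s = cls l" "t = cls m" "l \<in> pairs" "m \<in> pairs"
    by (auto elim!: tensorE)
  then have "l @ m \<in> pairs" by simp
  with * show "tensor_lift X \<beta> (s \<oplus>\<^bsub>T\<^esub> t) = tensor_lift X \<beta> s \<oplus>\<^bsub>X\<^esub> tensor_lift X \<beta> t"
    by (simp add: add_class cl tensor_sum_append[OF assms(1) c])
next
  interpret X: vectorspace K X by fact
  note c = bilin_map_closed[OF assms(2)]
  note cl = lift_class[OF assms]
  fix t assume t: "t \<in> carrier T"
  then show "tensor_lift X \<beta> t \<in> carrier X"
    by (auto elim!: tensorE simp: cl intro: tensor_sum_closed[OF assms(1) c])
  fix a assume a: "a \<in> carrier K"
  from t obtain l where l: "l \<in> pairs" "t = cls l" by (auto elim: tensorE)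
  have "tensor_sum X \<beta> (map (\<lambda>(v, w). (a \<odot>\<^bsub>V\<^esub> v, w)) l) = a \<odot>\<^bsub>X\<^esub> tensor_sum X \<beta> l"
    using l(1)
    by (induction l)
      (auto simp: a c X.smult_r_distr tensor_sum_closed[OF assms(1) c]
        module_hom_smult[OF bilin_map_left[OF assms(2)]])
  with l a smult_pairs[of a l] show "tensor_lift X \<beta> (a \<odot>\<^bsub>T\<^esub> t) = a \<odot>\<^bsub>X\<^esub> tensor_lift X \<beta> t"
    by (simp add: smult_class cl)
qed

lemma lift_closed:
  "\<lbrakk>vectorspace K X; bilin_map K V W X \<beta>; t \<in> carrier T\<rbrakk> \<Longrightarrow> tensor_lift X \<beta> t \<in> carrier X"
  by (rule lin_map_closed[OF lift_lin])

lemma lift_cong: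
  assumes "t \<in> carrier T"
    and "\<And>v w. v \<in> carrier V \<Longrightarrow> w \<in> carrier W \<Longrightarrow> \<beta> v w = \<gamma> v w"
  shows "tensor_lift X \<beta> t = tensor_lift X \<gamma> t"
proof -
  from assms(1) have "\<And>l. l \<in> t \<Longrightarrow> l \<in> pairs"
    using equiv_pairs by (auto elim!: tensorE simp: in_class_iff)
  then have "(\<lambda>l. tensor_sum X \<beta> l) ` t = (\<lambda>l. tensor_sum X \<gamma> l) ` t"
    by (intro image_cong tensor_sum_cong[where V = V and W = W] assms(2)) auto
  then show ?thesis by (simp add: tensor_lift_tensor_sum)
qed

lemma lift_zero:
  assumes "vectorspace K X" "t \<in> carrier T"
  shows "tensor_lift X (\<lambda>v w. \<zero>\<^bsub>X\<^esub>) t = \<zero>\<^bsub>X\<^esub>"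
proof -
  interpret X: vectorspace K X by fact
  have bil: "bilin_map K V W X (\<lambda>v w. \<zero>\<^bsub>X\<^esub>)"
    by (intro bilin_mapI lin_map_zero_map assms(1))
  from assms(2) obtain l where l: "l \<in> pairs" "t = cls l" by (rule tensorE)
  have "tensor_sum X (\<lambda>v w. \<zero>\<^bsub>X\<^esub>) l = \<zero>\<^bsub>X\<^esub>" for l :: "('v \<times> 'w) list" by (induction l) auto
  then show ?thesis by (simp add: l(2) lift_class[OF assms(1) bil l(1)])
qed

lemma tensor_ext:
  assumes "vectorspace K X" "lin_map K T X f" "lin_map K T X g" "t \<in> carrier T"
    and "\<And>v w. v \<in> carrier V \<Longrightarrow> w \<in> carrier W \<Longrightarrow> f (pure v w) = g (pure v w)"
  shows "f t = g t"
  using assms(4)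
  by (induction rule: tensor_induct)
    (simp_all add: lin_map_zero[OF tensor_vectorspace assms(1)] assms
      module_hom_add[OF assms(2)] module_hom_add[OF assms(3)])

lemma lin_map_lift:
  assumes "vectorspace K X" "vectorspace K Y" "lin_map K X Y f" "bilin_map K V W X \<beta>" "t \<in> carrier T"
  shows "f (tensor_lift X \<beta> t) = tensor_lift Y (\<lambda>v w. f (\<beta> v w)) t"
proof -
  from assms(5) obtain l where l: "l \<in> pairs" "t = cls l" by (auto elim: tensorE)
  then show ?thesis
    using lin_map_tensor_sum[OF assms(1-3) bilin_map_closed[OF assms(4)]]
      bilin_map_comp[OF assms(4,3)] assms(1,2,4)
    by (simp add: lift_class)
qed

text \<open>
  In an iterated sum over tensors, the inner sum is linear in the variables that it takes over from
  the outer one.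
\<close>
lemma lift_param:
  assumes "vectorspace K X" "t \<in> carrier T"
    and "\<And>z. z \<in> carrier Z \<Longrightarrow> bilin_map K V W X (\<beta> z)"
    and "\<And>v w. v \<in> carrier V \<Longrightarrow> w \<in> carrier W \<Longrightarrow> lin_map K Z X (\<lambda>z. \<beta> z v w)"
    and "vectorspace K Z"
  shows "lin_map K Z X (\<lambda>z. tensor_lift X (\<beta> z) t)"
proof -
  from assms(2) obtain l where l: "l \<in> pairs" "t = cls l" by (auto elim: tensorE)
  have "lin_map K Z X (\<lambda>z. tensor_sum X (\<beta> z) l)"
    using l(1)
    by (induction l) (auto intro!: lin_map_zero_map lin_map_add assms)
  then show ?thesis
    by (rule lin_map_cong) (auto simp: l lift_class assms)
qed

end

text \<open>
  Both sides are linear in \<open>t\<close>, and for a pure tensor \<open>t\<close> they have the same terms.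
\<close>
lemma lift_swap:
  assumes "vectorspace K V" "vectorspace K W" "vectorspace K V'" "vectorspace K W'" "vectorspace K X"
    and s: "s \<in> carrier (tensor K V W)" and t: "t \<in> carrier (tensor K V' W')"
    and b1: "\<And>v w. v \<in> carrier V \<Longrightarrow> w \<in> carrier W \<Longrightarrow> bilin_map K V' W' X (F v w)"
    and b2: "\<And>v' w'. v' \<in> carrier V' \<Longrightarrow> w' \<in> carrier W' \<Longrightarrow> bilin_map K V W X (\<lambda>v w. F v w v' w')"
  shows "tensor_lift X (\<lambda>v w. tensor_lift X (\<lambda>v' w'. F v w v' w') t) s =
    tensor_lift X (\<lambda>v' w'. tensor_lift X (\<lambda>v w. F v w v' w') s) t"
proof -
  interpret S: two_spaces K V W using assms(1,2) by (rule two_spaces.intro)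
  interpret R: two_spaces K V' W' using assms(3,4) by (rule two_spaces.intro)
  have bl: "bilin_map K V W X (\<lambda>v w. tensor_lift X (F v w) t)" if "t \<in> carrier R.T" for t
    by (intro bilin_mapI R.lift_param assms that) (auto intro: b1 b2 bilin_map_left bilin_map_right)
  have br: "bilin_map K V' W' X (\<lambda>v' w'. tensor_lift X (\<lambda>v w. F v w v' w') s)"
    by (intro bilin_mapI S.lift_param assms s)
      (auto intro: b1 b2 bilin_map_left[OF b1] bilin_map_right)
  show ?thesis
  proof (rule R.tensor_ext[OF assms(5) _ _ t])
    show "lin_map K R.T X (tensor_lift X (\<lambda>v' w'. tensor_lift X (\<lambda>v w. F v w v' w') s))"
      by (rule R.lift_lin[OF assms(5) br])
    show "lin_map K R.T X (\<lambda>t. tensor_lift X (\<lambda>v w. tensor_lift X (F v w) t) s)"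
      by (rule S.lift_param[OF assms(5) s bl R.lift_lin]) (auto intro: b1 assms R.tensor_vectorspace)
  next
    fix v w assume "v \<in> carrier V'" "w \<in> carrier W'"
    then show "tensor_lift X (\<lambda>v' w'. tensor_lift X (F v' w') (R.pure v w)) s =
        tensor_lift X (\<lambda>v' w'. tensor_lift X (\<lambda>v w. F v w v' w') s) (R.pure v w)"
      using br by (auto intro!: S.lift_cong[OF s] simp: assms b1)
  qed
qed

section \<open>Products and threefold tensors\<close>

text \<open>
  Only bilinear products are assumed.  This makes the locale applicable to the factors \<open>H \<otimes> H\<close> and
  \<open>H\<close> of the threefold tensor product as soon as the product of \<open>H \<otimes> H\<close> is known to be bilinear.
\<close>
locale two_mults = two_spaces K V W
  for K :: "'k ring" and V :: "('k, 'v) module" and W :: "('k, 'w) module" +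
  assumes mult_V: "bilin_map K V V V (mult V)" and mult_W: "bilin_map K W W W (mult W)"
begin

lemma pure_mult_bilin:
  assumes "a \<in> carrier V" "b \<in> carrier W"
  shows "bilin_map K V W T (\<lambda>c d. pure (a \<otimes>\<^bsub>V\<^esub> c) (b \<otimes>\<^bsub>W\<^esub> d))"
  using assms
  by (intro bilin_mapI lin_map_comp[OF bilin_map_right[OF mult_W] bilin_map_right[OF pure_bilin]]
      lin_map_comp[OF bilin_map_right[OF mult_V] bilin_map_left[OF pure_bilin]])
    (auto intro: bilin_map_closed[OF mult_V] bilin_map_closed[OF mult_W])

lemma pure_mult_bilin':
  assumes "c \<in> carrier V" "d \<in> carrier W"
  shows "bilin_map K V W T (\<lambda>a b. pure (a \<otimes>\<^bsub>V\<^esub> c) (b \<otimes>\<^bsub>W\<^esub> d))"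
  using assms
  by (intro bilin_mapI lin_map_comp[OF bilin_map_left[OF mult_W] bilin_map_right[OF pure_bilin]]
      lin_map_comp[OF bilin_map_left[OF mult_V] bilin_map_left[OF pure_bilin]])
    (auto intro: bilin_map_closed[OF mult_V] bilin_map_closed[OF mult_W])

lemma left_mult_bilin:
  assumes "t \<in> carrier T"
  shows "bilin_map K V W T (\<lambda>a b. tensor_lift T (\<lambda>c d. pure (a \<otimes>\<^bsub>V\<^esub> c) (b \<otimes>\<^bsub>W\<^esub> d)) t)"
  by (intro bilin_mapI lift_param tensor_vectorspace assms V.vectorspace_axioms W.vectorspace_axioms)
    (auto intro: bilin_map_right[OF pure_mult_bilin] bilin_map_left[OF pure_mult_bilin]
      bilin_map_right[OF pure_mult_bilin'] bilin_map_left[OF pure_mult_bilin'])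

lemma mult_tensor_class:
  assumes "l \<in> pairs" "m \<in> pairs"
  shows "cls [(a \<otimes>\<^bsub>V\<^esub> c, b \<otimes>\<^bsub>W\<^esub> d). (a, b) \<leftarrow> l, (c, d) \<leftarrow> m] =
    tensor_sum T (\<lambda>a b. tensor_sum T (\<lambda>c d. pure (a \<otimes>\<^bsub>V\<^esub> c) (b \<otimes>\<^bsub>W\<^esub> d)) m) l"
proof -
  note cV = bilin_map_closed[OF mult_V] and cW = bilin_map_closed[OF mult_W]
  have row: "map (\<lambda>(c, d). (a \<otimes>\<^bsub>V\<^esub> c, b \<otimes>\<^bsub>W\<^esub> d)) m \<in> pairs \<and>
      cls (map (\<lambda>(c, d). (a \<otimes>\<^bsub>V\<^esub> c, b \<otimes>\<^bsub>W\<^esub> d)) m) =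
      tensor_sum T (\<lambda>c d. pure (a \<otimes>\<^bsub>V\<^esub> c) (b \<otimes>\<^bsub>W\<^esub> d)) m"
    if "a \<in> carrier V" "b \<in> carrier W" for a b
    using assms(2)
  proof (induction m)
    case (Cons p m)
    then show ?case using that by (cases p) (simp add: cV cW class_Cons)
  qed (simp add: zero_tensor)
  have "[(a \<otimes>\<^bsub>V\<^esub> c, b \<otimes>\<^bsub>W\<^esub> d). (a, b) \<leftarrow> l, (c, d) \<leftarrow> m] \<in> pairs \<and>
    cls [(a \<otimes>\<^bsub>V\<^esub> c, b \<otimes>\<^bsub>W\<^esub> d). (a, b) \<leftarrow> l, (c, d) \<leftarrow> m] =
    tensor_sum T (\<lambda>a b. tensor_sum T (\<lambda>c d. pure (a \<otimes>\<^bsub>V\<^esub> c) (b \<otimes>\<^bsub>W\<^esub> d)) m) l"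
    using assms(1)
  proof (induction l)
    case (Cons p l)
    then show ?case using row by (cases p) (simp add: add_class[symmetric])
  qed (simp add: zero_tensor)
  then show ?thesis ..
qed

text \<open>
  The product is the union of the classes obtained from all pairs of representing lists; each of
  them is the iterated lift, which does not mention the lists.
\<close>
lemma mult_tensor:
  assumes "s \<in> carrier T" "t \<in> carrier T"
  shows "s \<otimes>\<^bsub>T\<^esub> t = tensor_lift T (\<lambda>a b. tensor_lift T (\<lambda>c d. pure (a \<otimes>\<^bsub>V\<^esub> c) (b \<otimes>\<^bsub>W\<^esub> d)) t) s"
proof -
  let ?r = "tensor_lift T (\<lambda>a b. tensor_lift T (\<lambda>c d. pure (a \<otimes>\<^bsub>V\<^esub> c) (b \<otimes>\<^bsub>W\<^esub> d)) t) s"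
  obtain l0 m0 where 0: "s = cls l0" "t = cls m0" "l0 \<in> pairs" "m0 \<in> pairs"
    using assms by (auto elim!: tensorE)
  have eq: "cls [(a \<otimes>\<^bsub>V\<^esub> c, b \<otimes>\<^bsub>W\<^esub> d). (a, b) \<leftarrow> l, (c, d) \<leftarrow> m] = ?r" if "l \<in> s" "m \<in> t" for l m
  proof -
    from that 0 have "eqv l0 l" "eqv m0 m" by (simp_all add: in_class_iff)
    with 0 have lm: "s = cls l" "t = cls m" "l \<in> pairs" "m \<in> pairs"
      using equiv_pairs[of l0 l] equiv_pairs[of m0 m] by (simp_all add: class_eq_iff)
    have "?r = tensor_sum T (\<lambda>a b. tensor_lift T (\<lambda>c d. pure (a \<otimes>\<^bsub>V\<^esub> c) (b \<otimes>\<^bsub>W\<^esub> d)) t) l"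
      using lift_class[OF tensor_vectorspace left_mult_bilin[OF assms(2)] lm(3)] lm(1) by simp
    also have "\<dots> = tensor_sum T (\<lambda>a b. tensor_sum T (\<lambda>c d. pure (a \<otimes>\<^bsub>V\<^esub> c) (b \<otimes>\<^bsub>W\<^esub> d)) m) l"
      by (rule tensor_sum_cong[OF _ lm(3)])
        (simp add: lm(2) lift_class[OF tensor_vectorspace pure_mult_bilin lm(4)])
    finally show ?thesis using mult_tensor_class[OF lm(3,4)] by simp
  qed
  have ne: "l0 \<in> s" "m0 \<in> t" using 0 in_class by auto
  have "s \<otimes>\<^bsub>T\<^esub> t = (\<Union>l\<in>s. \<Union>m\<in>t. cls [(a \<otimes>\<^bsub>V\<^esub> c, b \<otimes>\<^bsub>W\<^esub> d). (a, b) \<leftarrow> l, (c, d) \<leftarrow> m])"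
    by (simp add: tensor_def)
  also have "\<dots> = (\<Union>l\<in>s. \<Union>m\<in>t. ?r)"
    by (intro SUP_cong HOL.refl eq)
  also have "\<dots> = ?r" using ne by blast
  finally show ?thesis .
qed

lemma mult_bilin: "bilin_map K T T T (mult T)"
proof (intro bilin_mapI)
  fix s assume s: "s \<in> carrier T"
  have "lin_map K T T (\<lambda>t. tensor_lift T (\<lambda>a b. tensor_lift T (\<lambda>c d. pure (a \<otimes>\<^bsub>V\<^esub> c) (b \<otimes>\<^bsub>W\<^esub> d)) t) s)"
    by (rule lift_param[OF tensor_vectorspace s left_mult_bilin lift_lin[OF tensor_vectorspace pure_mult_bilin]
        tensor_vectorspace])
  then show "lin_map K T T (mult T s)"
    by (rule lin_map_cong[OF _ tensor_vectorspace]) (rule mult_tensor[OF s])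
next
  fix t assume t: "t \<in> carrier T"
  show "lin_map K T T (\<lambda>s. s \<otimes>\<^bsub>T\<^esub> t)"
    by (rule lin_map_cong[OF lift_lin[OF tensor_vectorspace left_mult_bilin[OF t]] tensor_vectorspace])
      (rule mult_tensor[OF _ t])
qed

lemma mult_pure:
  assumes "a \<in> carrier V" "b \<in> carrier W" "c \<in> carrier V" "d \<in> carrier W"
  shows "pure a b \<otimes>\<^bsub>T\<^esub> pure c d = pure (a \<otimes>\<^bsub>V\<^esub> c) (b \<otimes>\<^bsub>W\<^esub> d)"
  using assms
  by (simp add: mult_tensor left_mult_bilin pure_mult_bilin tensor_vectorspace)

lemma lift_mult:
  assumes "vectorspace K X" "bilin_map K V W X \<beta>" "s \<in> carrier T" "t \<in> carrier T"
  shows "tensor_lift X \<beta> (s \<otimes>\<^bsub>T\<^esub> t) =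
    tensor_lift X (\<lambda>a b. tensor_lift X (\<lambda>c d. \<beta> (a \<otimes>\<^bsub>V\<^esub> c) (b \<otimes>\<^bsub>W\<^esub> d)) t) s"
proof -
  note cV = bilin_map_closed[OF mult_V] and cW = bilin_map_closed[OF mult_W]
  note L = lin_map_lift[OF tensor_vectorspace assms(1) lift_lin[OF assms(1,2)]]
  have "tensor_lift X \<beta> (s \<otimes>\<^bsub>T\<^esub> t) = tensor_lift X (\<lambda>a b. tensor_lift X \<beta>
      (tensor_lift T (\<lambda>c d. pure (a \<otimes>\<^bsub>V\<^esub> c) (b \<otimes>\<^bsub>W\<^esub> d)) t)) s"
    by (simp add: mult_tensor assms L left_mult_bilin)
  also have "\<dots> = tensor_lift X (\<lambda>a b. tensor_lift X (\<lambda>c d. \<beta> (a \<otimes>\<^bsub>V\<^esub> c) (b \<otimes>\<^bsub>W\<^esub> d)) t) s"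
    by (intro lift_cong assms(3), subst L) (auto simp: assms cV cW pure_mult_bilin intro!: lift_cong)
  finally show ?thesis .
qed

end

context unital_algebra
begin

lemma mult_bilin_map: "bilin_map K A A A (mult A)"
  by (intro bilin_mapI lin_mapI) (auto simp: smult_mult_left smult_mult_right l_distr r_distr)

end

locale two_algebras = V: unital_algebra K V + W: unital_algebra K W
  for K :: "'k ring" and V :: "('k, 'v) module" and W :: "('k, 'w) module"

sublocale two_algebras \<subseteq> two_mults K V W
  by unfold_locales (rule V.mult_bilin_map W.mult_bilin_map)+

text \<open>
  All laws are linear in each of the tensors involved, so they may be checked on pure tensors.
\<close>
lemma (in two_algebras) tensor_monoid: "monoid T"
proof (intro monoidI)
  note ml = bilin_map_left[OF mult_bilin] and mr = bilin_map_right[OF mult_bilin]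
    and c = bilin_map_closed[OF mult_bilin] and vs = tensor_vectorspace
  have one: "\<one>\<^bsub>T\<^esub> = pure \<one>\<^bsub>V\<^esub> \<one>\<^bsub>W\<^esub>" by (simp add: tensor_def)
  show one_c: "\<one>\<^bsub>T\<^esub> \<in> carrier T" by (simp add: one)
  show "s \<otimes>\<^bsub>T\<^esub> t \<in> carrier T" if "s \<in> carrier T" "t \<in> carrier T" for s t
    using that by (rule c)
  show "\<one>\<^bsub>T\<^esub> \<otimes>\<^bsub>T\<^esub> t = t" if "t \<in> carrier T" for t
    by (rule tensor_ext[OF vs mr[OF one_c] lin_map_id that]) (simp add: one mult_pure)
  show "t \<otimes>\<^bsub>T\<^esub> \<one>\<^bsub>T\<^esub> = t" if "t \<in> carrier T" for t
    by (rule tensor_ext[OF vs ml[OF one_c] lin_map_id that]) (simp add: one mult_pure)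
  show "(r \<otimes>\<^bsub>T\<^esub> s) \<otimes>\<^bsub>T\<^esub> t = r \<otimes>\<^bsub>T\<^esub> (s \<otimes>\<^bsub>T\<^esub> t)"
    if r: "r \<in> carrier T" and s: "s \<in> carrier T" and t: "t \<in> carrier T" for r s t
  proof (rule tensor_ext[where t = r, OF vs _ _ r])
    show "lin_map K T T (\<lambda>r. r \<otimes>\<^bsub>T\<^esub> s \<otimes>\<^bsub>T\<^esub> t)" by (rule lin_map_comp[OF ml[OF s] ml[OF t]])
    show "lin_map K T T (\<lambda>r. r \<otimes>\<^bsub>T\<^esub> (s \<otimes>\<^bsub>T\<^esub> t))" by (rule ml[OF c[OF s t]])
    fix a b assume ab: "a \<in> carrier V" "b \<in> carrier W"
    then have p: "pure a b \<in> carrier T" by simp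
    show "pure a b \<otimes>\<^bsub>T\<^esub> s \<otimes>\<^bsub>T\<^esub> t = pure a b \<otimes>\<^bsub>T\<^esub> (s \<otimes>\<^bsub>T\<^esub> t)"
    proof (rule tensor_ext[where t = s, OF vs _ _ s])
      show "lin_map K T T (\<lambda>s. pure a b \<otimes>\<^bsub>T\<^esub> s \<otimes>\<^bsub>T\<^esub> t)" by (rule lin_map_comp[OF mr[OF p] ml[OF t]])
      show "lin_map K T T (\<lambda>s. pure a b \<otimes>\<^bsub>T\<^esub> (s \<otimes>\<^bsub>T\<^esub> t))" by (rule lin_map_comp[OF ml[OF t] mr[OF p]])
      fix a' b' assume ab': "a' \<in> carrier V" "b' \<in> carrier W"
      then have p': "pure a' b' \<in> carrier T" by simp
      show "pure a b \<otimes>\<^bsub>T\<^esub> pure a' b' \<otimes>\<^bsub>T\<^esub> t = pure a b \<otimes>\<^bsub>T\<^esub> (pure a' b' \<otimes>\<^bsub>T\<^esub> t)"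
      proof (rule tensor_ext[where t = t, OF vs _ _ t])
        show "lin_map K T T (\<lambda>t. pure a b \<otimes>\<^bsub>T\<^esub> pure a' b' \<otimes>\<^bsub>T\<^esub> t)" by (rule mr[OF c[OF p p']])
        show "lin_map K T T (\<lambda>t. pure a b \<otimes>\<^bsub>T\<^esub> (pure a' b' \<otimes>\<^bsub>T\<^esub> t))"
          by (rule lin_map_comp[OF mr[OF p'] mr[OF p]])
      qed (use ab ab' in \<open>simp add: mult_pure V.m_assoc W.m_assoc\<close>)
    qed
  qed
qed

definition tri_lift ::
  "('k, 'x) module \<Rightarrow> ('u \<Rightarrow> 'v \<Rightarrow> 'w \<Rightarrow> 'x) \<Rightarrow> (('u, 'v) tensor, 'w) tensor \<Rightarrow> 'x" where
  "tri_lift X F = tensor_lift X (\<lambda>s w. tensor_lift X (\<lambda>u v. F u v w) s)"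

definition trilin_map ::
  "'k ring \<Rightarrow> ('k, 'u) module \<Rightarrow> ('k, 'v) module \<Rightarrow> ('k, 'w) module \<Rightarrow> ('k, 'x) module \<Rightarrow>
    ('u \<Rightarrow> 'v \<Rightarrow> 'w \<Rightarrow> 'x) \<Rightarrow> bool" where
  "trilin_map K U V W X F \<longleftrightarrow>
    (\<forall>u\<in>carrier U. \<forall>v\<in>carrier V. lin_map K W X (\<lambda>w. F u v w)) \<and>
    (\<forall>u\<in>carrier U. \<forall>w\<in>carrier W. lin_map K V X (\<lambda>v. F u v w)) \<and>
    (\<forall>v\<in>carrier V. \<forall>w\<in>carrier W. lin_map K U X (\<lambda>u. F u v w))"

lemma trilin_mapI:
  assumes "\<And>u v. u \<in> carrier U \<Longrightarrow> v \<in> carrier V \<Longrightarrow> lin_map K W X (\<lambda>w. F u v w)"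
    and "\<And>u w. u \<in> carrier U \<Longrightarrow> w \<in> carrier W \<Longrightarrow> lin_map K V X (\<lambda>v. F u v w)"
    and "\<And>v w. v \<in> carrier V \<Longrightarrow> w \<in> carrier W \<Longrightarrow> lin_map K U X (\<lambda>u. F u v w)"
  shows "trilin_map K U V W X F"
  using assms by (auto simp: trilin_map_def)

locale three_spaces = U: vectorspace K U + VW: two_spaces K V W
  for K :: "'k ring" and U :: "('k, 'u) module" and V :: "('k, 'v) module" and W :: "('k, 'w) module"
begin

sublocale UV: two_spaces K U V by unfold_locales

sublocale UV_W: two_spaces K UV.T W
  using UV.tensor_vectorspace VW.W.vectorspace_axioms by (rule two_spaces.intro)

lemma tri_lift_bilin:
  assumes "vectorspace K X" "trilin_map K U V W X F"
  shows "w \<in> carrier W \<Longrightarrow> bilin_map K U V X (\<lambda>u v. F u v w)"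
    and "bilin_map K UV.T W X (\<lambda>s w. tensor_lift X (\<lambda>u v. F u v w) s)"
proof -
  show *: "bilin_map K U V X (\<lambda>u v. F u v w)" if "w \<in> carrier W" for w
    using assms(2) that by (auto simp: trilin_map_def intro!: bilin_mapI)
  show "bilin_map K UV.T W X (\<lambda>s w. tensor_lift X (\<lambda>u v. F u v w) s)"
    by (intro bilin_mapI UV.lift_param UV.lift_lin assms * VW.W.vectorspace_axioms)
      (use assms(2) in \<open>auto simp: trilin_map_def\<close>)
qed

lemma tri_lift_lin:
  assumes "vectorspace K X" "trilin_map K U V W X F"
  shows "lin_map K UV_W.T X (tri_lift X F)"
  unfolding tri_lift_def by (rule UV_W.lift_lin[OF assms(1) tri_lift_bilin(2)[OF assms]])

lemma tri_lift_pure: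
  assumes "vectorspace K X" "trilin_map K U V W X F" "s \<in> carrier UV.T" "w \<in> carrier W"
  shows "tri_lift X F (UV_W.pure s w) = tensor_lift X (\<lambda>u v. F u v w) s"
  unfolding tri_lift_def
  by (rule UV_W.lift_pure[OF assms(1) tri_lift_bilin(2)[OF assms(1,2)] assms(3,4)])

lemma tri_lift_pure3 [simp]:
  assumes "vectorspace K X" "trilin_map K U V W X F" "u \<in> carrier U" "v \<in> carrier V" "w \<in> carrier W"
  shows "tri_lift X F (UV_W.pure (UV.pure u v) w) = F u v w"
  using assms by (simp add: tri_lift_pure tri_lift_bilin)

lemma tri_ext:
  assumes X: "vectorspace K X" and f: "lin_map K UV_W.T X f" and g: "lin_map K UV_W.T X g"
    and t: "t \<in> carrier UV_W.T"
    and eq: "\<And>u v w. \<lbrakk>u \<in> carrier U; v \<in> carrier V; w \<in> carrier W\<rbrakk> \<Longrightarrow>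
      f (UV_W.pure (UV.pure u v) w) = g (UV_W.pure (UV.pure u v) w)"
  shows "f t = g t"
proof (rule UV_W.tensor_ext[OF X f g t])
  fix s w assume s: "s \<in> carrier UV.T" and w: "w \<in> carrier W"
  note pl = bilin_map_left[OF UV_W.pure_bilin w]
  show "f (UV_W.pure s w) = g (UV_W.pure s w)"
    by (rule UV.tensor_ext[OF X lin_map_comp[OF pl f] lin_map_comp[OF pl g] s]) (rule eq[OF _ _ w])
qed

lemma unassoc_pure_bilin:
  "u \<in> carrier U \<Longrightarrow> bilin_map K V W UV_W.T (\<lambda>v w. UV_W.pure (UV.pure u v) w)"
  by (intro bilin_mapI bilin_map_right[OF UV_W.pure_bilin]
      lin_map_comp[OF bilin_map_right[OF UV.pure_bilin] bilin_map_left[OF UV_W.pure_bilin]]) auto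

lemma unassoc_bilin:
  "bilin_map K U VW.T UV_W.T (\<lambda>u. tensor_lift UV_W.T (\<lambda>v w. UV_W.pure (UV.pure u v) w))"
  by (intro bilin_mapI VW.lift_lin VW.lift_param UV_W.tensor_vectorspace unassoc_pure_bilin
      lin_map_comp[OF bilin_map_left[OF UV.pure_bilin] bilin_map_left[OF UV_W.pure_bilin]]
      U.vectorspace_axioms) auto

sublocale U_VW: two_spaces K U VW.T
  using U.vectorspace_axioms VW.tensor_vectorspace by (rule two_spaces.intro)

lemma unassoc_lin: "lin_map K U_VW.T UV_W.T (tensor_unassoc K U V W)"
  unfolding tensor_unassoc_def Let_def
  by (rule U_VW.lift_lin[OF UV_W.tensor_vectorspace unassoc_bilin])

lemma unassoc_pure:
  assumes "u \<in> carrier U" "s \<in> carrier VW.T"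
  shows "tensor_unassoc K U V W (U_VW.pure u s) =
    tensor_lift UV_W.T (\<lambda>v w. UV_W.pure (UV.pure u v) w) s"
  unfolding tensor_unassoc_def Let_def
  by (rule U_VW.lift_pure[OF UV_W.tensor_vectorspace unassoc_bilin assms])

lemma tri_lift_unassoc_pure:
  assumes X: "vectorspace K X" and F: "trilin_map K U V W X F"
    and u: "u \<in> carrier U" and s: "s \<in> carrier VW.T"
  shows "tri_lift X F (tensor_unassoc K U V W (U_VW.pure u s)) = tensor_lift X (\<lambda>v w. F u v w) s"
  unfolding unassoc_pure[OF u s]
  by (subst VW.lin_map_lift[OF UV_W.tensor_vectorspace X tri_lift_lin[OF X F] unassoc_pure_bilin[OF u] s])
    (rule VW.lift_cong[OF s], simp add: X F u)

end

context two_spaces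
begin

lemma tensor_map_bilin:
  assumes "lin_map K V V' f" "lin_map K W W' g" "vectorspace K V'" "vectorspace K W'"
  shows "bilin_map K V W (tensor K V' W') (\<lambda>x y. pure_tensor K V' W' (f x) (g y))"
proof -
  interpret T': two_spaces K V' W' using assms(3,4) by (rule two_spaces.intro)
  show ?thesis
    by (intro bilin_mapI lin_map_comp[OF assms(1) bilin_map_left[OF T'.pure_bilin]]
        lin_map_comp[OF assms(2) bilin_map_right[OF T'.pure_bilin]])
      (auto intro: lin_map_closed[OF assms(1)] lin_map_closed[OF assms(2)])
qed

lemma tensor_map_lin:
  assumes "lin_map K V V' f" "lin_map K W W' g" "vectorspace K V'" "vectorspace K W'"
  shows "lin_map K T (tensor K V' W') (tensor_map K V' W' f g)"
  unfolding tensor_map_def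
  by (rule lift_lin[OF two_spaces.tensor_vectorspace[OF two_spaces.intro[OF assms(3,4)]]
      tensor_map_bilin[OF assms]])

lemma lin_map_tensor_map:
  assumes "lin_map K V V' f" "lin_map K W W' g" "vectorspace K V'" "vectorspace K W'"
    "vectorspace K X" "lin_map K (tensor K V' W') X F" "t \<in> carrier T"
  shows "F (tensor_map K V' W' f g t) = tensor_lift X (\<lambda>x y. F (pure_tensor K V' W' (f x) (g y))) t"
  unfolding tensor_map_def
  by (rule lin_map_lift[OF two_spaces.tensor_vectorspace[OF two_spaces.intro[OF assms(3,4)]]
      assms(5,6) tensor_map_bilin[OF assms(1-4)] assms(7)])

lemma swap_bilin: "bilin_map K V W (tensor K W V) (\<lambda>v w. pure_tensor K W V w v)"
proof -
  interpret T': two_spaces K W V by unfold_locales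
  show ?thesis
    using bilin_map_left[OF T'.pure_bilin] bilin_map_right[OF T'.pure_bilin] by (intro bilin_mapI)
qed

lemma swap_lin: "lin_map K T (tensor K W V) (tensor_swap K V W)"
  unfolding tensor_swap_def
  by (rule lift_lin[OF two_spaces.tensor_vectorspace[OF two_spaces.intro] swap_bilin])
    unfold_locales

lemma swap_pure: "v \<in> carrier V \<Longrightarrow> w \<in> carrier W \<Longrightarrow> tensor_swap K V W (pure v w) = pure_tensor K W V w v"
  unfolding tensor_swap_def
  by (rule lift_pure[OF two_spaces.tensor_vectorspace[OF two_spaces.intro] swap_bilin])
    unfold_locales

lemma lift_tensor_swap:
  assumes "vectorspace K X" "bilin_map K W V X \<beta>" "t \<in> carrier T"
  shows "tensor_lift X \<beta> (tensor_swap K V W t) = tensor_lift X (\<lambda>v w. \<beta> w v) t"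
proof -
  interpret T': two_spaces K W V by unfold_locales
  show ?thesis unfolding tensor_swap_def
    by (subst lin_map_lift[OF T'.tensor_vectorspace assms(1) T'.lift_lin[OF assms(1,2)] swap_bilin assms(3)])
      (rule lift_cong[OF assms(3)], simp add: assms)
qed

lemma swap_swap: "t \<in> carrier T \<Longrightarrow> tensor_swap K W V (tensor_swap K V W t) = t"
proof -
  interpret T': two_spaces K W V by unfold_locales
  show "t \<in> carrier T \<Longrightarrow> ?thesis"
    by (rule tensor_ext[OF tensor_vectorspace lin_map_comp[OF swap_lin T'.swap_lin] lin_map_id])
      (auto simp: swap_pure T'.swap_pure)
qed

end

section \<open>Sweedler calculus\<close>

context bialgebra
begin

sublocale H1: one_space K H by unfold_locales

sublocale HH: two_algebras K H H by unfold_locales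

sublocale H3: three_spaces K H H H by unfold_locales

lemmas HH_vectorspace = HH.tensor_vectorspace

sublocale HH_H: two_mults K "tensor K H H" H
  by unfold_locales (rule HH.mult_bilin mult_bilin_map HH.tensor_vectorspace)+

lemma comult_lin: "lin_map K H (tensor K H H) \<Delta>"
  using comult_hom by (simp add: algebra_hom_def)

lemma comult_closed: "h \<in> carrier H \<Longrightarrow> \<Delta> h \<in> carrier (tensor K H H)"
  by (rule lin_map_closed[OF comult_lin])

lemma counit_closed: "h \<in> carrier H \<Longrightarrow> \<epsilon> h \<in> carrier K"
  using counit_hom by (auto simp: algebra_hom_def base_algebra_def module_hom_def)

lemma counit_add: "g \<in> carrier H \<Longrightarrow> h \<in> carrier H \<Longrightarrow> \<epsilon> (g \<oplus>\<^bsub>H\<^esub> h) = \<epsilon> g \<oplus>\<^bsub>K\<^esub> \<epsilon> h"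
  using counit_hom by (auto simp: algebra_hom_def base_algebra_def module_hom_def)

lemma counit_smult: "c \<in> carrier K \<Longrightarrow> h \<in> carrier H \<Longrightarrow> \<epsilon> (c \<odot>\<^bsub>H\<^esub> h) = c \<otimes>\<^bsub>K\<^esub> \<epsilon> h"
  using counit_hom by (auto simp: algebra_hom_def base_algebra_def module_hom_def)

lemma counit_mult: "g \<in> carrier H \<Longrightarrow> h \<in> carrier H \<Longrightarrow> \<epsilon> (g \<otimes>\<^bsub>H\<^esub> h) = \<epsilon> g \<otimes>\<^bsub>K\<^esub> \<epsilon> h"
  using counit_hom by (auto simp: algebra_hom_def base_algebra_def ring_hom_def)

lemma counit_one: "\<epsilon> \<one>\<^bsub>H\<^esub> = \<one>\<^bsub>K\<^esub>"
  using counit_hom by (auto simp: algebra_hom_def base_algebra_def ring_hom_def)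

lemma comult_mult:
  "g \<in> carrier H \<Longrightarrow> h \<in> carrier H \<Longrightarrow> \<Delta> (g \<otimes>\<^bsub>H\<^esub> h) = \<Delta> g \<otimes>\<^bsub>tensor K H H\<^esub> \<Delta> h"
  using comult_hom by (auto simp: algebra_hom_def ring_hom_def)

lemma comult_one: "\<Delta> \<one>\<^bsub>H\<^esub> = pure_tensor K H H \<one>\<^bsub>H\<^esub> \<one>\<^bsub>H\<^esub>"
  using comult_hom by (auto simp: algebra_hom_def ring_hom_def tensor_def)

text \<open>
  A sum \<open>\<Sum> F(h', h'')\<close> in Sweedler notation is the value of \<open>tensor_lift X F\<close> at \<open>\<Delta> h\<close>.  The axioms are
  put into the form of identities between such sums for an arbitrary multilinear \<open>F\<close>; in this form
  they apply to expressions that involve an action.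
\<close>
lemma lift_comult_mult:
  assumes "vectorspace K X" "bilin_map K H H X \<beta>" "g \<in> carrier H" "h \<in> carrier H"
  shows "tensor_lift X \<beta> (\<Delta> (g \<otimes>\<^bsub>H\<^esub> h)) =
    tensor_lift X (\<lambda>a b. tensor_lift X (\<lambda>c d. \<beta> (a \<otimes>\<^bsub>H\<^esub> c) (b \<otimes>\<^bsub>H\<^esub> d)) (\<Delta> h)) (\<Delta> g)"
  using assms by (simp add: comult_mult HH.lift_mult comult_closed)

lemma lift_comult_one:
  assumes "vectorspace K X" "bilin_map K H H X \<beta>"
  shows "tensor_lift X \<beta> (\<Delta> \<one>\<^bsub>H\<^esub>) = \<beta> \<one>\<^bsub>H\<^esub> \<one>\<^bsub>H\<^esub>"
  using assms by (simp add: comult_one)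

lemma tri_lift_comult_left:
  assumes X: "vectorspace K X" and F: "trilin_map K H H H X F" and t: "t \<in> carrier (tensor K H H)"
  shows "tri_lift X F (tensor_map K (tensor K H H) H \<Delta> id t) =
    tensor_lift X (\<lambda>x y. tensor_lift X (\<lambda>u v. F u v y) (\<Delta> x)) t"
  by (subst HH.lin_map_tensor_map[OF comult_lin _ HH_vectorspace vectorspace_axioms X
        H3.tri_lift_lin[OF X F] t])
    (auto simp: id_def[symmetric] H3.tri_lift_pure X F comult_closed lin_map_id[folded id_def]
      intro!: HH.lift_cong[OF t])

lemma tri_lift_comult_right:
  assumes X: "vectorspace K X" and F: "trilin_map K H H H X F" and t: "t \<in> carrier (tensor K H H)"
  shows "tri_lift X F (tensor_unassoc K H H H (tensor_map K H (tensor K H H) id \<Delta> t)) =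
    tensor_lift X (\<lambda>x y. tensor_lift X (\<lambda>u v. F x u v) (\<Delta> y)) t"
  by (subst HH.lin_map_tensor_map[OF _ comult_lin vectorspace_axioms HH_vectorspace X
        lin_map_comp[OF H3.unassoc_lin H3.tri_lift_lin[OF X F]] t])
    (auto simp: H3.tri_lift_unassoc_pure X F comult_closed lin_map_id[folded id_def]
      intro!: HH.lift_cong[OF t])

text \<open>Coassociativity: the three Sweedler components of \<open>h\<close> may be produced in either order.\<close>

lemma coassoc_lift:
  assumes X: "vectorspace K X" and F: "trilin_map K H H H X F" and h: "h \<in> carrier H"
  shows "tensor_lift X (\<lambda>x y. tensor_lift X (\<lambda>u v. F u v y) (\<Delta> x)) (\<Delta> h) =
    tensor_lift X (\<lambda>x y. tensor_lift X (\<lambda>u v. F x u v) (\<Delta> y)) (\<Delta> h)"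
  using coassoc[OF h] tri_lift_comult_left[OF X F comult_closed[OF h]]
    tri_lift_comult_right[OF X F comult_closed[OF h]] by simp

lemma counit_smult_lin:
  assumes "vectorspace K X" "x \<in> carrier X" "lin_map K Z H f"
  shows "lin_map K Z X (\<lambda>z. \<epsilon> (f z) \<odot>\<^bsub>X\<^esub> x)"
proof -
  interpret X: vectorspace K X by fact
  show ?thesis using lin_map_closed[OF assms(3)] assms(2)
    by (intro lin_mapI) (simp_all add: module_hom_add[OF assms(3)] module_hom_smult[OF assms(3)]
        counit_add counit_smult counit_closed X.smult_l_distr X.smult_assoc1)
qed

lemma counit_smult_lin':
  assumes "vectorspace K X" "lin_map K Z X f" "h \<in> carrier H"
  shows "lin_map K Z X (\<lambda>z. \<epsilon> h \<odot>\<^bsub>X\<^esub> f z)"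
  by (rule lin_map_smult_const[OF assms(1,2)]) (rule counit_closed[OF assms(3)])

lemma counit_left_bilin: "bilin_map K H H H (\<lambda>x y. \<epsilon> x \<odot>\<^bsub>H\<^esub> y)"
  and counit_right_bilin: "bilin_map K H H H (\<lambda>x y. \<epsilon> y \<odot>\<^bsub>H\<^esub> x)"
  by (intro bilin_mapI counit_smult_lin counit_smult_lin' vectorspace_axioms lin_map_id; assumption)+

lemma counit_left_lift:
  assumes X: "vectorspace K X" and f: "lin_map K H X f" and h: "h \<in> carrier H"
  shows "tensor_lift X (\<lambda>x y. \<epsilon> x \<odot>\<^bsub>X\<^esub> f y) (\<Delta> h) = f h"
proof -
  have "f h = tensor_lift X (\<lambda>x y. f (\<epsilon> x \<odot>\<^bsub>H\<^esub> y)) (\<Delta> h)"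
    by (subst (1) counit_left[OF h, symmetric])
      (rule HH.lin_map_lift[OF vectorspace_axioms X f counit_left_bilin comult_closed[OF h]])
  also have "\<dots> = tensor_lift X (\<lambda>x y. \<epsilon> x \<odot>\<^bsub>X\<^esub> f y) (\<Delta> h)"
    by (rule HH.lift_cong[OF comult_closed[OF h]]) (simp add: module_hom_smult[OF f] counit_closed)
  finally show ?thesis by simp
qed

lemma counit_right_lift:
  assumes X: "vectorspace K X" and f: "lin_map K H X f" and h: "h \<in> carrier H"
  shows "tensor_lift X (\<lambda>x y. \<epsilon> y \<odot>\<^bsub>X\<^esub> f x) (\<Delta> h) = f h"
proof -
  have "f h = tensor_lift X (\<lambda>x y. f (\<epsilon> y \<odot>\<^bsub>H\<^esub> x)) (\<Delta> h)"
    by (subst (1) counit_right[OF h, symmetric])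
      (rule HH.lin_map_lift[OF vectorspace_axioms X f counit_right_bilin comult_closed[OF h]])
  also have "\<dots> = tensor_lift X (\<lambda>x y. \<epsilon> y \<odot>\<^bsub>X\<^esub> f x) (\<Delta> h)"
    by (rule HH.lift_cong[OF comult_closed[OF h]]) (simp add: module_hom_smult[OF f] counit_closed)
  finally show ?thesis by simp
qed

lemma lift_comult_lin:
  assumes "vectorspace K X" "bilin_map K H H X \<beta>" "lin_map K Z H f"
  shows "lin_map K Z X (\<lambda>z. tensor_lift X \<beta> (\<Delta> (f z)))"
  by (rule lin_map_comp[OF lin_map_comp[OF assms(3) comult_lin] HH.lift_lin[OF assms(1,2)]])

lemma lift_HH_param:
  assumes "vectorspace K X" "t \<in> carrier (tensor K H H)"
    and "\<And>z. z \<in> carrier Z \<Longrightarrow> bilin_map K H H X (\<beta> z)"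
    and "\<And>v w. v \<in> carrier H \<Longrightarrow> w \<in> carrier H \<Longrightarrow> lin_map K Z X (\<lambda>z. \<beta> z v w)"
    and "vectorspace K Z"
  shows "lin_map K Z X (\<lambda>z. tensor_lift X (\<beta> z) t)"
  by (rule HH.lift_param[OF assms])

subsection \<open>Quasitriangular structures in terms of bilinear and trilinear forms\<close>

lemma embed_bilin:
  shows "bilin_map K H H H3.UV_W.T (\<lambda>x y. H3.UV_W.pure (HH.pure x y) \<one>\<^bsub>H\<^esub>)"
    and "bilin_map K H H H3.UV_W.T (\<lambda>x y. H3.UV_W.pure (HH.pure x \<one>\<^bsub>H\<^esub>) y)"
    and "bilin_map K H H H3.UV_W.T (\<lambda>x y. H3.UV_W.pure (HH.pure \<one>\<^bsub>H\<^esub> x) y)"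
  by (intro bilin_mapI bilin_map_right[OF H3.UV_W.pure_bilin]
      lin_map_comp[OF bilin_map_right[OF HH.pure_bilin] bilin_map_left[OF H3.UV_W.pure_bilin]]
      lin_map_comp[OF bilin_map_left[OF HH.pure_bilin] bilin_map_left[OF H3.UV_W.pure_bilin]];
      simp)+

lemma tri_lift_mult:
  assumes X: "vectorspace K X" and F: "trilin_map K H H H X F"
    and s: "s \<in> carrier (tensor K H H)" and t: "t \<in> carrier (tensor K H H)"
    and \<beta>: "bilin_map K H H H3.UV_W.T \<beta>" and \<gamma>: "bilin_map K H H H3.UV_W.T \<gamma>"
  shows "tri_lift X F (tensor_lift H3.UV_W.T \<beta> s \<otimes>\<^bsub>H3.UV_W.T\<^esub> tensor_lift H3.UV_W.T \<gamma> t) =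
    tensor_lift X (\<lambda>x y. tensor_lift X (\<lambda>u v. tri_lift X F (\<beta> x y \<otimes>\<^bsub>H3.UV_W.T\<^esub> \<gamma> u v)) t) s"
proof -
  note L = H3.tri_lift_lin[OF X F] and vs = H3.UV_W.tensor_vectorspace
  note ml = bilin_map_left[OF HH_H.mult_bilin] and mr = bilin_map_right[OF HH_H.mult_bilin]
  have ct: "tensor_lift H3.UV_W.T \<gamma> t \<in> carrier H3.UV_W.T" by (rule HH.lift_closed[OF vs \<gamma> t])
  show ?thesis
    by (subst HH.lin_map_lift[OF vs X lin_map_comp[OF ml[OF ct] L] \<beta> s], rule HH.lift_cong[OF s],
        subst HH.lin_map_lift[OF vs X lin_map_comp[OF mr[OF bilin_map_closed[OF \<beta>]] L] \<gamma> t])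
      simp_all
qed

lemma tri_lift_embed13_embed23:
  assumes X: "vectorspace K X" and F: "trilin_map K H H H X F"
    and s: "s \<in> carrier (tensor K H H)" and t: "t \<in> carrier (tensor K H H)"
  shows "tri_lift X F (embed13 K H s \<otimes>\<^bsub>H3.UV_W.T\<^esub> embed23 K H t) =
    tensor_lift X (\<lambda>x y. tensor_lift X (\<lambda>u v. F x u (y \<otimes>\<^bsub>H\<^esub> v)) t) s"
  unfolding embed13_def embed23_def
  by (subst tri_lift_mult[OF X F s t embed_bilin(2,3)])
    (intro HH.lift_cong[OF s] HH.lift_cong[OF t], simp add: HH_H.mult_pure HH.mult_pure X F)

lemma tri_lift_embed13_embed12:
  assumes X: "vectorspace K X" and F: "trilin_map K H H H X F"
    and s: "s \<in> carrier (tensor K H H)" and t: "t \<in> carrier (tensor K H H)"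
  shows "tri_lift X F (embed13 K H s \<otimes>\<^bsub>H3.UV_W.T\<^esub> embed12 K H t) =
    tensor_lift X (\<lambda>x y. tensor_lift X (\<lambda>u v. F (x \<otimes>\<^bsub>H\<^esub> u) v y) t) s"
  unfolding embed13_def embed12_def
  by (subst tri_lift_mult[OF X F s t embed_bilin(2,1)])
    (intro HH.lift_cong[OF s] HH.lift_cong[OF t], simp add: HH_H.mult_pure HH.mult_pure X F)

lemma quasitriangular_closed: "quasitriangular K H \<Delta> \<epsilon> R \<Longrightarrow> R \<in> carrier (tensor K H H)"
  by (simp add: quasitriangular_def Let_def)

lemma swap_closed: "t \<in> carrier (tensor K H H) \<Longrightarrow> tensor_swap K H H t \<in> carrier (tensor K H H)"
  by (rule lin_map_closed[OF HH.swap_lin])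

text \<open>
  The left-hand side of \<open>\<Delta>\<^sup>o\<^sup>p(h) R = R \<Delta>(h)\<close>, tested against a bilinear map.
\<close>
lemma lift_opposite_mult:
  assumes X: "vectorspace K X" and B: "bilin_map K H H X B"
    and R: "R \<in> carrier (tensor K H H)" and h: "h \<in> carrier H"
  shows "tensor_lift X B (tensor_swap K H H (\<Delta> h) \<otimes>\<^bsub>tensor K H H\<^esub> R) =
      tensor_lift X (\<lambda>p q. tensor_lift X (\<lambda>x y. B (q \<otimes>\<^bsub>H\<^esub> x) (p \<otimes>\<^bsub>H\<^esub> y)) R) (\<Delta> h)"
proof -
  have "bilin_map K H H X (\<lambda>a b. tensor_lift X (\<lambda>c d. B (a \<otimes>\<^bsub>H\<^esub> c) (b \<otimes>\<^bsub>H\<^esub> d)) R)"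
    by (intro bilin_mapI lift_HH_param X R vectorspace_axioms
        lin_map_comp[OF bilin_map_right[OF mult_bilin_map] bilin_map_right[OF B]]
        lin_map_comp[OF bilin_map_right[OF mult_bilin_map] bilin_map_left[OF B]]
        lin_map_comp[OF bilin_map_left[OF mult_bilin_map] bilin_map_right[OF B]]
        lin_map_comp[OF bilin_map_left[OF mult_bilin_map] bilin_map_left[OF B]]) auto
  then show ?thesis
    by (simp add: HH.lift_mult X B R swap_closed comult_closed h HH.lift_tensor_swap)
qed

lemma quasitriangular_comm:
  assumes "quasitriangular K H \<Delta> \<epsilon> R" and X: "vectorspace K X" and B: "bilin_map K H H X B"
    and h: "h \<in> carrier H"
  shows "tensor_lift X (\<lambda>p q. tensor_lift X (\<lambda>x y. B (q \<otimes>\<^bsub>H\<^esub> x) (p \<otimes>\<^bsub>H\<^esub> y)) R) (\<Delta> h) =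
    tensor_lift X (\<lambda>x y. tensor_lift X (\<lambda>p q. B (x \<otimes>\<^bsub>H\<^esub> p) (y \<otimes>\<^bsub>H\<^esub> q)) (\<Delta> h)) R"
proof -
  note R = quasitriangular_closed[OF assms(1)]
  have "tensor_swap K H H (\<Delta> h) \<otimes>\<^bsub>tensor K H H\<^esub> R = R \<otimes>\<^bsub>tensor K H H\<^esub> \<Delta> h"
    using assms(1) h by (simp add: quasitriangular_def Let_def)
  then show ?thesis
    using lift_opposite_mult[OF X B R h] HH.lift_mult[OF X B R comult_closed[OF h]] by simp
qed

lemma quasitriangular_counit:
  assumes "quasitriangular K H \<Delta> \<epsilon> R" and X: "vectorspace K X" and f: "lin_map K H X f"
  shows "tensor_lift X (\<lambda>x y. \<epsilon> x \<odot>\<^bsub>X\<^esub> f y) R = f \<one>\<^bsub>H\<^esub>"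
    and "tensor_lift X (\<lambda>x y. \<epsilon> y \<odot>\<^bsub>X\<^esub> f x) R = f \<one>\<^bsub>H\<^esub>"
proof -
  note R = quasitriangular_closed[OF assms(1)]
  have 1: "tensor_lift H (\<lambda>x y. \<epsilon> x \<odot>\<^bsub>H\<^esub> y) R = \<one>\<^bsub>H\<^esub>" "tensor_lift H (\<lambda>x y. \<epsilon> y \<odot>\<^bsub>H\<^esub> x) R = \<one>\<^bsub>H\<^esub>"
    using assms(1) by (simp_all add: quasitriangular_def Let_def)
  show "tensor_lift X (\<lambda>x y. \<epsilon> x \<odot>\<^bsub>X\<^esub> f y) R = f \<one>\<^bsub>H\<^esub>"
    unfolding 1(1)[symmetric] HH.lin_map_lift[OF vectorspace_axioms X f counit_left_bilin R]
    by (rule HH.lift_cong[OF R]) (simp add: module_hom_smult[OF f] counit_closed)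
  show "tensor_lift X (\<lambda>x y. \<epsilon> y \<odot>\<^bsub>X\<^esub> f x) R = f \<one>\<^bsub>H\<^esub>"
    unfolding 1(2)[symmetric] HH.lin_map_lift[OF vectorspace_axioms X f counit_right_bilin R]
    by (rule HH.lift_cong[OF R]) (simp add: module_hom_smult[OF f] counit_closed)
qed

lemma quasitriangular_comult_left:
  assumes "quasitriangular K H \<Delta> \<epsilon> R" and X: "vectorspace K X" and F: "trilin_map K H H H X F"
  shows "tensor_lift X (\<lambda>x y. tensor_lift X (\<lambda>u v. F u v y) (\<Delta> x)) R =
    tensor_lift X (\<lambda>x y. tensor_lift X (\<lambda>u v. F x u (y \<otimes>\<^bsub>H\<^esub> v)) R) R"
proof -
  note R = quasitriangular_closed[OF assms(1)]
  have "tensor_map K (tensor K H H) H \<Delta> id R = embed13 K H R \<otimes>\<^bsub>H3.UV_W.T\<^esub> embed23 K H R"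
    using assms(1) by (simp add: quasitriangular_def Let_def)
  then show ?thesis
    using tri_lift_comult_left[OF X F R] tri_lift_embed13_embed23[OF X F R R] by simp
qed

lemma quasitriangular_comult_right:
  assumes "quasitriangular K H \<Delta> \<epsilon> R" and X: "vectorspace K X" and F: "trilin_map K H H H X F"
  shows "tensor_lift X (\<lambda>x y. tensor_lift X (\<lambda>u v. F x u v) (\<Delta> y)) R =
    tensor_lift X (\<lambda>x y. tensor_lift X (\<lambda>u v. F (x \<otimes>\<^bsub>H\<^esub> u) v y) R) R"
proof -
  note R = quasitriangular_closed[OF assms(1)]
  have "tensor_unassoc K H H H (tensor_map K H (tensor K H H) id \<Delta> R) =
      embed13 K H R \<otimes>\<^bsub>H3.UV_W.T\<^esub> embed12 K H R"
    using assms(1) by (simp add: quasitriangular_def Let_def)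
  then show ?thesis
    using tri_lift_comult_right[OF X F R] tri_lift_embed13_embed12[OF X F R R] by simp
qed

end

section \<open>Spaces of linear maps and dual spaces\<close>

lemma base_algebra_vectorspace:
  assumes "field K" shows "vectorspace K (base_algebra K)"
proof -
  interpret field K by fact
  have "\<forall>v\<in>carrier K. \<exists>w\<in>carrier K. v \<oplus>\<^bsub>K\<^esub> w = \<zero>\<^bsub>K\<^esub>" using r_neg a_inv_closed by blast
  then show ?thesis
    by (intro vs_criteria) (auto simp: base_algebra_def assms a_ac m_ac l_distr r_distr)
qed

lemma base_algebra_ops:
  "carrier (base_algebra K) = carrier K"
  "x \<oplus>\<^bsub>base_algebra K\<^esub> y = x \<oplus>\<^bsub>K\<^esub> y"
  "x \<odot>\<^bsub>base_algebra K\<^esub> y = x \<otimes>\<^bsub>K\<^esub> y"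
  by (simp_all add: base_algebra_def)

context two_spaces
begin

abbreviation "Hom \<equiv> hom_space K V W"

lemma hom_space_iff: "f \<in> carrier Hom \<longleftrightarrow> lin_map K V W f \<and> f \<in> extensional (carrier V)"
  by (simp add: hom_space_def)

lemma hom_space_lin: "f \<in> carrier Hom \<Longrightarrow> lin_map K V W f"
  by (simp add: hom_space_iff)

lemma hom_space_restrict: "lin_map K V W f \<Longrightarrow> (\<lambda>v\<in>carrier V. f v) \<in> carrier Hom"
  by (auto simp: hom_space_iff intro: lin_map_cong[OF _ V.vectorspace_axioms])

lemma hom_space_eqI:
  "\<lbrakk>f \<in> carrier Hom; g \<in> carrier Hom; \<And>v. v \<in> carrier V \<Longrightarrow> f v = g v\<rbrakk> \<Longrightarrow> f = g"
  by (auto simp: hom_space_iff intro: extensionalityI)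

lemma hom_space_apply:
  "v \<in> carrier V \<Longrightarrow> (f \<oplus>\<^bsub>Hom\<^esub> g) v = f v \<oplus>\<^bsub>W\<^esub> g v"
  "v \<in> carrier V \<Longrightarrow> (c \<odot>\<^bsub>Hom\<^esub> f) v = c \<odot>\<^bsub>W\<^esub> f v"
  "v \<in> carrier V \<Longrightarrow> \<zero>\<^bsub>Hom\<^esub> v = \<zero>\<^bsub>W\<^esub>"
  by (simp_all add: hom_space_def)

lemma hom_space_closed:
  "f \<in> carrier Hom \<Longrightarrow> g \<in> carrier Hom \<Longrightarrow> f \<oplus>\<^bsub>Hom\<^esub> g \<in> carrier Hom"
  "c \<in> carrier K \<Longrightarrow> f \<in> carrier Hom \<Longrightarrow> c \<odot>\<^bsub>Hom\<^esub> f \<in> carrier Hom"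
  "\<zero>\<^bsub>Hom\<^esub> \<in> carrier Hom"
proof -
  have eq: "f \<oplus>\<^bsub>Hom\<^esub> g = (\<lambda>v\<in>carrier V. f v \<oplus>\<^bsub>W\<^esub> g v)" "c \<odot>\<^bsub>Hom\<^esub> f = (\<lambda>v\<in>carrier V. c \<odot>\<^bsub>W\<^esub> f v)"
    "\<zero>\<^bsub>Hom\<^esub> = (\<lambda>v\<in>carrier V. \<zero>\<^bsub>W\<^esub>)" for f g c
    by (simp_all add: hom_space_def)
  show "f \<in> carrier Hom \<Longrightarrow> g \<in> carrier Hom \<Longrightarrow> f \<oplus>\<^bsub>Hom\<^esub> g \<in> carrier Hom"
    "c \<in> carrier K \<Longrightarrow> f \<in> carrier Hom \<Longrightarrow> c \<odot>\<^bsub>Hom\<^esub> f \<in> carrier Hom"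
    "\<zero>\<^bsub>Hom\<^esub> \<in> carrier Hom"
    unfolding eq
    by (intro hom_space_restrict lin_map_add lin_map_smult_const lin_map_zero_map W.vectorspace_axioms
        hom_space_lin; assumption)+
qed

lemma hom_space_vectorspace: "vectorspace K Hom"
proof -
  note cl = lin_map_closed[OF hom_space_lin]
  have inverse: "\<forall>f\<in>carrier Hom. \<exists>g\<in>carrier Hom. f \<oplus>\<^bsub>Hom\<^esub> g = \<zero>\<^bsub>Hom\<^esub>"
  proof
    fix f assume f: "f \<in> carrier Hom"
    let ?g = "(\<ominus>\<^bsub>K\<^esub> \<one>\<^bsub>K\<^esub>) \<odot>\<^bsub>Hom\<^esub> f"
    have g: "?g \<in> carrier Hom" using f by (intro hom_space_closed) simp_all
    have "f \<oplus>\<^bsub>Hom\<^esub> ?g = \<zero>\<^bsub>Hom\<^esub>"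
    proof (rule hom_space_eqI)
      fix v assume v: "v \<in> carrier V"
      then have "f v \<oplus>\<^bsub>W\<^esub> (\<ominus>\<^bsub>K\<^esub> \<one>\<^bsub>K\<^esub>) \<odot>\<^bsub>W\<^esub> f v = \<zero>\<^bsub>W\<^esub>"
        using cl[OF f v] by (simp add: W.smult_minus_1 W.M.r_neg)
      then show "(f \<oplus>\<^bsub>Hom\<^esub> ?g) v = \<zero>\<^bsub>Hom\<^esub> v"
        using v by (simp add: hom_space_apply)
    qed (intro hom_space_closed f g)+
    with g show "\<exists>g\<in>carrier Hom. f \<oplus>\<^bsub>Hom\<^esub> g = \<zero>\<^bsub>Hom\<^esub>" by blast
  qed
  show ?thesis
    by (rule vs_criteria[OF V.field_axioms hom_space_closed(3) _ inverse])
      (auto intro!: hom_space_eqI hom_space_closed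
        simp: hom_space_apply cl W.M.a_ac W.smult_assoc1 W.smult_l_distr W.smult_r_distr)
qed

lemma hom_space_eval: "v \<in> carrier V \<Longrightarrow> lin_map K Hom W (\<lambda>f. f v)"
  by (intro lin_mapI) (simp_all add: hom_space_apply lin_map_closed[OF hom_space_lin])

lemma hom_space_curry:
  assumes "\<And>z. z \<in> carrier Z \<Longrightarrow> lin_map K V W (G z)"
    and "\<And>v. v \<in> carrier V \<Longrightarrow> lin_map K Z W (\<lambda>z. G z v)" and "vectorspace K Z"
  shows "lin_map K Z Hom (\<lambda>z. \<lambda>v\<in>carrier V. G z v)"
proof -
  interpret Z: vectorspace K Z by fact
  note cl = lin_map_closed[OF assms(1)]
  show ?thesis
    by (intro lin_mapI hom_space_restrict assms hom_space_eqI hom_space_closed)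
      (simp_all add: hom_space_apply module_hom_add[OF assms(2)] module_hom_smult[OF assms(2)])
qed

end

abbreviation functional :: "'k ring \<Rightarrow> ('k, 'v) module \<Rightarrow> ('v \<Rightarrow> 'k) \<Rightarrow> bool" where
  "functional K V c \<equiv> lin_map K V (base_algebra K) c"

abbreviation dual_space :: "'k ring \<Rightarrow> ('k, 'v) module \<Rightarrow> ('k, 'v \<Rightarrow> 'k) module" where
  "dual_space K V \<equiv> hom_space K V (base_algebra K)"

lemma functional_closed: "functional K V c \<Longrightarrow> v \<in> carrier V \<Longrightarrow> c v \<in> carrier K"
  using lin_map_closed[of c K V "base_algebra K"] by (simp add: base_algebra_def)

lemma functional_smult_lin:
  assumes "vectorspace K X" "x \<in> carrier X" "functional K Z c"
  shows "lin_map K Z X (\<lambda>z. c z \<odot>\<^bsub>X\<^esub> x)"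
proof -
  interpret X: vectorspace K X by fact
  show ?thesis using functional_closed[OF assms(3)] assms(2)
      module_hom_add[OF assms(3)] module_hom_smult[OF assms(3)]
    by (intro lin_mapI) (simp_all add: base_algebra_def X.smult_l_distr X.smult_assoc1)
qed

text \<open>
  A coevaluation is an element \<open>\<Sum> e\<^sub>i \<otimes> c\<^sub>i\<close> of \<open>V \<otimes> V\<^sup>*\<close> with \<open>v = \<Sum> c\<^sub>i(v) e\<^sub>i\<close> for all \<open>v\<close>.
  Its existence is a basis-free form of finite dimensionality.
\<close>

definition coevaluation ::
  "'k ring \<Rightarrow> ('k, 'v) module \<Rightarrow> ('v, 'v \<Rightarrow> 'k) tensor \<Rightarrow> bool" where
  "coevaluation K V d \<longleftrightarrow> d \<in> carrier (tensor K V (dual_space K V)) \<and>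
    (\<forall>v\<in>carrier V. tensor_lift V (\<lambda>e c. c v \<odot>\<^bsub>V\<^esub> e) d = v)"

lemma (in one_space) two_spaces_base: "two_spaces K V (base_algebra K)"
  using vectorspace_axioms base_algebra_vectorspace[OF field_axioms] by (rule two_spaces.intro)

lemma (in one_space) two_spaces_dual: "two_spaces K V (dual_space K V)"
  using vectorspace_axioms two_spaces.hom_space_vectorspace[OF two_spaces_base]
  by (rule two_spaces.intro)

lemma (in one_space) dual_functional: "c \<in> carrier (dual_space K V) \<Longrightarrow> functional K V c"
  by (rule two_spaces.hom_space_lin[OF two_spaces_base])

lemma (in one_space) dual_eval: "v \<in> carrier V \<Longrightarrow> functional K (dual_space K V) (\<lambda>c. c v)"
  by (rule two_spaces.hom_space_eval[OF two_spaces_base])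

lemma (in one_space) coevaluation_bilin:
  assumes "vectorspace K X" "lin_map K V X f" "v \<in> carrier V"
  shows "bilin_map K V (dual_space K V) X (\<lambda>e c. c v \<odot>\<^bsub>X\<^esub> f e)"
  using assms
  by (intro bilin_mapI functional_smult_lin lin_map_smult_const dual_eval)
    (auto intro: lin_map_closed functional_closed[OF dual_functional])

text \<open>Apply \<open>f\<close> to \<open>v = \<Sum> c\<^sub>i(v) e\<^sub>i\<close>.\<close>
lemma (in one_space) coevaluation_apply:
  assumes "vectorspace K X" "lin_map K V X f" "v \<in> carrier V" "coevaluation K V d"
  shows "tensor_lift X (\<lambda>e c. c v \<odot>\<^bsub>X\<^esub> f e) d = f v"
proof -
  interpret D: two_spaces K V "dual_space K V" by (rule two_spaces_dual)
  have d: "d \<in> carrier D.T" "tensor_lift V (\<lambda>e c. c v \<odot>\<^bsub>V\<^esub> e) d = v"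
    using assms(3,4) by (auto simp: coevaluation_def)
  have "f v = tensor_lift X (\<lambda>e c. f (c v \<odot>\<^bsub>V\<^esub> e)) d"
    using D.lin_map_lift[OF vectorspace_axioms assms(1,2)
        coevaluation_bilin[OF vectorspace_axioms lin_map_id assms(3)] d(1)] d(2) by simp
  also have "\<dots> = tensor_lift X (\<lambda>e c. c v \<odot>\<^bsub>X\<^esub> f e) d"
    using assms(3) by (intro D.lift_cong[OF d(1)])
      (simp add: module_hom_smult[OF assms(2)] functional_closed[OF dual_functional])
  finally show ?thesis by simp
qed

context two_spaces
begin

text \<open>Contraction of the second factor with a functional.\<close>
definition slice :: "('w \<Rightarrow> 'k) \<Rightarrow> ('v, 'w) tensor \<Rightarrow> 'v" where
  "slice c = tensor_lift V (\<lambda>v w. c w \<odot>\<^bsub>V\<^esub> v)"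

lemma slice_bilin: "functional K W c \<Longrightarrow> bilin_map K V W V (\<lambda>v w. c w \<odot>\<^bsub>V\<^esub> v)"
  by (intro bilin_mapI functional_smult_lin lin_map_smult_const V.vectorspace_axioms lin_map_id)
    (auto intro: functional_closed)

lemma slice_lin: "functional K W c \<Longrightarrow> lin_map K T V (slice c)"
  unfolding slice_def by (rule lift_lin[OF V.vectorspace_axioms slice_bilin])

lemma slice_pure:
  "functional K W c \<Longrightarrow> v \<in> carrier V \<Longrightarrow> w \<in> carrier W \<Longrightarrow> slice c (pure v w) = c w \<odot>\<^bsub>V\<^esub> v"
  unfolding slice_def by (rule lift_pure[OF V.vectorspace_axioms slice_bilin])

lemma slice_dual_lin:
  assumes "t \<in> carrier T" shows "lin_map K (dual_space K W) V (\<lambda>c. slice c t)"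
  unfolding slice_def
  by (intro lift_param assms V.vectorspace_axioms slice_bilin W.dual_functional
      functional_smult_lin W.dual_eval two_spaces.hom_space_vectorspace[OF W.two_spaces_base])

text \<open>
  For \<open>d = \<Sum> e\<^sub>i \<otimes> c\<^sub>i\<close>, the slices with the functionals \<open>c\<^sub>i\<close> are the coefficients in \<open>V\<close> of a tensor
  expanded in the \<open>e\<^sub>i\<close>.
\<close>
lemma tensor_slices:
  assumes "coevaluation K W d" "t \<in> carrier T"
  shows "tensor_lift T (\<lambda>e c. pure (slice c t) e) d = t"
proof -
  interpret D: two_spaces K W "dual_space K W" by (rule W.two_spaces_dual)
  have d: "d \<in> carrier D.T" using assms(1) by (simp add: coevaluation_def)
  note cf = W.dual_functional
  have bil: "bilin_map K W (dual_space K W) T (\<lambda>e c. pure (slice c t) e)" if "t \<in> carrier T" for t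
    using that
    by (intro bilin_mapI lin_map_comp[OF slice_dual_lin bilin_map_left[OF pure_bilin]]
        bilin_map_right[OF pure_bilin]) (auto intro: lin_map_closed[OF slice_lin[OF cf]])
  show ?thesis
  proof (rule tensor_ext[OF tensor_vectorspace _ lin_map_id assms(2)])
    show "lin_map K T T (\<lambda>t. tensor_lift T (\<lambda>e c. pure (slice c t) e) d)"
      by (intro D.lift_param bil tensor_vectorspace d
          lin_map_comp[OF slice_lin[OF cf] bilin_map_left[OF pure_bilin]])
    fix v w assume vw: "v \<in> carrier V" "w \<in> carrier W"
    then have "tensor_lift T (\<lambda>e c. pure (slice c (pure v w)) e) d =
        tensor_lift T (\<lambda>e c. c w \<odot>\<^bsub>T\<^esub> pure v e) d"
      by (intro D.lift_cong[OF d])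
        (simp add: slice_pure cf functional_closed[OF cf] pure_smult_left)
    also have "\<dots> = pure v w"
      by (rule W.coevaluation_apply[OF tensor_vectorspace bilin_map_right[OF pure_bilin vw(1)] vw(2) assms(1)])
    finally show "tensor_lift T (\<lambda>e c. pure (slice c (pure v w)) e) d = pure v w" .
  qed
qed

lemma tensor_zero_if_slices_zero:
  assumes "coevaluation K W d" "t \<in> carrier T"
    and "\<And>c. functional K W c \<Longrightarrow> slice c t = \<zero>\<^bsub>V\<^esub>"
  shows "t = \<zero>\<^bsub>T\<^esub>"
proof -
  interpret D: two_spaces K W "dual_space K W" by (rule W.two_spaces_dual)
  have d: "d \<in> carrier D.T" using assms(1) by (simp add: coevaluation_def)
  have "t = tensor_lift T (\<lambda>e c. pure (slice c t) e) d"
    using tensor_slices[OF assms(1,2)] by simp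
  also have "\<dots> = tensor_lift T (\<lambda>e c. \<zero>\<^bsub>T\<^esub>) d"
    by (rule D.lift_cong[OF d]) (simp add: assms(3) W.dual_functional pure_zero_left)
  also have "\<dots> = \<zero>\<^bsub>T\<^esub>" by (rule D.lift_zero[OF tensor_vectorspace d])
  finally show ?thesis .
qed

end

text \<open>The assumption on common zeros is applied to \<open>x - y\<close>.\<close>
lemma lin_map_family_injI:
  assumes "vectorspace K V" "vectorspace K W" "\<And>i. i \<in> I \<Longrightarrow> lin_map K V W (F i)"
    and "\<And>v. v \<in> carrier V \<Longrightarrow> (\<And>i. i \<in> I \<Longrightarrow> F i v = \<zero>\<^bsub>W\<^esub>) \<Longrightarrow> v = \<zero>\<^bsub>V\<^esub>"
    and "x \<in> carrier V" "y \<in> carrier V" "\<And>i. i \<in> I \<Longrightarrow> F i x = F i y"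
  shows "x = y"
proof -
  interpret V: vectorspace K V by fact
  interpret W: vectorspace K W by fact
  let ?y = "(\<ominus>\<^bsub>K\<^esub> \<one>\<^bsub>K\<^esub>) \<odot>\<^bsub>V\<^esub> y"
  have "F i (x \<oplus>\<^bsub>V\<^esub> ?y) = \<zero>\<^bsub>W\<^esub>" if i: "i \<in> I" for i
  proof -
    have "F i (x \<oplus>\<^bsub>V\<^esub> ?y) = F i x \<oplus>\<^bsub>W\<^esub> (\<ominus>\<^bsub>K\<^esub> \<one>\<^bsub>K\<^esub>) \<odot>\<^bsub>W\<^esub> F i y"
      using assms(5,6) by (simp add: module_hom_add[OF assms(3)[OF i]] module_hom_smult[OF assms(3)[OF i]])
    then show ?thesis
      using lin_map_closed[OF assms(3)[OF i] assms(6)] assms(7)[OF i]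
      by (simp add: W.smult_minus_1 W.M.r_neg)
  qed
  then have "x \<oplus>\<^bsub>V\<^esub> \<ominus>\<^bsub>V\<^esub> y = \<zero>\<^bsub>V\<^esub>"
    using assms(4)[of "x \<oplus>\<^bsub>V\<^esub> ?y"] assms(5,6) by (simp add: V.smult_minus_1)
  then have "(x \<oplus>\<^bsub>V\<^esub> \<ominus>\<^bsub>V\<^esub> y) \<oplus>\<^bsub>V\<^esub> y = y" using assms(6) by simp
  then show ?thesis using assms(5,6) by (simp add: V.M.a_assoc V.M.l_neg)
qed

lemma lin_map_injI:
  assumes "vectorspace K V" "vectorspace K W" "lin_map K V W f"
    and "\<And>v. v \<in> carrier V \<Longrightarrow> f v = \<zero>\<^bsub>W\<^esub> \<Longrightarrow> v = \<zero>\<^bsub>V\<^esub>"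
    and "x \<in> carrier V" "y \<in> carrier V" "f x = f y"
  shows "x = y"
  by (rule lin_map_family_injI[where I = UNIV and F = "\<lambda>i::unit. f", OF assms(1,2) assms(3) assms(4) assms(5-7)]) simp_all

text \<open>All coefficients in \<open>v = \<Sum> c\<^sub>i(v) e\<^sub>i\<close> vanish.\<close>
lemma (in one_space) functionals_separate:
  assumes "coevaluation K V d" "v \<in> carrier V" "\<And>c. functional K V c \<Longrightarrow> c v = \<zero>\<^bsub>K\<^esub>"
  shows "v = \<zero>\<^bsub>V\<^esub>"
proof -
  interpret D: two_spaces K V "dual_space K V" by (rule two_spaces_dual)
  have d: "d \<in> carrier D.T" using assms(1) by (simp add: coevaluation_def)
  have "v = tensor_lift V (\<lambda>e c. c v \<odot>\<^bsub>V\<^esub> e) d" using assms(1,2) by (simp add: coevaluation_def)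
  also have "\<dots> = tensor_lift V (\<lambda>e c. \<zero>\<^bsub>V\<^esub>) d"
    by (rule D.lift_cong[OF d]) (simp add: assms(3) dual_functional)
  also have "\<dots> = \<zero>\<^bsub>V\<^esub>" by (rule D.lift_zero[OF vectorspace_axioms d])
  finally show ?thesis .
qed

lemma (in one_space) normalized_functional:
  assumes "coevaluation K V d" "v \<in> carrier V" "v \<noteq> \<zero>\<^bsub>V\<^esub>"
  obtains c where "functional K V c" "c v = \<one>\<^bsub>K\<^esub>"
proof -
  obtain c where c: "functional K V c" "c v \<noteq> \<zero>\<^bsub>K\<^esub>"
    using functionals_separate[OF assms(1,2)] assms(3) by blast
  have cv: "c v \<in> carrier K" by (rule functional_closed[OF c(1) assms(2)])
  have i: "inv\<^bsub>K\<^esub> c v \<in> carrier K" "inv\<^bsub>K\<^esub> c v \<otimes>\<^bsub>K\<^esub> c v = \<one>\<^bsub>K\<^esub>"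
    using cv c(2) by (simp_all add: field_Units)
  show ?thesis
  proof (rule that)
    have "lin_map K V (base_algebra K) (\<lambda>u. inv\<^bsub>K\<^esub> c v \<odot>\<^bsub>base_algebra K\<^esub> c u)"
      by (rule lin_map_smult_const[OF base_algebra_vectorspace[OF field_axioms] c(1) i(1)])
    then show "functional K V (\<lambda>u. inv\<^bsub>K\<^esub> c v \<otimes>\<^bsub>K\<^esub> c u)" by (simp add: base_algebra_def)
  qed (rule i(2))
qed

lemma (in one_space) smult_eq_zero:
  assumes "k \<in> carrier K" "v \<in> carrier V" "v \<noteq> \<zero>\<^bsub>V\<^esub>" "k \<odot>\<^bsub>V\<^esub> v = \<zero>\<^bsub>V\<^esub>"
  shows "k = \<zero>\<^bsub>K\<^esub>"
proof (rule ccontr)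
  assume "k \<noteq> \<zero>\<^bsub>K\<^esub>"
  then have "v = inv\<^bsub>K\<^esub> k \<odot>\<^bsub>V\<^esub> \<zero>\<^bsub>V\<^esub>" and "inv\<^bsub>K\<^esub> k \<in> carrier K"
    using assms(1) mult_inverse[OF assms(1,2,4)] by (simp_all add: field_Units)
  with assms(3) show False by simp
qed

lemma (in two_spaces) slice_tensor_map:
  assumes X: "vectorspace K X" and F: "lin_map K V X F" and c: "functional K W c" and t: "t \<in> carrier T"
  shows "two_spaces.slice X c (tensor_map K X W F (\<lambda>w. w) t) = F (slice c t)"
proof -
  interpret XW: two_spaces K X W using X W.vectorspace_axioms by (rule two_spaces.intro)
  show ?thesis
    by (rule tensor_ext[OF X lin_map_comp[OF tensor_map_lin[OF F lin_map_id X W.vectorspace_axioms]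
            XW.slice_lin[OF c]] lin_map_comp[OF slice_lin[OF c] F] t])
      (simp add: slice_pure XW.slice_pure c module_hom_smult[OF F] functional_closed[OF c]
        lin_map_closed[OF F] tensor_map_def XW.tensor_vectorspace
        tensor_map_bilin[OF F lin_map_id X W.vectorspace_axioms])
qed

text \<open>
  A slice of \<open>(F\<^sub>i \<otimes> id) t\<close> is the value of \<open>F\<^sub>i\<close> at the slice of \<open>t\<close>; so the property of separating
  points passes from the maps \<open>F\<^sub>i\<close> to the maps \<open>F\<^sub>i \<otimes> id\<close>.
\<close>
lemma (in two_spaces) tensor_zero_if_images_zero:
  assumes d: "coevaluation K W d" and X: "vectorspace K X"
    and F: "\<And>i. i \<in> I \<Longrightarrow> lin_map K V X (F i)"
    and sep: "\<And>v. v \<in> carrier V \<Longrightarrow> (\<And>i. i \<in> I \<Longrightarrow> F i v = \<zero>\<^bsub>X\<^esub>) \<Longrightarrow> v = \<zero>\<^bsub>V\<^esub>"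
    and t: "t \<in> carrier T"
    and zero: "\<And>i. i \<in> I \<Longrightarrow> tensor_map K X W (F i) (\<lambda>w. w) t = \<zero>\<^bsub>tensor K X W\<^esub>"
  shows "t = \<zero>\<^bsub>T\<^esub>"
proof (rule tensor_zero_if_slices_zero[OF d t])
  interpret XW: two_spaces K X W using X W.vectorspace_axioms by (rule two_spaces.intro)
  fix c assume c: "functional K W c"
  show "slice c t = \<zero>\<^bsub>V\<^esub>"
  proof (rule sep[OF lin_map_closed[OF slice_lin[OF c] t]])
    fix i assume i: "i \<in> I"
    have "F i (slice c t) = XW.slice c (tensor_map K X W (F i) (\<lambda>w. w) t)"
      by (rule slice_tensor_map[OF X F[OF i] c t, symmetric])
    then show "F i (slice c t) = \<zero>\<^bsub>X\<^esub>"
      using lin_map_zero[OF XW.tensor_vectorspace X XW.slice_lin[OF c]] by (simp add: zero[OF i])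
  qed
qed

section \<open>Hopf algebras acting on algebras\<close>

locale hopf_action = hopf_algebra K H \<Delta> \<epsilon> S + module_algebra K H \<Delta> \<epsilon> A act
  for K :: "'k ring" and H :: "('k, 'h) module" and \<Delta> \<epsilon> S
    and A :: "('k, 'a) module" and act
begin

sublocale A1: one_space K A by unfold_locales
sublocale AH: two_spaces K A H by unfold_locales
sublocale AA: two_spaces K A A by unfold_locales

lemma act_closed: "h \<in> carrier H \<Longrightarrow> a \<in> carrier A \<Longrightarrow> act h a \<in> carrier A"
  by (rule lin_map_closed[OF act_linear])

lemma S_closed: "h \<in> carrier H \<Longrightarrow> S h \<in> carrier H"
  by (rule lin_map_closed[OF antipode_linear])

lemma act_lin_arg: "h \<in> carrier H \<Longrightarrow> lin_map K Z A f \<Longrightarrow> lin_map K Z A (\<lambda>z. act h (f z))"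
  by (rule lin_map_comp[OF _ act_linear])

lemma act_lin_op:
  assumes "a \<in> carrier A" "lin_map K Z H f" shows "lin_map K Z A (\<lambda>z. act (f z) a)"
  by (rule lin_map_comp[OF assms(2)]) (intro lin_mapI; simp add: assms(1) act_closed act_add act_smult)

lemma A_mult_lin:
  "a \<in> carrier A \<Longrightarrow> lin_map K Z A f \<Longrightarrow> lin_map K Z A (\<lambda>z. a \<otimes>\<^bsub>A\<^esub> f z)"
  "a \<in> carrier A \<Longrightarrow> lin_map K Z A f \<Longrightarrow> lin_map K Z A (\<lambda>z. f z \<otimes>\<^bsub>A\<^esub> a)"
  by (rule lin_map_comp[OF _ bilin_map_right[OF A.mult_bilin_map]]
      lin_map_comp[OF _ bilin_map_left[OF A.mult_bilin_map]]; assumption)+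

lemma H_mult_lin:
  "a \<in> carrier H \<Longrightarrow> lin_map K Z H f \<Longrightarrow> lin_map K Z H (\<lambda>z. a \<otimes>\<^bsub>H\<^esub> f z)"
  "a \<in> carrier H \<Longrightarrow> lin_map K Z H f \<Longrightarrow> lin_map K Z H (\<lambda>z. f z \<otimes>\<^bsub>H\<^esub> a)"
  by (rule lin_map_comp[OF _ bilin_map_right[OF mult_bilin_map]]
      lin_map_comp[OF _ bilin_map_left[OF mult_bilin_map]]; assumption)+

lemma S_lin: "lin_map K Z H f \<Longrightarrow> lin_map K Z H (\<lambda>z. S (f z))"
  by (rule lin_map_comp[OF _ antipode_linear])

lemma AH_pure_lin:
  "a \<in> carrier A \<Longrightarrow> lin_map K Z H f \<Longrightarrow> lin_map K Z AH.T (\<lambda>z. AH.pure a (f z))"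
  "h \<in> carrier H \<Longrightarrow> lin_map K Z A g \<Longrightarrow> lin_map K Z AH.T (\<lambda>z. AH.pure (g z) h)"
  by (rule lin_map_comp[OF _ bilin_map_right[OF AH.pure_bilin]]
      lin_map_comp[OF _ bilin_map_left[OF AH.pure_bilin]]; assumption)+

lemma lift_AH_lin:
  "vectorspace K X \<Longrightarrow> bilin_map K A H X \<beta> \<Longrightarrow> lin_map K Z AH.T f \<Longrightarrow>
    lin_map K Z X (\<lambda>z. tensor_lift X \<beta> (f z))"
  by (rule lin_map_comp[OF _ AH.lift_lin])

lemmas vs_facts = vectorspace_axioms V.vectorspace_axioms HH_vectorspace AH.tensor_vectorspace
  H3.UV_W.tensor_vectorspace AA.hom_space_vectorspace

text \<open>
  Backward rules for multilinearity: each step strips one operation off the expression, along the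
  argument that contains the variable in question.
\<close>
lemmas multilin = lin_map_id bilin_mapI trilin_mapI act_lin_arg act_lin_op A_mult_lin H_mult_lin S_lin
  AH_pure_lin lift_comult_lin lift_HH_param AH.lift_param lift_AH_lin counit_smult_lin counit_smult_lin'
  lin_map_smult_const act_closed S_closed A.m_closed m_closed comult_closed counit_closed
  AH.pure_closed HH.lift_closed AH.lift_closed vs_facts

lemma act_product_lift:
  "\<lbrakk>h \<in> carrier H; a \<in> carrier A; b \<in> carrier A\<rbrakk>
    \<Longrightarrow> tensor_lift A (\<lambda>x y. act x a \<otimes>\<^bsub>A\<^esub> act y b) (\<Delta> h) = act h (a \<otimes>\<^bsub>A\<^esub> b)"
  by (simp add: act_product)

text \<open>
  \<open>\<Sum> S(h' g) h'' = \<epsilon>(h) S(g)\<close>.  This is the form in which the antimultiplicativity of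
  \<open>S\<close> enters; it is obtained by inserting \<open>\<epsilon>(g'') = g'' S(g''')\<close> and recognizing \<open>S((h g)') (h g)''\<close>.
\<close>

lemma antipode_cancel:
  assumes h: "h \<in> carrier H" and g: "g \<in> carrier H"
  shows "tensor_lift H (\<lambda>x y. S (x \<otimes>\<^bsub>H\<^esub> g) \<otimes>\<^bsub>H\<^esub> y) (\<Delta> h) = \<epsilon> h \<odot>\<^bsub>H\<^esub> S g"
proof -
  note vs = vectorspace_axioms
  note dh = comult_closed[OF h] and dg = comult_closed[OF g]
  define G where "G x = tensor_lift H (\<lambda>p q. S (p \<otimes>\<^bsub>H\<^esub> x) \<otimes>\<^bsub>H\<^esub> q) (\<Delta> h)" for x
  define F where "F u v w =
    tensor_lift H (\<lambda>p q. (S (p \<otimes>\<^bsub>H\<^esub> u) \<otimes>\<^bsub>H\<^esub> (q \<otimes>\<^bsub>H\<^esub> v)) \<otimes>\<^bsub>H\<^esub> S w) (\<Delta> h)" for u v w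
  have bil: "bilin_map K H H H (\<lambda>p q. S (p \<otimes>\<^bsub>H\<^esub> u) \<otimes>\<^bsub>H\<^esub> (q \<otimes>\<^bsub>H\<^esub> v))"
    if "u \<in> carrier H" "v \<in> carrier H" for u v
    by (intro multilin that)
  have G_lin: "lin_map K H H G" unfolding G_def by (intro multilin h)
  have F_tri: "trilin_map K H H H H F" unfolding F_def by (intro multilin h)
  have Gc: "x \<in> carrier H \<Longrightarrow> G x \<in> carrier H" for x by (rule lin_map_closed[OF G_lin])
  have F1: "tensor_lift H (\<lambda>u v. F u v y) (\<Delta> x) = \<epsilon> x \<odot>\<^bsub>H\<^esub> (\<epsilon> h \<odot>\<^bsub>H\<^esub> S y)"
    if x: "x \<in> carrier H" and y: "y \<in> carrier H" for x y
  proof -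
    note dx = comult_closed[OF x]
    have "tensor_lift H (\<lambda>u v. F u v y) (\<Delta> x) =
      tensor_lift H (\<lambda>p q. tensor_lift H (\<lambda>u v. (S (p \<otimes>\<^bsub>H\<^esub> u) \<otimes>\<^bsub>H\<^esub> (q \<otimes>\<^bsub>H\<^esub> v)) \<otimes>\<^bsub>H\<^esub> S y) (\<Delta> x)) (\<Delta> h)"
      unfolding F_def by (rule lift_swap[OF vs vs vs vs vs dx dh]) (intro multilin y; assumption)+
    also have "\<dots> = tensor_lift H (\<lambda>a b. S a \<otimes>\<^bsub>H\<^esub> b \<otimes>\<^bsub>H\<^esub> S y) (\<Delta> (h \<otimes>\<^bsub>H\<^esub> x))"
      by (rule lift_comult_mult[OF vs _ h x, symmetric]) (intro multilin y)
    also have "\<dots> = tensor_lift H (\<lambda>a b. S a \<otimes>\<^bsub>H\<^esub> b) (\<Delta> (h \<otimes>\<^bsub>H\<^esub> x)) \<otimes>\<^bsub>H\<^esub> S y"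
      by (rule HH.lin_map_lift[OF vs vs _ _ comult_closed[OF m_closed[OF h x]], where f = "\<lambda>z. z \<otimes>\<^bsub>H\<^esub> S y", symmetric]) (intro multilin y h x)+
    also have "\<dots> = \<epsilon> x \<odot>\<^bsub>H\<^esub> (\<epsilon> h \<odot>\<^bsub>H\<^esub> S y)"
      using h x y by (simp add: antipode_left counit_mult counit_closed smult_mult_left S_closed
          smult_assoc1[symmetric] R.m_comm)
    finally show ?thesis .
  qed
  have F2: "tensor_lift H (\<lambda>u v. F x u v) (\<Delta> y) = \<epsilon> y \<odot>\<^bsub>H\<^esub> G x"
    if x: "x \<in> carrier H" and y: "y \<in> carrier H" for x y
  proof -
    note dy = comult_closed[OF y]
    have "tensor_lift H (\<lambda>u v. F x u v) (\<Delta> y) =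
      tensor_lift H (\<lambda>p q. tensor_lift H (\<lambda>u v. (S (p \<otimes>\<^bsub>H\<^esub> x) \<otimes>\<^bsub>H\<^esub> (q \<otimes>\<^bsub>H\<^esub> u)) \<otimes>\<^bsub>H\<^esub> S v) (\<Delta> y)) (\<Delta> h)"
      unfolding F_def by (rule lift_swap[OF vs vs vs vs vs dy dh]) (intro multilin x; assumption)+
    also have "\<dots> = tensor_lift H (\<lambda>p q. \<epsilon> y \<odot>\<^bsub>H\<^esub> (S (p \<otimes>\<^bsub>H\<^esub> x) \<otimes>\<^bsub>H\<^esub> q)) (\<Delta> h)"
    proof (rule HH.lift_cong[OF dh])
      fix p q assume pq: "p \<in> carrier H" "q \<in> carrier H"
      have "tensor_lift H (\<lambda>u v. (S (p \<otimes>\<^bsub>H\<^esub> x) \<otimes>\<^bsub>H\<^esub> (q \<otimes>\<^bsub>H\<^esub> u)) \<otimes>\<^bsub>H\<^esub> S v) (\<Delta> y) =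
        tensor_lift H (\<lambda>u v. (S (p \<otimes>\<^bsub>H\<^esub> x) \<otimes>\<^bsub>H\<^esub> q) \<otimes>\<^bsub>H\<^esub> (u \<otimes>\<^bsub>H\<^esub> S v)) (\<Delta> y)"
        by (rule HH.lift_cong[OF dy]) (simp add: m_assoc pq x S_closed)
      also have "\<dots> = (S (p \<otimes>\<^bsub>H\<^esub> x) \<otimes>\<^bsub>H\<^esub> q) \<otimes>\<^bsub>H\<^esub> tensor_lift H (\<lambda>u v. u \<otimes>\<^bsub>H\<^esub> S v) (\<Delta> y)"
        by (rule HH.lin_map_lift[OF vs vs _ _ dy, where f = "\<lambda>z. (S (p \<otimes>\<^bsub>H\<^esub> x) \<otimes>\<^bsub>H\<^esub> q) \<otimes>\<^bsub>H\<^esub> z", symmetric])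
          (intro multilin y x pq)+
      finally show "tensor_lift H (\<lambda>u v. (S (p \<otimes>\<^bsub>H\<^esub> x) \<otimes>\<^bsub>H\<^esub> (q \<otimes>\<^bsub>H\<^esub> u)) \<otimes>\<^bsub>H\<^esub> S v) (\<Delta> y) =
          \<epsilon> y \<odot>\<^bsub>H\<^esub> (S (p \<otimes>\<^bsub>H\<^esub> x) \<otimes>\<^bsub>H\<^esub> q)"
        using pq x y by (simp add: antipode_right smult_mult_right counit_closed S_closed)
    qed
    also have "\<dots> = \<epsilon> y \<odot>\<^bsub>H\<^esub> G x"
      unfolding G_def by (rule HH.lin_map_lift[OF vs vs _ _ dh, where f = "\<lambda>z. \<epsilon> y \<odot>\<^bsub>H\<^esub> z", symmetric])
          (intro multilin y x h)+
    finally show ?thesis .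
  qed
  have "G g = tensor_lift H (\<lambda>x y. \<epsilon> y \<odot>\<^bsub>H\<^esub> G x) (\<Delta> g)"
    by (rule counit_right_lift[OF vs G_lin g, symmetric])
  also have "\<dots> = tensor_lift H (\<lambda>x y. tensor_lift H (\<lambda>u v. F x u v) (\<Delta> y)) (\<Delta> g)"
    by (rule HH.lift_cong[OF dg]) (simp add: F2)
  also have "\<dots> = tensor_lift H (\<lambda>x y. tensor_lift H (\<lambda>u v. F u v y) (\<Delta> x)) (\<Delta> g)"
    by (rule coassoc_lift[OF vs F_tri g, symmetric])
  also have "\<dots> = tensor_lift H (\<lambda>x y. \<epsilon> x \<odot>\<^bsub>H\<^esub> (\<epsilon> h \<odot>\<^bsub>H\<^esub> S y)) (\<Delta> g)"
    by (rule HH.lift_cong[OF dg]) (simp add: F1)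
  also have "\<dots> = \<epsilon> h \<odot>\<^bsub>H\<^esub> S g"
    by (rule counit_left_lift[OF vs _ g]) (intro multilin h)
  finally show ?thesis by (simp add: G_def)
qed

lemma antipode_one: "S \<one>\<^bsub>H\<^esub> = \<one>\<^bsub>H\<^esub>"
proof -
  have "tensor_lift H (\<lambda>x y. S x \<otimes>\<^bsub>H\<^esub> y) (\<Delta> \<one>\<^bsub>H\<^esub>) = S \<one>\<^bsub>H\<^esub> \<otimes>\<^bsub>H\<^esub> \<one>\<^bsub>H\<^esub>"
    by (rule lift_comult_one) (intro multilin)+
  then show ?thesis using antipode_left[OF one_closed] by (simp add: counit_one S_closed)
qed

subsection \<open>The Galois map and conjugation by the antipode\<close>

text \<open>
  The map in the Galois condition, without the restriction that makes its values extensional.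
\<close>
definition galois_map :: "('a, 'h) tensor \<Rightarrow> 'a \<Rightarrow> 'a" where
  "galois_map t b = tensor_lift A (\<lambda>a h. a \<otimes>\<^bsub>A\<^esub> act h b) t"

lemma galois_map_lin:
  "b \<in> carrier A \<Longrightarrow> lin_map K AH.T A (\<lambda>t. galois_map t b)"
  "t \<in> carrier AH.T \<Longrightarrow> lin_map K A A (galois_map t)"
  unfolding galois_map_def by (intro multilin; assumption)+

lemma galois_map_pure:
  "a \<in> carrier A \<Longrightarrow> h \<in> carrier H \<Longrightarrow> b \<in> carrier A \<Longrightarrow> galois_map (AH.pure a h) b = a \<otimes>\<^bsub>A\<^esub> act h b"
  unfolding galois_map_def by (rule AH.lift_pure) (intro multilin; assumption)+

lemma galois_map_lift_hom:
  assumes "t \<in> carrier AH.T"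
  shows "tensor_lift AA.Hom (\<lambda>a h. \<lambda>b\<in>carrier A. a \<otimes>\<^bsub>A\<^esub> act h b) t \<in> carrier AA.Hom"
    and "b \<in> carrier A \<Longrightarrow> tensor_lift AA.Hom (\<lambda>a h. \<lambda>b\<in>carrier A. a \<otimes>\<^bsub>A\<^esub> act h b) t b = galois_map t b"
proof -
  have bil: "bilin_map K A H AA.Hom (\<lambda>a h. \<lambda>b\<in>carrier A. a \<otimes>\<^bsub>A\<^esub> act h b)"
    by (intro bilin_mapI AA.hom_space_curry; intro multilin; assumption)
  show "tensor_lift AA.Hom (\<lambda>a h. \<lambda>b\<in>carrier A. a \<otimes>\<^bsub>A\<^esub> act h b) t \<in> carrier AA.Hom"
    by (rule AH.lift_closed[OF AA.hom_space_vectorspace bil assms])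
  assume b: "b \<in> carrier A"
  show "tensor_lift AA.Hom (\<lambda>a h. \<lambda>b\<in>carrier A. a \<otimes>\<^bsub>A\<^esub> act h b) t b = galois_map t b"
    unfolding galois_map_def
    by (subst AH.lin_map_lift[OF AA.hom_space_vectorspace V.vectorspace_axioms AA.hom_space_eval[OF b] bil assms])
      (simp add: b)
qed

text \<open>
  Injectivity is tested at zero and operators are compared pointwise, so that the Galois condition
  can be used for operators that are not extensional.
\<close>
lemma dual_galois_iff:
  "dual_galois K H A act \<longleftrightarrow>
    (\<forall>t\<in>carrier AH.T. (\<forall>b\<in>carrier A. galois_map t b = \<zero>\<^bsub>A\<^esub>) \<longrightarrow> t = \<zero>\<^bsub>AH.T\<^esub>) \<and>
    (\<forall>f. lin_map K A A f \<longrightarrow> (\<exists>t\<in>carrier AH.T. \<forall>b\<in>carrier A. galois_map t b = f b))"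
  (is "?L \<longleftrightarrow> ?inj \<and> ?surj")
proof -
  let ?G = "tensor_lift AA.Hom (\<lambda>a h. \<lambda>b\<in>carrier A. a \<otimes>\<^bsub>A\<^esub> act h b)"
  have bil: "bilin_map K A H AA.Hom (\<lambda>a h. \<lambda>b\<in>carrier A. a \<otimes>\<^bsub>A\<^esub> act h b)"
    by (intro bilin_mapI AA.hom_space_curry; intro multilin; assumption)
  note Gl = AH.lift_lin[OF AA.hom_space_vectorspace bil]
  have zero: "?G t = \<zero>\<^bsub>AA.Hom\<^esub> \<longleftrightarrow> (\<forall>b\<in>carrier A. galois_map t b = \<zero>\<^bsub>A\<^esub>)" if t: "t \<in> carrier AH.T" for t
  proof
    assume "?G t = \<zero>\<^bsub>AA.Hom\<^esub>"
    then show "\<forall>b\<in>carrier A. galois_map t b = \<zero>\<^bsub>A\<^esub>"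
      by (simp add: galois_map_lift_hom(2)[OF t, symmetric] AA.hom_space_apply)
  next
    assume "\<forall>b\<in>carrier A. galois_map t b = \<zero>\<^bsub>A\<^esub>"
    then show "?G t = \<zero>\<^bsub>AA.Hom\<^esub>"
      by (intro AA.hom_space_eqI[OF galois_map_lift_hom(1)[OF t] AA.hom_space_closed(3)])
        (simp add: galois_map_lift_hom(2)[OF t] AA.hom_space_apply)
  qed
  have "inj_on ?G (carrier AH.T) \<longleftrightarrow> ?inj"
  proof
    assume inj: "inj_on ?G (carrier AH.T)"
    have z: "\<zero>\<^bsub>AH.T\<^esub> \<in> carrier AH.T" by (rule AH.zero_closed)
    show ?inj
    proof (intro ballI impI)
      fix t assume t: "t \<in> carrier AH.T" "\<forall>b\<in>carrier A. galois_map t b = \<zero>\<^bsub>A\<^esub>"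
      have "?G t = ?G \<zero>\<^bsub>AH.T\<^esub>"
        unfolding lin_map_zero[OF AH.tensor_vectorspace AA.hom_space_vectorspace Gl]
        by (rule zero[OF t(1), THEN iffD2, OF t(2)])
      then show "t = \<zero>\<^bsub>AH.T\<^esub>" by (rule inj_onD[OF inj _ t(1) z])
    qed
  next
    assume inj: ?inj
    show "inj_on ?G (carrier AH.T)"
    proof (rule inj_onI)
      fix s t assume st: "s \<in> carrier AH.T" "t \<in> carrier AH.T" "?G s = ?G t"
      show "s = t"
        by (rule lin_map_injI[OF AH.tensor_vectorspace AA.hom_space_vectorspace Gl _ st])
          (use inj zero in blast)
    qed
  qed
  moreover have "?G ` carrier AH.T = carrier AA.Hom \<longleftrightarrow> ?surj"
  proof
    assume onto: "?G ` carrier AH.T = carrier AA.Hom"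
    show ?surj
    proof (intro allI impI)
      fix f assume f: "lin_map K A A f"
      have "(\<lambda>b\<in>carrier A. f b) \<in> ?G ` carrier AH.T"
        unfolding onto by (rule AA.hom_space_restrict[OF f])
      then obtain t where t: "t \<in> carrier AH.T" "?G t = (\<lambda>b\<in>carrier A. f b)"
        by (elim imageE) simp
      have "\<forall>b\<in>carrier A. galois_map t b = f b"
        by (simp add: galois_map_lift_hom(2)[OF t(1), symmetric] t(2))
      with t(1) show "\<exists>t\<in>carrier AH.T. \<forall>b\<in>carrier A. galois_map t b = f b" ..
    qed
  next
    assume surj: ?surj
    show "?G ` carrier AH.T = carrier AA.Hom"
    proof
      show "?G ` carrier AH.T \<subseteq> carrier AA.Hom" using galois_map_lift_hom(1) by blast
      show "carrier AA.Hom \<subseteq> ?G ` carrier AH.T"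
      proof
        fix f assume f: "f \<in> carrier AA.Hom"
        from surj AA.hom_space_lin[OF f]
        obtain t where t: "t \<in> carrier AH.T" "\<forall>b\<in>carrier A. galois_map t b = f b"
          by blast
        have "?G t = f"
          by (rule AA.hom_space_eqI[OF galois_map_lift_hom(1)[OF t(1)] f])
            (simp add: galois_map_lift_hom(2)[OF t(1)] t(2))
        with t(1) show "f \<in> ?G ` carrier AH.T" by blast
      qed
    qed
  qed
  ultimately show ?thesis by (simp add: dual_galois_def bij_betw_def)
qed

end

context hopf_action
begin

text \<open>The diagonal action \<open>h (a \<otimes> g) = \<Sum> h' a \<otimes> h'' g\<close>.\<close>
definition diag_act :: "'h \<Rightarrow> ('a, 'h) tensor \<Rightarrow> ('a, 'h) tensor" where
  "diag_act h t = tensor_lift AH.T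
    (\<lambda>a g. tensor_lift AH.T (\<lambda>p q. AH.pure (act p a) (q \<otimes>\<^bsub>H\<^esub> g)) (\<Delta> h)) t"

text \<open>
  For \<open>t = a \<otimes> g\<close> this is the operator \<open>b \<mapsto> \<Sum> a (g' (f (S(g'') b)))\<close>: the adjoint action of \<open>g\<close> on the
  operator \<open>f\<close>, followed by left multiplication by \<open>a\<close>.
\<close>
definition conj_map :: "('a \<Rightarrow> 'a) \<Rightarrow> ('a, 'h) tensor \<Rightarrow> 'a \<Rightarrow> 'a" where
  "conj_map f t b = tensor_lift A
    (\<lambda>a g. tensor_lift A (\<lambda>p q. a \<otimes>\<^bsub>A\<^esub> act p (f (act (S q) b))) (\<Delta> g)) t"

lemma diag_act_bilin:
  "h \<in> carrier H \<Longrightarrow>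
    bilin_map K A H AH.T (\<lambda>a g. tensor_lift AH.T (\<lambda>p q. AH.pure (act p a) (q \<otimes>\<^bsub>H\<^esub> g)) (\<Delta> h))"
  by (intro multilin; assumption)

lemma diag_act_lin:
  "h \<in> carrier H \<Longrightarrow> lin_map K AH.T AH.T (diag_act h)"
  "t \<in> carrier AH.T \<Longrightarrow> lin_map K H AH.T (\<lambda>h. diag_act h t)"
  unfolding diag_act_def by (intro multilin; assumption)+

lemma diag_act_pure:
  "h \<in> carrier H \<Longrightarrow> a \<in> carrier A \<Longrightarrow> g \<in> carrier H \<Longrightarrow> diag_act h (AH.pure a g) =
    tensor_lift AH.T (\<lambda>p q. AH.pure (act p a) (q \<otimes>\<^bsub>H\<^esub> g)) (\<Delta> h)"
  unfolding diag_act_def by (rule AH.lift_pure[OF AH.tensor_vectorspace diag_act_bilin])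

lemma conj_map_bilin:
  assumes "lin_map K A A f" "b \<in> carrier A"
  shows "bilin_map K A H A (\<lambda>a g. tensor_lift A (\<lambda>p q. a \<otimes>\<^bsub>A\<^esub> act p (f (act (S q) b))) (\<Delta> g))"
  by (intro multilin lin_map_comp[OF _ assms(1)] lin_map_closed[OF assms(1)] assms(2); assumption)

lemma conj_map_lin:
  assumes f: "lin_map K A A f"
  shows "b \<in> carrier A \<Longrightarrow> lin_map K AH.T A (\<lambda>t. conj_map f t b)"
    and "t \<in> carrier AH.T \<Longrightarrow> lin_map K A A (conj_map f t)"
  unfolding conj_map_def by (intro multilin lin_map_comp[OF _ f] lin_map_closed[OF f]; assumption)+

lemma conj_map_pure:
  "lin_map K A A f \<Longrightarrow> b \<in> carrier A \<Longrightarrow> a \<in> carrier A \<Longrightarrow> g \<in> carrier H \<Longrightarrow>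
    conj_map f (AH.pure a g) b = tensor_lift A (\<lambda>p q. a \<otimes>\<^bsub>A\<^esub> act p (f (act (S q) b))) (\<Delta> g)"
  unfolding conj_map_def by (rule AH.lift_pure[OF V.vectorspace_axioms conj_map_bilin])

text \<open>
  This is the rule \<open>h (a (g b)) = \<Sum> (h' a) (h'' (g b))\<close> of a module algebra.
\<close>
lemma galois_map_diag_act:
  assumes h: "h \<in> carrier H" and t: "t \<in> carrier AH.T" and b: "b \<in> carrier A"
  shows "galois_map (diag_act h t) b = act h (galois_map t b)"
proof (rule AH.tensor_ext[OF V.vectorspace_axioms _ _ t])
  note gl = galois_map_lin(1)[OF b]
  show "lin_map K AH.T A (\<lambda>t. galois_map (diag_act h t) b)"
    by (rule lin_map_comp[OF diag_act_lin(1)[OF h] gl])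
  show "lin_map K AH.T A (\<lambda>t. act h (galois_map t b))"
    by (rule act_lin_arg[OF h gl])
  fix a g assume ag: "a \<in> carrier A" "g \<in> carrier H"
  have "galois_map (diag_act h (AH.pure a g)) b =
      tensor_lift A (\<lambda>p q. galois_map (AH.pure (act p a) (q \<otimes>\<^bsub>H\<^esub> g)) b) (\<Delta> h)"
    unfolding diag_act_pure[OF h ag]
    by (rule HH.lin_map_lift[OF AH.tensor_vectorspace V.vectorspace_axioms gl _ comult_closed[OF h]])
      (intro multilin ag; assumption)
  also have "\<dots> = tensor_lift A (\<lambda>p q. act p a \<otimes>\<^bsub>A\<^esub> act q (act g b)) (\<Delta> h)"
    by (rule HH.lift_cong[OF comult_closed[OF h]]) (simp add: galois_map_pure ag b act_closed act_mult)
  also have "\<dots> = act h (galois_map (AH.pure a g) b)"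
    by (simp add: act_product_lift galois_map_pure h ag b act_closed)
  finally show "galois_map (diag_act h (AH.pure a g)) b = act h (galois_map (AH.pure a g) b)" .
qed

text \<open>
  For \<open>t = a \<otimes> g\<close> the left-hand side is \<open>\<Sum> (h' a) (h'' (g' (f (S(h''' g'') (h'''' b)))))\<close>.  By
  \<open>antipode_cancel\<close> the last two components of \<open>h\<close> cancel, and what remains is
  \<open>\<Sum> (h' a) (h'' (g' (f (S(g'') b))))\<close>, the action of \<open>h\<close> on a product.
\<close>
lemma conj_map_equivariant:
  assumes f: "lin_map K A A f" and h: "h \<in> carrier H" and t: "t \<in> carrier AH.T" and b: "b \<in> carrier A"
  shows "tensor_lift A (\<lambda>x y. conj_map f (diag_act x t) (act y b)) (\<Delta> h) = act h (conj_map f t b)"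
proof (rule AH.tensor_ext[OF V.vectorspace_axioms _ _ t])
  note vH = vectorspace_axioms and vA = V.vectorspace_axioms
  note lf = lin_map_comp[OF _ f] lin_map_closed[OF f]
  note cl1 = lin_map_comp[OF _ conj_map_lin(1)[OF f]]
  note dh = comult_closed[OF h]
  have bil: "bilin_map K H H A (\<lambda>x y. conj_map f (diag_act x t) (act y b))" if t: "t \<in> carrier AH.T" for t
  proof (rule bilin_mapI)
    show "lin_map K H A (\<lambda>y. conj_map f (diag_act x t) (act y b))" if "x \<in> carrier H" for x
      by (rule lin_map_comp[OF act_lin_op[OF b lin_map_id]
            conj_map_lin(2)[OF f lin_map_closed[OF diag_act_lin(2)[OF t] that]]])
    show "lin_map K H A (\<lambda>x. conj_map f (diag_act x t) (act y b))" if "y \<in> carrier H" for y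
      by (rule lin_map_comp[OF diag_act_lin(2)[OF t] conj_map_lin(1)[OF f act_closed[OF that b]]])
  qed
  show "lin_map K AH.T A (\<lambda>t. tensor_lift A (\<lambda>x y. conj_map f (diag_act x t) (act y b)) (\<Delta> h))"
    by (rule HH.lift_param[OF vA dh bil _ AH.tensor_vectorspace])
      (assumption, rule lin_map_comp[OF diag_act_lin(1) conj_map_lin(1)[OF f act_closed[OF _ b]]])
  show "lin_map K AH.T A (\<lambda>t. act h (conj_map f t b))"
    by (rule act_lin_arg[OF h conj_map_lin(1)[OF f b]])
  fix a g assume a: "a \<in> carrier A" and g: "g \<in> carrier H"
  note dg = comult_closed[OF g]
  define C where "C u v y =
    tensor_lift A (\<lambda>p q. act u a \<otimes>\<^bsub>A\<^esub> act p (f (act (S q) (act y b)))) (\<Delta> (v \<otimes>\<^bsub>H\<^esub> g))" for u v y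
  define M where "M x r =
    tensor_lift A (\<lambda>p q. act x a \<otimes>\<^bsub>A\<^esub> act (r \<otimes>\<^bsub>H\<^esub> p) (f (act (S q) b))) (\<Delta> g)" for x r
  have C_tri: "trilin_map K H H H A C"
    unfolding C_def by (intro multilin lf a b g; assumption)
  have M_lin: "x \<in> carrier H \<Longrightarrow> lin_map K H A (M x)" for x
    unfolding M_def by (intro multilin lf a b g; assumption)
  have C_sum: "tensor_lift A (\<lambda>v y. C x v y) (\<Delta> w) = M x w"
    if x: "x \<in> carrier H" and w: "w \<in> carrier H" for x w
  proof -
    note dw = comult_closed[OF w]
    define D where "D r s y = tensor_lift A (\<lambda>p q. act x a \<otimes>\<^bsub>A\<^esub>
        act (r \<otimes>\<^bsub>H\<^esub> p) (f (act (S (s \<otimes>\<^bsub>H\<^esub> q)) (act y b)))) (\<Delta> g)" for r s y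
    have D_tri: "trilin_map K H H H A D"
      unfolding D_def by (intro multilin lf a b g x; assumption)
    have D_sum: "tensor_lift A (\<lambda>s y. D r s y) (\<Delta> z) = \<epsilon> z \<odot>\<^bsub>A\<^esub> M x r"
      if r: "r \<in> carrier H" and z: "z \<in> carrier H" for r z
    proof -
      note dz = comult_closed[OF z]
      have "tensor_lift A (\<lambda>s y. D r s y) (\<Delta> z) =
        tensor_lift A (\<lambda>p q. tensor_lift A (\<lambda>s y. act x a \<otimes>\<^bsub>A\<^esub>
          act (r \<otimes>\<^bsub>H\<^esub> p) (f (act (S (s \<otimes>\<^bsub>H\<^esub> q)) (act y b)))) (\<Delta> z)) (\<Delta> g)"
        unfolding D_def
        by (rule lift_swap[OF vH vH vH vH vA dz dg]) (intro multilin lf a b x r; assumption)+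
      also have "\<dots> = tensor_lift A (\<lambda>p q. \<epsilon> z \<odot>\<^bsub>A\<^esub>
          (act x a \<otimes>\<^bsub>A\<^esub> act (r \<otimes>\<^bsub>H\<^esub> p) (f (act (S q) b)))) (\<Delta> g)"
      proof (rule HH.lift_cong[OF dg])
        fix p q assume p: "p \<in> carrier H" and q: "q \<in> carrier H"
        let ?L = "\<lambda>u. act x a \<otimes>\<^bsub>A\<^esub> act (r \<otimes>\<^bsub>H\<^esub> p) (f (act u b))"
        have L: "lin_map K H A ?L" by (intro multilin lf a b x r p)
        have "tensor_lift A (\<lambda>s y. act x a \<otimes>\<^bsub>A\<^esub>
            act (r \<otimes>\<^bsub>H\<^esub> p) (f (act (S (s \<otimes>\<^bsub>H\<^esub> q)) (act y b)))) (\<Delta> z) =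
          tensor_lift A (\<lambda>s y. ?L (S (s \<otimes>\<^bsub>H\<^esub> q) \<otimes>\<^bsub>H\<^esub> y)) (\<Delta> z)"
          by (rule HH.lift_cong[OF dz]) (simp add: act_mult S_closed q b)
        also have "\<dots> = ?L (tensor_lift H (\<lambda>s y. S (s \<otimes>\<^bsub>H\<^esub> q) \<otimes>\<^bsub>H\<^esub> y) (\<Delta> z))"
          by (rule HH.lin_map_lift[OF vH vA L _ dz, symmetric]) (intro multilin q; assumption)
        also have "\<dots> = \<epsilon> z \<odot>\<^bsub>A\<^esub> ?L (S q)"
          unfolding antipode_cancel[OF z q]
          by (rule module_hom_smult[OF L counit_closed[OF z] S_closed[OF q]])
        finally show "tensor_lift A (\<lambda>s y. act x a \<otimes>\<^bsub>A\<^esub>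
            act (r \<otimes>\<^bsub>H\<^esub> p) (f (act (S (s \<otimes>\<^bsub>H\<^esub> q)) (act y b)))) (\<Delta> z) =
          \<epsilon> z \<odot>\<^bsub>A\<^esub> ?L (S q)" .
      qed
      also have "\<dots> = \<epsilon> z \<odot>\<^bsub>A\<^esub> M x r"
        unfolding M_def
        by (rule HH.lin_map_lift[OF vA vA _ _ dg, where f = "\<lambda>u. \<epsilon> z \<odot>\<^bsub>A\<^esub> u", symmetric])
          (intro multilin lf a b x r z; assumption)+
      finally show ?thesis .
    qed
    have "tensor_lift A (\<lambda>v y. C x v y) (\<Delta> w) =
      tensor_lift A (\<lambda>v y. tensor_lift A (\<lambda>r s. D r s y) (\<Delta> v)) (\<Delta> w)"
      unfolding C_def D_def
      by (rule HH.lift_cong[OF dw], rule lift_comult_mult[OF vA])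
        (intro multilin lf a b x g; assumption | assumption | rule g)+
    also have "\<dots> = tensor_lift A (\<lambda>r z. tensor_lift A (\<lambda>s y. D r s y) (\<Delta> z)) (\<Delta> w)"
      by (rule coassoc_lift[OF vA D_tri w])
    also have "\<dots> = tensor_lift A (\<lambda>r z. \<epsilon> z \<odot>\<^bsub>A\<^esub> M x r) (\<Delta> w)"
      by (rule HH.lift_cong[OF dw]) (rule D_sum)
    also have "\<dots> = M x w" by (rule counit_right_lift[OF vA M_lin[OF x] w])
    finally show ?thesis .
  qed
  have "tensor_lift A (\<lambda>x y. conj_map f (diag_act x (AH.pure a g)) (act y b)) (\<Delta> h) =
    tensor_lift A (\<lambda>x y. tensor_lift A (\<lambda>u v. C u v y) (\<Delta> x)) (\<Delta> h)"
  proof (rule HH.lift_cong[OF dh])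
    fix x y assume x: "x \<in> carrier H" and y: "y \<in> carrier H"
    note yb = act_closed[OF y b]
    have "conj_map f (diag_act x (AH.pure a g)) (act y b) =
        tensor_lift A (\<lambda>u v. conj_map f (AH.pure (act u a) (v \<otimes>\<^bsub>H\<^esub> g)) (act y b)) (\<Delta> x)"
      unfolding diag_act_pure[OF x a g]
      by (rule HH.lin_map_lift[OF AH.tensor_vectorspace vA conj_map_lin(1)[OF f yb] _ comult_closed[OF x]])
        (intro multilin a g; assumption)
    also have "\<dots> = tensor_lift A (\<lambda>u v. C u v y) (\<Delta> x)"
      unfolding C_def
      by (rule HH.lift_cong[OF comult_closed[OF x]]) (simp add: conj_map_pure f yb act_closed a g)
    finally show "conj_map f (diag_act x (AH.pure a g)) (act y b) =
      tensor_lift A (\<lambda>u v. C u v y) (\<Delta> x)" .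
  qed
  also have "\<dots> = tensor_lift A (\<lambda>x w. tensor_lift A (\<lambda>v y. C x v y) (\<Delta> w)) (\<Delta> h)"
    by (rule coassoc_lift[OF vA C_tri h])
  also have "\<dots> = tensor_lift A (\<lambda>x w. M x w) (\<Delta> h)"
    by (rule HH.lift_cong[OF dh]) (rule C_sum)
  also have "\<dots> = tensor_lift A (\<lambda>p q. tensor_lift A (\<lambda>x w.
      act x a \<otimes>\<^bsub>A\<^esub> act (w \<otimes>\<^bsub>H\<^esub> p) (f (act (S q) b))) (\<Delta> h)) (\<Delta> g)"
    unfolding M_def
    by (rule lift_swap[OF vH vH vH vH vA dh dg]) (intro multilin lf a b; assumption)+
  also have "\<dots> = tensor_lift A (\<lambda>p q. act h (a \<otimes>\<^bsub>A\<^esub> act p (f (act (S q) b)))) (\<Delta> g)"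
  proof (rule HH.lift_cong[OF dg])
    fix p q assume p: "p \<in> carrier H" and q: "q \<in> carrier H"
    have fc: "f (act (S q) b) \<in> carrier A" by (intro lf(2) act_closed S_closed q b)
    have "tensor_lift A (\<lambda>x w. act x a \<otimes>\<^bsub>A\<^esub> act (w \<otimes>\<^bsub>H\<^esub> p) (f (act (S q) b))) (\<Delta> h) =
      tensor_lift A (\<lambda>x w. act x a \<otimes>\<^bsub>A\<^esub> act w (act p (f (act (S q) b)))) (\<Delta> h)"
      by (rule HH.lift_cong[OF dh]) (simp add: act_mult p fc)
    then show "tensor_lift A (\<lambda>x w. act x a \<otimes>\<^bsub>A\<^esub> act (w \<otimes>\<^bsub>H\<^esub> p) (f (act (S q) b))) (\<Delta> h) =
        act h (a \<otimes>\<^bsub>A\<^esub> act p (f (act (S q) b)))"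
      by (simp add: act_product_lift h a act_closed p fc)
  qed
  also have "\<dots> = act h (conj_map f (AH.pure a g) b)"
    unfolding conj_map_pure[OF f b a g]
    by (rule HH.lin_map_lift[OF vA vA act_linear[OF h] _ dg, symmetric])
      (intro multilin lf a b; assumption)
  finally show "tensor_lift A (\<lambda>x y. conj_map f (diag_act x (AH.pure a g)) (act y b)) (\<Delta> h) =
    act h (conj_map f (AH.pure a g) b)" .
qed

lemma conj_map_one:
  assumes f: "lin_map K A A f" and b: "b \<in> carrier A"
  shows "conj_map f (AH.pure \<one>\<^bsub>A\<^esub> \<one>\<^bsub>H\<^esub>) b = f b"
proof -
  have "conj_map f (AH.pure \<one>\<^bsub>A\<^esub> \<one>\<^bsub>H\<^esub>) b =
      tensor_lift A (\<lambda>p q. \<one>\<^bsub>A\<^esub> \<otimes>\<^bsub>A\<^esub> act p (f (act (S q) b))) (\<Delta> \<one>\<^bsub>H\<^esub>)"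
    by (simp add: conj_map_pure f b)
  also have "\<dots> = \<one>\<^bsub>A\<^esub> \<otimes>\<^bsub>A\<^esub> act \<one>\<^bsub>H\<^esub> (f (act (S \<one>\<^bsub>H\<^esub>) b))"
    by (rule lift_comult_one[OF V.vectorspace_axioms])
      (intro multilin lin_map_comp[OF _ f] lin_map_closed[OF f] b A.one_closed; assumption)
  finally show ?thesis
    using lin_map_closed[OF f b] b by (simp add: antipode_one act_one)
qed

end

section \<open>Galois actions\<close>

text \<open>
  The two coevaluations record that \<open>H\<close> and \<open>A\<close> are finite dimensional.
\<close>
locale galois_action = hopf_action K H \<Delta> \<epsilon> S A act
  for K :: "'k ring" and H :: "('k, 'h) module" and \<Delta> \<epsilon> S and A :: "('k, 'a) module" and act +
  fixes dH dA
  assumes coev_H: "coevaluation K H dH" and coev_A: "coevaluation K A dA"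
    and galois: "dual_galois K H A act"
begin

sublocale AD: two_spaces K A "dual_space K A" by (rule A1.two_spaces_dual)

lemma dA: "dA \<in> carrier AD.T" using coev_A by (simp add: coevaluation_def)

lemma galois_zero:
  "t \<in> carrier AH.T \<Longrightarrow> (\<And>b. b \<in> carrier A \<Longrightarrow> galois_map t b = \<zero>\<^bsub>A\<^esub>) \<Longrightarrow> t = \<zero>\<^bsub>AH.T\<^esub>"
  using galois[unfolded dual_galois_iff, THEN conjunct1] by blast

lemma galois_onto:
  assumes "lin_map K A A f"
  obtains t where "t \<in> carrier AH.T" "\<And>b. b \<in> carrier A \<Longrightarrow> galois_map t b = f b"
  using galois[unfolded dual_galois_iff, THEN conjunct2] assms by blast

lemma galois_eqI:
  assumes "s \<in> carrier AH.T" "t \<in> carrier AH.T"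
    and "\<And>b. b \<in> carrier A \<Longrightarrow> galois_map s b = galois_map t b"
  shows "s = t"
  by (rule lin_map_family_injI[OF AH.tensor_vectorspace V.vectorspace_axioms galois_map_lin(1) galois_zero assms])

text \<open>
  If \<open>h\<close> acts as zero, then \<open>1 \<otimes> h\<close> is in the kernel of the Galois map.
\<close>
lemma act_faithful:
  assumes "h \<in> carrier H" "\<And>a. a \<in> carrier A \<Longrightarrow> act h a = \<zero>\<^bsub>A\<^esub>"
  shows "h = \<zero>\<^bsub>H\<^esub>"
proof (rule H1.functionals_separate[OF coev_H assms(1)])
  fix c assume c: "functional K H c"
  have "AH.pure \<one>\<^bsub>A\<^esub> h = \<zero>\<^bsub>AH.T\<^esub>"
    by (rule galois_zero) (simp_all add: assms galois_map_pure)
  then have "c h \<odot>\<^bsub>A\<^esub> \<one>\<^bsub>A\<^esub> = \<zero>\<^bsub>A\<^esub>"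
    using AH.slice_pure[OF c A.one_closed assms(1)]
      lin_map_zero[OF AH.tensor_vectorspace V.vectorspace_axioms AH.slice_lin[OF c]] by simp
  then show "c h = \<zero>\<^bsub>K\<^esub>"
    using A1.smult_eq_zero[OF functional_closed[OF c assms(1)] A.one_closed A.algebra_one_not_zero] by simp
qed

subsection \<open>Evaluation separates tensors\<close>

text \<open>
  One factor \<open>H\<close> is added: the maps \<open>F\<^sub>i \<otimes> id\<close> separate the points of \<open>V \<otimes> H\<close>, and
  their values in \<open>A \<otimes> H\<close> are determined by the injective Galois map.
\<close>
lemma separation:
  assumes V: "vectorspace K V" and F: "\<And>i. i \<in> I \<Longrightarrow> lin_map K V A (F i)"
    and sep: "\<And>v. v \<in> carrier V \<Longrightarrow> (\<And>i. i \<in> I \<Longrightarrow> F i v = \<zero>\<^bsub>A\<^esub>) \<Longrightarrow> v = \<zero>\<^bsub>V\<^esub>"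
    and t: "t \<in> carrier (tensor K V H)"
    and zero: "\<And>i b. i \<in> I \<Longrightarrow> b \<in> carrier A \<Longrightarrow> tensor_lift A (\<lambda>v h. F i v \<otimes>\<^bsub>A\<^esub> act h b) t = \<zero>\<^bsub>A\<^esub>"
  shows "t = \<zero>\<^bsub>tensor K V H\<^esub>"
proof -
  interpret VH: two_spaces K V H using V vectorspace_axioms by (rule two_spaces.intro)
  show ?thesis
  proof (rule VH.tensor_zero_if_images_zero[OF coev_H V.vectorspace_axioms F sep t])
    fix i assume i: "i \<in> I"
    note l = VH.tensor_map_lin[OF F[OF i] lin_map_id V.vectorspace_axioms vectorspace_axioms]
    show "tensor_map K A H (F i) (\<lambda>h. h) t = \<zero>\<^bsub>AH.T\<^esub>"
    proof (rule galois_zero[OF lin_map_closed[OF l t]])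
      fix b assume b: "b \<in> carrier A"
      have "galois_map (tensor_map K A H (F i) (\<lambda>h. h) t) b = tensor_lift A (\<lambda>v h. F i v \<otimes>\<^bsub>A\<^esub> act h b) t"
        unfolding VH.lin_map_tensor_map[OF F[OF i] lin_map_id V.vectorspace_axioms vectorspace_axioms
            V.vectorspace_axioms galois_map_lin(1)[OF b] t]
        by (rule VH.lift_cong[OF t]) (simp add: galois_map_pure lin_map_closed[OF F[OF i]] b)
      then show "galois_map (tensor_map K A H (F i) (\<lambda>h. h) t) b = \<zero>\<^bsub>A\<^esub>" by (simp add: zero i b)
    qed
  qed
qed

definition eval2 :: "'a \<Rightarrow> 'a \<Rightarrow> ('h, 'h) tensor \<Rightarrow> 'a" where
  "eval2 a b = tensor_lift A (\<lambda>x y. act x a \<otimes>\<^bsub>A\<^esub> act y b)"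

lemma eval2_bilin: "a \<in> carrier A \<Longrightarrow> b \<in> carrier A \<Longrightarrow> bilin_map K H H A (\<lambda>x y. act x a \<otimes>\<^bsub>A\<^esub> act y b)"
  by (intro multilin; assumption)

lemma eval2_lin: "a \<in> carrier A \<Longrightarrow> b \<in> carrier A \<Longrightarrow> lin_map K HH.T A (eval2 a b)"
  unfolding eval2_def by (rule HH.lift_lin[OF V.vectorspace_axioms eval2_bilin])

lemma eval2_zero:
  assumes "t \<in> carrier HH.T" "\<And>a b. a \<in> carrier A \<Longrightarrow> b \<in> carrier A \<Longrightarrow> eval2 a b t = \<zero>\<^bsub>A\<^esub>"
  shows "t = \<zero>\<^bsub>HH.T\<^esub>"
  by (rule separation[where I = "carrier A" and F = "\<lambda>a h. act h a", OF vectorspace_axioms _ act_faithful])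
    (simp_all add: act_lin_op lin_map_id assms(2)[unfolded eval2_def] assms(1))

lemma eval2_pairs_zero:
  assumes "t \<in> carrier HH.T"
    "\<And>i. i \<in> carrier A \<times> carrier A \<Longrightarrow> (case i of (a, b) \<Rightarrow> eval2 a b) t = \<zero>\<^bsub>A\<^esub>"
  shows "t = \<zero>\<^bsub>HH.T\<^esub>"
proof (rule eval2_zero[OF assms(1)])
  show "eval2 a b t = \<zero>\<^bsub>A\<^esub>" if "a \<in> carrier A" "b \<in> carrier A" for a b
    using assms(2)[of "(a, b)"] that by simp
qed

lemma eval2_eqI:
  assumes "s \<in> carrier HH.T" "t \<in> carrier HH.T"
    and "\<And>a b. a \<in> carrier A \<Longrightarrow> b \<in> carrier A \<Longrightarrow> eval2 a b s = eval2 a b t"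
  shows "s = t"
proof (rule lin_map_family_injI[where I = "carrier A \<times> carrier A" and F = "\<lambda>(a, b). eval2 a b",
      OF HH_vectorspace V.vectorspace_axioms _ eval2_pairs_zero assms(1,2)])
  fix i assume "i \<in> carrier A \<times> carrier A"
  then show "lin_map K HH.T A (case i of (a, b) \<Rightarrow> eval2 a b)"
    and "(case i of (a, b) \<Rightarrow> eval2 a b) s = (case i of (a, b) \<Rightarrow> eval2 a b) t"
    by (auto simp: eval2_lin assms(3))
qed

lemma swapped_eval2_eqI:
  assumes s: "s \<in> carrier HH.T" and t: "t \<in> carrier HH.T"
    and eq: "\<And>a b. a \<in> carrier A \<Longrightarrow> b \<in> carrier A \<Longrightarrow>
      tensor_lift A (\<lambda>x y. act y a \<otimes>\<^bsub>A\<^esub> act x b) s = tensor_lift A (\<lambda>x y. act y a \<otimes>\<^bsub>A\<^esub> act x b) t"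
  shows "s = t"
proof -
  have ev: "eval2 a b (tensor_swap K H H u) = tensor_lift A (\<lambda>x y. act y a \<otimes>\<^bsub>A\<^esub> act x b) u"
    if "a \<in> carrier A" "b \<in> carrier A" "u \<in> carrier HH.T" for a b u
    unfolding eval2_def by (rule HH.lift_tensor_swap[OF V.vectorspace_axioms eval2_bilin that(3)]) (rule that)+
  have "tensor_swap K H H s = tensor_swap K H H t"
  proof (rule eval2_eqI[OF swap_closed[OF s] swap_closed[OF t]])
    fix a b assume ab: "a \<in> carrier A" "b \<in> carrier A"
    show "eval2 a b (tensor_swap K H H s) = eval2 a b (tensor_swap K H H t)"
      unfolding ev[OF ab s] ev[OF ab t] by (rule eq[OF ab])
  qed
  then have "tensor_swap K H H (tensor_swap K H H s) = tensor_swap K H H (tensor_swap K H H t)"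
    by (simp only:)
  then show ?thesis by (simp only: HH.swap_swap s t)
qed

abbreviation "HHH \<equiv> H3.UV_W.T"

lemma eval3_tri:
  assumes "a \<in> carrier A" "b \<in> carrier A" "c \<in> carrier A"
  shows "trilin_map K H H H A (\<lambda>x y z. (act x a \<otimes>\<^bsub>A\<^esub> act y b) \<otimes>\<^bsub>A\<^esub> act z c)"
    and "trilin_map K H H H A (\<lambda>x y z. (act z a \<otimes>\<^bsub>A\<^esub> act x b) \<otimes>\<^bsub>A\<^esub> act y c)"
    and "trilin_map K H H H A (\<lambda>x y z. (act y a \<otimes>\<^bsub>A\<^esub> act z b) \<otimes>\<^bsub>A\<^esub> act x c)"
  by (intro multilin assms; assumption)+

lemma eval3_zero:
  assumes t: "t \<in> carrier HHH"
    and zero: "\<And>a b c. \<lbrakk>a \<in> carrier A; b \<in> carrier A; c \<in> carrier A\<rbrakk> \<Longrightarrow>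
      tri_lift A (\<lambda>x y z. (act x a \<otimes>\<^bsub>A\<^esub> act y b) \<otimes>\<^bsub>A\<^esub> act z c) t = \<zero>\<^bsub>A\<^esub>"
  shows "t = \<zero>\<^bsub>HHH\<^esub>"
proof (rule separation[where I = "carrier A \<times> carrier A" and F = "\<lambda>(a, b). eval2 a b",
      OF HH_vectorspace _ eval2_pairs_zero t])
  fix i c assume i: "i \<in> carrier A \<times> carrier A" and c: "c \<in> carrier A"
  obtain a b where ab: "i = (a, b)" "a \<in> carrier A" "b \<in> carrier A" using i by auto
  have "tensor_lift A (\<lambda>s z. eval2 a b s \<otimes>\<^bsub>A\<^esub> act z c) t =
      tri_lift A (\<lambda>x y z. (act x a \<otimes>\<^bsub>A\<^esub> act y b) \<otimes>\<^bsub>A\<^esub> act z c) t"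
    unfolding tri_lift_def eval2_def
  proof (rule H3.UV_W.lift_cong[OF t])
    fix s z assume s: "s \<in> carrier HH.T" and z: "z \<in> carrier H"
    show "tensor_lift A (\<lambda>x y. act x a \<otimes>\<^bsub>A\<^esub> act y b) s \<otimes>\<^bsub>A\<^esub> act z c =
        tensor_lift A (\<lambda>x y. (act x a \<otimes>\<^bsub>A\<^esub> act y b) \<otimes>\<^bsub>A\<^esub> act z c) s"
      by (rule HH.lin_map_lift[OF V.vectorspace_axioms V.vectorspace_axioms
            A_mult_lin(2)[OF act_closed[OF z c] lin_map_id] eval2_bilin[OF ab(2,3)] s])
  qed
  then show "tensor_lift A (\<lambda>v h. (case i of (a, b) \<Rightarrow> eval2 a b) v \<otimes>\<^bsub>A\<^esub> act h c) t = \<zero>\<^bsub>A\<^esub>"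
    by (simp add: zero ab c)
next
  fix i assume "i \<in> carrier A \<times> carrier A"
  then show "lin_map K HH.T A (case i of (a, b) \<Rightarrow> eval2 a b)" by (auto simp: eval2_lin)
qed

text \<open>
  The cyclic permutation \<open>x \<otimes> y \<otimes> z \<mapsto> z \<otimes> x \<otimes> y\<close>.  It reduces statements about the products
  \<open>(z a) (x b) (y c)\<close> and \<open>(y a) (z b) (x c)\<close> to \<open>eval3_zero\<close>.
\<close>
definition rotate :: "(('h, 'h) tensor, 'h) tensor \<Rightarrow> (('h, 'h) tensor, 'h) tensor" where
  "rotate = tri_lift HHH (\<lambda>x y z. H3.UV_W.pure (HH.pure z x) y)"

lemma pure3_tri: "trilin_map K H H H HHH (\<lambda>x y z. H3.UV_W.pure (HH.pure z x) y)"
  by (intro trilin_mapI bilin_map_right[OF H3.UV_W.pure_bilin]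
      lin_map_comp[OF bilin_map_right[OF HH.pure_bilin] bilin_map_left[OF H3.UV_W.pure_bilin]]
      lin_map_comp[OF bilin_map_left[OF HH.pure_bilin] bilin_map_left[OF H3.UV_W.pure_bilin]]
      HH.pure_closed)

lemma rotate_lin: "lin_map K HHH HHH rotate"
  unfolding rotate_def by (rule H3.tri_lift_lin[OF H3.UV_W.tensor_vectorspace pure3_tri])

lemma rotate_pure:
  "x \<in> carrier H \<Longrightarrow> y \<in> carrier H \<Longrightarrow> z \<in> carrier H \<Longrightarrow>
    rotate (H3.UV_W.pure (HH.pure x y) z) = H3.UV_W.pure (HH.pure z x) y"
  unfolding rotate_def by (rule H3.tri_lift_pure3[OF H3.UV_W.tensor_vectorspace pure3_tri])

lemma rotate_cube: "t \<in> carrier HHH \<Longrightarrow> rotate (rotate (rotate t)) = t"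
  by (rule H3.tri_ext[OF H3.UV_W.tensor_vectorspace
        lin_map_comp[OF lin_map_comp[OF rotate_lin rotate_lin] rotate_lin] lin_map_id])
    (simp_all add: rotate_pure)

lemma tri_lift_rotate:
  assumes "trilin_map K H H H A F" "trilin_map K H H H A (\<lambda>x y z. F z x y)" "t \<in> carrier HHH"
  shows "tri_lift A F (rotate t) = tri_lift A (\<lambda>x y z. F z x y) t"
  by (rule H3.tri_ext[OF V.vectorspace_axioms lin_map_comp[OF rotate_lin H3.tri_lift_lin] H3.tri_lift_lin])
    (simp_all add: assms rotate_pure V.vectorspace_axioms)

lemma rotated_eval3_eqI:
  assumes s: "s \<in> carrier HHH" and t: "t \<in> carrier HHH"
    and eq: "\<And>a b c. \<lbrakk>a \<in> carrier A; b \<in> carrier A; c \<in> carrier A\<rbrakk> \<Longrightarrow>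
      tri_lift A (\<lambda>x y z. (act z a \<otimes>\<^bsub>A\<^esub> act x b) \<otimes>\<^bsub>A\<^esub> act y c) s =
      tri_lift A (\<lambda>x y z. (act z a \<otimes>\<^bsub>A\<^esub> act x b) \<otimes>\<^bsub>A\<^esub> act y c) t"
  shows "s = t"
proof -
  let ?F = "\<lambda>(a, b, c). tri_lift A (\<lambda>x y z. (act z a \<otimes>\<^bsub>A\<^esub> act x b) \<otimes>\<^bsub>A\<^esub> act y c)"
  note l = H3.tri_lift_lin[OF V.vectorspace_axioms eval3_tri(2)]
  show ?thesis
  proof (rule lin_map_family_injI[where I = "carrier A \<times> carrier A \<times> carrier A" and F = ?F,
        OF H3.UV_W.tensor_vectorspace V.vectorspace_axioms _ _ s t])
    fix i assume i_in: "i \<in> carrier A \<times> carrier A \<times> carrier A"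
    obtain a b c where abc: "i = (a, b, c)" by (rule prod_cases3)
    have i: "i = (a, b, c)" "a \<in> carrier A" "b \<in> carrier A" "c \<in> carrier A"
      using i_in unfolding abc by simp_all
    show "lin_map K HHH A (?F i)" unfolding i(1) prod.case by (rule l[OF i(2-4)])
    show "?F i s = ?F i t" unfolding i(1) prod.case by (rule eq[OF i(2-4)])
  next
    fix u assume u: "u \<in> carrier HHH"
      and zeros: "\<And>i. i \<in> carrier A \<times> carrier A \<times> carrier A \<Longrightarrow> ?F i u = \<zero>\<^bsub>A\<^esub>"
    have "rotate u = \<zero>\<^bsub>HHH\<^esub>"
    proof (rule eval3_zero[OF lin_map_closed[OF rotate_lin u]])
      fix a b c assume abc: "a \<in> carrier A" "b \<in> carrier A" "c \<in> carrier A"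
      show "tri_lift A (\<lambda>x y z. (act x a \<otimes>\<^bsub>A\<^esub> act y b) \<otimes>\<^bsub>A\<^esub> act z c) (rotate u) = \<zero>\<^bsub>A\<^esub>"
        unfolding tri_lift_rotate[OF eval3_tri(1,2)[OF abc] u]
        by (rule zeros[of "(a, b, c)", unfolded prod.case]) (simp add: abc)
    qed
    moreover have "rotate \<zero>\<^bsub>HHH\<^esub> = \<zero>\<^bsub>HHH\<^esub>"
      by (rule lin_map_zero[OF H3.UV_W.tensor_vectorspace H3.UV_W.tensor_vectorspace rotate_lin])
    ultimately have "rotate (rotate (rotate u)) = \<zero>\<^bsub>HHH\<^esub>" by (simp only:)
    then show "u = \<zero>\<^bsub>HHH\<^esub>" by (simp only: rotate_cube[OF u])
  qed
qed

lemma rotated_eval3_eqI':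
  assumes s: "s \<in> carrier HHH" and t: "t \<in> carrier HHH"
    and eq: "\<And>a b c. \<lbrakk>a \<in> carrier A; b \<in> carrier A; c \<in> carrier A\<rbrakk> \<Longrightarrow>
      tri_lift A (\<lambda>x y z. (act y a \<otimes>\<^bsub>A\<^esub> act z b) \<otimes>\<^bsub>A\<^esub> act x c) s =
      tri_lift A (\<lambda>x y z. (act y a \<otimes>\<^bsub>A\<^esub> act z b) \<otimes>\<^bsub>A\<^esub> act x c) t"
  shows "s = t"
proof -
  note rc = lin_map_closed[OF rotate_lin]
  have "rotate s = rotate t"
  proof (rule rotated_eval3_eqI[OF rc[OF s] rc[OF t]])
    fix a b c assume abc: "a \<in> carrier A" "b \<in> carrier A" "c \<in> carrier A"
    note r = tri_lift_rotate[OF eval3_tri(2,3)[OF abc]]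
    show "tri_lift A (\<lambda>x y z. (act z a \<otimes>\<^bsub>A\<^esub> act x b) \<otimes>\<^bsub>A\<^esub> act y c) (rotate s) =
        tri_lift A (\<lambda>x y z. (act z a \<otimes>\<^bsub>A\<^esub> act x b) \<otimes>\<^bsub>A\<^esub> act y c) (rotate t)"
      unfolding r[OF s] r[OF t] by (rule eq[OF abc])
  qed
  then have "rotate (rotate (rotate s)) = rotate (rotate (rotate t))" by (simp only:)
  then show ?thesis by (simp only: rotate_cube s t)
qed

subsection \<open>Rank one operators and projections onto equivariant maps\<close>

definition rank_one :: "('a \<Rightarrow> 'k) \<Rightarrow> ('a, 'h) tensor" where
  "rank_one c = (SOME t. t \<in> carrier AH.T \<and> (\<forall>b\<in>carrier A. galois_map t b = c b \<odot>\<^bsub>A\<^esub> \<one>\<^bsub>A\<^esub>))"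

lemma rank_one:
  assumes c: "functional K A c"
  shows "rank_one c \<in> carrier AH.T"
    and "b \<in> carrier A \<Longrightarrow> galois_map (rank_one c) b = c b \<odot>\<^bsub>A\<^esub> \<one>\<^bsub>A\<^esub>"
proof -
  have "lin_map K A A (\<lambda>b. c b \<odot>\<^bsub>A\<^esub> \<one>\<^bsub>A\<^esub>)"
    by (rule functional_smult_lin[OF V.vectorspace_axioms A.one_closed c])
  then have "\<exists>t. t \<in> carrier AH.T \<and> (\<forall>b\<in>carrier A. galois_map t b = c b \<odot>\<^bsub>A\<^esub> \<one>\<^bsub>A\<^esub>)"
    by (elim galois_onto) blast
  from someI_ex[OF this] show "rank_one c \<in> carrier AH.T"
    "b \<in> carrier A \<Longrightarrow> galois_map (rank_one c) b = c b \<odot>\<^bsub>A\<^esub> \<one>\<^bsub>A\<^esub>"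
    by (simp_all add: rank_one_def)
qed

text \<open>Linear, because preimages under the Galois map are unique.\<close>
lemma rank_one_lin: "lin_map K (dual_space K A) AH.T rank_one"
proof -
  interpret T: vectorspace K AH.T by (rule AH.tensor_vectorspace)
  note f = A1.dual_functional
  note D = AD.W.vectorspace_axioms
  have fa: "functional K A (c \<oplus>\<^bsub>dual_space K A\<^esub> d)"
    if "c \<in> carrier (dual_space K A)" "d \<in> carrier (dual_space K A)" for c d
    using that by (intro f AD.W.M.a_closed)
  have fs: "functional K A (k \<odot>\<^bsub>dual_space K A\<^esub> c)"
    if "c \<in> carrier (dual_space K A)" "k \<in> carrier K" for c k
    using that by (intro f AD.W.smult_closed)
  note ev = module_hom_add[OF A1.dual_eval] module_hom_smult[OF A1.dual_eval]
  show ?thesis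
    by (intro lin_mapI galois_eqI)
      (simp_all add: rank_one f fa fs ev base_algebra_ops functional_closed[OF f]
        module_hom_add[OF galois_map_lin(1)] module_hom_smult[OF galois_map_lin(1)]
        V.smult_l_distr V.smult_assoc1)
qed

text \<open>
  The Galois map sends both sides to \<open>b \<mapsto> h (c(b) 1) = \<epsilon>(h) c(b) 1\<close>.
\<close>
lemma diag_act_rank_one:
  assumes h: "h \<in> carrier H" and c: "functional K A c"
  shows "diag_act h (rank_one c) = \<epsilon> h \<odot>\<^bsub>AH.T\<^esub> rank_one c"
proof -
  interpret T: vectorspace K AH.T by (rule AH.tensor_vectorspace)
  show ?thesis
    by (rule galois_eqI)
      (simp_all add: rank_one[OF c] lin_map_closed[OF diag_act_lin(1)[OF h]] galois_map_diag_act h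
        counit_closed module_hom_smult[OF galois_map_lin(1)] module_hom_smult[OF act_linear]
        functional_closed[OF c] act_unit V.smult_assoc1[symmetric] R.m_comm)
qed

text \<open>
  Since the rank one element is invariant under the diagonal action, the first component of \<open>h\<close> in
  \<open>conj_map_equivariant\<close> is absorbed by the counit.
\<close>
lemma conj_map_rank_one_equivariant:
  assumes f: "lin_map K A A f" and c: "functional K A c" and h: "h \<in> carrier H" and b: "b \<in> carrier A"
  shows "conj_map f (rank_one c) (act h b) = act h (conj_map f (rank_one c) b)"
proof -
  have "act h (conj_map f (rank_one c) b) =
      tensor_lift A (\<lambda>x y. conj_map f (diag_act x (rank_one c)) (act y b)) (\<Delta> h)"
    by (simp add: conj_map_equivariant f h b rank_one[OF c])
  also have "\<dots> = tensor_lift A (\<lambda>x y. \<epsilon> x \<odot>\<^bsub>A\<^esub> conj_map f (rank_one c) (act y b)) (\<Delta> h)"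
    by (rule HH.lift_cong[OF comult_closed[OF h]])
      (simp add: diag_act_rank_one c counit_closed act_closed b rank_one[OF c]
        module_hom_smult[OF conj_map_lin(1)[OF f]])
  also have "\<dots> = conj_map f (rank_one c) (act h b)"
    by (rule counit_left_lift[OF V.vectorspace_axioms _ h])
      (rule lin_map_comp[OF act_lin_op[OF b lin_map_id] conj_map_lin(2)[OF f rank_one(1)[OF c]]])
  finally show ?thesis by simp
qed

lemma conj_map_left_mult:
  assumes f: "lin_map K A A f" and e: "e \<in> carrier A" and t: "t \<in> carrier AH.T" and b: "b \<in> carrier A"
  shows "conj_map f (tensor_lift AH.T (\<lambda>a g. AH.pure (e \<otimes>\<^bsub>A\<^esub> a) g) t) b = e \<otimes>\<^bsub>A\<^esub> conj_map f t b"
    and "galois_map (tensor_lift AH.T (\<lambda>a g. AH.pure (e \<otimes>\<^bsub>A\<^esub> a) g) t) b = e \<otimes>\<^bsub>A\<^esub> galois_map t b"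
proof -
  note vA = V.vectorspace_axioms and vT = AH.tensor_vectorspace
  have bil: "bilin_map K A H AH.T (\<lambda>a g. AH.pure (e \<otimes>\<^bsub>A\<^esub> a) g)" by (intro multilin e; assumption)
  note ll = AH.lift_lin[OF vT bil]
  show "conj_map f (tensor_lift AH.T (\<lambda>a g. AH.pure (e \<otimes>\<^bsub>A\<^esub> a) g) t) b = e \<otimes>\<^bsub>A\<^esub> conj_map f t b"
  proof (rule AH.tensor_ext[OF vA lin_map_comp[OF ll conj_map_lin(1)[OF f b]]
        A_mult_lin(1)[OF e conj_map_lin(1)[OF f b]] t])
    fix a g assume a: "a \<in> carrier A" and g: "g \<in> carrier H"
    have "conj_map f (AH.pure (e \<otimes>\<^bsub>A\<^esub> a) g) b =
        tensor_lift A (\<lambda>p q. e \<otimes>\<^bsub>A\<^esub> (a \<otimes>\<^bsub>A\<^esub> act p (f (act (S q) b)))) (\<Delta> g)"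
      unfolding conj_map_pure[OF f b A.m_closed[OF e a] g]
      by (rule HH.lift_cong[OF comult_closed[OF g]])
        (simp add: A.m_assoc e a act_closed lin_map_closed[OF f] S_closed b)
    also have "\<dots> = e \<otimes>\<^bsub>A\<^esub> conj_map f (AH.pure a g) b"
      unfolding conj_map_pure[OF f b a g]
      by (rule HH.lin_map_lift[OF vA vA, where f = "\<lambda>u. e \<otimes>\<^bsub>A\<^esub> u", symmetric])
        (intro multilin lin_map_comp[OF _ f] lin_map_closed[OF f] e a b g; assumption | rule comult_closed[OF g])+
    finally show "conj_map f (tensor_lift AH.T (\<lambda>a g. AH.pure (e \<otimes>\<^bsub>A\<^esub> a) g) (AH.pure a g)) b =
        e \<otimes>\<^bsub>A\<^esub> conj_map f (AH.pure a g) b"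
      by (simp add: bil vT a g)
  qed
  show "galois_map (tensor_lift AH.T (\<lambda>a g. AH.pure (e \<otimes>\<^bsub>A\<^esub> a) g) t) b = e \<otimes>\<^bsub>A\<^esub> galois_map t b"
    by (rule AH.tensor_ext[OF vA lin_map_comp[OF ll galois_map_lin(1)[OF b]]
          A_mult_lin(1)[OF e galois_map_lin(1)[OF b]] t])
      (simp add: bil vT galois_map_pure e b A.m_assoc act_closed)
qed

text \<open>
  Writing the identity as a sum of rank one operators \<open>e\<^sub>i c\<^sub>i\<close> expresses any operator through
  equivariant ones with coefficients in \<open>A\<close> on the left.
\<close>

lemma conj_map_decomposition:
  assumes f: "lin_map K A A f" and b: "b \<in> carrier A"
  shows "tensor_lift A (\<lambda>e c. e \<otimes>\<^bsub>A\<^esub> conj_map f (rank_one c) b) dA = f b"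
proof -
  note vA = V.vectorspace_axioms and vT = AH.tensor_vectorspace
  note ro = lin_map_closed[OF rank_one_lin]
  have bil: "bilin_map K A (dual_space K A) AH.T
      (\<lambda>e c. tensor_lift AH.T (\<lambda>a g. AH.pure (e \<otimes>\<^bsub>A\<^esub> a) g) (rank_one c))"
  proof (rule bilin_mapI)
    show "lin_map K (dual_space K A) AH.T (\<lambda>c. tensor_lift AH.T (\<lambda>a g. AH.pure (e \<otimes>\<^bsub>A\<^esub> a) g) (rank_one c))"
      if "e \<in> carrier A" for e
      by (rule lin_map_comp[OF rank_one_lin AH.lift_lin[OF vT]]) (intro multilin that; assumption)
    show "lin_map K A AH.T (\<lambda>e. tensor_lift AH.T (\<lambda>a g. AH.pure (e \<otimes>\<^bsub>A\<^esub> a) g) (rank_one c))"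
      if "c \<in> carrier (dual_space K A)" for c
      by (intro multilin ro that; assumption)
  qed
  let ?I = "tensor_lift AH.T (\<lambda>e c. tensor_lift AH.T (\<lambda>a g. AH.pure (e \<otimes>\<^bsub>A\<^esub> a) g) (rank_one c)) dA"
  have I: "?I = AH.pure \<one>\<^bsub>A\<^esub> \<one>\<^bsub>H\<^esub>"
  proof (rule galois_eqI[OF AD.lift_closed[OF vT bil dA]])
    fix b assume b: "b \<in> carrier A"
    have "galois_map ?I b = tensor_lift A (\<lambda>e c. c b \<odot>\<^bsub>A\<^esub> e) dA"
      unfolding AD.lin_map_lift[OF vT vA galois_map_lin(1)[OF b] bil dA]
      by (rule AD.lift_cong[OF dA])
        (simp add: conj_map_left_mult(2)[OF lin_map_id] rank_one A1.dual_functional b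
          A.smult_mult_right functional_closed[OF A1.dual_functional])
    then show "galois_map ?I b = galois_map (AH.pure \<one>\<^bsub>A\<^esub> \<one>\<^bsub>H\<^esub>) b"
      using coev_A b by (simp add: coevaluation_def galois_map_pure act_one)
  qed simp
  have "f b = conj_map f ?I b" by (simp add: I conj_map_one f b)
  also have "\<dots> = tensor_lift A (\<lambda>e c. e \<otimes>\<^bsub>A\<^esub> conj_map f (rank_one c) b) dA"
    unfolding AD.lin_map_lift[OF vT vA conj_map_lin(1)[OF f b] bil dA]
    by (rule AD.lift_cong[OF dA]) (simp add: conj_map_left_mult(1) f ro b)
  finally show ?thesis by simp
qed

end

section \<open>Commuting Galois actions\<close>

text \<open>
  The two actions enter symmetrically, so every consequence may also be read with \<open>H\<close> and \<open>E\<close>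
  exchanged.
\<close>
locale commuting_actions = H: hopf_action K H \<Delta> \<epsilon> S A act + E: hopf_action K E \<Delta>\<^sub>E \<epsilon>\<^sub>E S\<^sub>E A actE
  for K :: "'k ring" and H :: "('k, 'h) module" and \<Delta> \<epsilon> S and A :: "('k, 'a) module" and act
    and E :: "('k, 'e) module" and \<Delta>\<^sub>E \<epsilon>\<^sub>E S\<^sub>E and actE +
  assumes commute: "\<lbrakk>h \<in> carrier H; \<phi> \<in> carrier E; a \<in> carrier A\<rbrakk> \<Longrightarrow>
    act h (actE \<phi> a) = actE \<phi> (act h a)"
begin

lemmas vs_A = H.V.vectorspace_axioms and vs_H = H.vectorspace_axioms and vs_E = E.vectorspace_axioms

lemmas multilin = H.multilin E.multilin

text \<open>
  For \<open>t = a \<otimes> \<phi>\<close> the left-hand side is \<open>\<Sum> h' (a (\<phi> (S(h'') b))) = \<Sum> (h' a) (\<phi> (h'' S(h''') b))\<close>, as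
  \<open>\<phi>\<close> commutes with \<open>H\<close>.  So the action of \<open>h\<close> on the first factors of \<open>t\<close> is visible in the operator
  given by \<open>t\<close>.
\<close>
lemma act_coefficients:
  assumes h: "h \<in> carrier H" and t: "t \<in> carrier E.AH.T" and b: "b \<in> carrier A"
  shows "tensor_lift A (\<lambda>x y. act x (E.galois_map t (act (S y) b))) (\<Delta> h) =
    tensor_lift A (\<lambda>a \<phi>. act h a \<otimes>\<^bsub>A\<^esub> actE \<phi> b) t"
proof (rule E.AH.tensor_ext[OF vs_A _ _ t])
  note dh = H.comult_closed[OF h]
  note gl = E.galois_map_lin
  have bil: "bilin_map K H H A (\<lambda>x y. act x (E.galois_map t (act (S y) b)))" if "t \<in> carrier E.AH.T" for t
    by (intro multilin lin_map_comp[OF _ gl(2)] lin_map_closed[OF gl(2)] b that; assumption)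
  show "lin_map K E.AH.T A (\<lambda>t. tensor_lift A (\<lambda>x y. act x (E.galois_map t (act (S y) b))) (\<Delta> h))"
    by (rule H.HH.lift_param[OF vs_A dh bil _ E.AH.tensor_vectorspace])
      (assumption, (intro H.act_lin_arg gl(1) H.act_closed H.S_closed b; assumption))
  show "lin_map K E.AH.T A (tensor_lift A (\<lambda>a \<phi>. act h a \<otimes>\<^bsub>A\<^esub> actE \<phi> b))"
    by (rule E.AH.lift_lin[OF vs_A]) (intro multilin h b; assumption)
  fix a \<phi> assume a: "a \<in> carrier A" and \<phi>: "\<phi> \<in> carrier E"
  define F where "F u v y = act u a \<otimes>\<^bsub>A\<^esub> actE \<phi> (act (v \<otimes>\<^bsub>H\<^esub> S y) b)" for u v y
  have F_tri: "trilin_map K H H H A F"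
    unfolding F_def by (intro multilin a b \<phi>; assumption)
  have F_sum: "tensor_lift A (\<lambda>v y. F u v y) (\<Delta> w) = \<epsilon> w \<odot>\<^bsub>A\<^esub> (act u a \<otimes>\<^bsub>A\<^esub> actE \<phi> b)"
    if u: "u \<in> carrier H" and w: "w \<in> carrier H" for u w
  proof -
    let ?L = "\<lambda>x. act u a \<otimes>\<^bsub>A\<^esub> actE \<phi> (act x b)"
    have L: "lin_map K H A ?L" by (intro multilin a b \<phi> u)
    have "tensor_lift A (\<lambda>v y. F u v y) (\<Delta> w) = ?L (tensor_lift H (\<lambda>v y. v \<otimes>\<^bsub>H\<^esub> S y) (\<Delta> w))"
      unfolding F_def
      by (rule H.HH.lin_map_lift[OF vs_H vs_A L _ H.comult_closed[OF w], symmetric])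
        (intro multilin; assumption)
    also have "\<dots> = \<epsilon> w \<odot>\<^bsub>A\<^esub> ?L \<one>\<^bsub>H\<^esub>"
      unfolding H.antipode_right[OF w]
      by (rule module_hom_smult[OF L H.counit_closed[OF w] H.one_closed])
    finally show ?thesis by (simp add: H.act_one b)
  qed
  have "tensor_lift A (\<lambda>x y. act x (E.galois_map (E.AH.pure a \<phi>) (act (S y) b))) (\<Delta> h) =
    tensor_lift A (\<lambda>x y. tensor_lift A (\<lambda>u v. F u v y) (\<Delta> x)) (\<Delta> h)"
  proof (rule H.HH.lift_cong[OF dh])
    fix x y assume x: "x \<in> carrier H" and y: "y \<in> carrier H"
    have c: "actE \<phi> (act (S y) b) \<in> carrier A" by (intro E.act_closed \<phi> H.act_closed H.S_closed y b)
    have "act x (E.galois_map (E.AH.pure a \<phi>) (act (S y) b)) =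
        tensor_lift A (\<lambda>u v. act u a \<otimes>\<^bsub>A\<^esub> act v (actE \<phi> (act (S y) b))) (\<Delta> x)"
      by (simp add: E.galois_map_pure a \<phi> H.act_closed H.S_closed y b H.act_product_lift x c)
    also have "\<dots> = tensor_lift A (\<lambda>u v. F u v y) (\<Delta> x)"
      unfolding F_def
      by (rule H.HH.lift_cong[OF H.comult_closed[OF x]])
        (simp add: commute \<phi> H.act_closed H.S_closed y b H.act_mult)
    finally show "act x (E.galois_map (E.AH.pure a \<phi>) (act (S y) b)) =
      tensor_lift A (\<lambda>u v. F u v y) (\<Delta> x)" .
  qed
  also have "\<dots> = tensor_lift A (\<lambda>u w. tensor_lift A (\<lambda>v y. F u v y) (\<Delta> w)) (\<Delta> h)"
    by (rule H.coassoc_lift[OF vs_A F_tri h])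
  also have "\<dots> = tensor_lift A (\<lambda>u w. \<epsilon> w \<odot>\<^bsub>A\<^esub> (act u a \<otimes>\<^bsub>A\<^esub> actE \<phi> b)) (\<Delta> h)"
    by (rule H.HH.lift_cong[OF dh]) (rule F_sum)
  also have "\<dots> = act h a \<otimes>\<^bsub>A\<^esub> actE \<phi> b"
    by (rule H.counit_right_lift[OF vs_A _ h]) (intro multilin a b \<phi>)
  finally show "tensor_lift A (\<lambda>x y. act x (E.galois_map (E.AH.pure a \<phi>) (act (S y) b))) (\<Delta> h) =
      tensor_lift A (\<lambda>a \<phi>. act h a \<otimes>\<^bsub>A\<^esub> actE \<phi> b) (E.AH.pure a \<phi>)"
    by (subst E.AH.lift_pure[OF vs_A _ a \<phi>]) (intro multilin h b; assumption)+
qed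

text \<open>
  Since \<open>H\<close> commutes with \<open>E\<close>, conjugating the operator \<open>\<Sum> x \<phi>\<close> affects its coefficients \<open>x\<close> only.
\<close>
lemma conj_map_galois_map:
  assumes Q: "Q \<in> carrier H.AH.T" and t: "t \<in> carrier E.AH.T" and b: "b \<in> carrier A"
  shows "H.conj_map (E.galois_map t) Q b =
    tensor_lift A (\<lambda>x \<phi>. H.galois_map Q x \<otimes>\<^bsub>A\<^esub> actE \<phi> b) t"
proof (rule H.AH.tensor_ext[OF vs_A _ _ Q])
  note gl = E.galois_map_lin and hl = H.galois_map_lin
  show "lin_map K H.AH.T A (\<lambda>Q. H.conj_map (E.galois_map t) Q b)"
    by (rule H.conj_map_lin(1)[OF gl(2)[OF t] b])
  show "lin_map K H.AH.T A (\<lambda>Q. tensor_lift A (\<lambda>x \<phi>. H.galois_map Q x \<otimes>\<^bsub>A\<^esub> actE \<phi> b) t)"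
    by (rule E.AH.lift_param[OF vs_A t _ _ H.AH.tensor_vectorspace])
      (intro multilin hl lin_map_closed[OF hl(2)] b; assumption)+
  fix a g assume a: "a \<in> carrier A" and g: "g \<in> carrier H"
  note dg = H.comult_closed[OF g]
  have "H.conj_map (E.galois_map t) (H.AH.pure a g) b =
      tensor_lift A (\<lambda>p q. a \<otimes>\<^bsub>A\<^esub> act p (E.galois_map t (act (S q) b))) (\<Delta> g)"
    by (rule H.conj_map_pure[OF gl(2)[OF t] b a g])
  also have "\<dots> = a \<otimes>\<^bsub>A\<^esub> tensor_lift A (\<lambda>p q. act p (E.galois_map t (act (S q) b))) (\<Delta> g)"
    by (rule H.HH.lin_map_lift[OF vs_A vs_A H.A_mult_lin(1)[OF a lin_map_id] _ dg, symmetric])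
      (intro multilin lin_map_comp[OF _ gl(2)[OF t]] lin_map_closed[OF gl(2)[OF t]] b; assumption)
  also have "\<dots> = a \<otimes>\<^bsub>A\<^esub> tensor_lift A (\<lambda>x \<phi>. act g x \<otimes>\<^bsub>A\<^esub> actE \<phi> b) t"
    by (simp only: act_coefficients[OF g t b])
  also have "\<dots> = tensor_lift A (\<lambda>x \<phi>. a \<otimes>\<^bsub>A\<^esub> (act g x \<otimes>\<^bsub>A\<^esub> actE \<phi> b)) t"
    by (rule E.AH.lin_map_lift[OF vs_A vs_A H.A_mult_lin(1)[OF a lin_map_id] _ t])
      (intro multilin b g; assumption)
  also have "\<dots> = tensor_lift A (\<lambda>x \<phi>. H.galois_map (H.AH.pure a g) x \<otimes>\<^bsub>A\<^esub> actE \<phi> b) t"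
    by (rule E.AH.lift_cong[OF t]) (simp add: H.galois_map_pure a g H.A.m_assoc H.act_closed E.act_closed b)
  finally show "H.conj_map (E.galois_map t) (H.AH.pure a g) b =
    tensor_lift A (\<lambda>x \<phi>. H.galois_map (H.AH.pure a g) x \<otimes>\<^bsub>A\<^esub> actE \<phi> b) t" .
qed

end

text \<open>
  Here \<open>E\<close> is the full commutant of \<open>H\<close>.  It is given as an algebra that acts faithfully, rather than
  as a set of operators, so that the roles of \<open>H\<close> and \<open>E\<close> can be exchanged.
\<close>
locale galois_pair = commuting_actions K H \<Delta> \<epsilon> S A act E \<Delta>\<^sub>E \<epsilon>\<^sub>E S\<^sub>E actE +
  G: galois_action K H \<Delta> \<epsilon> S A act dH dA
  for K :: "'k ring" and H :: "('k, 'h) module" and \<Delta> \<epsilon> S and A :: "('k, 'a) module" and act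
    and E :: "('k, 'e) module" and \<Delta>\<^sub>E \<epsilon>\<^sub>E S\<^sub>E and actE and dH dA +
  assumes E_faithful: "\<lbrakk>\<phi> \<in> carrier E; \<And>a. a \<in> carrier A \<Longrightarrow> actE \<phi> a = \<zero>\<^bsub>A\<^esub>\<rbrakk> \<Longrightarrow> \<phi> = \<zero>\<^bsub>E\<^esub>"
    and E_full: "\<lbrakk>lin_map K A A f;
      \<And>h a. h \<in> carrier H \<Longrightarrow> a \<in> carrier A \<Longrightarrow> f (act h a) = act h (f a)\<rbrakk>
      \<Longrightarrow> \<exists>\<phi>\<in>carrier E. \<forall>a\<in>carrier A. actE \<phi> a = f a"
begin

lemma E_eqI:
  assumes "\<phi> \<in> carrier E" "\<psi> \<in> carrier E" "\<And>a. a \<in> carrier A \<Longrightarrow> actE \<phi> a = actE \<psi> a"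
  shows "\<phi> = \<psi>"
  by (rule lin_map_family_injI[where I = "carrier A" and F = "\<lambda>a \<phi>. actE \<phi> a",
        OF vs_E vs_A _ E_faithful assms(1,2)])
    (simp_all add: assms(3) E.act_lin_op lin_map_id)

text \<open>
  The elements of \<open>E\<close> that represent the operators depend linearly on the parameter, because \<open>E\<close> acts
  faithfully.
\<close>
lemma lift_to_E:
  assumes Z: "vectorspace K Z" and lin: "\<And>z. z \<in> carrier Z \<Longrightarrow> lin_map K A A (G z)"
    and eqv: "\<And>z h a. \<lbrakk>z \<in> carrier Z; h \<in> carrier H; a \<in> carrier A\<rbrakk> \<Longrightarrow> G z (act h a) = act h (G z a)"
    and linz: "\<And>a. a \<in> carrier A \<Longrightarrow> lin_map K Z A (\<lambda>z. G z a)"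
  shows "\<exists>\<psi>. lin_map K Z E \<psi> \<and> (\<forall>z\<in>carrier Z. \<forall>a\<in>carrier A. actE (\<psi> z) a = G z a)"
proof -
  interpret Z: vectorspace K Z by fact
  have "\<exists>\<phi>. \<phi> \<in> carrier E \<and> (\<forall>a\<in>carrier A. actE \<phi> a = G z a)" if "z \<in> carrier Z" for z
    using E_full[OF lin[OF that] eqv[OF that]] by blast
  then obtain \<psi> where \<psi>: "\<And>z. z \<in> carrier Z \<Longrightarrow> \<psi> z \<in> carrier E \<and> (\<forall>a\<in>carrier A. actE (\<psi> z) a = G z a)"
    by metis
  have "lin_map K Z E \<psi>"
    by (intro lin_mapI E_eqI)
      (simp_all add: \<psi> E.act_add E.act_smult module_hom_add[OF linz] module_hom_smult[OF linz])
  then show ?thesis using \<psi> by (intro exI[of _ \<psi>]) simp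
qed

lemma conj_to_E:
  assumes f: "lin_map K A A f"
  shows "\<exists>\<psi>. lin_map K (dual_space K A) E \<psi> \<and> (\<forall>c\<in>carrier (dual_space K A). \<forall>a\<in>carrier A.
    actE (\<psi> c) a = H.conj_map f (G.rank_one c) a)"
proof (rule lift_to_E)
  note ro = lin_map_closed[OF G.rank_one_lin] and df = H.A1.dual_functional
  show "vectorspace K (dual_space K A)" by (rule G.AD.W.vectorspace_axioms)
  show "lin_map K A A (H.conj_map f (G.rank_one c))" if "c \<in> carrier (dual_space K A)" for c
    by (rule H.conj_map_lin(2)[OF f ro[OF that]])
  show "H.conj_map f (G.rank_one c) (act h a) = act h (H.conj_map f (G.rank_one c) a)"
    if "c \<in> carrier (dual_space K A)" "h \<in> carrier H" "a \<in> carrier A" for c h a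
    by (rule G.conj_map_rank_one_equivariant[OF f df[OF that(1)] that(2,3)])
  show "lin_map K (dual_space K A) A (\<lambda>c. H.conj_map f (G.rank_one c) a)" if "a \<in> carrier A" for a
    by (rule lin_map_comp[OF G.rank_one_lin H.conj_map_lin(1)[OF f that]])
qed

subsection \<open>The second action is Galois\<close>

text \<open>
  If \<open>\<Sum> x \<phi>\<close> is the zero operator for \<open>t = \<Sum> x \<otimes> \<phi>\<close>, then so is its conjugate \<open>\<Sum> c(x) \<phi>\<close> by the rank
  one element of a functional \<open>c\<close>.  Hence all slices of \<open>t\<close> vanish.
\<close>
lemma E_galois_zero:
  assumes t: "t \<in> carrier E.AH.T" and zero: "\<And>b. b \<in> carrier A \<Longrightarrow> E.galois_map t b = \<zero>\<^bsub>A\<^esub>"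
  shows "t = \<zero>\<^bsub>E.AH.T\<^esub>"
proof -
  interpret EA: two_spaces K E A by unfold_locales
  have s: "tensor_swap K A E t \<in> carrier EA.T" by (rule lin_map_closed[OF E.AH.swap_lin t])
  have "tensor_swap K A E t = \<zero>\<^bsub>EA.T\<^esub>"
  proof (rule EA.tensor_zero_if_slices_zero[OF G.coev_A s])
    fix c assume c: "functional K A c"
    note ro = G.rank_one[OF c] and fc = functional_closed[OF c]
    have bilE: "bilin_map K A E E (\<lambda>x \<phi>. c x \<odot>\<^bsub>E\<^esub> \<phi>)"
      by (intro bilin_mapI functional_smult_lin lin_map_smult_const vs_E lin_map_id c fc; assumption)
    have sl: "EA.slice c (tensor_swap K A E t) = tensor_lift E (\<lambda>x \<phi>. c x \<odot>\<^bsub>E\<^esub> \<phi>) t"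
      unfolding EA.slice_def by (rule E.AH.lift_tensor_swap[OF vs_E EA.slice_bilin[OF c] t])
    show "EA.slice c (tensor_swap K A E t) = \<zero>\<^bsub>E\<^esub>"
      unfolding sl
    proof (rule E_faithful[OF E.AH.lift_closed[OF vs_E bilE t]])
      fix b assume b: "b \<in> carrier A"
      have "actE (tensor_lift E (\<lambda>x \<phi>. c x \<odot>\<^bsub>E\<^esub> \<phi>) t) b =
          tensor_lift A (\<lambda>x \<phi>. actE (c x \<odot>\<^bsub>E\<^esub> \<phi>) b) t"
        by (rule E.AH.lin_map_lift[OF vs_E vs_A E.act_lin_op[OF b lin_map_id] bilE t])
      also have "\<dots> = tensor_lift A (\<lambda>x \<phi>. H.galois_map (G.rank_one c) x \<otimes>\<^bsub>A\<^esub> actE \<phi> b) t"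
        by (rule E.AH.lift_cong[OF t])
          (simp add: ro E.act_smult fc b H.A.smult_mult_left E.act_closed)
      also have "\<dots> = H.conj_map (E.galois_map t) (G.rank_one c) b"
        by (rule conj_map_galois_map[OF ro(1) t b, symmetric])
      also have "\<dots> = tensor_lift A (\<lambda>a g. \<zero>\<^bsub>A\<^esub>) (G.rank_one c)"
        unfolding H.conj_map_def
      proof (rule H.AH.lift_cong[OF ro(1)])
        fix a g assume a: "a \<in> carrier A" and g: "g \<in> carrier H"
        have "tensor_lift A (\<lambda>p q. a \<otimes>\<^bsub>A\<^esub> act p (E.galois_map t (act (S q) b))) (\<Delta> g) =
          tensor_lift A (\<lambda>p q. \<zero>\<^bsub>A\<^esub>) (\<Delta> g)"
          by (rule H.HH.lift_cong[OF H.comult_closed[OF g]])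
            (simp add: zero H.act_closed H.S_closed b a lin_map_zero[OF vs_A vs_A H.act_linear])
        then show "tensor_lift A (\<lambda>p q. a \<otimes>\<^bsub>A\<^esub> act p (E.galois_map t (act (S q) b))) (\<Delta> g) = \<zero>\<^bsub>A\<^esub>"
          by (simp add: H.HH.lift_zero[OF vs_A H.comult_closed[OF g]])
      qed
      also have "\<dots> = \<zero>\<^bsub>A\<^esub>" by (rule H.AH.lift_zero[OF vs_A ro(1)])
      finally show "actE (tensor_lift E (\<lambda>x \<phi>. c x \<odot>\<^bsub>E\<^esub> \<phi>) t) b = \<zero>\<^bsub>A\<^esub>" .
    qed
  qed
  then have "tensor_swap K E A (tensor_swap K A E t) = \<zero>\<^bsub>E.AH.T\<^esub>"
    using lin_map_zero[OF EA.tensor_vectorspace E.AH.tensor_vectorspace EA.swap_lin] by (simp only:)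
  then show ?thesis by (simp only: E.AH.swap_swap[OF t])
qed

text \<open>
  By \<open>conj_map_decomposition\<close>, \<open>f = \<Sum> e\<^sub>i f\<^sub>i\<close> with the equivariant operators \<open>f\<^sub>i\<close> obtained by conjugating
  \<open>f\<close> with the rank one elements of the \<open>c\<^sub>i\<close>.
\<close>
lemma E_galois_onto:
  assumes f: "lin_map K A A f"
  shows "\<exists>t\<in>carrier E.AH.T. \<forall>b\<in>carrier A. E.galois_map t b = f b"
proof -
  obtain \<psi> where \<psi>: "lin_map K (dual_space K A) E \<psi>"
    "\<And>c a. c \<in> carrier (dual_space K A) \<Longrightarrow> a \<in> carrier A \<Longrightarrow> actE (\<psi> c) a = H.conj_map f (G.rank_one c) a"
    using conj_to_E[OF f] by blast
  note dA = G.dA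
  have bil: "bilin_map K A (dual_space K A) E.AH.T (\<lambda>e c. E.AH.pure e (\<psi> c))"
    by (rule bilin_mapI, rule E.AH_pure_lin(1)[OF _ \<psi>(1)], assumption,
        rule E.AH_pure_lin(2)[OF lin_map_closed[OF \<psi>(1)] lin_map_id], assumption)
  let ?t = "tensor_lift E.AH.T (\<lambda>e c. E.AH.pure e (\<psi> c)) dA"
  have "E.galois_map ?t b = f b" if b: "b \<in> carrier A" for b
  proof -
    have "E.galois_map ?t b = tensor_lift A (\<lambda>e c. e \<otimes>\<^bsub>A\<^esub> H.conj_map f (G.rank_one c) b) dA"
      unfolding G.AD.lin_map_lift[OF E.AH.tensor_vectorspace vs_A E.galois_map_lin(1)[OF b] bil dA]
      by (rule G.AD.lift_cong[OF dA]) (simp add: E.galois_map_pure b lin_map_closed[OF \<psi>(1)] \<psi>(2))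
    then show ?thesis by (simp add: G.conj_map_decomposition[OF f b])
  qed
  moreover have "?t \<in> carrier E.AH.T" by (rule G.AD.lift_closed[OF E.AH.tensor_vectorspace bil dA])
  ultimately show ?thesis by blast
qed

lemma E_galois: "dual_galois K E A actE"
  unfolding E.dual_galois_iff using E_galois_zero E_galois_onto by blast

end

context hopf_action
begin

lemma conj_map_cong:
  assumes "t \<in> carrier AH.T" "b \<in> carrier A" "\<And>a. a \<in> carrier A \<Longrightarrow> f a = g a"
  shows "conj_map f t b = conj_map g t b"
  unfolding conj_map_def
  by (rule AH.lift_cong[OF assms(1)], rule HH.lift_cong[OF comult_closed], assumption)
    (simp add: assms act_closed S_closed)

lemma conj_map_operator_lin:
  assumes "t \<in> carrier AH.T" "b \<in> carrier A"
  shows "lin_map K AA.Hom A (\<lambda>f. conj_map f t b)"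
  unfolding conj_map_def
proof (rule AH.lift_param[OF V.vectorspace_axioms assms(1) conj_map_bilin[OF AA.hom_space_lin assms(2)]],
    assumption)
  fix a g assume a: "a \<in> carrier A" and g: "g \<in> carrier H"
  show "lin_map K AA.Hom A (\<lambda>f. tensor_lift A (\<lambda>p q. a \<otimes>\<^bsub>A\<^esub> act p (f (act (S q) b))) (\<Delta> g))"
  proof (rule HH.lift_param[OF V.vectorspace_axioms comult_closed[OF g] _ _ AA.hom_space_vectorspace])
    show "bilin_map K H H A (\<lambda>p q. a \<otimes>\<^bsub>A\<^esub> act p (f (act (S q) b)))" if "f \<in> carrier AA.Hom" for f
      by (intro multilin lin_map_comp[OF _ AA.hom_space_lin[OF that]]
          lin_map_closed[OF AA.hom_space_lin[OF that]] assms a; assumption)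
    show "lin_map K AA.Hom A (\<lambda>f. a \<otimes>\<^bsub>A\<^esub> act p (f (act (S q) b)))"
      if "p \<in> carrier H" "q \<in> carrier H" for p q
      by (intro A_mult_lin(1) act_lin_arg AA.hom_space_eval act_closed S_closed assms a that)
  qed
qed (rule AA.hom_space_vectorspace)

end

context galois_pair
begin

lemma E_galois_eqI:
  assumes "s \<in> carrier E.AH.T" "t \<in> carrier E.AH.T"
    and "\<And>b. b \<in> carrier A \<Longrightarrow> E.galois_map s b = E.galois_map t b"
  shows "s = t"
  by (rule lin_map_family_injI[OF E.AH.tensor_vectorspace vs_A E.galois_map_lin(1) E_galois_zero assms])

subsection \<open>Finite dimensionality of \<open>E\<close>\<close>

text \<open>
  Conjugation by the rank one operator \<open>b \<mapsto> c(b) 1\<close> with \<open>c(1) = 1\<close> is a projection of \<open>End(A)\<close> onto the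
  operators from \<open>E\<close>.  It carries the coevaluation of \<open>End(A)\<close> to one of \<open>E\<close>.
\<close>

lemma E_coevaluation: "\<exists>dE. coevaluation K E dE"
proof -
  obtain c1 where c1: "functional K A c1" "c1 \<one>\<^bsub>A\<^esub> = \<one>\<^bsub>K\<^esub>"
    using H.A1.normalized_functional[OF G.coev_A H.A.one_closed H.A.algebra_one_not_zero] .
  note Q = G.rank_one[OF c1(1)]
  note dA = G.dA and df = H.A1.dual_functional
  let ?Hom = "hom_space K A A"
  note vsHom = H.AA.hom_space_vectorspace
  interpret ED: two_spaces K E "dual_space K E" by (rule E.H1.two_spaces_dual)
  interpret EB: two_spaces K E "base_algebra K" by (rule E.H1.two_spaces_base)
  \<comment> \<open>\<open>\<Theta>\<close> identifies \<open>A \<otimes> A\<^sup>*\<close> with \<open>End(A)\<close>, and \<open>\<psi>\<close> is the projection onto \<open>E\<close>.\<close>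
  define \<Theta> where "\<Theta> = tensor_lift ?Hom (\<lambda>e c. \<lambda>b\<in>carrier A. c b \<odot>\<^bsub>A\<^esub> e)"
  have \<Theta>_bil: "bilin_map K A (dual_space K A) ?Hom (\<lambda>e c. \<lambda>b\<in>carrier A. c b \<odot>\<^bsub>A\<^esub> e)"
    by (intro bilin_mapI H.AA.hom_space_curry functional_smult_lin lin_map_smult_const vs_A lin_map_id
        df H.A1.dual_eval functional_closed[OF df] G.AD.W.vectorspace_axioms; assumption)
  have \<Theta>_lin: "lin_map K G.AD.T ?Hom \<Theta>"
    unfolding \<Theta>_def by (rule G.AD.lift_lin[OF vsHom \<Theta>_bil])
  have \<Theta>_hom: "z \<in> carrier G.AD.T \<Longrightarrow> lin_map K A A (\<Theta> z)" for z
    by (rule H.AA.hom_space_lin[OF lin_map_closed[OF \<Theta>_lin]])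
  have "\<exists>\<psi>. lin_map K G.AD.T E \<psi> \<and> (\<forall>z\<in>carrier G.AD.T. \<forall>a\<in>carrier A.
      actE (\<psi> z) a = H.conj_map (\<Theta> z) (G.rank_one c1) a)"
  proof (rule lift_to_E[OF G.AD.tensor_vectorspace])
    show "lin_map K A A (H.conj_map (\<Theta> z) (G.rank_one c1))" if "z \<in> carrier G.AD.T" for z
      by (rule H.conj_map_lin(2)[OF \<Theta>_hom[OF that] Q(1)])
    show "H.conj_map (\<Theta> z) (G.rank_one c1) (act h a) = act h (H.conj_map (\<Theta> z) (G.rank_one c1) a)"
      if "z \<in> carrier G.AD.T" "h \<in> carrier H" "a \<in> carrier A" for z h a
      by (rule G.conj_map_rank_one_equivariant[OF \<Theta>_hom[OF that(1)] c1(1) that(2,3)])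
    show "lin_map K G.AD.T A (\<lambda>z. H.conj_map (\<Theta> z) (G.rank_one c1) a)" if "a \<in> carrier A" for a
      by (rule lin_map_comp[OF \<Theta>_lin H.conj_map_operator_lin[OF Q(1) that]])
  qed
  then obtain \<psi> where \<psi>_lin: "lin_map K G.AD.T E \<psi>" and \<psi>: "\<And>z a. z \<in> carrier G.AD.T \<Longrightarrow> a \<in> carrier A \<Longrightarrow>
      actE (\<psi> z) a = H.conj_map (\<Theta> z) (G.rank_one c1) a"
    by blast
  define \<kappa> where "\<kappa> e c = (\<lambda>\<phi>\<in>carrier E. c (actE \<phi> e))" for e :: 'a and c :: "'a \<Rightarrow> 'k"
  have \<kappa>_lin1: "lin_map K (dual_space K A) (dual_space K E) (\<kappa> e)" if e: "e \<in> carrier A" for e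
    unfolding \<kappa>_def
    by (rule EB.hom_space_curry[OF lin_map_comp[OF E.act_lin_op[OF e lin_map_id] df]
          H.A1.dual_eval G.AD.W.vectorspace_axioms]) (assumption, rule E.act_closed[OF _ e])
  have \<kappa>_lin2: "lin_map K A (dual_space K E) (\<lambda>e. \<kappa> e c)" if c: "c \<in> carrier (dual_space K A)" for c
    unfolding \<kappa>_def
    by (rule EB.hom_space_curry[OF lin_map_comp[OF E.act_lin_op df[OF c]] _ vs_A])
      (assumption, rule lin_map_id, rule lin_map_comp[OF E.act_linear df[OF c]])
  have \<kappa>_app: "\<kappa> e c \<phi> = c (actE \<phi> e)" if "\<phi> \<in> carrier E" for e c \<phi>
    using that by (simp add: \<kappa>_def)
  note pA = G.AD.pure_bilin and pE = ED.pure_bilin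
  have \<psi>p: "c \<in> carrier (dual_space K A) \<Longrightarrow> lin_map K A E (\<lambda>e. \<psi> (G.AD.pure e c))"
    "e \<in> carrier A \<Longrightarrow> lin_map K (dual_space K A) E (\<lambda>c. \<psi> (G.AD.pure e c))" for e c
    by (rule lin_map_comp[OF bilin_map_left[OF pA] \<psi>_lin], assumption)
      (rule lin_map_comp[OF bilin_map_right[OF pA] \<psi>_lin])
  have \<psi>c: "e \<in> carrier A \<Longrightarrow> c \<in> carrier (dual_space K A) \<Longrightarrow> \<psi> (G.AD.pure e c) \<in> carrier E" for e c
    by (rule lin_map_closed[OF \<psi>p(1)])
  note \<kappa>c = lin_map_closed[OF \<kappa>_lin1]
  have inner_bil: "bilin_map K A (dual_space K A) ED.T (\<lambda>e2 c2. ED.pure (\<psi> (G.AD.pure e2 c')) (\<kappa> e c2))"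
    if "e \<in> carrier A" "c' \<in> carrier (dual_space K A)" for e c'
    by (intro bilin_mapI lin_map_comp[OF \<kappa>_lin1 bilin_map_right[OF pE]]
        lin_map_comp[OF \<psi>p(1) bilin_map_left[OF pE]] \<psi>c \<kappa>c that; assumption)
  have outer_bil: "bilin_map K A (dual_space K A) ED.T
      (\<lambda>e c'. tensor_lift ED.T (\<lambda>e2 c2. ED.pure (\<psi> (G.AD.pure e2 c')) (\<kappa> e c2)) dA)"
    by (intro bilin_mapI G.AD.lift_param ED.tensor_vectorspace inner_bil dA vs_A G.AD.W.vectorspace_axioms
        lin_map_comp[OF \<kappa>_lin2 bilin_map_right[OF pE]]
        lin_map_comp[OF \<psi>p(2) bilin_map_left[OF pE]] \<psi>c \<kappa>c; assumption)
  \<comment> \<open>The sum over \<open>i\<close> and \<open>j\<close> of \<open>\<psi>(e\<^sub>j \<otimes> c\<^sub>i) \<otimes> (\<phi> \<mapsto> c\<^sub>j(\<phi>(e\<^sub>i)))\<close>: the matrix entries of \<open>\<phi>\<close> are its coordinates.\<close>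
  define dE where "dE = tensor_lift ED.T
      (\<lambda>e c'. tensor_lift ED.T (\<lambda>e2 c2. ED.pure (\<psi> (G.AD.pure e2 c')) (\<kappa> e c2)) dA) dA"
  have dE: "dE \<in> carrier ED.T"
    unfolding dE_def by (rule G.AD.lift_closed[OF ED.tensor_vectorspace outer_bil dA])
  have "tensor_lift E (\<lambda>e c. c \<phi> \<odot>\<^bsub>E\<^esub> e) dE = \<phi>" if \<phi>: "\<phi> \<in> carrier E" for \<phi>
  proof -
    have Lb: "bilin_map K E (dual_space K E) E (\<lambda>e c. c \<phi> \<odot>\<^bsub>E\<^esub> e)"
      by (rule E.H1.coevaluation_bilin[OF vs_E lin_map_id \<phi>])
    note L = ED.lift_lin[OF vs_E Lb]
    have zb: "bilin_map K A (dual_space K A) G.AD.T (\<lambda>e c'. G.AD.pure (actE \<phi> e) c')"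
      by (intro bilin_mapI lin_map_comp[OF E.act_linear[OF \<phi>] bilin_map_left[OF pA]]
          bilin_map_right[OF pA] E.act_closed \<phi>; assumption)
    \<comment> \<open>\<open>z = \<Sum> \<phi>(e\<^sub>i) \<otimes> c\<^sub>i\<close> represents the operator \<open>\<phi>\<close> in \<open>A \<otimes> A\<^sup>*\<close>.\<close>
    define z where "z = tensor_lift G.AD.T (\<lambda>e c'. G.AD.pure (actE \<phi> e) c') dA"
    have z: "z \<in> carrier G.AD.T" unfolding z_def by (rule G.AD.lift_closed[OF G.AD.tensor_vectorspace zb dA])
    have "tensor_lift E (\<lambda>e c. c \<phi> \<odot>\<^bsub>E\<^esub> e) dE = tensor_lift E (\<lambda>e c'. \<psi> (G.AD.pure (actE \<phi> e) c')) dA"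
      unfolding dE_def G.AD.lin_map_lift[OF ED.tensor_vectorspace vs_E L outer_bil dA]
    proof (rule G.AD.lift_cong[OF dA])
      fix e c' assume e: "e \<in> carrier A" and c': "c' \<in> carrier (dual_space K A)"
      have "tensor_lift E (\<lambda>e c. c \<phi> \<odot>\<^bsub>E\<^esub> e)
            (tensor_lift ED.T (\<lambda>e2 c2. ED.pure (\<psi> (G.AD.pure e2 c')) (\<kappa> e c2)) dA) =
          tensor_lift E (\<lambda>e2 c2. c2 (actE \<phi> e) \<odot>\<^bsub>E\<^esub> \<psi> (G.AD.pure e2 c')) dA"
        unfolding G.AD.lin_map_lift[OF ED.tensor_vectorspace vs_E L inner_bil[OF e c'] dA]
        by (rule G.AD.lift_cong[OF dA]) (simp add: Lb vs_E \<psi>c \<kappa>c e c' \<kappa>_app \<phi>)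
      also have "\<dots> = \<psi> (G.AD.pure (actE \<phi> e) c')"
        by (rule H.A1.coevaluation_apply[OF vs_E \<psi>p(1)[OF c'] E.act_closed[OF \<phi> e] G.coev_A])
      finally show "tensor_lift E (\<lambda>e c. c \<phi> \<odot>\<^bsub>E\<^esub> e)
            (tensor_lift ED.T (\<lambda>e2 c2. ED.pure (\<psi> (G.AD.pure e2 c')) (\<kappa> e c2)) dA) =
          \<psi> (G.AD.pure (actE \<phi> e) c')" .
    qed
    also have "\<dots> = \<psi> z"
      unfolding z_def by (rule G.AD.lin_map_lift[OF G.AD.tensor_vectorspace vs_E \<psi>_lin zb dA, symmetric])
    also have "\<psi> z = \<phi>"
    proof (rule E_eqI[OF lin_map_closed[OF \<psi>_lin z] \<phi>])
      fix b assume b: "b \<in> carrier A"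
      have \<Theta>z: "\<Theta> z a = E.galois_map (E.AH.pure \<one>\<^bsub>A\<^esub> \<phi>) a" if a: "a \<in> carrier A" for a
      proof -
        have "\<Theta> z a = tensor_lift A (\<lambda>e c'. \<Theta> (G.AD.pure (actE \<phi> e) c') a) dA"
          unfolding z_def
          by (rule G.AD.lin_map_lift[OF G.AD.tensor_vectorspace vs_A
                lin_map_comp[OF \<Theta>_lin H.AA.hom_space_eval[OF a]] zb dA])
        also have "\<dots> = tensor_lift A (\<lambda>e c'. c' a \<odot>\<^bsub>A\<^esub> actE \<phi> e) dA"
          by (rule G.AD.lift_cong[OF dA]) (simp add: \<Theta>_def vsHom \<Theta>_bil E.act_closed \<phi> a)
        also have "\<dots> = actE \<phi> a"
          by (rule H.A1.coevaluation_apply[OF vs_A E.act_linear[OF \<phi>] a G.coev_A])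
        finally show ?thesis by (simp add: E.galois_map_pure \<phi> a E.act_closed)
      qed
      have "actE (\<psi> z) b = H.conj_map (E.galois_map (E.AH.pure \<one>\<^bsub>A\<^esub> \<phi>)) (G.rank_one c1) b"
        unfolding \<psi>[OF z b] by (rule H.conj_map_cong[OF Q(1) b \<Theta>z])
      also have "\<dots> = tensor_lift A (\<lambda>x \<phi>. H.galois_map (G.rank_one c1) x \<otimes>\<^bsub>A\<^esub> actE \<phi> b) (E.AH.pure \<one>\<^bsub>A\<^esub> \<phi>)"
        by (rule conj_map_galois_map[OF Q(1) _ b]) (simp add: \<phi>)
      also have "\<dots> = H.galois_map (G.rank_one c1) \<one>\<^bsub>A\<^esub> \<otimes>\<^bsub>A\<^esub> actE \<phi> b"
        by (rule E.AH.lift_pure[OF vs_A _ H.A.one_closed \<phi>])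
          (intro multilin lin_map_comp[OF _ H.galois_map_lin(2)[OF Q(1)]]
            lin_map_closed[OF H.galois_map_lin(2)[OF Q(1)]] b; assumption)
      also have "\<dots> = actE \<phi> b"
        by (simp add: Q c1(2) E.act_closed \<phi> b)
      finally show "actE (\<psi> z) b = actE \<phi> b" .
    qed
    finally show ?thesis .
  qed
  with dE show ?thesis unfolding coevaluation_def by blast
qed

subsection \<open>The double centralizer property\<close>

text \<open>
  Write the operator \<open>b \<mapsto> c(b) 1\<close> as \<open>\<Sum> x \<phi>\<close> with \<open>\<phi>\<close> in \<open>E\<close>.  For an invariant \<open>a\<close> this gives
  \<open>c(a) 1 = \<Sum> x \<phi>(a) = \<Sum> x \<epsilon>(\<phi>) a = \<Sum> x \<phi>(1) a = c(1) a\<close>.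
\<close>
lemma E_invariant_scalar:
  assumes a: "a \<in> carrier A" and inv: "\<And>\<phi>. \<phi> \<in> carrier E \<Longrightarrow> actE \<phi> a = \<epsilon>\<^sub>E \<phi> \<odot>\<^bsub>A\<^esub> a"
    and c: "functional K A c" "c \<one>\<^bsub>A\<^esub> = \<one>\<^bsub>K\<^esub>"
  shows "a = c a \<odot>\<^bsub>A\<^esub> \<one>\<^bsub>A\<^esub>"
proof -
  have "lin_map K A A (\<lambda>b. c b \<odot>\<^bsub>A\<^esub> \<one>\<^bsub>A\<^esub>)"
    by (rule functional_smult_lin[OF vs_A H.A.one_closed c(1)])
  then obtain t where t: "t \<in> carrier E.AH.T" "\<And>b. b \<in> carrier A \<Longrightarrow> E.galois_map t b = c b \<odot>\<^bsub>A\<^esub> \<one>\<^bsub>A\<^esub>"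
    using E_galois_onto by blast
  have "a = E.galois_map t \<one>\<^bsub>A\<^esub> \<otimes>\<^bsub>A\<^esub> a" by (simp add: t(2) c(2) a)
  also have "\<dots> = tensor_lift A (\<lambda>x \<phi>. (x \<otimes>\<^bsub>A\<^esub> actE \<phi> \<one>\<^bsub>A\<^esub>) \<otimes>\<^bsub>A\<^esub> a) t"
    unfolding E.galois_map_def
    by (rule E.AH.lin_map_lift[OF vs_A vs_A H.A_mult_lin(2)[OF a lin_map_id] _ t(1)])
      (intro multilin H.A.one_closed; assumption)
  also have "\<dots> = E.galois_map t a"
    unfolding E.galois_map_def
    by (rule E.AH.lift_cong[OF t(1)])
      (simp add: inv E.act_unit a E.counit_closed H.A.smult_mult_left H.A.smult_mult_right)
  also have "\<dots> = c a \<odot>\<^bsub>A\<^esub> \<one>\<^bsub>A\<^esub>" by (rule t(2)[OF a])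
  finally show ?thesis .
qed

text \<open>
  Let \<open>f\<close> be the operator \<open>\<Sum> a h\<close>.  As \<open>f\<close> commutes with \<open>E\<close>, the sum \<open>\<Sum> \<phi>' f S(\<phi>'')\<close> of operators is
  \<open>\<epsilon>(\<phi>) f\<close>; by \<open>act_coefficients\<close> for the exchanged actions it is \<open>\<Sum> \<phi>(a) h\<close>.  As
  the Galois map is injective, the coefficients of \<open>\<Sum> a \<otimes> h\<close> with respect to a basis of \<open>H\<close> are
  invariant under \<open>E\<close>, hence scalars, and \<open>f\<close> is given by an element of \<open>H\<close>.
\<close>
lemma H_full:
  assumes f: "lin_map K A A f"
    and comm: "\<And>\<phi> a. \<phi> \<in> carrier E \<Longrightarrow> a \<in> carrier A \<Longrightarrow> f (actE \<phi> a) = actE \<phi> (f a)"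
  shows "\<exists>h\<in>carrier H. \<forall>a\<in>carrier A. act h a = f a"
proof -
  interpret X: commuting_actions K E \<Delta>\<^sub>E \<epsilon>\<^sub>E S\<^sub>E A actE H \<Delta> \<epsilon> S act
    by unfold_locales (simp add: commute)
  interpret HD: two_spaces K H "dual_space K H" by (rule H.H1.two_spaces_dual)
  have dH: "dH \<in> carrier HD.T" using G.coev_H by (simp add: coevaluation_def)
  obtain c1 where c1: "functional K A c1" "c1 \<one>\<^bsub>A\<^esub> = \<one>\<^bsub>K\<^esub>"
    using H.A1.normalized_functional[OF G.coev_A H.A.one_closed H.A.algebra_one_not_zero] .
  obtain t where t: "t \<in> carrier H.AH.T" "\<And>b. b \<in> carrier A \<Longrightarrow> H.galois_map t b = f b"
    using G.galois_onto[OF f] by blast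
  note fc = lin_map_closed[OF f]
  interpret T: vectorspace K H.AH.T by (rule H.AH.tensor_vectorspace)
  have scaled: "tensor_map K A H (actE \<phi>) (\<lambda>h. h) t = \<epsilon>\<^sub>E \<phi> \<odot>\<^bsub>H.AH.T\<^esub> t" if \<phi>: "\<phi> \<in> carrier E" for \<phi>
  proof (rule G.galois_eqI)
    show "tensor_map K A H (actE \<phi>) (\<lambda>h. h) t \<in> carrier H.AH.T"
      by (rule lin_map_closed[OF H.AH.tensor_map_lin[OF E.act_linear[OF \<phi>] lin_map_id vs_A vs_H] t(1)])
    show "\<epsilon>\<^sub>E \<phi> \<odot>\<^bsub>H.AH.T\<^esub> t \<in> carrier H.AH.T" by (rule T.smult_closed[OF E.counit_closed[OF \<phi>] t(1)])
    fix b assume b: "b \<in> carrier A"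
    note d = E.comult_closed[OF \<phi>]
    have "H.galois_map (tensor_map K A H (actE \<phi>) (\<lambda>h. h) t) b =
        tensor_lift A (\<lambda>a h. actE \<phi> a \<otimes>\<^bsub>A\<^esub> act h b) t"
      unfolding H.AH.lin_map_tensor_map[OF E.act_linear[OF \<phi>] lin_map_id vs_A vs_H vs_A
          H.galois_map_lin(1)[OF b] t(1)]
      by (rule H.AH.lift_cong[OF t(1)]) (simp add: H.galois_map_pure E.act_closed \<phi> b)
    also have "\<dots> = tensor_lift A (\<lambda>x y. actE x (H.galois_map t (actE (S\<^sub>E y) b))) (\<Delta>\<^sub>E \<phi>)"
      by (rule X.act_coefficients[OF \<phi> t(1) b, symmetric])
    also have "\<dots> = tensor_lift A (\<lambda>x y. f (actE (x \<otimes>\<^bsub>E\<^esub> S\<^sub>E y) b)) (\<Delta>\<^sub>E \<phi>)"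
      by (rule E.HH.lift_cong[OF d]) (simp add: t(2) E.act_closed E.S_closed b E.act_mult comm)
    also have "\<dots> = f (actE (tensor_lift E (\<lambda>x y. x \<otimes>\<^bsub>E\<^esub> S\<^sub>E y) (\<Delta>\<^sub>E \<phi>)) b)"
      by (rule E.HH.lin_map_lift[OF vs_E vs_A lin_map_comp[OF E.act_lin_op[OF b lin_map_id] f] _ d, symmetric])
        (intro multilin; assumption)
    also have "\<dots> = \<epsilon>\<^sub>E \<phi> \<odot>\<^bsub>A\<^esub> f b"
      by (simp add: E.antipode_right \<phi> E.act_smult E.counit_closed b E.act_one module_hom_smult[OF f])
    also have "\<dots> = H.galois_map (\<epsilon>\<^sub>E \<phi> \<odot>\<^bsub>H.AH.T\<^esub> t) b"
      by (simp add: module_hom_smult[OF H.galois_map_lin(1)[OF b]] E.counit_closed \<phi> t b)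
    finally show "H.galois_map (tensor_map K A H (actE \<phi>) (\<lambda>h. h) t) b =
      H.galois_map (\<epsilon>\<^sub>E \<phi> \<odot>\<^bsub>H.AH.T\<^esub> t) b" .
  qed
  have slices: "H.AH.slice c t = c1 (H.AH.slice c t) \<odot>\<^bsub>A\<^esub> \<one>\<^bsub>A\<^esub>" if c: "functional K H c" for c
  proof (rule E_invariant_scalar[OF lin_map_closed[OF H.AH.slice_lin[OF c] t(1)] _ c1])
    fix \<phi> assume \<phi>: "\<phi> \<in> carrier E"
    show "actE \<phi> (H.AH.slice c t) = \<epsilon>\<^sub>E \<phi> \<odot>\<^bsub>A\<^esub> H.AH.slice c t"
      using H.AH.slice_tensor_map[OF vs_A E.act_linear[OF \<phi>] c t(1)]
      by (simp add: scaled \<phi> module_hom_smult[OF H.AH.slice_lin[OF c]] E.counit_closed t(1))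
  qed
  have cf: "functional K (dual_space K H) (\<lambda>c. c1 (H.AH.slice c t))"
    by (rule lin_map_comp[OF H.AH.slice_dual_lin[OF t(1)] c1(1)])
  have bil: "bilin_map K H (dual_space K H) H (\<lambda>e c. c1 (H.AH.slice c t) \<odot>\<^bsub>H\<^esub> e)"
    by (intro bilin_mapI functional_smult_lin[OF vs_H _ cf] lin_map_smult_const vs_H lin_map_id
        functional_closed[OF cf]; assumption)
  define h where "h = tensor_lift H (\<lambda>e c. c1 (H.AH.slice c t) \<odot>\<^bsub>H\<^esub> e) dH"
  have h: "h \<in> carrier H" unfolding h_def by (rule HD.lift_closed[OF vs_H bil dH])
  have "t = tensor_lift H.AH.T (\<lambda>e c. H.AH.pure (H.AH.slice c t) e) dH"
    by (rule H.AH.tensor_slices[OF G.coev_H t(1), symmetric])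
  also have "\<dots> = tensor_lift H.AH.T (\<lambda>e c. H.AH.pure \<one>\<^bsub>A\<^esub> (c1 (H.AH.slice c t) \<odot>\<^bsub>H\<^esub> e)) dH"
  proof (rule HD.lift_cong[OF dH])
    fix e c assume e: "e \<in> carrier H" and c: "c \<in> carrier (dual_space K H)"
    note k = functional_closed[OF cf c]
    have "H.AH.pure (H.AH.slice c t) e = H.AH.pure (c1 (H.AH.slice c t) \<odot>\<^bsub>A\<^esub> \<one>\<^bsub>A\<^esub>) e"
      using slices[OF H.H1.dual_functional[OF c]] by (rule arg_cong)
    then show "H.AH.pure (H.AH.slice c t) e = H.AH.pure \<one>\<^bsub>A\<^esub> (c1 (H.AH.slice c t) \<odot>\<^bsub>H\<^esub> e)"
      using k e by (simp only: H.AH.pure_smult_left H.AH.pure_smult_right H.A.one_closed)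
  qed
  also have "\<dots> = H.AH.pure \<one>\<^bsub>A\<^esub> h"
    unfolding h_def
    by (rule HD.lin_map_lift[OF vs_H H.AH.tensor_vectorspace H.AH_pure_lin(1)[OF H.A.one_closed lin_map_id]
          bil dH, symmetric])
  finally have t_eq: "t = H.AH.pure \<one>\<^bsub>A\<^esub> h" .
  have "act h a = f a" if a: "a \<in> carrier A" for a
    using t(2)[OF a] H.galois_map_pure[OF H.A.one_closed h a] H.A.l_one[OF H.act_closed[OF h a]]
    unfolding t_eq by simp
  with h show ?thesis by blast
qed

subsection \<open>Equivariant bilinear maps\<close>

text \<open>
  For fixed \<open>a\<close> write the operator \<open>\<theta>(a, \<cdot>)\<close> as \<open>\<Sum> x \<phi>\<close> and put \<open>\<tau>(a) = \<Sum> x \<otimes> \<phi>\<close>.  Equivariance of \<open>\<theta>\<close>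
  makes \<open>\<tau>\<close> equivariant for the action of \<open>H\<close> on the factor \<open>x\<close>, as \<open>act_coefficients\<close> shows.  So the
  coefficients of \<open>\<tau>(a)\<close> with respect to a basis of \<open>E\<close> are equivariant in \<open>a\<close>, which means that they
  are given by elements of \<open>E\<close>.
\<close>
lemma equivariant_bilinear:
  assumes bil: "bilin_map K A A A \<theta>" and dE: "coevaluation K E dE"
    and eqv: "\<And>h a b. \<lbrakk>h \<in> carrier H; a \<in> carrier A; b \<in> carrier A\<rbrakk> \<Longrightarrow>
      act h (\<theta> a b) = tensor_lift A (\<lambda>x y. \<theta> (act x a) (act y b)) (\<Delta> h)"
  shows "\<exists>R\<in>carrier (tensor K E E). \<forall>a\<in>carrier A. \<forall>b\<in>carrier A.
    \<theta> a b = tensor_lift A (\<lambda>x y. actE x a \<otimes>\<^bsub>A\<^esub> actE y b) R"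
proof -
  interpret ED: two_spaces K E "dual_space K E" by (rule E.H1.two_spaces_dual)
  have d: "dE \<in> carrier ED.T" using dE by (simp add: coevaluation_def)
  note bl = bilin_map_left[OF bil] and br = bilin_map_right[OF bil] and bc = bilin_map_closed[OF bil]
  have "\<exists>t. t \<in> carrier E.AH.T \<and> (\<forall>b\<in>carrier A. E.galois_map t b = \<theta> a b)" if "a \<in> carrier A" for a
    using E_galois_onto[OF br[OF that]] by blast
  then obtain \<tau> where \<tau>': "\<And>a. a \<in> carrier A \<Longrightarrow>
      \<tau> a \<in> carrier E.AH.T \<and> (\<forall>b\<in>carrier A. E.galois_map (\<tau> a) b = \<theta> a b)"
    by metis
  have \<tau>c: "a \<in> carrier A \<Longrightarrow> \<tau> a \<in> carrier E.AH.T"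
    and \<tau>: "a \<in> carrier A \<Longrightarrow> b \<in> carrier A \<Longrightarrow> E.galois_map (\<tau> a) b = \<theta> a b" for a b
    using \<tau>' by blast+
  interpret T: vectorspace K E.AH.T by (rule E.AH.tensor_vectorspace)
  have \<tau>_lin: "lin_map K A E.AH.T \<tau>"
    by (intro lin_mapI E_galois_eqI)
      (simp_all add: \<tau>c \<tau> module_hom_add[OF E.galois_map_lin(1)] module_hom_smult[OF E.galois_map_lin(1)]
        module_hom_add[OF bl] module_hom_smult[OF bl])
  have \<tau>_eqv: "\<tau> (act h a) = tensor_map K A E (act h) (\<lambda>\<phi>. \<phi>) (\<tau> a)"
    if h: "h \<in> carrier H" and a: "a \<in> carrier A" for h a
  proof (rule E_galois_eqI[OF \<tau>c[OF H.act_closed[OF h a]]])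
    show "tensor_map K A E (act h) (\<lambda>\<phi>. \<phi>) (\<tau> a) \<in> carrier E.AH.T"
      by (rule lin_map_closed[OF E.AH.tensor_map_lin[OF H.act_linear[OF h] lin_map_id vs_A vs_E] \<tau>c[OF a]])
    fix b assume b: "b \<in> carrier A"
    note dh = H.comult_closed[OF h]
    define F where "F u v y = \<theta> (act u a) (act (v \<otimes>\<^bsub>H\<^esub> S y) b)" for u v y
    have F_tri: "trilin_map K H H H A F"
      unfolding F_def by (intro multilin lin_map_comp[OF _ bl] lin_map_comp[OF _ br] a b; assumption)
    have F_sum: "tensor_lift A (\<lambda>v y. F u v y) (\<Delta> w) = \<epsilon> w \<odot>\<^bsub>A\<^esub> \<theta> (act u a) b"
      if u: "u \<in> carrier H" and w: "w \<in> carrier H" for u w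
    proof -
      let ?L = "\<lambda>x. \<theta> (act u a) (act x b)"
      have L: "lin_map K H A ?L" by (intro multilin lin_map_comp[OF _ br] a b u)
      have "tensor_lift A (\<lambda>v y. F u v y) (\<Delta> w) = ?L (tensor_lift H (\<lambda>v y. v \<otimes>\<^bsub>H\<^esub> S y) (\<Delta> w))"
        unfolding F_def
        by (rule H.HH.lin_map_lift[OF vs_H vs_A L _ H.comult_closed[OF w], symmetric])
          (intro multilin; assumption)
      also have "\<dots> = \<epsilon> w \<odot>\<^bsub>A\<^esub> ?L \<one>\<^bsub>H\<^esub>"
        unfolding H.antipode_right[OF w]
        by (rule module_hom_smult[OF L H.counit_closed[OF w] H.one_closed])
      finally show ?thesis by (simp add: H.act_one b)
    qed
    have "E.galois_map (tensor_map K A E (act h) (\<lambda>\<phi>. \<phi>) (\<tau> a)) b =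
        tensor_lift A (\<lambda>x \<phi>. act h x \<otimes>\<^bsub>A\<^esub> actE \<phi> b) (\<tau> a)"
      unfolding E.AH.lin_map_tensor_map[OF H.act_linear[OF h] lin_map_id vs_A vs_E vs_A
          E.galois_map_lin(1)[OF b] \<tau>c[OF a]]
      by (rule E.AH.lift_cong[OF \<tau>c[OF a]]) (simp add: E.galois_map_pure H.act_closed h b)
    also have "\<dots> = tensor_lift A (\<lambda>x y. act x (E.galois_map (\<tau> a) (act (S y) b))) (\<Delta> h)"
      by (rule act_coefficients[OF h \<tau>c[OF a] b, symmetric])
    also have "\<dots> = tensor_lift A (\<lambda>x y. tensor_lift A (\<lambda>u v. F u v y) (\<Delta> x)) (\<Delta> h)"
    proof (rule H.HH.lift_cong[OF dh])
      fix x y assume x: "x \<in> carrier H" and y: "y \<in> carrier H"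
      have yb: "act (S y) b \<in> carrier A" by (intro H.act_closed H.S_closed y b)
      have "act x (E.galois_map (\<tau> a) (act (S y) b)) =
          tensor_lift A (\<lambda>u v. \<theta> (act u a) (act v (act (S y) b))) (\<Delta> x)"
        unfolding \<tau>[OF a yb] by (rule eqv[OF x a yb])
      also have "\<dots> = tensor_lift A (\<lambda>u v. F u v y) (\<Delta> x)"
        unfolding F_def
        by (rule H.HH.lift_cong[OF H.comult_closed[OF x]]) (simp add: H.act_mult H.S_closed y b)
      finally show "act x (E.galois_map (\<tau> a) (act (S y) b)) =
        tensor_lift A (\<lambda>u v. F u v y) (\<Delta> x)" .
    qed
    also have "\<dots> = tensor_lift A (\<lambda>u w. tensor_lift A (\<lambda>v y. F u v y) (\<Delta> w)) (\<Delta> h)"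
      by (rule H.coassoc_lift[OF vs_A F_tri h])
    also have "\<dots> = tensor_lift A (\<lambda>u w. \<epsilon> w \<odot>\<^bsub>A\<^esub> \<theta> (act u a) b) (\<Delta> h)"
      by (rule H.HH.lift_cong[OF dh]) (rule F_sum)
    also have "\<dots> = \<theta> (act h a) b"
      by (rule H.counit_right_lift[OF vs_A _ h]) (intro multilin lin_map_comp[OF _ bl] a b)
    also have "\<dots> = E.galois_map (\<tau> (act h a)) b"
      by (rule \<tau>[OF H.act_closed[OF h a] b, symmetric])
    finally show "E.galois_map (\<tau> (act h a)) b =
      E.galois_map (tensor_map K A E (act h) (\<lambda>\<phi>. \<phi>) (\<tau> a)) b" by (rule HOL.sym)
  qed
  have "\<exists>\<xi>. lin_map K (dual_space K E) E \<xi> \<and> (\<forall>c\<in>carrier (dual_space K E). \<forall>a\<in>carrier A.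
      actE (\<xi> c) a = E.AH.slice c (\<tau> a))"
  proof (rule lift_to_E[OF ED.W.vectorspace_axioms])
    note df = E.H1.dual_functional
    show "lin_map K A A (\<lambda>a. E.AH.slice c (\<tau> a))" if "c \<in> carrier (dual_space K E)" for c
      by (rule lin_map_comp[OF \<tau>_lin E.AH.slice_lin[OF df[OF that]]])
    show "E.AH.slice c (\<tau> (act h a)) = act h (E.AH.slice c (\<tau> a))"
      if "c \<in> carrier (dual_space K E)" "h \<in> carrier H" "a \<in> carrier A" for c h a
      unfolding \<tau>_eqv[OF that(2,3)]
      by (rule E.AH.slice_tensor_map[OF vs_A H.act_linear[OF that(2)] df[OF that(1)] \<tau>c[OF that(3)]])
    show "lin_map K (dual_space K E) A (\<lambda>c. E.AH.slice c (\<tau> a))" if "a \<in> carrier A" for a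
      by (rule E.AH.slice_dual_lin[OF \<tau>c[OF that]])
  qed
  then obtain \<xi> where \<xi>_lin: "lin_map K (dual_space K E) E \<xi>"
    and \<xi>: "\<And>c a. c \<in> carrier (dual_space K E) \<Longrightarrow> a \<in> carrier A \<Longrightarrow> actE (\<xi> c) a = E.AH.slice c (\<tau> a)"
    by blast
  note \<xi>c = lin_map_closed[OF \<xi>_lin]
  have Rb: "bilin_map K E (dual_space K E) E.HH.T (\<lambda>e c. E.HH.pure (\<xi> c) e)"
    by (intro bilin_mapI lin_map_comp[OF \<xi>_lin bilin_map_left[OF E.HH.pure_bilin]]
        bilin_map_right[OF E.HH.pure_bilin] \<xi>c; assumption)
  let ?R = "tensor_lift E.HH.T (\<lambda>e c. E.HH.pure (\<xi> c) e) dE"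
  have "\<theta> a b = tensor_lift A (\<lambda>x y. actE x a \<otimes>\<^bsub>A\<^esub> actE y b) ?R"
    if a: "a \<in> carrier A" and b: "b \<in> carrier A" for a b
  proof -
    have eb: "bilin_map K E E A (\<lambda>x y. actE x a \<otimes>\<^bsub>A\<^esub> actE y b)" by (intro multilin a b; assumption)
    note t = \<tau>c[OF a]
    have sb: "bilin_map K E (dual_space K E) E.AH.T (\<lambda>e c. E.AH.pure (E.AH.slice c (\<tau> a)) e)"
      by (intro bilin_mapI E.AH_pure_lin E.AH.slice_dual_lin[OF t] lin_map_id
          lin_map_closed[OF E.AH.slice_dual_lin[OF t]]; assumption)
    have "tensor_lift A (\<lambda>x y. actE x a \<otimes>\<^bsub>A\<^esub> actE y b) ?R =
        tensor_lift A (\<lambda>e c. E.AH.slice c (\<tau> a) \<otimes>\<^bsub>A\<^esub> actE e b) dE"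
      unfolding ED.lin_map_lift[OF E.HH_vectorspace vs_A E.HH.lift_lin[OF vs_A eb] Rb d]
      by (rule ED.lift_cong[OF d]) (simp add: vs_A eb \<xi>c \<xi> a)
    also have "\<dots> = E.galois_map (tensor_lift E.AH.T (\<lambda>e c. E.AH.pure (E.AH.slice c (\<tau> a)) e) dE) b"
      unfolding ED.lin_map_lift[OF E.AH.tensor_vectorspace vs_A E.galois_map_lin(1)[OF b] sb d]
      by (rule ED.lift_cong[OF d])
        (simp add: E.galois_map_pure b lin_map_closed[OF E.AH.slice_dual_lin[OF t]])
    finally show ?thesis by (simp add: E.AH.tensor_slices[OF dE t] \<tau> a b)
  qed
  moreover have "?R \<in> carrier (tensor K E E)" by (rule ED.lift_closed[OF E.HH_vectorspace Rb d])
  ultimately show ?thesis by blast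
qed

end

section \<open>Transfer of quasitriangular structures\<close>

context bialgebra
begin

lemma swap_mult:
  assumes s: "s \<in> carrier HH.T" and t: "t \<in> carrier HH.T"
  shows "tensor_swap K H H (s \<otimes>\<^bsub>HH.T\<^esub> t) = tensor_swap K H H s \<otimes>\<^bsub>HH.T\<^esub> tensor_swap K H H t"
proof (rule HH.tensor_ext[OF HH_vectorspace _ _ s])
  note ml = bilin_map_left[OF HH.mult_bilin] and mr = bilin_map_right[OF HH.mult_bilin]
  show "lin_map K HH.T HH.T (\<lambda>s. tensor_swap K H H (s \<otimes>\<^bsub>HH.T\<^esub> t))"
    by (rule lin_map_comp[OF ml[OF t] HH.swap_lin])
  show "lin_map K HH.T HH.T (\<lambda>s. tensor_swap K H H s \<otimes>\<^bsub>HH.T\<^esub> tensor_swap K H H t)"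
    by (rule lin_map_comp[OF HH.swap_lin ml[OF swap_closed[OF t]]])
  fix a b assume ab: "a \<in> carrier H" "b \<in> carrier H"
  show "tensor_swap K H H (HH.pure a b \<otimes>\<^bsub>HH.T\<^esub> t) =
      tensor_swap K H H (HH.pure a b) \<otimes>\<^bsub>HH.T\<^esub> tensor_swap K H H t"
    by (rule HH.tensor_ext[OF HH_vectorspace lin_map_comp[OF mr HH.swap_lin]
          lin_map_comp[OF HH.swap_lin mr] t])
      (simp_all add: ab HH.mult_pure HH.swap_pure)
qed

text \<open>
  Interchanging the factors turns \<open>R R\<^sub>2\<^sub>1 = 1\<close> into \<open>R\<^sub>2\<^sub>1 R = 1\<close>, so either equation says that
  \<open>R\<^sub>2\<^sub>1\<close> is the inverse of \<open>R\<close>.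
\<close>

lemma triangular_iff:
  "triangular K H \<Delta> \<epsilon> R \<longleftrightarrow>
    quasitriangular K H \<Delta> \<epsilon> R \<and> R \<otimes>\<^bsub>HH.T\<^esub> tensor_swap K H H R = HH.pure \<one>\<^bsub>H\<^esub> \<one>\<^bsub>H\<^esub>"
proof -
  interpret M: monoid HH.T by (rule HH.tensor_monoid)
  have one: "\<one>\<^bsub>HH.T\<^esub> = HH.pure \<one>\<^bsub>H\<^esub> \<one>\<^bsub>H\<^esub>" by (simp add: tensor_def)
  show ?thesis
  proof
    assume "triangular K H \<Delta> \<epsilon> R"
    then have "quasitriangular K H \<Delta> \<epsilon> R" "R \<in> Units HH.T" "inv\<^bsub>HH.T\<^esub> R = tensor_swap K H H R"
      by (simp_all add: triangular_def)
    then show "quasitriangular K H \<Delta> \<epsilon> R \<and> R \<otimes>\<^bsub>HH.T\<^esub> tensor_swap K H H R = HH.pure \<one>\<^bsub>H\<^esub> \<one>\<^bsub>H\<^esub>"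
      using M.Units_r_inv[of R] by (simp add: one)
  next
    assume *: "quasitriangular K H \<Delta> \<epsilon> R \<and> R \<otimes>\<^bsub>HH.T\<^esub> tensor_swap K H H R = HH.pure \<one>\<^bsub>H\<^esub> \<one>\<^bsub>H\<^esub>"
    have R: "R \<in> carrier HH.T" using * quasitriangular_closed by blast
    note S = swap_closed[OF R]
    have 1: "R \<otimes>\<^bsub>HH.T\<^esub> tensor_swap K H H R = \<one>\<^bsub>HH.T\<^esub>" using * by (simp add: one)
    have "tensor_swap K H H (R \<otimes>\<^bsub>HH.T\<^esub> tensor_swap K H H R) = tensor_swap K H H \<one>\<^bsub>HH.T\<^esub>"
      unfolding 1 ..
    then have 2: "tensor_swap K H H R \<otimes>\<^bsub>HH.T\<^esub> R = \<one>\<^bsub>HH.T\<^esub>"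
      by (simp add: swap_mult R S HH.swap_swap one HH.swap_pure)
    have "R \<in> Units HH.T" using 1 2 R S by (auto simp: Units_def)
    moreover have "inv\<^bsub>HH.T\<^esub> R = tensor_swap K H H R"
      by (rule M.inv_unique'[OF R S 1 2, symmetric])
    ultimately show "triangular K H \<Delta> \<epsilon> R" using * by (simp add: triangular_def)
  qed
qed

end

text \<open>
  The axioms for \<open>R'\<close> may be verified on elements of \<open>A\<close>, because evaluation separates tensors over
  \<open>E\<close>.  There the relation translates them into the axioms for \<open>R\<close>.
\<close>
locale related_elements = commuting_actions K H \<Delta> \<epsilon> S A act E \<Delta>\<^sub>E \<epsilon>\<^sub>E S\<^sub>E actE +
  EG: galois_action K E \<Delta>\<^sub>E \<epsilon>\<^sub>E S\<^sub>E A actE dE dA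
  for K :: "'k ring" and H :: "('k, 'h) module" and \<Delta> \<epsilon> S and A :: "('k, 'a) module" and act
    and E :: "('k, 'e) module" and \<Delta>\<^sub>E \<epsilon>\<^sub>E S\<^sub>E and actE and dE dA +
  fixes R R'
  assumes R: "R \<in> carrier (tensor K H H)" and R': "R' \<in> carrier (tensor K E E)"
    and rel: "\<And>a b. \<lbrakk>a \<in> carrier A; b \<in> carrier A\<rbrakk> \<Longrightarrow>
      tensor_lift A (\<lambda>x y. actE y a \<otimes>\<^bsub>A\<^esub> actE x b) R' = tensor_lift A (\<lambda>x y. act y b \<otimes>\<^bsub>A\<^esub> act x a) R"
begin

lemmas closed = H.act_closed E.act_closed H.A.m_closed

text \<open>
  Evaluated at \<open>a\<close> and \<open>b\<close>, both sides are \<open>\<phi>\<close> applied to the common value of the relation: the left-hand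
  side directly, the right-hand side because the relation turns \<open>R'\<close> into \<open>R\<close>, whose action commutes
  with that of \<open>E\<close>.
\<close>
lemma related_comm:
  assumes \<phi>: "\<phi> \<in> carrier E"
  shows "tensor_swap K E E (\<Delta>\<^sub>E \<phi>) \<otimes>\<^bsub>tensor K E E\<^esub> R' = R' \<otimes>\<^bsub>tensor K E E\<^esub> \<Delta>\<^sub>E \<phi>"
proof (rule EG.swapped_eval2_eqI)
  note d = E.comult_closed[OF \<phi>]
  show "tensor_swap K E E (\<Delta>\<^sub>E \<phi>) \<otimes>\<^bsub>tensor K E E\<^esub> R' \<in> carrier E.HH.T"
    "R' \<otimes>\<^bsub>tensor K E E\<^esub> \<Delta>\<^sub>E \<phi> \<in> carrier E.HH.T"
    by (intro bilin_map_closed[OF E.HH.mult_bilin] E.swap_closed d R')+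
  fix a b assume a: "a \<in> carrier A" and b: "b \<in> carrier A"
  have B: "bilin_map K E E A (\<lambda>x y. actE y a \<otimes>\<^bsub>A\<^esub> actE x b)" by (intro multilin a b; assumption)
  have B': "bilin_map K H H A (\<lambda>x y. act y b \<otimes>\<^bsub>A\<^esub> act x a)" by (intro multilin a b; assumption)
  let ?r = "tensor_lift A (\<lambda>x y. act y b \<otimes>\<^bsub>A\<^esub> act x a) R"
  have "tensor_lift A (\<lambda>x y. actE y a \<otimes>\<^bsub>A\<^esub> actE x b) (tensor_swap K E E (\<Delta>\<^sub>E \<phi>) \<otimes>\<^bsub>tensor K E E\<^esub> R') =
    tensor_lift A (\<lambda>p q. tensor_lift A (\<lambda>x y. actE (p \<otimes>\<^bsub>E\<^esub> y) a \<otimes>\<^bsub>A\<^esub> actE (q \<otimes>\<^bsub>E\<^esub> x) b) R') (\<Delta>\<^sub>E \<phi>)"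
    by (rule E.lift_opposite_mult[OF vs_A B R' \<phi>])
  also have "\<dots> = tensor_lift A (\<lambda>x y. tensor_lift A (\<lambda>p q. actE (p \<otimes>\<^bsub>E\<^esub> y) a \<otimes>\<^bsub>A\<^esub> actE (q \<otimes>\<^bsub>E\<^esub> x) b) (\<Delta>\<^sub>E \<phi>)) R'"
    by (rule lift_swap[OF vs_E vs_E vs_E vs_E vs_A d R']) (intro multilin a b; assumption)+
  also have "\<dots> = tensor_lift A (\<lambda>x y. actE \<phi> (actE y a \<otimes>\<^bsub>A\<^esub> actE x b)) R'"
  proof (rule E.HH.lift_cong[OF R'])
    fix x y assume xy: "x \<in> carrier E" "y \<in> carrier E"
    have "tensor_lift A (\<lambda>p q. actE (p \<otimes>\<^bsub>E\<^esub> y) a \<otimes>\<^bsub>A\<^esub> actE (q \<otimes>\<^bsub>E\<^esub> x) b) (\<Delta>\<^sub>E \<phi>) =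
      tensor_lift A (\<lambda>p q. actE p (actE y a) \<otimes>\<^bsub>A\<^esub> actE q (actE x b)) (\<Delta>\<^sub>E \<phi>)"
      by (rule E.HH.lift_cong[OF d]) (simp add: E.act_mult xy a b)
    then show "tensor_lift A (\<lambda>p q. actE (p \<otimes>\<^bsub>E\<^esub> y) a \<otimes>\<^bsub>A\<^esub> actE (q \<otimes>\<^bsub>E\<^esub> x) b) (\<Delta>\<^sub>E \<phi>) =
      actE \<phi> (actE y a \<otimes>\<^bsub>A\<^esub> actE x b)" by (simp add: E.act_product_lift \<phi> closed xy a b)
  qed
  also have "\<dots> = actE \<phi> ?r"
    unfolding rel[OF a b, symmetric]
    by (rule E.HH.lin_map_lift[OF vs_A vs_A E.act_linear[OF \<phi>] B R', symmetric])
  finally have left: "tensor_lift A (\<lambda>x y. actE y a \<otimes>\<^bsub>A\<^esub> actE x b)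
    (tensor_swap K E E (\<Delta>\<^sub>E \<phi>) \<otimes>\<^bsub>tensor K E E\<^esub> R') = actE \<phi> ?r" .
  have "tensor_lift A (\<lambda>x y. actE y a \<otimes>\<^bsub>A\<^esub> actE x b) (R' \<otimes>\<^bsub>tensor K E E\<^esub> \<Delta>\<^sub>E \<phi>) =
    tensor_lift A (\<lambda>x y. tensor_lift A (\<lambda>p q. actE (y \<otimes>\<^bsub>E\<^esub> q) a \<otimes>\<^bsub>A\<^esub> actE (x \<otimes>\<^bsub>E\<^esub> p) b) (\<Delta>\<^sub>E \<phi>)) R'"
    by (rule E.HH.lift_mult[OF vs_A B R' d])
  also have "\<dots> = tensor_lift A (\<lambda>p q. tensor_lift A (\<lambda>x y. actE (y \<otimes>\<^bsub>E\<^esub> q) a \<otimes>\<^bsub>A\<^esub> actE (x \<otimes>\<^bsub>E\<^esub> p) b) R') (\<Delta>\<^sub>E \<phi>)"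
    by (rule lift_swap[OF vs_E vs_E vs_E vs_E vs_A R' d]) (intro multilin a b; assumption)+
  also have "\<dots> = tensor_lift A (\<lambda>p q. tensor_lift A (\<lambda>x y. actE p (act y b) \<otimes>\<^bsub>A\<^esub> actE q (act x a)) R) (\<Delta>\<^sub>E \<phi>)"
  proof (rule E.HH.lift_cong[OF d])
    fix p q assume pq: "p \<in> carrier E" "q \<in> carrier E"
    have "tensor_lift A (\<lambda>x y. actE (y \<otimes>\<^bsub>E\<^esub> q) a \<otimes>\<^bsub>A\<^esub> actE (x \<otimes>\<^bsub>E\<^esub> p) b) R' =
      tensor_lift A (\<lambda>x y. actE y (actE q a) \<otimes>\<^bsub>A\<^esub> actE x (actE p b)) R'"
      by (rule E.HH.lift_cong[OF R']) (simp add: E.act_mult pq a b)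
    also have "\<dots> = tensor_lift A (\<lambda>x y. act y (actE p b) \<otimes>\<^bsub>A\<^esub> act x (actE q a)) R"
      by (rule rel) (simp_all add: closed pq a b)
    also have "\<dots> = tensor_lift A (\<lambda>x y. actE p (act y b) \<otimes>\<^bsub>A\<^esub> actE q (act x a)) R"
      by (rule H.HH.lift_cong[OF R]) (simp add: commute pq a b)
    finally show "tensor_lift A (\<lambda>x y. actE (y \<otimes>\<^bsub>E\<^esub> q) a \<otimes>\<^bsub>A\<^esub> actE (x \<otimes>\<^bsub>E\<^esub> p) b) R' =
      tensor_lift A (\<lambda>x y. actE p (act y b) \<otimes>\<^bsub>A\<^esub> actE q (act x a)) R" .
  qed
  also have "\<dots> = tensor_lift A (\<lambda>x y. tensor_lift A (\<lambda>p q. actE p (act y b) \<otimes>\<^bsub>A\<^esub> actE q (act x a)) (\<Delta>\<^sub>E \<phi>)) R"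
    by (rule lift_swap[OF vs_E vs_E vs_H vs_H vs_A d R]) (intro multilin a b; assumption)+
  also have "\<dots> = tensor_lift A (\<lambda>x y. actE \<phi> (act y b \<otimes>\<^bsub>A\<^esub> act x a)) R"
    by (rule H.HH.lift_cong[OF R]) (simp add: E.act_product_lift \<phi> closed a b)
  also have "\<dots> = actE \<phi> ?r"
    by (rule H.HH.lin_map_lift[OF vs_A vs_A E.act_linear[OF \<phi>] B' R, symmetric])
  finally show "tensor_lift A (\<lambda>x y. actE y a \<otimes>\<^bsub>A\<^esub> actE x b) (tensor_swap K E E (\<Delta>\<^sub>E \<phi>) \<otimes>\<^bsub>tensor K E E\<^esub> R') =
    tensor_lift A (\<lambda>x y. actE y a \<otimes>\<^bsub>A\<^esub> actE x b) (R' \<otimes>\<^bsub>tensor K E E\<^esub> \<Delta>\<^sub>E \<phi>)"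
    unfolding left by (rule HOL.sym)
qed

lemma E_eq_one:
  assumes "\<phi> \<in> carrier E" "\<And>a. a \<in> carrier A \<Longrightarrow> actE \<phi> a = a"
  shows "\<phi> = \<one>\<^bsub>E\<^esub>"
proof (rule lin_map_family_injI[where I = "carrier A" and F = "\<lambda>a \<phi>. actE \<phi> a",
      OF vs_E vs_A _ EG.act_faithful assms(1) E.one_closed])
  show "lin_map K E A (\<lambda>\<phi>. actE \<phi> a)" if "a \<in> carrier A" for a
    by (rule E.act_lin_op[OF that lin_map_id])
qed (simp_all add: assms(2) E.act_one)

text \<open>
  The relation with one of its arguments equal to \<open>1\<close>, on which both algebras act by their counits.
\<close>
lemma related_counit:
  assumes q: "quasitriangular K H \<Delta> \<epsilon> R"
  shows "tensor_lift E (\<lambda>x y. \<epsilon>\<^sub>E x \<odot>\<^bsub>E\<^esub> y) R' = \<one>\<^bsub>E\<^esub>"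
    and "tensor_lift E (\<lambda>x y. \<epsilon>\<^sub>E y \<odot>\<^bsub>E\<^esub> x) R' = \<one>\<^bsub>E\<^esub>"
proof -
  show "tensor_lift E (\<lambda>x y. \<epsilon>\<^sub>E x \<odot>\<^bsub>E\<^esub> y) R' = \<one>\<^bsub>E\<^esub>"
  proof (rule E_eq_one[OF E.HH.lift_closed[OF vs_E E.counit_left_bilin R']])
    fix a assume a: "a \<in> carrier A"
    have "actE (tensor_lift E (\<lambda>x y. \<epsilon>\<^sub>E x \<odot>\<^bsub>E\<^esub> y) R') a = tensor_lift A (\<lambda>x y. actE (\<epsilon>\<^sub>E x \<odot>\<^bsub>E\<^esub> y) a) R'"
      by (rule E.HH.lin_map_lift[OF vs_E vs_A E.act_lin_op[OF a lin_map_id] E.counit_left_bilin R'])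
    also have "\<dots> = tensor_lift A (\<lambda>x y. actE y a \<otimes>\<^bsub>A\<^esub> actE x \<one>\<^bsub>A\<^esub>) R'"
      by (rule E.HH.lift_cong[OF R'])
        (simp add: E.act_unit E.act_smult E.counit_closed a closed H.A.smult_mult_right)
    also have "\<dots> = tensor_lift A (\<lambda>x y. act y \<one>\<^bsub>A\<^esub> \<otimes>\<^bsub>A\<^esub> act x a) R"
      by (rule rel[OF a H.A.one_closed])
    also have "\<dots> = tensor_lift A (\<lambda>x y. \<epsilon> y \<odot>\<^bsub>A\<^esub> act x a) R"
      by (rule H.HH.lift_cong[OF R]) (simp add: H.act_unit H.counit_closed a closed H.A.smult_mult_left)
    also have "\<dots> = act \<one>\<^bsub>H\<^esub> a"
      by (rule H.quasitriangular_counit(2)[OF q vs_A H.act_lin_op[OF a lin_map_id]])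
    finally show "actE (tensor_lift E (\<lambda>x y. \<epsilon>\<^sub>E x \<odot>\<^bsub>E\<^esub> y) R') a = a" by (simp add: H.act_one a)
  qed
  show "tensor_lift E (\<lambda>x y. \<epsilon>\<^sub>E y \<odot>\<^bsub>E\<^esub> x) R' = \<one>\<^bsub>E\<^esub>"
  proof (rule E_eq_one[OF E.HH.lift_closed[OF vs_E E.counit_right_bilin R']])
    fix a assume a: "a \<in> carrier A"
    have "actE (tensor_lift E (\<lambda>x y. \<epsilon>\<^sub>E y \<odot>\<^bsub>E\<^esub> x) R') a = tensor_lift A (\<lambda>x y. actE (\<epsilon>\<^sub>E y \<odot>\<^bsub>E\<^esub> x) a) R'"
      by (rule E.HH.lin_map_lift[OF vs_E vs_A E.act_lin_op[OF a lin_map_id] E.counit_right_bilin R'])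
    also have "\<dots> = tensor_lift A (\<lambda>x y. actE y \<one>\<^bsub>A\<^esub> \<otimes>\<^bsub>A\<^esub> actE x a) R'"
      by (rule E.HH.lift_cong[OF R'])
        (simp add: E.act_unit E.act_smult E.counit_closed a closed H.A.smult_mult_left)
    also have "\<dots> = tensor_lift A (\<lambda>x y. act y a \<otimes>\<^bsub>A\<^esub> act x \<one>\<^bsub>A\<^esub>) R"
      by (rule rel[OF H.A.one_closed a])
    also have "\<dots> = tensor_lift A (\<lambda>x y. \<epsilon> x \<odot>\<^bsub>A\<^esub> act y a) R"
      by (rule H.HH.lift_cong[OF R]) (simp add: H.act_unit H.counit_closed a closed H.A.smult_mult_right)
    also have "\<dots> = act \<one>\<^bsub>H\<^esub> a"
      by (rule H.quasitriangular_counit(1)[OF q vs_A H.act_lin_op[OF a lin_map_id]])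
    finally show "actE (tensor_lift E (\<lambda>x y. \<epsilon>\<^sub>E y \<odot>\<^bsub>E\<^esub> x) R') a = a" by (simp add: H.act_one a)
  qed
qed

end

context related_elements
begin

lemmas swapRR = lift_swap[OF vs_H vs_H vs_H vs_H vs_A R R]
  and swapR'R' = lift_swap[OF vs_E vs_E vs_E vs_E vs_A R' R']
  and swapR'R = lift_swap[OF vs_E vs_E vs_H vs_H vs_A R' R]

lemma rel_bilin:
  assumes "a \<in> carrier A" "b \<in> carrier A"
  shows "bilin_map K E E A (\<lambda>x y. actE y a \<otimes>\<^bsub>A\<^esub> actE x b)"
    and "bilin_map K H H A (\<lambda>x y. act y b \<otimes>\<^bsub>A\<^esub> act x a)"
  by (intro multilin assms; assumption)+

lemma rel_mult:
  assumes a: "a \<in> carrier A" and b: "b \<in> carrier A" and c: "c \<in> carrier A"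
  shows "tensor_lift A (\<lambda>x y. (actE y a \<otimes>\<^bsub>A\<^esub> actE x b) \<otimes>\<^bsub>A\<^esub> c) R' =
      tensor_lift A (\<lambda>x y. (act y b \<otimes>\<^bsub>A\<^esub> act x a) \<otimes>\<^bsub>A\<^esub> c) R"
    and "tensor_lift A (\<lambda>x y. c \<otimes>\<^bsub>A\<^esub> (actE y a \<otimes>\<^bsub>A\<^esub> actE x b)) R' =
      tensor_lift A (\<lambda>x y. c \<otimes>\<^bsub>A\<^esub> (act y b \<otimes>\<^bsub>A\<^esub> act x a)) R"
proof -
  note l = H.A_mult_lin[OF c lin_map_id]
  note E' = E.HH.lin_map_lift[OF vs_A vs_A _ rel_bilin(1)[OF a b] R']
    and H' = H.HH.lin_map_lift[OF vs_A vs_A _ rel_bilin(2)[OF a b] R]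
  show "tensor_lift A (\<lambda>x y. (actE y a \<otimes>\<^bsub>A\<^esub> actE x b) \<otimes>\<^bsub>A\<^esub> c) R' =
      tensor_lift A (\<lambda>x y. (act y b \<otimes>\<^bsub>A\<^esub> act x a) \<otimes>\<^bsub>A\<^esub> c) R"
    unfolding E'[OF l(2), symmetric] H'[OF l(2), symmetric] by (simp only: rel[OF a b])
  show "tensor_lift A (\<lambda>x y. c \<otimes>\<^bsub>A\<^esub> (actE y a \<otimes>\<^bsub>A\<^esub> actE x b)) R' =
      tensor_lift A (\<lambda>x y. c \<otimes>\<^bsub>A\<^esub> (act y b \<otimes>\<^bsub>A\<^esub> act x a)) R"
    unfolding E'[OF l(1), symmetric] H'[OF l(1), symmetric] by (simp only: rel[OF a b])
qed

lemma embed_closed: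
  "embed12 K E R' \<in> carrier EG.HHH" "embed13 K E R' \<in> carrier EG.HHH" "embed23 K E R' \<in> carrier EG.HHH"
  unfolding embed12_def embed13_def embed23_def
  by (intro E.HH.lift_closed E.H3.UV_W.tensor_vectorspace E.embed_bilin R')+

text \<open>
  Evaluated at \<open>a, b, c\<close>, both sides become \<open>\<Sum> (r''\<^sub>i b) (r''\<^sub>j c) (r'\<^sub>j r'\<^sub>i a)\<close>.  On the left-hand side \<open>\<Delta>\<close>
  turns into the action on the product \<open>b c\<close>, and the relation at \<open>a\<close> and \<open>b c\<close> leads to the formula for
  \<open>(id \<otimes> \<Delta>) R\<close>.  On the right-hand side the relation is used once for each factor \<open>R'\<close>.
\<close>
lemma related_comult_left:
  assumes q: "quasitriangular K H \<Delta> \<epsilon> R"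
  shows "tensor_map K (tensor K E E) E \<Delta>\<^sub>E id R' = embed13 K E R' \<otimes>\<^bsub>EG.HHH\<^esub> embed23 K E R'"
proof (rule EG.rotated_eval3_eqI)
  show "tensor_map K (tensor K E E) E \<Delta>\<^sub>E id R' \<in> carrier EG.HHH"
    by (rule lin_map_closed[OF E.HH.tensor_map_lin[OF E.comult_lin lin_map_id[folded id_def]
          E.HH_vectorspace vs_E] R'])
  show "embed13 K E R' \<otimes>\<^bsub>EG.HHH\<^esub> embed23 K E R' \<in> carrier EG.HHH"
    by (intro bilin_map_closed[OF E.HH_H.mult_bilin] embed_closed)
  fix a b c assume a: "a \<in> carrier A" and b: "b \<in> carrier A" and c: "c \<in> carrier A"
  note F = EG.eval3_tri(2)[OF a b c]
  have F': "trilin_map K H H H A (\<lambda>x u v. (act u b \<otimes>\<^bsub>A\<^esub> act v c) \<otimes>\<^bsub>A\<^esub> act x a)"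
    by (intro multilin a b c; assumption)
  let ?F = "\<lambda>x y z. (actE z a \<otimes>\<^bsub>A\<^esub> actE x b) \<otimes>\<^bsub>A\<^esub> actE y c"
  let ?M = "tensor_lift A (\<lambda>x y. tensor_lift A (\<lambda>u v. (act y b \<otimes>\<^bsub>A\<^esub> act v c) \<otimes>\<^bsub>A\<^esub> act u (act x a)) R) R"
  have "tri_lift A ?F (tensor_map K (tensor K E E) E \<Delta>\<^sub>E id R') =
    tensor_lift A (\<lambda>x y. tensor_lift A (\<lambda>u v. (actE y a \<otimes>\<^bsub>A\<^esub> actE u b) \<otimes>\<^bsub>A\<^esub> actE v c) (\<Delta>\<^sub>E x)) R'"
    by (rule E.tri_lift_comult_left[OF vs_A F R'])
  also have "\<dots> = tensor_lift A (\<lambda>x y. actE y a \<otimes>\<^bsub>A\<^esub> actE x (b \<otimes>\<^bsub>A\<^esub> c)) R'"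
  proof (rule E.HH.lift_cong[OF R'])
    fix x y assume x: "x \<in> carrier E" and y: "y \<in> carrier E"
    note d = E.comult_closed[OF x]
    have "tensor_lift A (\<lambda>u v. (actE y a \<otimes>\<^bsub>A\<^esub> actE u b) \<otimes>\<^bsub>A\<^esub> actE v c) (\<Delta>\<^sub>E x) =
      tensor_lift A (\<lambda>u v. actE y a \<otimes>\<^bsub>A\<^esub> (actE u b \<otimes>\<^bsub>A\<^esub> actE v c)) (\<Delta>\<^sub>E x)"
      by (rule E.HH.lift_cong[OF d]) (simp add: H.A.m_assoc closed y a b c)
    also have "\<dots> = actE y a \<otimes>\<^bsub>A\<^esub> tensor_lift A (\<lambda>u v. actE u b \<otimes>\<^bsub>A\<^esub> actE v c) (\<Delta>\<^sub>E x)"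
      by (rule E.HH.lin_map_lift[OF vs_A vs_A H.A_mult_lin(1)[OF E.act_closed[OF y a] lin_map_id] _ d, symmetric])
        (intro multilin b c; assumption)
    finally show "tensor_lift A (\<lambda>u v. (actE y a \<otimes>\<^bsub>A\<^esub> actE u b) \<otimes>\<^bsub>A\<^esub> actE v c) (\<Delta>\<^sub>E x) =
      actE y a \<otimes>\<^bsub>A\<^esub> actE x (b \<otimes>\<^bsub>A\<^esub> c)" by (simp add: E.act_product_lift x b c)
  qed
  also have "\<dots> = tensor_lift A (\<lambda>x y. act y (b \<otimes>\<^bsub>A\<^esub> c) \<otimes>\<^bsub>A\<^esub> act x a) R"
    by (rule rel[OF a]) (simp add: b c)
  also have "\<dots> = tensor_lift A (\<lambda>x y. tensor_lift A (\<lambda>u v. (act u b \<otimes>\<^bsub>A\<^esub> act v c) \<otimes>\<^bsub>A\<^esub> act x a) (\<Delta> y)) R"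
  proof (rule H.HH.lift_cong[OF R])
    fix x y assume x: "x \<in> carrier H" and y: "y \<in> carrier H"
    show "act y (b \<otimes>\<^bsub>A\<^esub> c) \<otimes>\<^bsub>A\<^esub> act x a =
        tensor_lift A (\<lambda>u v. (act u b \<otimes>\<^bsub>A\<^esub> act v c) \<otimes>\<^bsub>A\<^esub> act x a) (\<Delta> y)"
      unfolding H.act_product[OF y b c]
      by (rule H.HH.lin_map_lift[OF vs_A vs_A H.A_mult_lin(2)[OF H.act_closed[OF x a] lin_map_id] _
            H.comult_closed[OF y]]) (intro multilin b c; assumption)
  qed
  also have "\<dots> = tensor_lift A (\<lambda>x y. tensor_lift A
      (\<lambda>u v. (act v b \<otimes>\<^bsub>A\<^esub> act y c) \<otimes>\<^bsub>A\<^esub> act (x \<otimes>\<^bsub>H\<^esub> u) a) R) R"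
    by (rule H.quasitriangular_comult_right[OF q vs_A F'])
  also have "\<dots> = tensor_lift A (\<lambda>u v. tensor_lift A
      (\<lambda>x y. (act v b \<otimes>\<^bsub>A\<^esub> act y c) \<otimes>\<^bsub>A\<^esub> act (x \<otimes>\<^bsub>H\<^esub> u) a) R) R"
    by (rule swapRR) (intro multilin a b c; assumption)+
  also have "\<dots> = ?M"
    by (rule H.HH.lift_cong[OF R], rule H.HH.lift_cong[OF R]) (simp add: H.act_mult a)
  finally have left: "tri_lift A ?F (tensor_map K (tensor K E E) E \<Delta>\<^sub>E id R') = ?M" .
  have "tri_lift A ?F (embed13 K E R' \<otimes>\<^bsub>EG.HHH\<^esub> embed23 K E R') =
    tensor_lift A (\<lambda>x y. tensor_lift A
      (\<lambda>u v. (actE (y \<otimes>\<^bsub>E\<^esub> v) a \<otimes>\<^bsub>A\<^esub> actE x b) \<otimes>\<^bsub>A\<^esub> actE u c) R') R'"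
    by (rule E.tri_lift_embed13_embed23[OF vs_A F R' R'])
  also have "\<dots> = tensor_lift A (\<lambda>u v. tensor_lift A
      (\<lambda>x y. (actE (y \<otimes>\<^bsub>E\<^esub> v) a \<otimes>\<^bsub>A\<^esub> actE x b) \<otimes>\<^bsub>A\<^esub> actE u c) R') R'"
    by (rule swapR'R') (intro multilin a b c; assumption)+
  also have "\<dots> = tensor_lift A (\<lambda>u v. tensor_lift A
      (\<lambda>x y. act y b \<otimes>\<^bsub>A\<^esub> (actE v (act x a) \<otimes>\<^bsub>A\<^esub> actE u c)) R) R'"
  proof (rule E.HH.lift_cong[OF R'])
    fix u v assume u: "u \<in> carrier E" and v: "v \<in> carrier E"
    have "tensor_lift A (\<lambda>x y. (actE (y \<otimes>\<^bsub>E\<^esub> v) a \<otimes>\<^bsub>A\<^esub> actE x b) \<otimes>\<^bsub>A\<^esub> actE u c) R' =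
      tensor_lift A (\<lambda>x y. (actE y (actE v a) \<otimes>\<^bsub>A\<^esub> actE x b) \<otimes>\<^bsub>A\<^esub> actE u c) R'"
      by (rule E.HH.lift_cong[OF R']) (simp add: E.act_mult v a)
    also have "\<dots> = tensor_lift A (\<lambda>x y. (act y b \<otimes>\<^bsub>A\<^esub> act x (actE v a)) \<otimes>\<^bsub>A\<^esub> actE u c) R"
      by (rule rel_mult(1)[OF E.act_closed[OF v a] b E.act_closed[OF u c]])
    also have "\<dots> = tensor_lift A (\<lambda>x y. act y b \<otimes>\<^bsub>A\<^esub> (actE v (act x a) \<otimes>\<^bsub>A\<^esub> actE u c)) R"
      by (rule H.HH.lift_cong[OF R]) (simp add: commute H.A.m_assoc closed u v a b c)
    finally show "tensor_lift A (\<lambda>x y. (actE (y \<otimes>\<^bsub>E\<^esub> v) a \<otimes>\<^bsub>A\<^esub> actE x b) \<otimes>\<^bsub>A\<^esub> actE u c) R' =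
      tensor_lift A (\<lambda>x y. act y b \<otimes>\<^bsub>A\<^esub> (actE v (act x a) \<otimes>\<^bsub>A\<^esub> actE u c)) R" .
  qed
  also have "\<dots> = tensor_lift A (\<lambda>x y. tensor_lift A
      (\<lambda>u v. act y b \<otimes>\<^bsub>A\<^esub> (actE v (act x a) \<otimes>\<^bsub>A\<^esub> actE u c)) R') R"
    by (rule swapR'R) (intro multilin a b c; assumption)+
  also have "\<dots> = ?M"
  proof (rule H.HH.lift_cong[OF R])
    fix x y assume x: "x \<in> carrier H" and y: "y \<in> carrier H"
    have "tensor_lift A (\<lambda>u v. act y b \<otimes>\<^bsub>A\<^esub> (actE v (act x a) \<otimes>\<^bsub>A\<^esub> actE u c)) R' =
      tensor_lift A (\<lambda>u v. act y b \<otimes>\<^bsub>A\<^esub> (act v c \<otimes>\<^bsub>A\<^esub> act u (act x a))) R"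
      by (rule rel_mult(2)[OF H.act_closed[OF x a] c H.act_closed[OF y b]])
    also have "\<dots> = tensor_lift A (\<lambda>u v. (act y b \<otimes>\<^bsub>A\<^esub> act v c) \<otimes>\<^bsub>A\<^esub> act u (act x a)) R"
      by (rule H.HH.lift_cong[OF R]) (simp add: H.A.m_assoc closed x y a b c)
    finally show "tensor_lift A (\<lambda>u v. act y b \<otimes>\<^bsub>A\<^esub> (actE v (act x a) \<otimes>\<^bsub>A\<^esub> actE u c)) R' =
      tensor_lift A (\<lambda>u v. (act y b \<otimes>\<^bsub>A\<^esub> act v c) \<otimes>\<^bsub>A\<^esub> act u (act x a)) R" .
  qed
  finally show "tri_lift A ?F (tensor_map K (tensor K E E) E \<Delta>\<^sub>E id R') =
      tri_lift A ?F (embed13 K E R' \<otimes>\<^bsub>EG.HHH\<^esub> embed23 K E R')"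
    unfolding left by (rule HOL.sym)
qed

text \<open>
  As before, now with the action on the product \<open>a b\<close> and the formula for \<open>(\<Delta> \<otimes> id) R\<close>; the common value
  is \<open>\<Sum> (r''\<^sub>j r''\<^sub>i c) (r'\<^sub>j a) (r'\<^sub>i b)\<close>.
\<close>
lemma related_comult_right:
  assumes q: "quasitriangular K H \<Delta> \<epsilon> R"
  shows "tensor_unassoc K E E E (tensor_map K E (tensor K E E) id \<Delta>\<^sub>E R') =
    embed13 K E R' \<otimes>\<^bsub>EG.HHH\<^esub> embed12 K E R'"
proof (rule EG.rotated_eval3_eqI')
  show "tensor_unassoc K E E E (tensor_map K E (tensor K E E) id \<Delta>\<^sub>E R') \<in> carrier EG.HHH"
    by (rule lin_map_closed[OF lin_map_comp[OF E.HH.tensor_map_lin[OF lin_map_id[folded id_def]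
            E.comult_lin vs_E E.HH_vectorspace] E.H3.unassoc_lin] R'])
  show "embed13 K E R' \<otimes>\<^bsub>EG.HHH\<^esub> embed12 K E R' \<in> carrier EG.HHH"
    by (intro bilin_map_closed[OF E.HH_H.mult_bilin] embed_closed)
  fix a b c assume a: "a \<in> carrier A" and b: "b \<in> carrier A" and c: "c \<in> carrier A"
  note F = EG.eval3_tri(3)[OF a b c]
  have F': "trilin_map K H H H A (\<lambda>u v y. act y c \<otimes>\<^bsub>A\<^esub> (act u a \<otimes>\<^bsub>A\<^esub> act v b))"
    by (intro multilin a b c; assumption)
  let ?F = "\<lambda>x y z. (actE y a \<otimes>\<^bsub>A\<^esub> actE z b) \<otimes>\<^bsub>A\<^esub> actE x c"
  let ?M = "tensor_lift A (\<lambda>x y. tensor_lift A (\<lambda>u v. (act v (act y c) \<otimes>\<^bsub>A\<^esub> act u a) \<otimes>\<^bsub>A\<^esub> act x b) R) R"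
  have "tri_lift A ?F (tensor_unassoc K E E E (tensor_map K E (tensor K E E) id \<Delta>\<^sub>E R')) =
    tensor_lift A (\<lambda>x y. tensor_lift A (\<lambda>u v. (actE u a \<otimes>\<^bsub>A\<^esub> actE v b) \<otimes>\<^bsub>A\<^esub> actE x c) (\<Delta>\<^sub>E y)) R'"
    by (rule E.tri_lift_comult_right[OF vs_A F R'])
  also have "\<dots> = tensor_lift A (\<lambda>x y. actE y (a \<otimes>\<^bsub>A\<^esub> b) \<otimes>\<^bsub>A\<^esub> actE x c) R'"
  proof (rule E.HH.lift_cong[OF R'])
    fix x y assume x: "x \<in> carrier E" and y: "y \<in> carrier E"
    show "tensor_lift A (\<lambda>u v. (actE u a \<otimes>\<^bsub>A\<^esub> actE v b) \<otimes>\<^bsub>A\<^esub> actE x c) (\<Delta>\<^sub>E y) =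
        actE y (a \<otimes>\<^bsub>A\<^esub> b) \<otimes>\<^bsub>A\<^esub> actE x c"
      unfolding E.act_product[OF y a b]
      by (rule E.HH.lin_map_lift[OF vs_A vs_A H.A_mult_lin(2)[OF E.act_closed[OF x c] lin_map_id] _
            E.comult_closed[OF y], symmetric]) (intro multilin a b; assumption)
  qed
  also have "\<dots> = tensor_lift A (\<lambda>x y. act y c \<otimes>\<^bsub>A\<^esub> act x (a \<otimes>\<^bsub>A\<^esub> b)) R"
    by (rule rel[OF _ c]) (simp add: a b)
  also have "\<dots> = tensor_lift A (\<lambda>x y. tensor_lift A (\<lambda>u v. act y c \<otimes>\<^bsub>A\<^esub> (act u a \<otimes>\<^bsub>A\<^esub> act v b)) (\<Delta> x)) R"
  proof (rule H.HH.lift_cong[OF R])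
    fix x y assume x: "x \<in> carrier H" and y: "y \<in> carrier H"
    show "act y c \<otimes>\<^bsub>A\<^esub> act x (a \<otimes>\<^bsub>A\<^esub> b) =
        tensor_lift A (\<lambda>u v. act y c \<otimes>\<^bsub>A\<^esub> (act u a \<otimes>\<^bsub>A\<^esub> act v b)) (\<Delta> x)"
      unfolding H.act_product[OF x a b]
      by (rule H.HH.lin_map_lift[OF vs_A vs_A H.A_mult_lin(1)[OF H.act_closed[OF y c] lin_map_id] _
            H.comult_closed[OF x]]) (intro multilin a b; assumption)
  qed
  also have "\<dots> = tensor_lift A (\<lambda>x y. tensor_lift A
      (\<lambda>u v. act (y \<otimes>\<^bsub>H\<^esub> v) c \<otimes>\<^bsub>A\<^esub> (act x a \<otimes>\<^bsub>A\<^esub> act u b)) R) R"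
    by (rule H.quasitriangular_comult_left[OF q vs_A F'])
  also have "\<dots> = tensor_lift A (\<lambda>u v. tensor_lift A
      (\<lambda>x y. act (y \<otimes>\<^bsub>H\<^esub> v) c \<otimes>\<^bsub>A\<^esub> (act x a \<otimes>\<^bsub>A\<^esub> act u b)) R) R"
    by (rule swapRR) (intro multilin a b c; assumption)+
  also have "\<dots> = ?M"
    by (rule H.HH.lift_cong[OF R], rule H.HH.lift_cong[OF R])
      (simp add: H.act_mult H.A.m_assoc closed a b c)
  finally have left: "tri_lift A ?F (tensor_unassoc K E E E (tensor_map K E (tensor K E E) id \<Delta>\<^sub>E R')) = ?M" .
  have "tri_lift A ?F (embed13 K E R' \<otimes>\<^bsub>EG.HHH\<^esub> embed12 K E R') =
    tensor_lift A (\<lambda>x y. tensor_lift A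
      (\<lambda>u v. (actE v a \<otimes>\<^bsub>A\<^esub> actE y b) \<otimes>\<^bsub>A\<^esub> actE (x \<otimes>\<^bsub>E\<^esub> u) c) R') R'"
    by (rule E.tri_lift_embed13_embed12[OF vs_A F R' R'])
  also have "\<dots> = tensor_lift A (\<lambda>u v. tensor_lift A
      (\<lambda>x y. (actE v a \<otimes>\<^bsub>A\<^esub> actE y b) \<otimes>\<^bsub>A\<^esub> actE (x \<otimes>\<^bsub>E\<^esub> u) c) R') R'"
    by (rule swapR'R') (intro multilin a b c; assumption)+
  also have "\<dots> = tensor_lift A (\<lambda>u v. tensor_lift A
      (\<lambda>x y. (actE v a \<otimes>\<^bsub>A\<^esub> actE u (act y c)) \<otimes>\<^bsub>A\<^esub> act x b) R) R'"
  proof (rule E.HH.lift_cong[OF R'])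
    fix u v assume u: "u \<in> carrier E" and v: "v \<in> carrier E"
    have "tensor_lift A (\<lambda>x y. (actE v a \<otimes>\<^bsub>A\<^esub> actE y b) \<otimes>\<^bsub>A\<^esub> actE (x \<otimes>\<^bsub>E\<^esub> u) c) R' =
      tensor_lift A (\<lambda>x y. actE v a \<otimes>\<^bsub>A\<^esub> (actE y b \<otimes>\<^bsub>A\<^esub> actE x (actE u c))) R'"
      by (rule E.HH.lift_cong[OF R']) (simp add: E.act_mult H.A.m_assoc closed u v a b c)
    also have "\<dots> = tensor_lift A (\<lambda>x y. actE v a \<otimes>\<^bsub>A\<^esub> (act y (actE u c) \<otimes>\<^bsub>A\<^esub> act x b)) R"
      by (rule rel_mult(2)[OF b E.act_closed[OF u c] E.act_closed[OF v a]])
    also have "\<dots> = tensor_lift A (\<lambda>x y. (actE v a \<otimes>\<^bsub>A\<^esub> actE u (act y c)) \<otimes>\<^bsub>A\<^esub> act x b) R"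
      by (rule H.HH.lift_cong[OF R]) (simp add: commute H.A.m_assoc closed u v a b c)
    finally show "tensor_lift A (\<lambda>x y. (actE v a \<otimes>\<^bsub>A\<^esub> actE y b) \<otimes>\<^bsub>A\<^esub> actE (x \<otimes>\<^bsub>E\<^esub> u) c) R' =
      tensor_lift A (\<lambda>x y. (actE v a \<otimes>\<^bsub>A\<^esub> actE u (act y c)) \<otimes>\<^bsub>A\<^esub> act x b) R" .
  qed
  also have "\<dots> = tensor_lift A (\<lambda>x y. tensor_lift A
      (\<lambda>u v. (actE v a \<otimes>\<^bsub>A\<^esub> actE u (act y c)) \<otimes>\<^bsub>A\<^esub> act x b) R') R"
    by (rule swapR'R) (intro multilin a b c; assumption)+
  also have "\<dots> = ?M"
    by (rule H.HH.lift_cong[OF R]) (rule rel_mult(1); simp add: closed a b c)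
  finally show "tri_lift A ?F (tensor_unassoc K E E E (tensor_map K E (tensor K E E) id \<Delta>\<^sub>E R')) =
      tri_lift A ?F (embed13 K E R' \<otimes>\<^bsub>EG.HHH\<^esub> embed12 K E R')"
    unfolding left by (rule HOL.sym)
qed

theorem related_quasitriangular:
  "quasitriangular K H \<Delta> \<epsilon> R \<Longrightarrow> quasitriangular K E \<Delta>\<^sub>E \<epsilon>\<^sub>E R'"
  unfolding quasitriangular_def[of K E] Let_def
  using R' related_comm related_counit related_comult_left related_comult_right by blast

text \<open>
  Using the relation once for each of the two factors turns the value of \<open>R' R'\<^sub>2\<^sub>1\<close> at \<open>a\<close> and \<open>b\<close> into
  that of \<open>R R\<^sub>2\<^sub>1\<close>.
\<close>
lemma related_inverse:
  assumes one: "R \<otimes>\<^bsub>H.HH.T\<^esub> tensor_swap K H H R = H.HH.pure \<one>\<^bsub>H\<^esub> \<one>\<^bsub>H\<^esub>"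
  shows "R' \<otimes>\<^bsub>E.HH.T\<^esub> tensor_swap K E E R' = E.HH.pure \<one>\<^bsub>E\<^esub> \<one>\<^bsub>E\<^esub>"
proof (rule EG.swapped_eval2_eqI)
  note S = H.swap_closed[OF R] and S' = E.swap_closed[OF R']
  show "R' \<otimes>\<^bsub>E.HH.T\<^esub> tensor_swap K E E R' \<in> carrier E.HH.T"
    by (rule bilin_map_closed[OF E.HH.mult_bilin R' S'])
  show "E.HH.pure \<one>\<^bsub>E\<^esub> \<one>\<^bsub>E\<^esub> \<in> carrier E.HH.T" by simp
  fix a b assume a: "a \<in> carrier A" and b: "b \<in> carrier A"
  note B = rel_bilin(1)[OF a b] and B' = rel_bilin(2)[OF b a]
  have "tensor_lift A (\<lambda>x y. actE y a \<otimes>\<^bsub>A\<^esub> actE x b) (R' \<otimes>\<^bsub>E.HH.T\<^esub> tensor_swap K E E R') =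
    tensor_lift A (\<lambda>p q. tensor_lift A (\<lambda>c d. actE (q \<otimes>\<^bsub>E\<^esub> d) a \<otimes>\<^bsub>A\<^esub> actE (p \<otimes>\<^bsub>E\<^esub> c) b)
      (tensor_swap K E E R')) R'"
    by (rule E.HH.lift_mult[OF vs_A B R' S'])
  also have "\<dots> = tensor_lift A (\<lambda>p q. tensor_lift A
      (\<lambda>u v. actE (q \<otimes>\<^bsub>E\<^esub> u) a \<otimes>\<^bsub>A\<^esub> actE (p \<otimes>\<^bsub>E\<^esub> v) b) R') R'"
    by (rule E.HH.lift_cong[OF R'], rule E.HH.lift_tensor_swap[OF vs_A _ R'])
      (intro multilin a b; assumption)
  also have "\<dots> = tensor_lift A (\<lambda>u v. tensor_lift A
      (\<lambda>p q. actE (q \<otimes>\<^bsub>E\<^esub> u) a \<otimes>\<^bsub>A\<^esub> actE (p \<otimes>\<^bsub>E\<^esub> v) b) R') R'"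
    by (rule swapR'R') (intro multilin a b; assumption)+
  also have "\<dots> = tensor_lift A (\<lambda>u v. tensor_lift A (\<lambda>p q. actE v (act q b) \<otimes>\<^bsub>A\<^esub> actE u (act p a)) R) R'"
  proof (rule E.HH.lift_cong[OF R'])
    fix u v assume u: "u \<in> carrier E" and v: "v \<in> carrier E"
    have "tensor_lift A (\<lambda>p q. actE (q \<otimes>\<^bsub>E\<^esub> u) a \<otimes>\<^bsub>A\<^esub> actE (p \<otimes>\<^bsub>E\<^esub> v) b) R' =
      tensor_lift A (\<lambda>p q. actE q (actE u a) \<otimes>\<^bsub>A\<^esub> actE p (actE v b)) R'"
      by (rule E.HH.lift_cong[OF R']) (simp add: E.act_mult u v a b)
    also have "\<dots> = tensor_lift A (\<lambda>p q. act q (actE v b) \<otimes>\<^bsub>A\<^esub> act p (actE u a)) R"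
      by (rule rel) (simp_all add: closed u v a b)
    also have "\<dots> = tensor_lift A (\<lambda>p q. actE v (act q b) \<otimes>\<^bsub>A\<^esub> actE u (act p a)) R"
      by (rule H.HH.lift_cong[OF R]) (simp add: commute u v a b)
    finally show "tensor_lift A (\<lambda>p q. actE (q \<otimes>\<^bsub>E\<^esub> u) a \<otimes>\<^bsub>A\<^esub> actE (p \<otimes>\<^bsub>E\<^esub> v) b) R' =
      tensor_lift A (\<lambda>p q. actE v (act q b) \<otimes>\<^bsub>A\<^esub> actE u (act p a)) R" .
  qed
  also have "\<dots> = tensor_lift A (\<lambda>p q. tensor_lift A (\<lambda>u v. actE v (act q b) \<otimes>\<^bsub>A\<^esub> actE u (act p a)) R') R"
    by (rule swapR'R) (intro multilin a b; assumption)+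
  also have "\<dots> = tensor_lift A (\<lambda>p q. tensor_lift A (\<lambda>u v. act (v \<otimes>\<^bsub>H\<^esub> p) a \<otimes>\<^bsub>A\<^esub> act (u \<otimes>\<^bsub>H\<^esub> q) b) R) R"
  proof (rule H.HH.lift_cong[OF R])
    fix p q assume p: "p \<in> carrier H" and q: "q \<in> carrier H"
    have "tensor_lift A (\<lambda>u v. actE v (act q b) \<otimes>\<^bsub>A\<^esub> actE u (act p a)) R' =
      tensor_lift A (\<lambda>u v. act v (act p a) \<otimes>\<^bsub>A\<^esub> act u (act q b)) R"
      by (rule rel) (simp_all add: closed p q a b)
    also have "\<dots> = tensor_lift A (\<lambda>u v. act (v \<otimes>\<^bsub>H\<^esub> p) a \<otimes>\<^bsub>A\<^esub> act (u \<otimes>\<^bsub>H\<^esub> q) b) R"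
      by (rule H.HH.lift_cong[OF R]) (simp add: H.act_mult p q a b)
    finally show "tensor_lift A (\<lambda>u v. actE v (act q b) \<otimes>\<^bsub>A\<^esub> actE u (act p a)) R' =
      tensor_lift A (\<lambda>u v. act (v \<otimes>\<^bsub>H\<^esub> p) a \<otimes>\<^bsub>A\<^esub> act (u \<otimes>\<^bsub>H\<^esub> q) b) R" .
  qed
  also have "\<dots> = tensor_lift A (\<lambda>u v. tensor_lift A (\<lambda>p q. act (v \<otimes>\<^bsub>H\<^esub> p) a \<otimes>\<^bsub>A\<^esub> act (u \<otimes>\<^bsub>H\<^esub> q) b) R) R"
    by (rule swapRR) (intro multilin a b; assumption)+
  also have "\<dots> = tensor_lift A (\<lambda>u v. tensor_lift A (\<lambda>c d. act (v \<otimes>\<^bsub>H\<^esub> d) a \<otimes>\<^bsub>A\<^esub> act (u \<otimes>\<^bsub>H\<^esub> c) b)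
      (tensor_swap K H H R)) R"
    by (rule H.HH.lift_cong[OF R], rule H.HH.lift_tensor_swap[OF vs_A _ R, symmetric])
      (intro multilin a b; assumption)
  also have "\<dots> = tensor_lift A (\<lambda>x y. act y a \<otimes>\<^bsub>A\<^esub> act x b) (R \<otimes>\<^bsub>H.HH.T\<^esub> tensor_swap K H H R)"
    by (rule H.HH.lift_mult[OF vs_A B' R S, symmetric])
  also have "\<dots> = tensor_lift A (\<lambda>x y. actE y a \<otimes>\<^bsub>A\<^esub> actE x b) (E.HH.pure \<one>\<^bsub>E\<^esub> \<one>\<^bsub>E\<^esub>)"
    unfolding one by (simp add: vs_A B B' H.act_one E.act_one a b)
  finally show "tensor_lift A (\<lambda>x y. actE y a \<otimes>\<^bsub>A\<^esub> actE x b) (R' \<otimes>\<^bsub>E.HH.T\<^esub> tensor_swap K E E R') =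
    tensor_lift A (\<lambda>x y. actE y a \<otimes>\<^bsub>A\<^esub> actE x b) (E.HH.pure \<one>\<^bsub>E\<^esub> \<one>\<^bsub>E\<^esub>)" .
qed

theorem related_triangular:
  "triangular K H \<Delta> \<epsilon> R \<Longrightarrow> triangular K E \<Delta>\<^sub>E \<epsilon>\<^sub>E R'"
  unfolding H.triangular_iff E.triangular_iff using related_quasitriangular related_inverse by blast

end

section \<open>Bases and finite dimensionality\<close>

context one_space
begin

lemma span_submodule: "S \<subseteq> carrier V \<Longrightarrow> submodule K (span S) V"
  by (rule span_is_submodule)

lemma basis_exists: "\<exists>B. basis B"
proof -
  let ?I = "{B. B \<subseteq> carrier V \<and> lin_indpt B}"
  have "\<exists>M\<in>?I. \<forall>X\<in>?I. M \<subseteq> X \<longrightarrow> X = M"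
  proof (rule subset_Zorn_nonempty)
    have "lin_indpt {}" by (simp add: lin_dep_def)
    then show "?I \<noteq> {}" by blast
    fix C assume C: "C \<noteq> {}" "subset.chain ?I C"
    then have sub: "C \<subseteq> ?I" by (simp add: subset.chain_def)
    have "lin_indpt (\<Union>C)"
    proof
      assume "lin_dep (\<Union>C)"
      then obtain A a v where *: "finite A" "A \<subseteq> \<Union>C" "a \<in> A \<rightarrow> carrier K" "lincomb a A = \<zero>\<^bsub>V\<^esub>"
        "v \<in> A" "a v \<noteq> \<zero>\<^bsub>K\<^esub>" unfolding lin_dep_def by blast
      obtain B where B: "B \<in> C" "A \<subseteq> B"
        using finite_subset_Union_chain[OF *(1,2) C] .
      have "lin_dep B" unfolding lin_dep_def using * B(2) by blast
      then show False using B(1) sub by blast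
    qed
    then show "\<Union>C \<in> ?I" using sub by blast
  qed
  then obtain M where "M \<in> ?I" and maximal: "\<forall>X\<in>?I. M \<subseteq> X \<longrightarrow> X = M" by (rule bexE)
  then have M: "M \<subseteq> carrier V" "lin_indpt M" by simp_all
  have max: "X = M" if "X \<subseteq> carrier V" "lin_indpt X" "M \<subseteq> X" for X
    using maximal that by simp
  have "v \<in> span M" if v: "v \<in> carrier V" for v
  proof (rule ccontr)
    assume n: "v \<notin> span M"
    then have "v \<notin> M" using in_own_span[OF M(1)] by blast
    then have "lin_indpt (M \<union> {v})" using lin_dep_iff_in_span[OF M v] n by blast
    then have "M \<union> {v} = M" using M(1) v by (intro max) auto
    then show False using \<open>v \<notin> M\<close> by blast
  qed
  then show ?thesis using M span_is_subset2[OF M(1)] unfolding basis_def by blast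
qed

lemma lin_map_finsum:
  assumes "vectorspace K W" "lin_map K V W f" "finite F" "g \<in> F \<rightarrow> carrier V"
  shows "f (\<Oplus>\<^bsub>V\<^esub>i\<in>F. g i) = (\<Oplus>\<^bsub>W\<^esub>i\<in>F. f (g i))"
proof -
  interpret W: vectorspace K W by fact
  note cl = lin_map_closed[OF assms(2)]
  show ?thesis using assms(3,4)
  proof (induction F)
    case empty
    then show ?case by (simp add: lin_map_zero[OF vectorspace_axioms assms(1,2)])
  next
    case (insert i F)
    then have "g \<in> F \<rightarrow> carrier V" "g i \<in> carrier V" by auto
    with insert show ?case by (simp add: cl module_hom_add[OF assms(2)] Pi_iff)
  qed
qed

lemma lin_map_span:
  assumes W: "vectorspace K W" and f: "lin_map K V W f" and S: "S \<subseteq> carrier V"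
    and N: "submodule K N W" and sub: "f ` S \<subseteq> N"
  shows "f ` span S \<subseteq> N"
proof -
  interpret N: submodule K N W by fact
  interpret W: vectorspace K W by fact
  have "submodule K {v \<in> carrier V. f v \<in> N} V"
    by (intro submodule.intro module_axioms)
      (auto simp: module_hom_add[OF f] module_hom_smult[OF f] lin_map_zero[OF vectorspace_axioms W f])
  then have "span S \<subseteq> {v \<in> carrier V. f v \<in> N}"
    using S sub by (intro span_is_subset) auto
  then show ?thesis by auto
qed

lemma lin_map_eq_on_span:
  assumes W: "vectorspace K W" and f: "lin_map K V W f" and g: "lin_map K V W g"
    and S: "S \<subseteq> carrier V" and eq: "\<And>s. s \<in> S \<Longrightarrow> f s = g s" and v: "v \<in> span S"
  shows "f v = g v"
proof -
  interpret W: vectorspace K W by fact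
  have "submodule K {v \<in> carrier V. f v = g v} V"
    using lin_map_closed[OF f] lin_map_closed[OF g]
    by (intro submodule.intro module_axioms)
      (auto simp: module_hom_add[OF f] module_hom_smult[OF f] module_hom_add[OF g] module_hom_smult[OF g]
        lin_map_zero[OF vectorspace_axioms W f] lin_map_zero[OF vectorspace_axioms W g])
  then have "span S \<subseteq> {v \<in> carrier V. f v = g v}"
    using S eq by (intro span_is_subset) auto
  then show ?thesis using v by auto
qed

subsection \<open>Coordinates\<close>

text \<open>
  The coordinate at \<open>\<beta>\<close> of a vector is characterized modulo the span of the other basis vectors,
  so that its linearity needs no manipulation of linear combinations.
\<close>

definition coord :: "'v set \<Rightarrow> 'v \<Rightarrow> 'v \<Rightarrow> 'k" where
  "coord B \<beta> v = (THE c. c \<in> carrier K \<and> (\<exists>w\<in>span (B - {\<beta>}). v = c \<odot>\<^bsub>V\<^esub> \<beta> \<oplus>\<^bsub>V\<^esub> w))"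

context
  fixes B assumes B: "basis B"
begin

lemma B_carrier: "B \<subseteq> carrier V" and B_span: "span B = carrier V" and B_indpt: "lin_indpt B"
  using B by (simp_all add: basis_def)

lemma others_submodule: "submodule K (span (B - {\<beta>})) V"
  using B_carrier by (intro span_submodule) blast

lemma others_carrier: "w \<in> span (B - {\<beta>}) \<Longrightarrow> w \<in> carrier V"
  using submodule.subset[OF others_submodule] by blast

lemma coord_unique:
  assumes \<beta>: "\<beta> \<in> B" and c: "c \<in> carrier K" and d: "d \<in> carrier K"
    and w: "w \<in> span (B - {\<beta>})" and u: "u \<in> span (B - {\<beta>})"
    and eq: "c \<odot>\<^bsub>V\<^esub> \<beta> \<oplus>\<^bsub>V\<^esub> w = d \<odot>\<^bsub>V\<^esub> \<beta> \<oplus>\<^bsub>V\<^esub> u"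
  shows "c = d"
proof (rule ccontr)
  assume ne: "c \<noteq> d"
  interpret N: submodule K "span (B - {\<beta>})" V by (rule others_submodule)
  have b: "\<beta> \<in> carrier V" using \<beta> B_carrier by blast
  let ?w = "(\<ominus>\<^bsub>K\<^esub> \<one>\<^bsub>K\<^esub>) \<odot>\<^bsub>V\<^esub> w"
  let ?k = "c \<oplus>\<^bsub>K\<^esub> \<ominus>\<^bsub>K\<^esub> d"
  have k: "?k \<in> carrier K" "?k \<noteq> \<zero>\<^bsub>K\<^esub>" using c d ne by (auto simp: R.minus_eq[symmetric])
  have wc: "w \<in> carrier V" "u \<in> carrier V" using w u others_carrier by blast+
  have "c \<odot>\<^bsub>V\<^esub> \<beta> = d \<odot>\<^bsub>V\<^esub> \<beta> \<oplus>\<^bsub>V\<^esub> (u \<oplus>\<^bsub>V\<^esub> ?w)"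
  proof -
    have "c \<odot>\<^bsub>V\<^esub> \<beta> = (c \<odot>\<^bsub>V\<^esub> \<beta> \<oplus>\<^bsub>V\<^esub> w) \<oplus>\<^bsub>V\<^esub> ?w"
      using c b wc by (simp add: smult_minus_1 M.a_assoc M.r_neg)
    also have "\<dots> = (d \<odot>\<^bsub>V\<^esub> \<beta> \<oplus>\<^bsub>V\<^esub> u) \<oplus>\<^bsub>V\<^esub> ?w" by (simp only: eq)
    finally show ?thesis using d b wc by (simp add: M.a_assoc)
  qed
  then have "?k \<odot>\<^bsub>V\<^esub> \<beta> = (d \<odot>\<^bsub>V\<^esub> \<beta> \<oplus>\<^bsub>V\<^esub> (u \<oplus>\<^bsub>V\<^esub> ?w)) \<oplus>\<^bsub>V\<^esub> (\<ominus>\<^bsub>K\<^esub> d) \<odot>\<^bsub>V\<^esub> \<beta>"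
    using c d b by (simp add: smult_l_distr)
  also have "\<dots> = (d \<oplus>\<^bsub>K\<^esub> \<ominus>\<^bsub>K\<^esub> d) \<odot>\<^bsub>V\<^esub> \<beta> \<oplus>\<^bsub>V\<^esub> (u \<oplus>\<^bsub>V\<^esub> ?w)"
    using d b wc by (simp add: smult_l_distr M.a_ac del: R.r_neg)
  also have "\<dots> = u \<oplus>\<^bsub>V\<^esub> ?w" using d b wc by (simp add: R.r_neg)
  finally have kb: "?k \<odot>\<^bsub>V\<^esub> \<beta> = u \<oplus>\<^bsub>V\<^esub> ?w" .
  have uw: "u \<oplus>\<^bsub>V\<^esub> ?w \<in> span (B - {\<beta>})" using w u by (intro N.m_closed N.smult_closed) auto
  have "\<beta> = inv\<^bsub>K\<^esub> ?k \<odot>\<^bsub>V\<^esub> (u \<oplus>\<^bsub>V\<^esub> ?w)" by (rule mult_inverse[OF k(1) b kb k(2)])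
  then have "\<beta> \<in> span (B - {\<beta>})" using uw k by (metis N.smult_closed Units_inv_closed field_Units Diff_iff singletonD)
  moreover have "B - {\<beta>} \<union> {\<beta>} = B" using \<beta> by blast
  moreover have "lin_indpt (B - {\<beta>})" by (rule subset_li_is_li[OF B_indpt]) blast
  ultimately show False
    using lin_dep_iff_in_span[of "B - {\<beta>}" \<beta>] B_carrier b B_indpt by auto
qed

lemma coord_eqI:
  assumes "\<beta> \<in> B" "c \<in> carrier K" "w \<in> span (B - {\<beta>})" "v = c \<odot>\<^bsub>V\<^esub> \<beta> \<oplus>\<^bsub>V\<^esub> w"
  shows "coord B \<beta> v = c"
  unfolding coord_def using assms coord_unique[OF assms(1)] by (intro the_equality) auto

lemma coord_exists:
  assumes "\<beta> \<in> B" "v \<in> carrier V"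
  obtains w where "coord B \<beta> v \<in> carrier K" "w \<in> span (B - {\<beta>})" "v = coord B \<beta> v \<odot>\<^bsub>V\<^esub> \<beta> \<oplus>\<^bsub>V\<^esub> w"
proof -
  have b: "\<beta> \<in> carrier V" using assms(1) B_carrier by blast
  interpret N: submodule K "span (B - {\<beta>})" V by (rule others_submodule)
  let ?P = "{v \<in> carrier V. \<exists>c\<in>carrier K. \<exists>w\<in>span (B - {\<beta>}). v = c \<odot>\<^bsub>V\<^esub> \<beta> \<oplus>\<^bsub>V\<^esub> w}"
  have "submodule K ?P V"
  proof (intro submodule.intro module_axioms)
    fix v u assume "v \<in> ?P" "u \<in> ?P"
    then obtain c w d x where *: "c \<in> carrier K" "w \<in> span (B - {\<beta>})" "v = c \<odot>\<^bsub>V\<^esub> \<beta> \<oplus>\<^bsub>V\<^esub> w"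
      "d \<in> carrier K" "x \<in> span (B - {\<beta>})" "u = d \<odot>\<^bsub>V\<^esub> \<beta> \<oplus>\<^bsub>V\<^esub> x" by blast
    then have "v \<oplus>\<^bsub>V\<^esub> u = (c \<oplus>\<^bsub>K\<^esub> d) \<odot>\<^bsub>V\<^esub> \<beta> \<oplus>\<^bsub>V\<^esub> (w \<oplus>\<^bsub>V\<^esub> x)"
      using b by (simp add: smult_l_distr M.a_ac others_carrier)
    moreover have "c \<oplus>\<^bsub>K\<^esub> d \<in> carrier K" "w \<oplus>\<^bsub>V\<^esub> x \<in> span (B - {\<beta>})" "v \<oplus>\<^bsub>V\<^esub> u \<in> carrier V"
      using * b by (auto intro: others_carrier)
    ultimately show "v \<oplus>\<^bsub>V\<^esub> u \<in> ?P" by blast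
  next
    have "\<zero>\<^bsub>V\<^esub> = \<zero>\<^bsub>K\<^esub> \<odot>\<^bsub>V\<^esub> \<beta> \<oplus>\<^bsub>V\<^esub> \<zero>\<^bsub>V\<^esub>" using b by simp
    then show "\<zero>\<^bsub>V\<^esub> \<in> ?P" using N.zero_closed by blast
  next
    fix k v assume k: "k \<in> carrier K" "v \<in> ?P"
    then obtain c w where *: "c \<in> carrier K" "w \<in> span (B - {\<beta>})" "v = c \<odot>\<^bsub>V\<^esub> \<beta> \<oplus>\<^bsub>V\<^esub> w" by blast
    then have "k \<odot>\<^bsub>V\<^esub> v = (k \<otimes>\<^bsub>K\<^esub> c) \<odot>\<^bsub>V\<^esub> \<beta> \<oplus>\<^bsub>V\<^esub> k \<odot>\<^bsub>V\<^esub> w"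
      using b k by (simp add: smult_r_distr smult_assoc1 others_carrier)
    moreover have "k \<otimes>\<^bsub>K\<^esub> c \<in> carrier K" "k \<odot>\<^bsub>V\<^esub> w \<in> span (B - {\<beta>})" "k \<odot>\<^bsub>V\<^esub> v \<in> carrier V"
      using * k b by (auto intro: others_carrier)
    ultimately show "k \<odot>\<^bsub>V\<^esub> v \<in> ?P" by blast
  qed blast
  moreover have "B \<subseteq> ?P"
  proof
    fix \<gamma> assume g: "\<gamma> \<in> B"
    then have gc: "\<gamma> \<in> carrier V" using B_carrier by blast
    show "\<gamma> \<in> ?P"
    proof (cases "\<gamma> = \<beta>")
      case True
      then have "\<gamma> = \<one>\<^bsub>K\<^esub> \<odot>\<^bsub>V\<^esub> \<beta> \<oplus>\<^bsub>V\<^esub> \<zero>\<^bsub>V\<^esub>" using b by simp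
      then show ?thesis using gc N.zero_closed by blast
    next
      case False
      then have "\<gamma> \<in> span (B - {\<beta>})" using g in_own_span[of "B - {\<beta>}"] B_carrier by blast
      moreover have "\<gamma> = \<zero>\<^bsub>K\<^esub> \<odot>\<^bsub>V\<^esub> \<beta> \<oplus>\<^bsub>V\<^esub> \<gamma>" using b gc by simp
      ultimately show ?thesis using gc by blast
    qed
  qed
  ultimately have "carrier V \<subseteq> ?P" using span_is_subset[of B ?P] B_span by simp
  then obtain c w where cw: "c \<in> carrier K" "w \<in> span (B - {\<beta>})" "v = c \<odot>\<^bsub>V\<^esub> \<beta> \<oplus>\<^bsub>V\<^esub> w"
    using assms(2) by blast
  then have "coord B \<beta> v = c" by (intro coord_eqI[OF assms(1)])
  with cw show ?thesis by (intro that) auto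
qed

lemma coord_functional: "\<beta> \<in> B \<Longrightarrow> functional K V (coord B \<beta>)"
proof (intro lin_mapI)
  interpret N: submodule K "span (B - {\<beta>})" V by (rule others_submodule)
  assume \<beta>: "\<beta> \<in> B"
  then have b: "\<beta> \<in> carrier V" using B_carrier by blast
  show "coord B \<beta> v \<in> carrier (base_algebra K)" if "v \<in> carrier V" for v
    using coord_exists[OF \<beta> that] by (simp add: base_algebra_ops)
  show "coord B \<beta> (v \<oplus>\<^bsub>V\<^esub> u) = coord B \<beta> v \<oplus>\<^bsub>base_algebra K\<^esub> coord B \<beta> u"
    if v: "v \<in> carrier V" and u: "u \<in> carrier V" for v u
  proof -
    obtain w where w: "coord B \<beta> v \<in> carrier K" "w \<in> span (B - {\<beta>})" "v = coord B \<beta> v \<odot>\<^bsub>V\<^esub> \<beta> \<oplus>\<^bsub>V\<^esub> w"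
      using coord_exists[OF \<beta> v] .
    obtain x where x: "coord B \<beta> u \<in> carrier K" "x \<in> span (B - {\<beta>})" "u = coord B \<beta> u \<odot>\<^bsub>V\<^esub> \<beta> \<oplus>\<^bsub>V\<^esub> x"
      using coord_exists[OF \<beta> u] .
    have "v \<oplus>\<^bsub>V\<^esub> u = (coord B \<beta> v \<odot>\<^bsub>V\<^esub> \<beta> \<oplus>\<^bsub>V\<^esub> w) \<oplus>\<^bsub>V\<^esub> (coord B \<beta> u \<odot>\<^bsub>V\<^esub> \<beta> \<oplus>\<^bsub>V\<^esub> x)"
      by (subst w(3), subst x(3)) (rule HOL.refl)
    also have "\<dots> = (coord B \<beta> v \<oplus>\<^bsub>K\<^esub> coord B \<beta> u) \<odot>\<^bsub>V\<^esub> \<beta> \<oplus>\<^bsub>V\<^esub> (w \<oplus>\<^bsub>V\<^esub> x)"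
      using w(1,2) x(1,2) b by (simp add: smult_l_distr M.a_ac others_carrier)
    finally show ?thesis
      unfolding base_algebra_ops using w(1,2) x(1,2) by (intro coord_eqI[OF \<beta>]) auto
  qed
  show "coord B \<beta> (k \<odot>\<^bsub>V\<^esub> v) = k \<odot>\<^bsub>base_algebra K\<^esub> coord B \<beta> v"
    if k: "k \<in> carrier K" and v: "v \<in> carrier V" for k v
  proof -
    obtain w where w: "coord B \<beta> v \<in> carrier K" "w \<in> span (B - {\<beta>})" "v = coord B \<beta> v \<odot>\<^bsub>V\<^esub> \<beta> \<oplus>\<^bsub>V\<^esub> w"
      using coord_exists[OF \<beta> v] .
    have "k \<odot>\<^bsub>V\<^esub> v = k \<odot>\<^bsub>V\<^esub> (coord B \<beta> v \<odot>\<^bsub>V\<^esub> \<beta> \<oplus>\<^bsub>V\<^esub> w)" by (subst w(3)) (rule HOL.refl)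
    also have "\<dots> = (k \<otimes>\<^bsub>K\<^esub> coord B \<beta> v) \<odot>\<^bsub>V\<^esub> \<beta> \<oplus>\<^bsub>V\<^esub> k \<odot>\<^bsub>V\<^esub> w"
      using w(1,2) k b by (simp add: smult_r_distr smult_assoc1 others_carrier)
    finally show ?thesis
      unfolding base_algebra_ops using w(1,2) k by (intro coord_eqI[OF \<beta>]) auto
  qed
qed

lemma coord_basis:
  assumes "\<beta> \<in> B" "\<gamma> \<in> B" shows "coord B \<beta> \<gamma> = (if \<gamma> = \<beta> then \<one>\<^bsub>K\<^esub> else \<zero>\<^bsub>K\<^esub>)"
proof -
  interpret N: submodule K "span (B - {\<beta>})" V by (rule others_submodule)
  have c: "\<beta> \<in> carrier V" "\<gamma> \<in> carrier V" using assms B_carrier by auto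
  have "\<gamma> \<in> span (B - {\<beta>})" if "\<gamma> \<noteq> \<beta>"
    using assms that in_own_span[of "B - {\<beta>}"] B_carrier by blast
  then show ?thesis
    using c coord_eqI[OF assms(1) R.one_closed N.zero_closed, of \<gamma>]
      coord_eqI[OF assms(1) R.zero_closed, of \<gamma> \<gamma>]
    by (cases "\<gamma> = \<beta>") simp_all
qed

definition supp :: "'v \<Rightarrow> 'v set" where "supp v = {\<beta> \<in> B. coord B \<beta> v \<noteq> \<zero>\<^bsub>K\<^esub>}"

text \<open>The vectors of finite support form a subspace that contains the basis.\<close>
lemma finite_supp:
  assumes "v \<in> carrier V" shows "finite (supp v)"
proof -
  have K0: "coord B \<beta> u \<in> carrier K" if "\<beta> \<in> B" "u \<in> carrier V" for \<beta> u
    using functional_closed[OF coord_functional] that by blast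
  note add = module_hom_add[OF coord_functional, unfolded base_algebra_ops]
    and smult = module_hom_smult[OF coord_functional, unfolded base_algebra_ops]
  have "submodule K {v \<in> carrier V. finite (supp v)} V"
  proof (intro submodule.intro module_axioms)
    fix v u assume *: "v \<in> {v \<in> carrier V. finite (supp v)}" "u \<in> {v \<in> carrier V. finite (supp v)}"
    then have "supp (v \<oplus>\<^bsub>V\<^esub> u) \<subseteq> supp v \<union> supp u" by (auto simp: supp_def add)
    then show "v \<oplus>\<^bsub>V\<^esub> u \<in> {v \<in> carrier V. finite (supp v)}" using * by (auto intro: finite_subset)
  next
    have "supp \<zero>\<^bsub>V\<^esub> = {}"
      using lin_map_zero[OF vectorspace_axioms base_algebra_vectorspace[OF field_axioms] coord_functional]
      by (auto simp: supp_def base_algebra_def)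
    then show "\<zero>\<^bsub>V\<^esub> \<in> {v \<in> carrier V. finite (supp v)}" by simp
  next
    fix k v assume *: "k \<in> carrier K" "v \<in> {v \<in> carrier V. finite (supp v)}"
    then have "supp (k \<odot>\<^bsub>V\<^esub> v) \<subseteq> supp v" by (auto simp: supp_def smult)
    then show "k \<odot>\<^bsub>V\<^esub> v \<in> {v \<in> carrier V. finite (supp v)}" using * by (auto intro: finite_subset)
  qed blast
  moreover have "B \<subseteq> {v \<in> carrier V. finite (supp v)}"
  proof
    fix \<gamma> assume "\<gamma> \<in> B"
    moreover from this have "supp \<gamma> \<subseteq> {\<gamma>}" by (auto simp: supp_def coord_basis split: if_splits)
    ultimately show "\<gamma> \<in> {v \<in> carrier V. finite (supp v)}" using B_carrier by (auto intro: finite_subset)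
  qed
  ultimately have "carrier V \<subseteq> {v \<in> carrier V. finite (supp v)}"
    using span_is_subset[of B] B_span by blast
  then show ?thesis using assms by blast
qed

definition extend :: "('v \<Rightarrow> 'v) \<Rightarrow> 'v \<Rightarrow> 'v" where
  "extend g v = (\<Oplus>\<^bsub>V\<^esub>\<beta>\<in>supp v. coord B \<beta> v \<odot>\<^bsub>V\<^esub> g \<beta>)"

context
  fixes g assumes g: "g \<in> B \<rightarrow> carrier V"
begin

lemma extend_eq:
  assumes "v \<in> carrier V" "finite F" "supp v \<subseteq> F" "F \<subseteq> B"
  shows "extend g v = (\<Oplus>\<^bsub>V\<^esub>\<beta>\<in>F. coord B \<beta> v \<odot>\<^bsub>V\<^esub> g \<beta>)"
  unfolding extend_def
proof (rule M.add.finprod_mono_neutral_cong_left[OF assms(2,3)])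
  show "coord B i v \<odot>\<^bsub>V\<^esub> g i = \<zero>\<^bsub>V\<^esub>" if "i \<in> F - supp v" for i
  proof -
    have "i \<in> B" "coord B i v = \<zero>\<^bsub>K\<^esub>" using that assms(4) by (auto simp: supp_def)
    moreover from this have "g i \<in> carrier V" using g by blast
    ultimately show ?thesis by simp
  qed
  show "(\<lambda>\<beta>. coord B \<beta> v \<odot>\<^bsub>V\<^esub> g \<beta>) \<in> F \<rightarrow> carrier V"
    using assms(1,4) g functional_closed[OF coord_functional] by (auto intro!: smult_closed)
qed simp

lemma extend_lin: "lin_map K V V (extend g)"
proof (intro lin_mapI)
  have cg: "coord B \<beta> v \<in> carrier K" "g \<beta> \<in> carrier V" if "\<beta> \<in> B" "v \<in> carrier V" for \<beta> v
    using functional_closed[OF coord_functional] that g by auto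
  have sB: "supp v \<subseteq> B" for v by (auto simp: supp_def)
  show "extend g v \<in> carrier V" if "v \<in> carrier V" for v
    unfolding extend_def using that sB cg by (intro M.finsum_closed) blast
  show "extend g (v \<oplus>\<^bsub>V\<^esub> u) = extend g v \<oplus>\<^bsub>V\<^esub> extend g u" if v: "v \<in> carrier V" and u: "u \<in> carrier V" for v u
  proof -
    let ?F = "supp v \<union> supp u \<union> supp (v \<oplus>\<^bsub>V\<^esub> u)"
    have F: "finite ?F" "?F \<subseteq> B" using finite_supp v u sB by auto
    have c: "(\<lambda>\<beta>. coord B \<beta> v \<odot>\<^bsub>V\<^esub> g \<beta>) \<in> ?F \<rightarrow> carrier V" if "v \<in> carrier V" for v
      using that F(2) cg by blast
    have "extend g (v \<oplus>\<^bsub>V\<^esub> u) = (\<Oplus>\<^bsub>V\<^esub>\<beta>\<in>?F. coord B \<beta> (v \<oplus>\<^bsub>V\<^esub> u) \<odot>\<^bsub>V\<^esub> g \<beta>)"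
      using v u by (intro extend_eq F) auto
    also have "\<dots> = (\<Oplus>\<^bsub>V\<^esub>\<beta>\<in>?F. coord B \<beta> v \<odot>\<^bsub>V\<^esub> g \<beta> \<oplus>\<^bsub>V\<^esub> coord B \<beta> u \<odot>\<^bsub>V\<^esub> g \<beta>)"
    proof (rule M.finsum_cong')
      show "coord B \<beta> (v \<oplus>\<^bsub>V\<^esub> u) \<odot>\<^bsub>V\<^esub> g \<beta> = coord B \<beta> v \<odot>\<^bsub>V\<^esub> g \<beta> \<oplus>\<^bsub>V\<^esub> coord B \<beta> u \<odot>\<^bsub>V\<^esub> g \<beta>"
        if "\<beta> \<in> ?F" for \<beta>
      proof -
        have \<beta>: "\<beta> \<in> B" using that F(2) by blast
        show ?thesis
          using module_hom_add[OF coord_functional[OF \<beta>] v u] cg[OF \<beta>] v u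
          by (simp add: base_algebra_ops smult_l_distr)
      qed
      show "(\<lambda>\<beta>. coord B \<beta> v \<odot>\<^bsub>V\<^esub> g \<beta> \<oplus>\<^bsub>V\<^esub> coord B \<beta> u \<odot>\<^bsub>V\<^esub> g \<beta>) \<in> ?F \<rightarrow> carrier V"
        using c[OF v] c[OF u] by blast
    qed simp
    also have "\<dots> = (\<Oplus>\<^bsub>V\<^esub>\<beta>\<in>?F. coord B \<beta> v \<odot>\<^bsub>V\<^esub> g \<beta>) \<oplus>\<^bsub>V\<^esub> (\<Oplus>\<^bsub>V\<^esub>\<beta>\<in>?F. coord B \<beta> u \<odot>\<^bsub>V\<^esub> g \<beta>)"
      by (rule M.finsum_addf[OF c[OF v] c[OF u]])
    also have "\<dots> = extend g v \<oplus>\<^bsub>V\<^esub> extend g u"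
    proof -
      have "extend g v = (\<Oplus>\<^bsub>V\<^esub>\<beta>\<in>?F. coord B \<beta> v \<odot>\<^bsub>V\<^esub> g \<beta>)" by (rule extend_eq[OF v F(1) _ F(2)]) blast
      moreover have "extend g u = (\<Oplus>\<^bsub>V\<^esub>\<beta>\<in>?F. coord B \<beta> u \<odot>\<^bsub>V\<^esub> g \<beta>)" by (rule extend_eq[OF u F(1) _ F(2)]) blast
      ultimately show ?thesis by (simp only:)
    qed
    finally show ?thesis .
  qed
  show "extend g (k \<odot>\<^bsub>V\<^esub> v) = k \<odot>\<^bsub>V\<^esub> extend g v" if k: "k \<in> carrier K" and v: "v \<in> carrier V" for k v
  proof -
    let ?F = "supp v \<union> supp (k \<odot>\<^bsub>V\<^esub> v)"
    have F: "finite ?F" "?F \<subseteq> B" using finite_supp v k sB by auto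
    have c: "(\<lambda>\<beta>. coord B \<beta> v \<odot>\<^bsub>V\<^esub> g \<beta>) \<in> ?F \<rightarrow> carrier V"
      using v F(2) cg by blast
    have "extend g (k \<odot>\<^bsub>V\<^esub> v) = (\<Oplus>\<^bsub>V\<^esub>\<beta>\<in>?F. coord B \<beta> (k \<odot>\<^bsub>V\<^esub> v) \<odot>\<^bsub>V\<^esub> g \<beta>)"
      using v k by (intro extend_eq F) auto
    also have "\<dots> = (\<Oplus>\<^bsub>V\<^esub>\<beta>\<in>?F. k \<odot>\<^bsub>V\<^esub> (coord B \<beta> v \<odot>\<^bsub>V\<^esub> g \<beta>))"
    proof (rule M.finsum_cong')
      show "coord B \<beta> (k \<odot>\<^bsub>V\<^esub> v) \<odot>\<^bsub>V\<^esub> g \<beta> = k \<odot>\<^bsub>V\<^esub> (coord B \<beta> v \<odot>\<^bsub>V\<^esub> g \<beta>)" if "\<beta> \<in> ?F" for \<beta>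
      proof -
        have \<beta>: "\<beta> \<in> B" using that F(2) by blast
        show ?thesis
          using module_hom_smult[OF coord_functional[OF \<beta>] k v] cg[OF \<beta>] v k
          by (simp add: base_algebra_ops smult_assoc1)
      qed
      show "(\<lambda>\<beta>. k \<odot>\<^bsub>V\<^esub> (coord B \<beta> v \<odot>\<^bsub>V\<^esub> g \<beta>)) \<in> ?F \<rightarrow> carrier V" using c k by blast
    qed simp
    also have "\<dots> = k \<odot>\<^bsub>V\<^esub> (\<Oplus>\<^bsub>V\<^esub>\<beta>\<in>?F. coord B \<beta> v \<odot>\<^bsub>V\<^esub> g \<beta>)"
      by (rule finsum_smult[OF k c, symmetric])
    also have "(\<Oplus>\<^bsub>V\<^esub>\<beta>\<in>?F. coord B \<beta> v \<odot>\<^bsub>V\<^esub> g \<beta>) = extend g v"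
      by (rule extend_eq[OF v F(1) _ F(2), symmetric]) blast
    finally show ?thesis .
  qed
qed

lemma extend_basis:
  assumes "\<gamma> \<in> B" shows "extend g \<gamma> = g \<gamma>"
proof -
  have c: "\<gamma> \<in> carrier V" "g \<gamma> \<in> carrier V" using assms B_carrier g by auto
  have "extend g \<gamma> = (\<Oplus>\<^bsub>V\<^esub>\<beta>\<in>{\<gamma>}. coord B \<beta> \<gamma> \<odot>\<^bsub>V\<^esub> g \<beta>)"
    using assms c by (intro extend_eq) (auto simp: supp_def coord_basis split: if_splits)
  also have "\<dots> = coord B \<gamma> \<gamma> \<odot>\<^bsub>V\<^esub> g \<gamma>"
    using c assms by (simp add: coord_basis Pi_iff)
  finally show ?thesis using assms c by (simp add: coord_basis)
qed

end

text \<open>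
  The coevaluation is \<open>\<Sum> \<beta> \<otimes> \<beta>\<^sup>*\<close> with the coordinate functionals \<open>\<beta>\<^sup>*\<close>.
\<close>
lemma finite_basis_coevaluation:
  assumes fin: "finite B" shows "\<exists>d. coevaluation K V d"
proof -
  interpret D: two_spaces K V "dual_space K V" by (rule two_spaces_dual)
  interpret DT: one_space K D.T by (intro one_space.intro D.tensor_vectorspace)
  interpret VB: two_spaces K V "base_algebra K" by (rule two_spaces_base)
  let ?c = "\<lambda>\<beta>. \<lambda>v\<in>carrier V. coord B \<beta> v"
  have c: "?c \<beta> \<in> carrier (dual_space K V)" if "\<beta> \<in> B" for \<beta>
    by (rule VB.hom_space_restrict[OF coord_functional[OF that]])
  have pc: "(\<lambda>\<beta>. D.pure \<beta> (?c \<beta>)) \<in> B \<rightarrow> carrier D.T"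
    using B_carrier c by (auto intro!: D.pure_closed)
  let ?d = "\<Oplus>\<^bsub>D.T\<^esub>\<beta>\<in>B. D.pure \<beta> (?c \<beta>)"
  have "tensor_lift V (\<lambda>e c. c v \<odot>\<^bsub>V\<^esub> e) ?d = v" if v: "v \<in> carrier V" for v
  proof -
    have id: "(\<lambda>\<beta>. \<beta>) \<in> B \<rightarrow> carrier V" using B_carrier by auto
    note bil = coevaluation_bilin[OF vectorspace_axioms lin_map_id v]
    have "tensor_lift V (\<lambda>e c. c v \<odot>\<^bsub>V\<^esub> e) ?d =
        (\<Oplus>\<^bsub>V\<^esub>\<beta>\<in>B. tensor_lift V (\<lambda>e c. c v \<odot>\<^bsub>V\<^esub> e) (D.pure \<beta> (?c \<beta>)))"
      by (rule DT.lin_map_finsum[OF vectorspace_axioms D.lift_lin[OF vectorspace_axioms bil] fin pc])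
    also have "\<dots> = (\<Oplus>\<^bsub>V\<^esub>\<beta>\<in>B. coord B \<beta> v \<odot>\<^bsub>V\<^esub> \<beta>)"
    proof (rule M.finsum_cong')
      show "tensor_lift V (\<lambda>e c. c v \<odot>\<^bsub>V\<^esub> e) (D.pure \<beta> (?c \<beta>)) = coord B \<beta> v \<odot>\<^bsub>V\<^esub> \<beta>" if "\<beta> \<in> B" for \<beta>
        using that B_carrier v c[OF that]
        by (subst D.lift_pure[OF vectorspace_axioms bil]) auto
      show "(\<lambda>\<beta>. coord B \<beta> v \<odot>\<^bsub>V\<^esub> \<beta>) \<in> B \<rightarrow> carrier V"
        using B_carrier v functional_closed[OF coord_functional] by (auto intro!: smult_closed)
    qed simp
    also have "\<dots> = extend (\<lambda>\<beta>. \<beta>) v"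
      by (rule extend_eq[OF id v fin, symmetric]) (auto simp: supp_def)
    also have "\<dots> = v"
      using B_span v
      by (intro lin_map_eq_on_span[OF vectorspace_axioms extend_lin[OF id] lin_map_id B_carrier
          extend_basis[OF id]]) auto
    finally show ?thesis .
  qed
  moreover have "?d \<in> carrier D.T" by (rule DT.M.finsum_closed[OF pc])
  ultimately show ?thesis unfolding coevaluation_def by blast
qed

subsection \<open>A diagonal argument\<close>

text \<open>
  Only the basis vectors in the supports of the given vectors could be spanned.  These supports are
  finite, so for infinite \<open>U\<close> there are at most as many such basis vectors as elements of \<open>U\<close>.
\<close>
lemma few_not_spanning:
  assumes inf: "infinite B" and less: "(card_of U, card_of B) \<in> ordLess"
    and N: "\<And>\<alpha>. \<alpha> \<in> U \<Longrightarrow> finite (N \<alpha>)" "\<And>\<alpha>. \<alpha> \<in> U \<Longrightarrow> N \<alpha> \<subseteq> carrier V"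
  shows "\<exists>v\<in>carrier V. v \<notin> span (\<Union>\<alpha>\<in>U. N \<alpha>)"
proof (rule ccontr)
  assume "\<not> ?thesis"
  then have all: "carrier V \<subseteq> span (\<Union>\<alpha>\<in>U. N \<alpha>)" by blast
  let ?X = "\<Union>\<alpha>\<in>U. N \<alpha>"
  define S where "S \<alpha> = (\<Union>x\<in>N \<alpha>. supp x)" for \<alpha>
  have finS: "finite (S \<alpha>)" if "\<alpha> \<in> U" for \<alpha>
    unfolding S_def using N[OF that] finite_supp by (intro finite_UN_I) auto
  have XC: "?X \<subseteq> carrier V" using N(2) by blast
  have BS: "B \<subseteq> (\<Union>\<alpha>\<in>U. S \<alpha>)"
  proof
    fix \<beta> assume \<beta>: "\<beta> \<in> B"
    show "\<beta> \<in> (\<Union>\<alpha>\<in>U. S \<alpha>)"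
    proof (rule ccontr)
      assume "\<beta> \<notin> (\<Union>\<alpha>\<in>U. S \<alpha>)"
      then have "coord B \<beta> x = \<zero>\<^bsub>base_algebra K\<^esub>" if "x \<in> ?X" for x
        using that \<beta> by (auto simp: S_def supp_def base_algebra_def)
      moreover have "\<beta> \<in> span ?X" using all \<beta> B_carrier by blast
      ultimately have "coord B \<beta> \<beta> = \<zero>\<^bsub>base_algebra K\<^esub>"
        using lin_map_eq_on_span[OF base_algebra_vectorspace[OF field_axioms] coord_functional[OF \<beta>]
            lin_map_zero_map[OF base_algebra_vectorspace[OF field_axioms]] XC] by blast
      then show False using \<beta> by (simp add: coord_basis base_algebra_def)
    qed
  qed
  show False
  proof (cases "finite U")
    case True
    then have "finite (\<Union>\<alpha>\<in>U. S \<alpha>)" using finS by blast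
    then show False using BS inf finite_subset by blast
  next
    case False
    have "(card_of (\<Union>\<alpha>\<in>U. S \<alpha>), card_of U) \<in> ordLeq"
    proof (rule card_of_UNION_ordLeq_infinite[OF False card_of_refl[THEN ordIso_imp_ordLeq]], intro ballI)
      fix \<alpha> assume "\<alpha> \<in> U"
      then show "(card_of (S \<alpha>), card_of U) \<in> ordLeq"
        using finS False
        by (intro ordLess_imp_ordLeq finite_ordLess_infinite card_of_Well_order) (simp_all add: Field_card_of)
    qed
    then have "(card_of B, card_of U) \<in> ordLeq"
      using card_of_mono1[OF BS] ordLeq_transitive by blast
    then show False using less not_ordLess_ordLeq by blast
  qed
qed

text \<open>
  Along a well-order of the basis in which all initial segments are small, the value at \<open>\<beta>\<close> is
  chosen outside the span of the vectors \<open>N \<alpha> \<beta>\<close> with \<open>\<alpha>\<close> below \<open>\<beta>\<close>.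
\<close>

lemma diagonal_operator:
  assumes inf: "infinite B"
    and N: "\<And>\<alpha> \<beta>. \<alpha> \<in> B \<Longrightarrow> \<beta> \<in> B \<Longrightarrow> finite (N \<alpha> \<beta>) \<and> N \<alpha> \<beta> \<subseteq> carrier V"
  shows "\<exists>f. lin_map K V V f \<and> (\<forall>F. finite F \<longrightarrow> F \<subseteq> B \<longrightarrow> (\<exists>\<beta>\<in>B. f \<beta> \<notin> span (\<Union>\<alpha>\<in>F. N \<alpha> \<beta>)))"
proof -
  let ?r = "card_of B"
  have co: "Card_order ?r" and fld: "Field ?r = B" by (rule card_of_Card_order, rule Field_card_of)
  have uB: "underS ?r \<beta> \<subseteq> B" for \<beta> using fld unfolding underS_def Field_def by blast
  have "\<exists>v\<in>carrier V. v \<notin> span (\<Union>\<alpha>\<in>underS ?r \<beta>. N \<alpha> \<beta>)" if \<beta>: "\<beta> \<in> B" for \<beta>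
  proof (rule few_not_spanning[OF inf])
    show "(card_of (underS ?r \<beta>), card_of B) \<in> ordLess"
      using card_of_underS[OF co] \<beta> fld by blast
  qed (use N uB \<beta> in blast)+
  then obtain g where g: "\<And>\<beta>. \<beta> \<in> B \<Longrightarrow> g \<beta> \<in> carrier V \<and> g \<beta> \<notin> span (\<Union>\<alpha>\<in>underS ?r \<beta>. N \<alpha> \<beta>)"
    by metis
  then have gB: "g \<in> B \<rightarrow> carrier V" by blast
  have above: "\<exists>\<beta>\<in>B. F \<subseteq> underS ?r \<beta>" if "finite F" "F \<subseteq> B" for F
    using that
  proof (induction F)
    case empty
    then show ?case using infinite_imp_nonempty[OF inf] by blast
  next
    case (insert a F)
    then obtain \<beta> where \<beta>: "\<beta> \<in> B" "F \<subseteq> underS ?r \<beta>" by blast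
    have lin: "Linear_order ?r" using co unfolding card_order_on_def well_order_on_def by simp
    then have tr: "trans ?r" and tot: "total_on B ?r" and anti: "antisym ?r" and rf: "refl_on B ?r"
      unfolding linear_order_on_def partial_order_on_def preorder_on_def using fld by auto
    obtain m where m: "m \<in> B" "(\<beta>, m) \<in> ?r" "(a, m) \<in> ?r"
      using tot rf \<beta>(1) insert.prems unfolding total_on_def refl_on_def by (metis insert_subset)
    obtain \<gamma> where \<gamma>: "\<gamma> \<in> B" "m \<noteq> \<gamma>" "(m, \<gamma>) \<in> ?r"
      using infinite_Card_order_limit[OF co] inf m(1) fld by metis
    have "x \<in> underS ?r \<gamma>" if "(x, m) \<in> ?r" for x
      using that \<gamma>(2,3) tr anti unfolding underS_def trans_def antisym_def by blast
    moreover have "(x, m) \<in> ?r" if "x \<in> F" for x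
      using that \<beta>(2) m(2) tr unfolding underS_def trans_def by blast
    ultimately show ?case using m(3) \<gamma>(1) by blast
  qed
  show ?thesis
  proof (intro exI conjI allI impI)
    show "lin_map K V V (extend g)" by (rule extend_lin[OF gB])
    fix F assume F: "finite F" "F \<subseteq> B"
    then obtain \<beta> where \<beta>: "\<beta> \<in> B" "F \<subseteq> underS ?r \<beta>" using above by blast
    have "span (\<Union>\<alpha>\<in>F. N \<alpha> \<beta>) \<subseteq> span (\<Union>\<alpha>\<in>underS ?r \<beta>. N \<alpha> \<beta>)"
      using \<beta>(2) by (intro span_is_monotone) blast
    then have "extend g \<beta> \<notin> span (\<Union>\<alpha>\<in>F. N \<alpha> \<beta>)"
      using g[OF \<beta>(1)] extend_basis[OF gB \<beta>(1)] by auto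
    with \<beta>(1) show "\<exists>\<beta>\<in>B. extend g \<beta> \<notin> span (\<Union>\<alpha>\<in>F. N \<alpha> \<beta>)" by blast
  qed
qed

end

lemma fin_dim_coevaluation: "fin_dim \<Longrightarrow> \<exists>d. coevaluation K V d"
  using finite_basis_exists finite_basis_coevaluation by blast

end

text \<open>
  Let the finite set \<open>J\<close> span \<open>H\<close>.  An operator in the image of the Galois map sends each \<open>b\<close> into the
  span of the vectors \<open>\<alpha> (j b)\<close>, where \<open>j\<close> is in \<open>J\<close> and \<open>\<alpha>\<close> in a finite set of basis vectors that does
  not depend on \<open>b\<close>.  If the basis were infinite, a diagonal operator would violate this for all
  finite sets at once.
\<close>
lemma (in hopf_action) galois_finite_dimensional:
  assumes fd: "fin_dim" and galois: "dual_galois K H A act"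
  shows "\<exists>d. coevaluation K A d"
proof -
  let ?span = "V.span"
  obtain J where J: "finite J" "J \<subseteq> carrier H" "span J = carrier H" using fd unfolding fin_dim_def by blast
  obtain B where B: "vectorspace.basis K A B" using A1.basis_exists by blast
  note BC = A1.B_carrier[OF B] and BS = A1.B_span[OF B]
  define N where "N \<alpha> \<beta> = (\<lambda>h. \<alpha> \<otimes>\<^bsub>A\<^esub> act h \<beta>) ` J" for \<alpha> \<beta>
  have N: "finite (N \<alpha> \<beta>) \<and> N \<alpha> \<beta> \<subseteq> carrier A" if "\<alpha> \<in> carrier A" "\<beta> \<in> carrier A" for \<alpha> \<beta>
    using that J by (auto simp: N_def act_closed)
  have NF: "(\<Union>\<alpha>\<in>F. N \<alpha> b) \<subseteq> carrier A" if "F \<subseteq> B" "b \<in> carrier A" for F b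
    using N that BC by blast
  have gm: "\<exists>F. finite F \<and> F \<subseteq> B \<and> (\<forall>b\<in>carrier A. galois_map t b \<in> ?span (\<Union>\<alpha>\<in>F. N \<alpha> b))"
    if "t \<in> carrier AH.T" for t
    using that
  proof (induction rule: AH.tensor_induct)
    case zero
    have "galois_map \<zero>\<^bsub>AH.T\<^esub> b = \<zero>\<^bsub>A\<^esub>" if "b \<in> carrier A" for b
      by (rule lin_map_zero[OF AH.tensor_vectorspace V.vectorspace_axioms galois_map_lin(1)[OF that]])
    then show ?case by (intro exI[of _ "{}"]) (simp add: V.span_zero)
  next
    case (add a h t)
    then obtain F where F: "finite F" "F \<subseteq> B" "\<And>b. b \<in> carrier A \<Longrightarrow> galois_map t b \<in> ?span (\<Union>\<alpha>\<in>F. N \<alpha> b)"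
      by blast
    have "a \<in> ?span B" using add(1) BS by simp
    then obtain k F' where F': "a = V.lincomb k F'" "finite F'" "F' \<subseteq> B" "k \<in> F' \<rightarrow> carrier K"
      unfolding V.span_def by (elim CollectE exE conjE)
    have a_span: "a \<in> ?span F'" unfolding V.span_def using F' by blast
    have "galois_map (AH.pure a h \<oplus>\<^bsub>AH.T\<^esub> t) b \<in> ?span (\<Union>\<alpha>\<in>F \<union> F'. N \<alpha> b)" if b: "b \<in> carrier A" for b
    proof -
      let ?U = "?span (\<Union>\<alpha>\<in>F \<union> F'. N \<alpha> b)"
      have UC: "(\<Union>\<alpha>\<in>F \<union> F'. N \<alpha> b) \<subseteq> carrier A" using F(2) F'(3) b by (intro NF) auto
      have U: "submodule K ?U A" by (rule V.span_is_submodule[OF UC])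
      have t: "galois_map t b \<in> ?U"
        using F(3)[OF b] V.span_is_monotone[of "\<Union>\<alpha>\<in>F. N \<alpha> b" "\<Union>\<alpha>\<in>F \<union> F'. N \<alpha> b"] by blast
      have gen: "\<alpha> \<otimes>\<^bsub>A\<^esub> act j b \<in> ?U" if "\<alpha> \<in> F'" "j \<in> J" for \<alpha> j
        using that V.in_own_span[OF UC] unfolding N_def by blast
      have "(\<lambda>j. \<alpha> \<otimes>\<^bsub>A\<^esub> act j b) ` span J \<subseteq> ?U" if \<alpha>: "\<alpha> \<in> F'" for \<alpha>
      proof (rule H1.lin_map_span[OF V.vectorspace_axioms _ J(2) U])
        have "\<alpha> \<in> carrier A" using \<alpha> F'(3) BC by blast
        then show "lin_map K H A (\<lambda>j. \<alpha> \<otimes>\<^bsub>A\<^esub> act j b)" by (intro A_mult_lin(1) act_lin_op lin_map_id b)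
        show "(\<lambda>j. \<alpha> \<otimes>\<^bsub>A\<^esub> act j b) ` J \<subseteq> ?U" using gen[OF \<alpha>] by blast
      qed
      then have "\<alpha> \<otimes>\<^bsub>A\<^esub> act h b \<in> ?U" if "\<alpha> \<in> F'" for \<alpha>
        using that add(2) J(3) by blast
      then have "(\<lambda>\<alpha>. \<alpha> \<otimes>\<^bsub>A\<^esub> act h b) ` ?span F' \<subseteq> ?U"
      proof (intro A1.lin_map_span[OF V.vectorspace_axioms _ _ U])
        show "lin_map K A A (\<lambda>\<alpha>. \<alpha> \<otimes>\<^bsub>A\<^esub> act h b)"
          by (intro A_mult_lin(2) act_closed lin_map_id add(2) b)
        show "F' \<subseteq> carrier A" using F'(3) BC by blast
      qed blast
      then have "a \<otimes>\<^bsub>A\<^esub> act h b \<in> ?U" using a_span by blast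
      then show ?thesis
        using t add(1-3) b submodule.m_closed[OF U]
        by (simp add: module_hom_add[OF galois_map_lin(1)] galois_map_pure)
    qed
    then show ?case using F(1,2) F'(2,3) by (intro exI[of _ "F \<union> F'"]) blast
  qed
  have "finite B"
  proof (rule ccontr)
    assume inf: "infinite B"
    have NB: "finite (N \<alpha> \<beta>) \<and> N \<alpha> \<beta> \<subseteq> carrier A" if "\<alpha> \<in> B" "\<beta> \<in> B" for \<alpha> \<beta>
      using that BC by (intro N) blast+
    have "\<exists>f. lin_map K A A f \<and> (\<forall>F. finite F \<longrightarrow> F \<subseteq> B \<longrightarrow> (\<exists>\<beta>\<in>B. f \<beta> \<notin> ?span (\<Union>\<alpha>\<in>F. N \<alpha> \<beta>)))"
      by (rule A1.diagonal_operator[OF B inf]) (rule NB)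
    then obtain f where f: "lin_map K A A f"
      and diag: "\<forall>F. finite F \<longrightarrow> F \<subseteq> B \<longrightarrow> (\<exists>\<beta>\<in>B. f \<beta> \<notin> ?span (\<Union>\<alpha>\<in>F. N \<alpha> \<beta>))"
      by (elim exE conjE)
    obtain t where t: "t \<in> carrier AH.T" "\<And>b. b \<in> carrier A \<Longrightarrow> galois_map t b = f b"
      using galois[unfolded dual_galois_iff, THEN conjunct2, rule_format, OF f] by (elim bexE) simp
    obtain F where F: "finite F" "F \<subseteq> B" "\<forall>b\<in>carrier A. galois_map t b \<in> ?span (\<Union>\<alpha>\<in>F. N \<alpha> b)"
      using gm[OF t(1)] by (elim exE conjE)
    obtain \<beta> where \<beta>: "\<beta> \<in> B" "f \<beta> \<notin> ?span (\<Union>\<alpha>\<in>F. N \<alpha> \<beta>)"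
      using diag[rule_format, OF F(1,2)] by (elim bexE)
    have "\<beta> \<in> carrier A" using \<beta>(1) BC by blast
    then show False using F(3) t(2) \<beta>(2) by simp
  qed
  then show ?thesis by (rule A1.finite_basis_coevaluation[OF B])
qed

section \<open>The correspondence\<close>

context galois_pair
begin

definition related :: "('h, 'h) tensor \<Rightarrow> ('e, 'e) tensor \<Rightarrow> bool" where
  "related R R' \<longleftrightarrow> (\<forall>a\<in>carrier A. \<forall>b\<in>carrier A.
    tensor_lift A (\<lambda>x y. act y b \<otimes>\<^bsub>A\<^esub> act x a) R = tensor_lift A (\<lambda>\<rho> \<rho>'. actE \<rho>' a \<otimes>\<^bsub>A\<^esub> actE \<rho> b) R')"

text \<open>
  The algebra \<open>E\<close> is Galois, and \<open>H\<close> is in turn the full commutant of \<open>E\<close>.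
\<close>
lemma swapped_pair:
  assumes "coevaluation K E dE"
  shows "galois_pair K E \<Delta>\<^sub>E \<epsilon>\<^sub>E S\<^sub>E A actE H \<Delta> \<epsilon> S act dE dA"
proof -
  interpret X: commuting_actions K E \<Delta>\<^sub>E \<epsilon>\<^sub>E S\<^sub>E A actE H \<Delta> \<epsilon> S act
    by unfold_locales (simp add: commute)
  interpret Y: galois_action K E \<Delta>\<^sub>E \<epsilon>\<^sub>E S\<^sub>E A actE dE dA
    by unfold_locales (rule assms G.coev_A E_galois)+
  show ?thesis
    by unfold_locales (rule G.act_faithful H_full; assumption)+
qed

lemma related_elementsI:
  assumes dE: "coevaluation K E dE" and R: "R \<in> carrier (tensor K H H)" and R': "R' \<in> carrier (tensor K E E)"
    and rel: "related R R'"
  shows "related_elements K H \<Delta> \<epsilon> S A act E \<Delta>\<^sub>E \<epsilon>\<^sub>E S\<^sub>E actE dE dA R R'"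
proof -
  interpret Y: galois_action K E \<Delta>\<^sub>E \<epsilon>\<^sub>E S\<^sub>E A actE dE dA
    by unfold_locales (rule dE G.coev_A E_galois)+
  show ?thesis
    by unfold_locales (use R R' rel in \<open>simp_all add: related_def\<close>)
qed

text \<open>
  The map \<open>(a, b) \<mapsto> \<Sum> (r'' b) (r' a)\<close> is equivariant because of \<open>\<Delta>\<^sup>o\<^sup>p(h) R = R \<Delta>(h)\<close>, so it is given
  by an element of \<open>E \<otimes> E\<close>.
\<close>
lemma related_exists:
  assumes q: "quasitriangular K H \<Delta> \<epsilon> R"
  shows "\<exists>R'. quasitriangular K E \<Delta>\<^sub>E \<epsilon>\<^sub>E R' \<and> related R R'"
proof -
  obtain dE where dE: "coevaluation K E dE" using E_coevaluation by blast
  note R = H.quasitriangular_closed[OF q]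
  define \<theta> where "\<theta> a b = tensor_lift A (\<lambda>x y. act y b \<otimes>\<^bsub>A\<^esub> act x a) R" for a b
  have B: "bilin_map K H H A (\<lambda>x y. act y b \<otimes>\<^bsub>A\<^esub> act x a)" if "a \<in> carrier A" "b \<in> carrier A" for a b
    by (intro multilin that; assumption)
  have \<theta>_bil: "bilin_map K A A A \<theta>" unfolding \<theta>_def by (intro multilin R; assumption)
  have eqv: "act h (\<theta> a b) = tensor_lift A (\<lambda>p q. \<theta> (act p a) (act q b)) (\<Delta> h)"
    if h: "h \<in> carrier H" and a: "a \<in> carrier A" and b: "b \<in> carrier A" for h a b
  proof -
    note dh = H.comult_closed[OF h]
    have "act h (\<theta> a b) = tensor_lift A (\<lambda>x y. act h (act y b \<otimes>\<^bsub>A\<^esub> act x a)) R"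
      unfolding \<theta>_def by (rule H.HH.lin_map_lift[OF vs_A vs_A H.act_linear[OF h] B[OF a b] R])
    also have "\<dots> = tensor_lift A (\<lambda>x y. tensor_lift A
        (\<lambda>p q. act (p \<otimes>\<^bsub>H\<^esub> y) b \<otimes>\<^bsub>A\<^esub> act (q \<otimes>\<^bsub>H\<^esub> x) a) (\<Delta> h)) R"
    proof (rule H.HH.lift_cong[OF R])
      fix x y assume xy: "x \<in> carrier H" "y \<in> carrier H"
      have "tensor_lift A (\<lambda>p q. act (p \<otimes>\<^bsub>H\<^esub> y) b \<otimes>\<^bsub>A\<^esub> act (q \<otimes>\<^bsub>H\<^esub> x) a) (\<Delta> h) =
        tensor_lift A (\<lambda>p q. act p (act y b) \<otimes>\<^bsub>A\<^esub> act q (act x a)) (\<Delta> h)"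
        by (rule H.HH.lift_cong[OF dh]) (simp add: H.act_mult xy a b)
      then show "act h (act y b \<otimes>\<^bsub>A\<^esub> act x a) =
          tensor_lift A (\<lambda>p q. act (p \<otimes>\<^bsub>H\<^esub> y) b \<otimes>\<^bsub>A\<^esub> act (q \<otimes>\<^bsub>H\<^esub> x) a) (\<Delta> h)"
        by (simp add: H.act_product_lift h H.act_closed xy a b)
    qed
    also have "\<dots> = tensor_lift A (\<lambda>p q. tensor_lift A
        (\<lambda>x y. act (p \<otimes>\<^bsub>H\<^esub> y) b \<otimes>\<^bsub>A\<^esub> act (q \<otimes>\<^bsub>H\<^esub> x) a) R) (\<Delta> h)"
      by (rule lift_swap[OF vs_H vs_H vs_H vs_H vs_A R dh]) (intro multilin a b; assumption)+
    also have "\<dots> = tensor_lift A (\<lambda>x y. tensor_lift A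
        (\<lambda>p q. act (y \<otimes>\<^bsub>H\<^esub> q) b \<otimes>\<^bsub>A\<^esub> act (x \<otimes>\<^bsub>H\<^esub> p) a) (\<Delta> h)) R"
      by (rule H.quasitriangular_comm[OF q vs_A B[OF a b] h])
    also have "\<dots> = tensor_lift A (\<lambda>p q. tensor_lift A
        (\<lambda>x y. act (y \<otimes>\<^bsub>H\<^esub> q) b \<otimes>\<^bsub>A\<^esub> act (x \<otimes>\<^bsub>H\<^esub> p) a) R) (\<Delta> h)"
      by (rule lift_swap[OF vs_H vs_H vs_H vs_H vs_A R dh]) (intro multilin a b; assumption)+
    also have "\<dots> = tensor_lift A (\<lambda>p q. \<theta> (act p a) (act q b)) (\<Delta> h)"
      unfolding \<theta>_def
      by (rule H.HH.lift_cong[OF dh], rule H.HH.lift_cong[OF R]) (simp add: H.act_mult a b)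
    finally show ?thesis .
  qed
  have "\<exists>R\<in>carrier (tensor K E E). \<forall>a\<in>carrier A. \<forall>b\<in>carrier A.
      \<theta> a b = tensor_lift A (\<lambda>x y. actE x a \<otimes>\<^bsub>A\<^esub> actE y b) R"
    by (rule equivariant_bilinear[OF \<theta>_bil dE]) (rule eqv)
  then obtain R0 where R0: "R0 \<in> carrier (tensor K E E)" and R0_rel: "\<forall>a\<in>carrier A. \<forall>b\<in>carrier A.
      \<theta> a b = tensor_lift A (\<lambda>x y. actE x a \<otimes>\<^bsub>A\<^esub> actE y b) R0"
    by (elim bexE)
  let ?R' = "tensor_swap K E E R0"
  have R': "?R' \<in> carrier (tensor K E E)" by (rule E.swap_closed[OF R0])
  have rel: "related R ?R'"
    unfolding related_def
  proof (intro ballI)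
    fix a b assume a: "a \<in> carrier A" and b: "b \<in> carrier A"
    have "tensor_lift A (\<lambda>\<rho> \<rho>'. actE \<rho>' a \<otimes>\<^bsub>A\<^esub> actE \<rho> b) ?R' = \<theta> a b"
      unfolding R0_rel[rule_format, OF a b]
      by (rule E.HH.lift_tensor_swap[OF vs_A _ R0]) (intro multilin a b; assumption)
    then show "tensor_lift A (\<lambda>x y. act y b \<otimes>\<^bsub>A\<^esub> act x a) R =
        tensor_lift A (\<lambda>\<rho> \<rho>'. actE \<rho>' a \<otimes>\<^bsub>A\<^esub> actE \<rho> b) ?R'"
      by (simp only: \<theta>_def)
  qed
  interpret X: related_elements K H \<Delta> \<epsilon> S A act E \<Delta>\<^sub>E \<epsilon>\<^sub>E S\<^sub>E actE dE dA R ?R'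
    by (rule related_elementsI[OF dE R R' rel])
  show ?thesis using X.related_quasitriangular[OF q] rel by blast
qed

lemma related_unique:
  assumes R1: "R1 \<in> carrier (tensor K H H)" and R2: "R2 \<in> carrier (tensor K H H)"
    and rel: "related R1 R'" "related R2 R'"
  shows "R1 = R2"
proof (rule G.swapped_eval2_eqI[OF R1 R2])
  fix a b assume ab: "a \<in> carrier A" "b \<in> carrier A"
  have "tensor_lift A (\<lambda>x y. act y a \<otimes>\<^bsub>A\<^esub> act x b) R = tensor_lift A (\<lambda>\<rho> \<rho>'. actE \<rho>' b \<otimes>\<^bsub>A\<^esub> actE \<rho> a) R'"
    if "related R R'" for R
    using that ab unfolding related_def by blast
  then show "tensor_lift A (\<lambda>x y. act y a \<otimes>\<^bsub>A\<^esub> act x b) R1 = tensor_lift A (\<lambda>x y. act y a \<otimes>\<^bsub>A\<^esub> act x b) R2"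
    using rel by simp
qed

text \<open>
  The relation is symmetric, so everything shown for \<open>R\<close> also holds for \<open>R'\<close> with \<open>H\<close> and \<open>E\<close> exchanged.
\<close>
theorem correspondence:
  shows "quasitriangular K E \<Delta>\<^sub>E \<epsilon>\<^sub>E R' \<Longrightarrow> \<exists>R. quasitriangular K H \<Delta> \<epsilon> R \<and> related R R'"
    and "\<lbrakk>R1' \<in> carrier (tensor K E E); R2' \<in> carrier (tensor K E E); related R R1'; related R R2'\<rbrakk>
      \<Longrightarrow> R1' = R2'"
    and "\<lbrakk>R \<in> carrier (tensor K H H); R' \<in> carrier (tensor K E E); related R R'\<rbrakk>
      \<Longrightarrow> triangular K E \<Delta>\<^sub>E \<epsilon>\<^sub>E R' \<longleftrightarrow> triangular K H \<Delta> \<epsilon> R"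
proof -
  obtain dE where dE: "coevaluation K E dE" using E_coevaluation by blast
  interpret Y: galois_pair K E \<Delta>\<^sub>E \<epsilon>\<^sub>E S\<^sub>E A actE H \<Delta> \<epsilon> S act dE dA by (rule swapped_pair[OF dE])
  have sym: "Y.related R' R \<longleftrightarrow> related R R'" for R R'
    unfolding related_def Y.related_def by (auto intro: HOL.sym)
  show "quasitriangular K E \<Delta>\<^sub>E \<epsilon>\<^sub>E R' \<Longrightarrow> \<exists>R. quasitriangular K H \<Delta> \<epsilon> R \<and> related R R'"
    using Y.related_exists unfolding sym .
  show "\<lbrakk>R1' \<in> carrier (tensor K E E); R2' \<in> carrier (tensor K E E); related R R1'; related R R2'\<rbrakk>
      \<Longrightarrow> R1' = R2'"
    using Y.related_unique unfolding sym .
  assume R: "R \<in> carrier (tensor K H H)" and R': "R' \<in> carrier (tensor K E E)" and rel: "related R R'"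
  interpret P: related_elements K H \<Delta> \<epsilon> S A act E \<Delta>\<^sub>E \<epsilon>\<^sub>E S\<^sub>E actE dE dA R R'
    by (rule related_elementsI[OF dE R R' rel])
  interpret Q: related_elements K E \<Delta>\<^sub>E \<epsilon>\<^sub>E S\<^sub>E A actE H \<Delta> \<epsilon> S act dH dA R' R
    by (rule Y.related_elementsI[OF G.coev_H R' R]) (simp add: sym rel)
  show "triangular K E \<Delta>\<^sub>E \<epsilon>\<^sub>E R' \<longleftrightarrow> triangular K H \<Delta> \<epsilon> R"
    using P.related_triangular Q.related_triangular by blast
qed

end

section \<open>Braidings\<close>

locale two_modules = U: left_module K H U actU + V: left_module K H V actV
  for K :: "'k ring" and H :: "('k, 'h) module"
    and U :: "('k, 'u) module" and actU :: "'h \<Rightarrow> 'u \<Rightarrow> 'u"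
    and V :: "('k, 'v) module" and actV :: "'h \<Rightarrow> 'v \<Rightarrow> 'v"
begin

lemma vs: "vectorspace K H" "vectorspace K U" "vectorspace K V"
  using U.H.vectorspace_axioms U.V.vectorspace_axioms V.V.vectorspace_axioms .

sublocale HH: two_spaces K H H using vs(1,1) by (rule two_spaces.intro)
sublocale UV: two_spaces K U V using vs(2,3) by (rule two_spaces.intro)
sublocale VU: two_spaces K V U using vs(3,2) by (rule two_spaces.intro)

lemma act_lin:
  "u \<in> carrier U \<Longrightarrow> lin_map K H U (\<lambda>h. actU h u)" "v \<in> carrier V \<Longrightarrow> lin_map K H V (\<lambda>h. actV h v)"
  by (intro lin_mapI; simp add: U.act_add V.act_add U.act_smult V.act_smult
      lin_map_closed[OF U.act_linear] lin_map_closed[OF V.act_linear])+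

lemma braiding_inner_bilin:
  "u \<in> carrier U \<Longrightarrow> v \<in> carrier V \<Longrightarrow> bilin_map K H H VU.T (\<lambda>x y. VU.pure (actV y v) (actU x u))"
  by (intro bilin_mapI lin_map_comp[OF act_lin(2) bilin_map_left[OF VU.pure_bilin]]
      lin_map_comp[OF act_lin(1) bilin_map_right[OF VU.pure_bilin]]
      lin_map_closed[OF U.act_linear] lin_map_closed[OF V.act_linear]; assumption)

context
  fixes R assumes R: "R \<in> carrier HH.T"
begin

lemma braiding_bilin:
  "bilin_map K U V VU.T (\<lambda>u v. tensor_lift VU.T (\<lambda>x y. VU.pure (actV y v) (actU x u)) R)"
  by (intro bilin_mapI HH.lift_param VU.tensor_vectorspace R braiding_inner_bilin vs
      lin_map_comp[OF V.act_linear bilin_map_left[OF VU.pure_bilin]]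
      lin_map_comp[OF U.act_linear bilin_map_right[OF VU.pure_bilin]]
      lin_map_closed[OF U.act_linear] lin_map_closed[OF V.act_linear]; assumption)

lemma braiding_lin: "lin_map K UV.T VU.T (braiding K R U actU V actV)"
  unfolding braiding_def by (rule UV.lift_lin[OF VU.tensor_vectorspace braiding_bilin])

lemma braiding_pure:
  "u \<in> carrier U \<Longrightarrow> v \<in> carrier V \<Longrightarrow> braiding K R U actU V actV (UV.pure u v) =
    tensor_lift VU.T (\<lambda>x y. VU.pure (actV y v) (actU x u)) R"
  unfolding braiding_def by (rule UV.lift_pure[OF VU.tensor_vectorspace braiding_bilin])

end

end

subsection \<open>Spaces of equivariant maps\<close>

lemma (in two_spaces) equivariant_hom_carrier:
  "\<sigma> \<in> carrier (equivariant_hom K H V actV W actW) \<longleftrightarrow>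
    \<sigma> \<in> carrier Hom \<and> (\<forall>h\<in>carrier H. \<forall>v\<in>carrier V. \<sigma> (actV h v) = actW h (\<sigma> v))"
  by (simp add: equivariant_hom_def)

lemma (in two_spaces) equivariant_hom_ops:
  "\<sigma> \<oplus>\<^bsub>equivariant_hom K H V actV W actW\<^esub> \<tau> = \<sigma> \<oplus>\<^bsub>Hom\<^esub> \<tau>"
  "c \<odot>\<^bsub>equivariant_hom K H V actV W actW\<^esub> \<sigma> = c \<odot>\<^bsub>Hom\<^esub> \<sigma>"
  "\<zero>\<^bsub>equivariant_hom K H V actV W actW\<^esub> = \<zero>\<^bsub>Hom\<^esub>"
  by (simp_all add: equivariant_hom_def)

lemma equivariant_hom_vectorspace:
  assumes V: "left_module K H V actV" and W: "left_module K H W actW"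
  shows "vectorspace K (equivariant_hom K H V actV W actW)"
proof -
  interpret V: left_module K H V actV by fact
  interpret W: left_module K H W actW by fact
  interpret VW: two_spaces K V W
    using V.V.vectorspace_axioms W.V.vectorspace_axioms by (rule two_spaces.intro)
  interpret Hom: vectorspace K VW.Hom by (rule VW.hom_space_vectorspace)
  note cl = lin_map_closed[OF VW.hom_space_lin]
  let ?S = "carrier (equivariant_hom K H V actV W actW)"
  have "submodule K ?S VW.Hom"
  proof (intro submodule.intro Hom.module_axioms)
    show "?S \<subseteq> carrier VW.Hom" by (auto simp: VW.equivariant_hom_carrier)
    show "\<sigma> \<oplus>\<^bsub>VW.Hom\<^esub> \<tau> \<in> ?S" if "\<sigma> \<in> ?S" "\<tau> \<in> ?S" for \<sigma> \<tau>
      using that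
      by (auto simp: VW.equivariant_hom_carrier VW.hom_space_apply lin_map_closed[OF V.act_linear] cl
          module_hom_add[OF W.act_linear])
    show "\<zero>\<^bsub>VW.Hom\<^esub> \<in> ?S"
      by (auto simp: VW.equivariant_hom_carrier VW.hom_space_apply lin_map_closed[OF V.act_linear]
          lin_map_zero[OF W.V.vectorspace_axioms W.V.vectorspace_axioms W.act_linear])
    show "c \<odot>\<^bsub>VW.Hom\<^esub> \<sigma> \<in> ?S" if "c \<in> carrier K" "\<sigma> \<in> ?S" for c \<sigma>
      using that
      by (auto simp: VW.equivariant_hom_carrier VW.hom_space_apply lin_map_closed[OF V.act_linear] cl
          module_hom_smult[OF W.act_linear])
  qed
  then have "vectorspace K (Hom.vs ?S)"
    by (intro Hom.subspace_is_vs subspace.intro Hom.vectorspace_axioms)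
  then show ?thesis by (simp add: equivariant_hom_def)
qed

lemma (in two_spaces) equivariant_hom_lin_map:
  "lin_map K Hom X f \<Longrightarrow> lin_map K (equivariant_hom K H V actV W actW) X f"
  by (intro lin_mapI)
    (auto simp: equivariant_hom_carrier equivariant_hom_ops module_hom_add module_hom_smult
      lin_map_closed[of f K Hom X])

subsection \<open>The functor \<open>Hom\<^sub>H(?, A)\<close> and the cup product\<close>
text \<open>
  The lift refers to the sum and the zero of the target only, and these agree on the space of
  equivariant maps and on the space of all linear maps.
\<close>
lemma cup_map_hom_space:
  "cup_map K H \<Delta> A act U actU V actV = tensor_lift (hom_space K (tensor K U V) A) (cup K U V A)"
  by (rule ext) (simp add: cup_map_def tensor_lift_def equivariant_hom_def)

context hopf_action
begin

lemma E_carrier: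
  "\<phi> \<in> carrier (equivariant_End K H A act) \<longleftrightarrow>
    \<phi> \<in> carrier AA.Hom \<and> (\<forall>h\<in>carrier H. \<forall>a\<in>carrier A. \<phi> (act h a) = act h (\<phi> a))"
  by (simp add: equivariant_End_def equivariant_hom_def)

lemma E_lin: "\<phi> \<in> carrier (equivariant_End K H A act) \<Longrightarrow> lin_map K A A \<phi>"
  by (simp add: E_carrier AA.hom_space_lin)

lemma E_apply:
  "a \<in> carrier A \<Longrightarrow> (\<phi> \<oplus>\<^bsub>equivariant_End K H A act\<^esub> \<psi>) a = \<phi> a \<oplus>\<^bsub>A\<^esub> \<psi> a"
  "a \<in> carrier A \<Longrightarrow> (c \<odot>\<^bsub>equivariant_End K H A act\<^esub> \<phi>) a = c \<odot>\<^bsub>A\<^esub> \<phi> a"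
  "a \<in> carrier A \<Longrightarrow> (\<phi> \<otimes>\<^bsub>equivariant_End K H A act\<^esub> \<psi>) a = \<phi> (\<psi> a)"
  "a \<in> carrier A \<Longrightarrow> \<one>\<^bsub>equivariant_End K H A act\<^esub> a = a"
  "a \<in> carrier A \<Longrightarrow> \<zero>\<^bsub>equivariant_End K H A act\<^esub> a = \<zero>\<^bsub>A\<^esub>"
  by (simp_all add: equivariant_End_def equivariant_hom_def hom_space_def compose_def)

lemma D_left_module:
  assumes V: "left_module K H V actV" and E: "unital_algebra K (equivariant_End K H A act)"
  shows "left_module K (equivariant_End K H A act) (equivariant_hom K H V actV A act) (D_act V)"
proof -
  let ?E = "equivariant_End K H A act" and ?D = "equivariant_hom K H V actV A act"
  interpret M: left_module K H V actV by fact
  interpret E: unital_algebra K ?E by fact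
  interpret VA: two_spaces K V A
    using M.V.vectorspace_axioms V.vectorspace_axioms by (rule two_spaces.intro)
  have D: "vectorspace K ?D"
    by (rule equivariant_hom_vectorspace[OF assms(1)]) unfold_locales
  interpret D: vectorspace K ?D by (rule D)
  have \<sigma>V: "\<sigma> v \<in> carrier A" if "\<sigma> \<in> carrier ?D" "v \<in> carrier V" for \<sigma> v
    using that lin_map_closed[OF VA.hom_space_lin] by (simp add: VA.equivariant_hom_carrier)
  have app: "D_act V \<phi> \<sigma> v = \<phi> (\<sigma> v)" if "v \<in> carrier V" for \<phi> \<sigma> v
    using that by (simp add: D_act_def compose_def)
  have closed: "D_act V \<phi> \<sigma> \<in> carrier ?D" if \<phi>: "\<phi> \<in> carrier ?E" and \<sigma>: "\<sigma> \<in> carrier ?D" for \<phi> \<sigma>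
  proof -
    have "lin_map K V A \<sigma>" using \<sigma> by (simp add: VA.equivariant_hom_carrier VA.hom_space_lin)
    then have "D_act V \<phi> \<sigma> \<in> carrier VA.Hom"
      using VA.hom_space_restrict[OF lin_map_comp[OF _ E_lin[OF \<phi>]]] by (simp add: D_act_def compose_def)
    then show ?thesis
      using \<phi> \<sigma> by (simp add: VA.equivariant_hom_carrier app lin_map_closed[OF M.act_linear] E_carrier
          \<sigma>V[OF \<sigma>])
  qed
  have eqI: "\<sigma> = \<tau>" if "\<sigma> \<in> carrier ?D" "\<tau> \<in> carrier ?D" "\<And>v. v \<in> carrier V \<Longrightarrow> \<sigma> v = \<tau> v" for \<sigma> \<tau>
    using that by (intro VA.hom_space_eqI) (simp_all add: VA.equivariant_hom_carrier)
  have Dapp: "(\<sigma> \<oplus>\<^bsub>?D\<^esub> \<tau>) v = \<sigma> v \<oplus>\<^bsub>A\<^esub> \<tau> v" "(c \<odot>\<^bsub>?D\<^esub> \<sigma>) v = c \<odot>\<^bsub>A\<^esub> \<sigma> v"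
    if "v \<in> carrier V" for \<sigma> \<tau> c v
    using that by (simp_all add: VA.equivariant_hom_ops VA.hom_space_apply)
  show ?thesis
  proof (intro left_module.intro left_module_axioms.intro)
    show "D_act V \<phi> \<in> module_hom K ?D ?D" if \<phi>: "\<phi> \<in> carrier ?E" for \<phi>
    proof (intro lin_mapI)
      show "D_act V \<phi> \<sigma> \<in> carrier ?D" if "\<sigma> \<in> carrier ?D" for \<sigma> by (rule closed[OF \<phi> that])
      show "D_act V \<phi> (\<sigma> \<oplus>\<^bsub>?D\<^esub> \<tau>) = D_act V \<phi> \<sigma> \<oplus>\<^bsub>?D\<^esub> D_act V \<phi> \<tau>"
        if "\<sigma> \<in> carrier ?D" "\<tau> \<in> carrier ?D" for \<sigma> \<tau>
        by (rule eqI) (simp_all add: closed \<phi> that app Dapp \<sigma>V module_hom_add[OF E_lin[OF \<phi>]])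
      show "D_act V \<phi> (c \<odot>\<^bsub>?D\<^esub> \<sigma>) = c \<odot>\<^bsub>?D\<^esub> D_act V \<phi> \<sigma>"
        if "c \<in> carrier K" "\<sigma> \<in> carrier ?D" for c \<sigma>
        by (rule eqI) (simp_all add: closed \<phi> that app Dapp \<sigma>V module_hom_smult[OF E_lin[OF \<phi>]])
    qed
    show "D_act V (\<phi> \<oplus>\<^bsub>?E\<^esub> \<psi>) \<sigma> = D_act V \<phi> \<sigma> \<oplus>\<^bsub>?D\<^esub> D_act V \<psi> \<sigma>"
      if "\<phi> \<in> carrier ?E" "\<psi> \<in> carrier ?E" "\<sigma> \<in> carrier ?D" for \<phi> \<psi> \<sigma>
      by (rule eqI) (simp_all add: closed that app Dapp \<sigma>V E_apply)
    show "D_act V (c \<odot>\<^bsub>?E\<^esub> \<phi>) \<sigma> = c \<odot>\<^bsub>?D\<^esub> D_act V \<phi> \<sigma>"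
      if "c \<in> carrier K" "\<phi> \<in> carrier ?E" "\<sigma> \<in> carrier ?D" for c \<phi> \<sigma>
      by (rule eqI) (simp_all add: closed that app Dapp \<sigma>V E_apply)
    show "D_act V (\<phi> \<otimes>\<^bsub>?E\<^esub> \<psi>) \<sigma> = D_act V \<phi> (D_act V \<psi> \<sigma>)"
      if "\<phi> \<in> carrier ?E" "\<psi> \<in> carrier ?E" "\<sigma> \<in> carrier ?D" for \<phi> \<psi> \<sigma>
      by (rule eqI) (simp_all add: closed that app \<sigma>V E_apply)
    show "D_act V \<one>\<^bsub>?E\<^esub> \<sigma> = \<sigma>" if "\<sigma> \<in> carrier ?D" for \<sigma>
      by (rule eqI) (simp_all add: closed that app \<sigma>V E_apply)
  qed (rule E.unital_algebra_axioms D)+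
qed

lemma cup_facts:
  assumes U: "left_module K H U actU" and V: "left_module K H V actV"
  shows "bilin_map K (equivariant_hom K H U actU A act) (equivariant_hom K H V actV A act)
      (hom_space K (tensor K U V) A) (cup K U V A)"
    and "\<lbrakk>\<tau> \<in> carrier (equivariant_hom K H U actU A act); \<sigma> \<in> carrier (equivariant_hom K H V actV A act);
        u \<in> carrier U; v \<in> carrier V\<rbrakk>
      \<Longrightarrow> cup K U V A \<tau> \<sigma> (pure_tensor K U V u v) = \<tau> u \<otimes>\<^bsub>A\<^esub> \<sigma> v"
proof -
  interpret U: left_module K H U actU by fact
  interpret V': left_module K H V actV by fact
  interpret UV: two_spaces K U V
    using U.V.vectorspace_axioms V'.V.vectorspace_axioms by (rule two_spaces.intro)
  interpret UA: two_spaces K U A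
    using U.V.vectorspace_axioms V.vectorspace_axioms by (rule two_spaces.intro)
  interpret VA: two_spaces K V A
    using V'.V.vectorspace_axioms V.vectorspace_axioms by (rule two_spaces.intro)
  interpret T: two_spaces K UV.T A
    using UV.tensor_vectorspace V.vectorspace_axioms by (rule two_spaces.intro)
  let ?DU = "equivariant_hom K H U actU A act" and ?DV = "equivariant_hom K H V actV A act"
  have la: "left_module K H A act" by unfold_locales
  note vD = equivariant_hom_vectorspace[OF U la] equivariant_hom_vectorspace[OF V la]
  have lU: "lin_map K U A \<tau>" if "\<tau> \<in> carrier ?DU" for \<tau>
    using that by (simp add: UA.equivariant_hom_carrier UA.hom_space_lin)
  have lV: "lin_map K V A \<sigma>" if "\<sigma> \<in> carrier ?DV" for \<sigma>
    using that by (simp add: VA.equivariant_hom_carrier VA.hom_space_lin)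
  have bil: "bilin_map K U V A (\<lambda>u v. \<tau> u \<otimes>\<^bsub>A\<^esub> \<sigma> v)" if "\<tau> \<in> carrier ?DU" "\<sigma> \<in> carrier ?DV" for \<tau> \<sigma>
    by (intro bilin_mapI A_mult_lin lU[OF that(1)] lV[OF that(2)] lin_map_closed[OF lU[OF that(1)]]
        lin_map_closed[OF lV[OF that(2)]]; assumption)
  show "bilin_map K ?DU ?DV T.Hom (cup K U V A)"
    unfolding cup_def
  proof (rule bilin_mapI)
    show "lin_map K ?DV T.Hom (\<lambda>\<sigma>. \<lambda>t\<in>carrier UV.T. tensor_lift A (\<lambda>u v. \<tau> u \<otimes>\<^bsub>A\<^esub> \<sigma> v) t)"
      if \<tau>: "\<tau> \<in> carrier ?DU" for \<tau>
    proof (rule T.hom_space_curry[OF UV.lift_lin[OF V.vectorspace_axioms bil[OF \<tau>]] _ vD(2)], assumption)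
      show "lin_map K ?DV A (\<lambda>\<sigma>. tensor_lift A (\<lambda>u v. \<tau> u \<otimes>\<^bsub>A\<^esub> \<sigma> v) t)" if "t \<in> carrier UV.T" for t
        by (rule UV.lift_param[OF V.vectorspace_axioms that bil[OF \<tau>] _ vD(2)], assumption,
            rule A_mult_lin(1)[OF lin_map_closed[OF lU[OF \<tau>]]
              VA.equivariant_hom_lin_map[OF VA.hom_space_eval]])
    qed
    show "lin_map K ?DU T.Hom (\<lambda>\<tau>. \<lambda>t\<in>carrier UV.T. tensor_lift A (\<lambda>u v. \<tau> u \<otimes>\<^bsub>A\<^esub> \<sigma> v) t)"
      if \<sigma>: "\<sigma> \<in> carrier ?DV" for \<sigma>
    proof (rule T.hom_space_curry[OF UV.lift_lin[OF V.vectorspace_axioms bil[OF _ \<sigma>]] _ vD(1)], assumption)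
      show "lin_map K ?DU A (\<lambda>\<tau>. tensor_lift A (\<lambda>u v. \<tau> u \<otimes>\<^bsub>A\<^esub> \<sigma> v) t)" if "t \<in> carrier UV.T" for t
        by (rule UV.lift_param[OF V.vectorspace_axioms that bil[OF _ \<sigma>] _ vD(1)], assumption,
            rule A_mult_lin(2)[OF lin_map_closed[OF lV[OF \<sigma>]]
              UA.equivariant_hom_lin_map[OF UA.hom_space_eval]])
    qed
  qed
  show "cup K U V A \<tau> \<sigma> (pure_tensor K U V u v) = \<tau> u \<otimes>\<^bsub>A\<^esub> \<sigma> v"
    if "\<tau> \<in> carrier ?DU" "\<sigma> \<in> carrier ?DV" "u \<in> carrier U" "v \<in> carrier V"
    using that by (simp add: cup_def bil V.vectorspace_axioms)
qed

text \<open>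
  On \<open>\<tau> \<otimes> \<sigma>\<close> and \<open>u \<otimes> v\<close> the two composites of the square are the two sides of the defining
  relation at \<open>a = \<sigma>(u)\<close> and \<open>b = \<tau>(v)\<close>.
\<close>

lemma braiding_square:
  assumes E: "unital_algebra K (equivariant_End K H A act)"
    and R: "R \<in> carrier (tensor K H H)"
    and R': "R' \<in> carrier (tensor K (equivariant_End K H A act) (equivariant_End K H A act))"
    and rel: "\<And>a b. \<lbrakk>a \<in> carrier A; b \<in> carrier A\<rbrakk> \<Longrightarrow>
      tensor_lift A (\<lambda>x y. act y b \<otimes>\<^bsub>A\<^esub> act x a) R = tensor_lift A (\<lambda>\<rho> \<rho>'. \<rho>' a \<otimes>\<^bsub>A\<^esub> \<rho> b) R'"
    and U: "left_module K H U actU" and V: "left_module K H V actV"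
    and x: "x \<in> carrier (tensor K (equivariant_hom K H V actV A act) (equivariant_hom K H U actU A act))"
  shows "D_map (tensor K U V) (braiding K R U actU V actV) (cup_map K H \<Delta> A act V actV U actU x) =
    cup_map K H \<Delta> A act U actU V actV (braiding K R' (equivariant_hom K H V actV A act) (D_act V)
      (equivariant_hom K H U actU A act) (D_act U) x)"
proof -
  let ?E = "equivariant_End K H A act"
  let ?DU = "equivariant_hom K H U actU A act" and ?DV = "equivariant_hom K H V actV A act"
  interpret UV: two_modules K H U actU V actV using U V by (rule two_modules.intro)
  interpret DD: two_modules K ?E ?DV "D_act V" ?DU "D_act U"
    using D_left_module[OF V E] D_left_module[OF U E] by (rule two_modules.intro)
  interpret TU: two_spaces K UV.UV.T A
    using UV.UV.tensor_vectorspace V.vectorspace_axioms by (rule two_spaces.intro)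
  interpret TV: two_spaces K UV.VU.T A
    using UV.VU.tensor_vectorspace V.vectorspace_axioms by (rule two_spaces.intro)
  interpret UA: two_spaces K U A using UV.vs(2) V.vectorspace_axioms by (rule two_spaces.intro)
  interpret VA: two_spaces K V A using UV.vs(3) V.vectorspace_axioms by (rule two_spaces.intro)
  note vA = V.vectorspace_axioms
  note cU = cup_facts[OF U V] and cV = cup_facts[OF V U]
  let ?cupU = "tensor_lift TU.Hom (cup K U V A)" and ?cupV = "tensor_lift TV.Hom (cup K V U A)"
  let ?c = "braiding K R U actU V actV" and ?d = "braiding K R' ?DV (D_act V) ?DU (D_act U)"
  have lcU: "lin_map K DD.VU.T TU.Hom ?cupU" by (rule DD.VU.lift_lin[OF TU.hom_space_vectorspace cU(1)])
  have lcV: "lin_map K DD.UV.T TV.Hom ?cupV" by (rule DD.UV.lift_lin[OF TV.hom_space_vectorspace cV(1)])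
  have c: "lin_map K UV.UV.T UV.VU.T ?c" by (rule UV.braiding_lin[OF R])
  have d: "lin_map K DD.UV.T DD.VU.T ?d" by (rule DD.braiding_lin[OF R'])
  have Uval: "\<sigma> u \<in> carrier A" if "\<sigma> \<in> carrier ?DU" "u \<in> carrier U" for \<sigma> u
    using that lin_map_closed[OF UA.hom_space_lin] by (simp add: UA.equivariant_hom_carrier)
  have Vval: "\<tau> v \<in> carrier A" if "\<tau> \<in> carrier ?DV" "v \<in> carrier V" for \<tau> v
    using that lin_map_closed[OF VA.hom_space_lin] by (simp add: VA.equivariant_hom_carrier)
  have square: "?cupV x (?c t) = ?cupU (?d x) t" if t: "t \<in> carrier UV.UV.T" for t
  proof (rule DD.UV.tensor_ext[OF vA _ _ x])
    show "lin_map K DD.UV.T A (\<lambda>x. ?cupV x (?c t))"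
      by (rule lin_map_comp[OF lcV TV.hom_space_eval[OF lin_map_closed[OF c t]]])
    show "lin_map K DD.UV.T A (\<lambda>x. ?cupU (?d x) t)"
      by (rule lin_map_comp[OF lin_map_comp[OF d lcU] TU.hom_space_eval[OF t]])
    fix \<tau> \<sigma> assume \<tau>: "\<tau> \<in> carrier ?DV" and \<sigma>: "\<sigma> \<in> carrier ?DU"
    have p: "DD.UV.pure \<tau> \<sigma> \<in> carrier DD.UV.T" using \<tau> \<sigma> by (rule DD.UV.pure_closed)
    have cup: "?cupV (DD.UV.pure \<tau> \<sigma>) = cup K V U A \<tau> \<sigma>"
      by (rule DD.UV.lift_pure[OF TV.hom_space_vectorspace cV(1) \<tau> \<sigma>])
    have cup_lin: "lin_map K UV.VU.T A (cup K V U A \<tau> \<sigma>)"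
      by (rule TV.hom_space_lin[OF bilin_map_closed[OF cV(1) \<tau> \<sigma>]])
    show "?cupV (DD.UV.pure \<tau> \<sigma>) (?c t) = ?cupU (?d (DD.UV.pure \<tau> \<sigma>)) t"
    proof (rule UV.UV.tensor_ext[OF vA _ _ t])
      show "lin_map K UV.UV.T A (\<lambda>t. ?cupV (DD.UV.pure \<tau> \<sigma>) (?c t))"
        unfolding cup by (rule lin_map_comp[OF c cup_lin])
      show "lin_map K UV.UV.T A (?cupU (?d (DD.UV.pure \<tau> \<sigma>)))"
        by (rule TU.hom_space_lin[OF lin_map_closed[OF lcU lin_map_closed[OF d p]]])
      fix u v assume u: "u \<in> carrier U" and v: "v \<in> carrier V"
      have uv: "UV.UV.pure u v \<in> carrier UV.UV.T" using u v by (rule UV.UV.pure_closed)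
      have \<tau>e: "\<tau> (actV y v) = act y (\<tau> v)" if "y \<in> carrier H" for y
        using \<tau> that v by (simp add: VA.equivariant_hom_carrier)
      have \<sigma>e: "\<sigma> (actU y u) = act y (\<sigma> u)" if "y \<in> carrier H" for y
        using \<sigma> that u by (simp add: UA.equivariant_hom_carrier)
      have "?cupV (DD.UV.pure \<tau> \<sigma>) (?c (UV.UV.pure u v)) =
          tensor_lift A (\<lambda>x y. cup K V U A \<tau> \<sigma> (UV.VU.pure (actV y v) (actU x u))) R"
        unfolding cup UV.braiding_pure[OF R u v]
        by (rule HH.lin_map_lift[OF UV.VU.tensor_vectorspace vA cup_lin UV.braiding_inner_bilin[OF u v] R])
      also have "\<dots> = tensor_lift A (\<lambda>x y. act y (\<tau> v) \<otimes>\<^bsub>A\<^esub> act x (\<sigma> u)) R"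
        by (rule HH.lift_cong[OF R])
          (simp add: cV(2)[OF \<tau> \<sigma>] u v lin_map_closed[OF UV.U.act_linear] lin_map_closed[OF UV.V.act_linear]
            \<tau>e \<sigma>e)
      also have "\<dots> = tensor_lift A (\<lambda>\<rho> \<rho>'. \<rho>' (\<sigma> u) \<otimes>\<^bsub>A\<^esub> \<rho> (\<tau> v)) R'"
        by (rule rel[OF Uval[OF \<sigma> u] Vval[OF \<tau> v]])
      also have "\<dots> = tensor_lift A (\<lambda>\<rho> \<rho>'. ?cupU (DD.VU.pure (D_act U \<rho>' \<sigma>) (D_act V \<rho> \<tau>)) (UV.UV.pure u v)) R'"
      proof (rule DD.HH.lift_cong[OF R'])
        fix \<rho> \<rho>' assume \<rho>: "\<rho> \<in> carrier ?E" "\<rho>' \<in> carrier ?E"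
        note cl = lin_map_closed[OF DD.U.act_linear[OF \<rho>(1)] \<tau>] lin_map_closed[OF DD.V.act_linear[OF \<rho>(2)] \<sigma>]
        have "?cupU (DD.VU.pure (D_act U \<rho>' \<sigma>) (D_act V \<rho> \<tau>)) = cup K U V A (D_act U \<rho>' \<sigma>) (D_act V \<rho> \<tau>)"
          by (rule DD.VU.lift_pure[OF TU.hom_space_vectorspace cU(1) cl(2,1)])
        then show "\<rho>' (\<sigma> u) \<otimes>\<^bsub>A\<^esub> \<rho> (\<tau> v) =
            ?cupU (DD.VU.pure (D_act U \<rho>' \<sigma>) (D_act V \<rho> \<tau>)) (UV.UV.pure u v)"
          by (simp add: cU(2)[OF cl(2,1) u v]) (simp add: D_act_def compose_def u v)
      qed
      also have "\<dots> = ?cupU (?d (DD.UV.pure \<tau> \<sigma>)) (UV.UV.pure u v)"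
        unfolding DD.braiding_pure[OF R' \<tau> \<sigma>]
        by (rule DD.HH.lin_map_lift[OF DD.VU.tensor_vectorspace vA
              lin_map_comp[OF lcU TU.hom_space_eval[OF uv]] DD.braiding_inner_bilin[OF \<tau> \<sigma>] R', symmetric])
      finally show "?cupV (DD.UV.pure \<tau> \<sigma>) (?c (UV.UV.pure u v)) =
          ?cupU (?d (DD.UV.pure \<tau> \<sigma>)) (UV.UV.pure u v)" .
    qed
  qed
  have h: "?cupU (?d x) \<in> carrier TU.Hom" by (rule lin_map_closed[OF lcU lin_map_closed[OF d x]])
  show ?thesis
    unfolding cup_map_hom_space
  proof (rule extensionalityI[where A = "carrier UV.UV.T"])
    show "D_map UV.UV.T ?c (?cupV x) \<in> extensional (carrier UV.UV.T)" by (simp add: D_map_def compose_def)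
    show "?cupU (?d x) \<in> extensional (carrier UV.UV.T)" using h by (simp add: TU.hom_space_iff)
    show "D_map UV.UV.T ?c (?cupV x) t = ?cupU (?d x) t" if "t \<in> carrier UV.UV.T" for t
      using square[OF that] that by (simp add: D_map_def compose_def)
  qed
qed

end

section \<open>The endomorphism algebra\<close>

lemma (in hopf_action) equivariant_End_galois_pair:
  assumes E_hopf: "hopf_algebra K (equivariant_End K H A act) \<Delta>\<^sub>E \<epsilon>\<^sub>E S\<^sub>E"
    and E_module_algebra: "module_algebra K (equivariant_End K H A act) \<Delta>\<^sub>E \<epsilon>\<^sub>E A (\<lambda>\<phi> a. \<phi> a)"
    and coev: "coevaluation K H dH" "coevaluation K A dA" and galois: "dual_galois K H A act"
  shows "galois_pair K H \<Delta> \<epsilon> S A act (equivariant_End K H A act) \<Delta>\<^sub>E \<epsilon>\<^sub>E S\<^sub>E (\<lambda>\<phi> a. \<phi> a) dH dA"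
proof -
  let ?E = "equivariant_End K H A act"
  interpret E: hopf_action K ?E \<Delta>\<^sub>E \<epsilon>\<^sub>E S\<^sub>E A "\<lambda>\<phi> a. \<phi> a"
    using E_hopf E_module_algebra by (rule hopf_action.intro)
  show ?thesis
  proof (intro galois_pair.intro commuting_actions.intro commuting_actions_axioms.intro
      galois_action.intro galois_action_axioms.intro galois_pair_axioms.intro)
    show "act h (\<phi> a) = \<phi> (act h a)" if "h \<in> carrier H" "\<phi> \<in> carrier ?E" "a \<in> carrier A" for h \<phi> a
      using that by (simp add: E_carrier)
    show "\<phi> = \<zero>\<^bsub>?E\<^esub>" if \<phi>: "\<phi> \<in> carrier ?E" and 0: "\<And>a. a \<in> carrier A \<Longrightarrow> \<phi> a = \<zero>\<^bsub>A\<^esub>" for \<phi>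
    proof (rule AA.hom_space_eqI)
      show "\<phi> \<in> carrier AA.Hom" using \<phi> by (simp add: E_carrier)
      have "\<zero>\<^bsub>?E\<^esub> \<in> carrier ?E" by simp
      then show "\<zero>\<^bsub>?E\<^esub> \<in> carrier AA.Hom" unfolding E_carrier by (rule conjunct1)
      show "\<phi> a = \<zero>\<^bsub>?E\<^esub> a" if "a \<in> carrier A" for a by (simp add: 0 E_apply that)
    qed
    show "\<exists>\<phi>\<in>carrier ?E. \<forall>a\<in>carrier A. \<phi> a = f a"
      if f: "lin_map K A A f" and eqv: "\<And>h a. h \<in> carrier H \<Longrightarrow> a \<in> carrier A \<Longrightarrow> f (act h a) = act h (f a)" for f
    proof
      show "restrict f (carrier A) \<in> carrier ?E"
        unfolding E_carrier using AA.hom_space_restrict[OF f] by (simp add: act_closed eqv)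
    qed simp
  qed (rule hopf_action_axioms E.hopf_action_axioms coev galois)+
qed


theorem proposition2p2:
  fixes K :: "'k ring"
    and H :: "('k, 'h) module" and \<Delta> :: "'h \<Rightarrow> ('h, 'h) tensor" and \<epsilon> :: "'h \<Rightarrow> 'k" and S :: "'h \<Rightarrow> 'h"
    and A :: "('k, 'a) module" and act :: "'h \<Rightarrow> 'a \<Rightarrow> 'a"
    and E :: "('k, 'a \<Rightarrow> 'a) module"
    and \<Delta>\<^sub>E :: "('a \<Rightarrow> 'a) \<Rightarrow> ('a \<Rightarrow> 'a, 'a \<Rightarrow> 'a) tensor"
    and \<epsilon>\<^sub>E :: "('a \<Rightarrow> 'a) \<Rightarrow> 'k" and S\<^sub>E :: "('a \<Rightarrow> 'a) \<Rightarrow> ('a \<Rightarrow> 'a)"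
  assumes H_hopf: "hopf_algebra K H \<Delta> \<epsilon> S"
    and H_fin_dim: "vectorspace.fin_dim K H"
    and A_module_algebra: "module_algebra K H \<Delta> \<epsilon> A act"
    and A_galois: "dual_galois K H A act"
    and E_eq: "E = equivariant_End K H A act"
    and E_hopf: "hopf_algebra K E \<Delta>\<^sub>E \<epsilon>\<^sub>E S\<^sub>E"
    and E_module_algebra: "module_algebra K E \<Delta>\<^sub>E \<epsilon>\<^sub>E A (\<lambda>\<phi> a. \<phi> a)"
  defines "corresponds \<equiv> \<lambda>R R'.
      \<forall>a\<in>carrier A. \<forall>b\<in>carrier A.
        tensor_lift A (\<lambda>x y. act y b \<otimes>\<^bsub>A\<^esub> act x a) R =
        tensor_lift A (\<lambda>\<rho> \<rho>'. \<rho>' a \<otimes>\<^bsub>A\<^esub> \<rho> b) R'"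
  shows "(\<exists>\<Phi>. bij_betw \<Phi> (Collect (quasitriangular K H \<Delta> \<epsilon>))
                         (Collect (quasitriangular K E \<Delta>\<^sub>E \<epsilon>\<^sub>E)) \<and>
            (\<forall>R R'. quasitriangular K H \<Delta> \<epsilon> R \<and> quasitriangular K E \<Delta>\<^sub>E \<epsilon>\<^sub>E R' \<longrightarrow>
               (\<Phi> R = R' \<longleftrightarrow> corresponds R R'))) \<and>
         (\<forall>R R'. quasitriangular K H \<Delta> \<epsilon> R \<and> quasitriangular K E \<Delta>\<^sub>E \<epsilon>\<^sub>E R' \<and> corresponds R R' \<longrightarrow>
            (triangular K E \<Delta>\<^sub>E \<epsilon>\<^sub>E R' \<longleftrightarrow> triangular K H \<Delta> \<epsilon> R) \<and>
            (\<forall>(U :: ('k, 'u) module) actU (V :: ('k, 'v) module) actV.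
               left_module K H U actU \<and> vectorspace.fin_dim K U \<and>
               left_module K H V actV \<and> vectorspace.fin_dim K V \<longrightarrow>
               (let DU = equivariant_hom K H U actU A act;
                    DV = equivariant_hom K H V actV A act
                in \<forall>x\<in>carrier (tensor K DV DU).
                     D_map (tensor K U V) (braiding K R U actU V actV)
                       (cup_map K H \<Delta> A act V actV U actU x) =
                     cup_map K H \<Delta> A act U actU V actV
                       (braiding K R' DV (D_act V) DU (D_act U) x))))"
proof -
  interpret H: hopf_action K H \<Delta> \<epsilon> S A act
    using H_hopf A_module_algebra by (rule hopf_action.intro)
  interpret E: hopf_algebra K E \<Delta>\<^sub>E \<epsilon>\<^sub>E S\<^sub>E by (rule E_hopf)
  have "one_space K H" by unfold_locales
  then obtain dH where dH: "coevaluation K H dH"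
    using one_space.fin_dim_coevaluation H_fin_dim by blast
  obtain dA where dA: "coevaluation K A dA"
    using H.galois_finite_dimensional[OF H_fin_dim A_galois] by blast
  have pair: "galois_pair K H \<Delta> \<epsilon> S A act E \<Delta>\<^sub>E \<epsilon>\<^sub>E S\<^sub>E (\<lambda>\<phi> a. \<phi> a) dH dA"
    unfolding E_eq
    by (rule H.equivariant_End_galois_pair[OF _ _ dH dA A_galois])
      (rule E_hopf[unfolded E_eq] E_module_algebra[unfolded E_eq])+
  have corr: "corresponds = galois_pair.related A act (\<lambda>\<phi> a. \<phi> a)"
    by (intro ext) (simp add: corresponds_def galois_pair.related_def[OF pair])
  let ?qH = "quasitriangular K H \<Delta> \<epsilon>" and ?qE = "quasitriangular K E \<Delta>\<^sub>E \<epsilon>\<^sub>E"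
  note closed = H.quasitriangular_closed E.quasitriangular_closed
  have ex: "\<exists>R'. ?qE R' \<and> corresponds R R'" if "?qH R" for R
    using galois_pair.related_exists[OF pair that] unfolding corr .
  have ex': "\<exists>R. ?qH R \<and> corresponds R R'" if "?qE R'" for R'
    using galois_pair.correspondence(1)[OF pair that] unfolding corr .
  have uniq: "R' = R''" if "?qE R'" "?qE R''" "corresponds R R'" "corresponds R R''" for R R' R''
    using galois_pair.correspondence(2)[OF pair closed(2)[OF that(1)] closed(2)[OF that(2)]] that(3,4)
    unfolding corr .
  have uniq': "R = R2" if "?qH R" "?qH R2" "corresponds R R'" "corresponds R2 R'" for R R2 R'
    using galois_pair.related_unique[OF pair closed(1)[OF that(1)] closed(1)[OF that(2)]] that(3,4)
    unfolding corr .
  define \<Phi> where "\<Phi> R = (SOME R'. ?qE R' \<and> corresponds R R')" for R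
  have \<Phi>: "?qE (\<Phi> R)" "corresponds R (\<Phi> R)" if "?qH R" for R
    using someI_ex[OF ex[OF that]] by (simp_all add: \<Phi>_def)
  have \<Phi>_iff: "\<Phi> R = R' \<longleftrightarrow> corresponds R R'" if "?qH R" "?qE R'" for R R'
    using \<Phi>[OF that(1)] uniq[OF \<Phi>(1)[OF that(1)] that(2) \<Phi>(2)[OF that(1)]] by blast
  have bij: "bij_betw \<Phi> (Collect ?qH) (Collect ?qE)"
  proof (rule bij_betwI')
    show "\<Phi> R = \<Phi> R2 \<longleftrightarrow> R = R2" if "R \<in> Collect ?qH" "R2 \<in> Collect ?qH" for R R2
    proof
      assume eq: "\<Phi> R = \<Phi> R2"
      show "R = R2"
        using that by (intro uniq'[OF _ _ \<Phi>(2) \<Phi>(2)[of R2, folded eq]]) simp_all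
    qed simp
    show "\<Phi> R \<in> Collect ?qE" if "R \<in> Collect ?qH" for R using that \<Phi>(1) by simp
    show "\<exists>R\<in>Collect ?qH. R' = \<Phi> R" if R': "R' \<in> Collect ?qE" for R'
    proof -
      obtain R where R: "?qH R" "corresponds R R'" using ex' R' by blast
      then have "\<Phi> R = R'" using \<Phi>_iff R' by simp
      then show ?thesis using R(1) by blast
    qed
  qed
  have tri: "triangular K E \<Delta>\<^sub>E \<epsilon>\<^sub>E R' \<longleftrightarrow> triangular K H \<Delta> \<epsilon> R"
    if "?qH R" "?qE R'" "corresponds R R'" for R R'
    using galois_pair.correspondence(3)[OF pair closed(1)[OF that(1)] closed(2)[OF that(2)]] that(3)
    unfolding corr .
  have square: "D_map (tensor K U V) (braiding K R U actU V actV) (cup_map K H \<Delta> A act V actV U actU x) =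
      cup_map K H \<Delta> A act U actU V actV (braiding K R' (equivariant_hom K H V actV A act) (D_act V)
        (equivariant_hom K H U actU A act) (D_act U) x)"
    if "?qH R" "?qE R'" "corresponds R R'" "left_module K H U actU" "left_module K H V actV"
      "x \<in> carrier (tensor K (equivariant_hom K H V actV A act) (equivariant_hom K H U actU A act))"
    for R R' and U :: "('k, 'u) module" and actU and V :: "('k, 'v) module" and actV and x
  proof (rule H.braiding_square[folded E_eq, OF _ closed(1)[OF that(1)] closed(2)[OF that(2)] _ that(4-6)])
    show "unital_algebra K E" by unfold_locales
    show "tensor_lift A (\<lambda>x y. act y b \<otimes>\<^bsub>A\<^esub> act x a) R = tensor_lift A (\<lambda>\<rho> \<rho>'. \<rho>' a \<otimes>\<^bsub>A\<^esub> \<rho> b) R'"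
      if "a \<in> carrier A" "b \<in> carrier A" for a b
      using \<open>corresponds R R'\<close> that unfolding corresponds_def by blast
  qed
  have "\<exists>\<Phi>. bij_betw \<Phi> (Collect ?qH) (Collect ?qE) \<and>
      (\<forall>R R'. ?qH R \<and> ?qE R' \<longrightarrow> (\<Phi> R = R' \<longleftrightarrow> corresponds R R'))"
    using bij \<Phi>_iff by blast
  then show ?thesis
    unfolding Let_def by (intro conjI allI impI ballI) (auto simp only: tri intro: square)
qed

end
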